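(* For every choice of integers $n_\infty, n_{z_1},\dots,n_{z_N},n_0\ge 1$ (write $\bm n=\{n_{z_1},\dots,n_{z_N}\}$), $\mathscr Z^{n_\infty,\bm n,n_0}_{\infty,\bm z,0}(\mathfrak g,\sigma)^\Gamma$ is a commutative subalgebra of $(U_{n_\infty,\bm n,n_0})^{\mathfrak g^\sigma}$. Consequently the universal cyclotomic Gaudin algebra $\mathscr Z_{\infty,\bm z,0}(\mathfrak g,\sigma)^\Gamma := \varprojlim \mathscr Z^{n_\infty,\bm n,n_0}_{\infty,\bm z,0}(\mathfrak g,\sigma)^\Gamma$ is a commutative subalgebra of $\big(\varprojlim U_{n_\infty,\bm n,n_0}\big)^{\mathfrak g^\sigma}$.
   Context: **Data.** Let $T\ge 1$, $\omega\in\mathbb C^\times$ a primitive $T$-th root of unity, $\Gamma=\langle\omega\rangle$ acting on $\mathbb{CP}^1$ by multiplication. Let $\mathfrak g$ be a finite-dimensional simple Lie algebra over $\mathbb C$ with invariant form $\langle\cdot,\cdot\rangle$ normalised so that long roots have square length 2, dual Coxeter number $h^\vee$, and $\sigma$ an automorphism of $\mathfrak g$ whose order divides $T$; $\mathfrak g^\sigma$ is its fixed subalgebra. Let $\bm z=\{z_1,\dots,z_N\}\subset\mathbb C^\times$ ($N\ge 0$) with pairwise disjoint $\Gamma$-orbits. $\mathfrak g^{\rm op}$ denotes $\mathfrak g$ with bracket $[X,Y]^{\rm op}=[Y,X]$. For a space $V$ of $\mathfrak g$-valued rational functions of $t$, or of $\mathfrak g$-valued Laurent series in $t$ or in $t^{-1}$,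 $V^\Gamma$ denotes the subspace of those $f$ with $f(\omega t)=\sigma(f(t))$. For a variable $s$, $\mathrm{res}_s$ is the coefficient of $s^{-1}$; $\iota_{t-z}$, $\iota_t$, $\iota_{t^{-1}}$ denote Laurent expansion at $z$, $0$, $\infty$. **Algebras $U_{n_\infty,\bm n,n_0}$.** Put $$\mathfrak p:=(\mathfrak g^{\rm op}\otimes t^{-1}\mathbb C[[t^{-1}]])^\Gamma\oplus\bigoplus_{i=1}^N\mathfrak g\otimes\mathbb C[[t-z_i]]\oplus(\mathfrak g\otimes\mathbb C[[t]])^\Gamma .$$ Let $U_{n_\infty,\bm n,n_0}$ be the quotient of $U(\mathfrak p)$ by the two-sided ideal generated by $(\mathfrak g^{\rm op}\otimes t^{-n_\infty}\mathbb C[[t^{-1}]])^\Gamma$, $\mathfrak g\otimes (t-z_i)^{n_{z_i}}\mathbb C[[t-z_i]]$ ($i=1,\dots,N$) and $(\mathfrak g\otimes t^{n_0}\mathbb C[[t]])^\Gamma$. With the natural projections these form an inverse system. $\mathfrak g^\sigma$ acts on $\mathfrak p$ by derivations: $X\in\mathfrak g^\sigma$ acts on each summand by $Y\otimes f\mapsto [X,Y]\otimes f$ (bracket of $\mathfrak g$); this is the adjoint action of $(-X;X,\dots,X;X)$. It induces an action by derivations on each $U_{n_\infty,\bm n,n_0}$ and on the inverse limit; superscript $\mathfrak g^\sigma$ means invariants. **The elements $X(u)$.** Fix $k\in\mathbb C$. Let $u\in\mathbb C^\times$ with $\Gamma u$ disjoint from $\Gamma\bm z$. Let $\widehat{\mathfrak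 g}_{\infty,N+1,0}$ be the central extension of $$(\mathfrak g^{\rm op}\otimes\mathbb C((t^{-1})))^\Gamma\oplus\bigoplus_{x\in\{z_1,\dots,z_N,u\}}\mathfrak g\otimes\mathbb C((t-x))\oplus(\mathfrak g\otimes\mathbb C((t)))^\Gamma$$ by $\mathbb CK$ with cocycle $$\Omega(f,g)=\Big(-\tfrac1T\mathrm{res}_{t^{-1}}t^2\langle f_\infty,\partial_tg_\infty\rangle+\sum_{x}\mathrm{res}_{t-x}\langle f_x,\partial_tg_x\rangle+\tfrac1T\mathrm{res}_t\langle f_0,\partial_tg_0\rangle\Big)K .$$ Let $\mathfrak g^\Gamma_{\infty,\bm z,u,0}$ be the Lie algebra of $\mathfrak g$-valued rational functions $f(t)$ with poles at most at $0,\infty$ and $\Gamma\bm z\cup\Gamma u$ such that $f(\omega t)=\sigma f(t)$; it embeds as a Lie subalgebra of $\widehat{\mathfrak g}_{\infty,N+1,0}$ by $f\mapsto(-\iota_{t^{-1}}f;\iota_{t-z_1}f,\dots,\iota_{t-z_N}f,\iota_{t-u}f;\iota_tf)$, and is complementary, as a vector space, to $\mathfrak p_u:=\mathfrak p\oplus\mathfrak g\otimes\mathbb C[[t-u]]\oplus\mathbb CK$. Let $\mathcal M=U_{n_\infty,\bm n,n_0}$, regarded as a left module over itself, hence over $\mathfrak p$. Make $\mathcal M\otimes\mathbb Cv_0$ a $\mathfrak p_u$-module with $\mathfrak g\otimes\mathbb C[[t-u]]$ acting by $0$ and $K$ by $k$, and let $\mathbb M_u:=U(\widehat{\mathfrak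 g}_{\infty,N+1,0})\otimes_{U(\mathfrak p_u)}(\mathcal M\otimes\mathbb Cv_0)$. The composite $\mathcal M\to\mathbb M_u\to\mathbb M_u/(\mathfrak g^\Gamma_{\infty,\bm z,u,0}\cdot\mathbb M_u)$, $m\mapsto[m\otimes v_0]$, is a linear isomorphism. Let $\mathbb V_0^k$ be the vacuum Verma module of level $k$ over the affine algebra $\widehat{\mathfrak g}_u=\mathfrak g\otimes\mathbb C((t-u))\oplus\mathbb CK_u$, induced from the one-dimensional module $\mathbb Cv_0$ over $\mathfrak g\otimes\mathbb C[[t-u]]\oplus\mathbb CK_u$ on which $\mathfrak g\otimes\mathbb C[[t-u]]$ acts as $0$ and $K_u$ as $k$. For $X=Pv_0\in\mathbb V_0^k$ with $P\in U(\mathfrak g\otimes(t-u)^{-1}\mathbb C[(t-u)^{-1}])$ write $m\otimes X:=P\cdot(m\otimes v_0)\in\mathbb M_u$, with $P$ acting at the point $u$. Define $X(u):\mathcal M\to\mathcal M$ by $[m\otimes X]=[(X(u)m)\otimes v_0]$. This map is left multiplication by the element $X(u)\cdot 1\in U_{n_\infty,\bm n,n_0}$, which is also denoted $X(u)$; it depends rationally on $u$ with poles at most at $0$, $\omega^kz_i$, $\infty$ (identifying the modules $\mathbb V_0^k$ for different $u$ via the local coordinate). These elements are compatible with the projections of the inverse system. **Gaudin algebras.** Take $k=-h^\vee$. Let $\mathfrak z(\widehat{\mathfrak g})\subset\mathbb V_0^{-h^\vee}$ be the space of singular vectors, i.e. vectors annihilated by $\mathfrak g\otimes\mathbb C[t]$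 ($t$ being the local coordinate). For $Z\in\mathfrak z(\widehat{\mathfrak g})$ one has $Z(u)\in (U_{n_\infty,\bm n,n_0})^{\mathfrak g^\sigma}$. Define $\mathscr Z^{n_\infty,\bm n,n_0}_{\infty,\bm z,0}(\mathfrak g,\sigma)^\Gamma$ to be the linear span in $(U_{n_\infty,\bm n,n_0})^{\mathfrak g^\sigma}$ of all coefficients of singular terms of the Laurent expansions (at $0$, the points $\omega^kz_i$, and $\infty$) of the $Z(u)$, $Z\in\mathfrak z(\widehat{\mathfrak g})$; at a finite point $x$ the singular terms are those with negative powers of $u-x$, and at $\infty$ those $u^p$ with $p\ge0$. These spaces form an inverse system under the projections. *)

theory Defs
  imports
    "HOL-Complex_Analysis.Complex_Analysis"
    "HOL-Library.Poly_Mapping"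
    "HOL-Library.Function_Algebras"
    "HOL-Algebra.Subrings"
begin

section \<open>Complex vector spaces and algebras as records\<close>

text \<open>
  Complex vector spaces and associative algebras that arise as quotients are records of type
  \<open>(complex, 'a) module\<close> of HOL-Algebra. If such a record stands for a mere vector space, its
  fields \<open>mult\<close> and \<open>one\<close> carry no meaning.
\<close>

definition lin_span :: "(complex, 'a) module \<Rightarrow> 'a set \<Rightarrow> 'a set" where
  "lin_span V S = {\<Oplus>\<^bsub>V\<^esub> j\<in>{..<l}. c j \<odot>\<^bsub>V\<^esub> a j | (l::nat) c a. \<forall>j<l. a j \<in> S}"

text \<open>The quotient by an ideal, respectively (for vector spaces) by a subspace.\<close>

definition quot :: "(complex, 'a) module \<Rightarrow> 'a set \<Rightarrow> (complex, 'a set) module" where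
  "quot A I = ring.extend (A Quot I)
     (module.fields (\<lambda>c C. \<Union>a\<in>C. I +>\<^bsub>A\<^esub> (c \<odot>\<^bsub>A\<^esub> a)))"

definition comm_subalgebra :: "'a set \<Rightarrow> (complex, 'a) module \<Rightarrow> bool" where
  "comm_subalgebra H A \<longleftrightarrow> subcring H A \<and> (\<forall>c. \<forall>x\<in>H. c \<odot>\<^bsub>A\<^esub> x \<in> H)"

definition pm_scale :: "complex \<Rightarrow> ('x \<Rightarrow>\<^sub>0 complex) \<Rightarrow> 'x \<Rightarrow>\<^sub>0 complex" where
  "pm_scale c = Poly_Mapping.map ((*) c)"

text \<open>The linear extension of a map between bases.\<close>

definition push :: "('x \<Rightarrow> 'y) \<Rightarrow> ('x \<Rightarrow>\<^sub>0 complex) \<Rightarrow> 'y \<Rightarrow>\<^sub>0 complex" where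
  "push \<phi> p = (\<Sum>k\<in>Poly_Mapping.keys p. Poly_Mapping.single (\<phi> k) (Poly_Mapping.lookup p k))"

definition free_space :: "'x set \<Rightarrow> (complex, 'x \<Rightarrow>\<^sub>0 complex) module" where
  "free_space B = \<lparr>carrier = {p. Poly_Mapping.keys p \<subseteq> B}, monoid.mult = undefined,
     one = undefined, ring.zero = 0, add = (+), smult = pm_scale\<rparr>"

text \<open>The free associative unital algebra on the set \<open>S\<close>; words are lists.\<close>

definition free_algebra :: "'x set \<Rightarrow> (complex, 'x list \<Rightarrow>\<^sub>0 complex) module" where
  "free_algebra S = \<lparr>carrier = {p. Poly_Mapping.keys p \<subseteq> lists S},
     monoid.mult = (\<lambda>p q. \<Sum>v\<in>Poly_Mapping.keys p. \<Sum>w\<in>Poly_Mapping.keys q.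
        Poly_Mapping.single (v @ w) (Poly_Mapping.lookup p v * Poly_Mapping.lookup q w)),
     one = Poly_Mapping.single [] 1, ring.zero = 0, add = (+), smult = pm_scale\<rparr>"


section \<open>Lie algebras, enveloping algebras and induced modules\<close>

text \<open>A Lie algebra is carried by a subspace of an additive group type.\<close>

record 'x lie_algebra =
  lcarrier :: "'x set"
  lscale :: "complex \<Rightarrow> 'x \<Rightarrow> 'x"
  lbracket :: "'x \<Rightarrow> 'x \<Rightarrow> 'x"

text \<open>
  The universal enveloping algebra, presented by generators \<open>x \<in> L\<close>, linear relations, and
  \<open>x y - y x = [x, y]\<close>.
\<close>

abbreviation gen :: "'x \<Rightarrow> 'x list \<Rightarrow>\<^sub>0 complex" where
  "gen x \<equiv> Poly_Mapping.single [x] 1"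

definition uea_relations :: "('x::ab_group_add) lie_algebra \<Rightarrow> ('x list \<Rightarrow>\<^sub>0 complex) set" where
  "uea_relations L =
     {gen (x + y) - gen x - gen y | x y. x \<in> lcarrier L \<and> y \<in> lcarrier L} \<union>
     {gen (lscale L c x) - pm_scale c (gen x) | c x. x \<in> lcarrier L} \<union>
     {Poly_Mapping.single [x, y] 1 - Poly_Mapping.single [y, x] 1 - gen (lbracket L x y) | x y.
        x \<in> lcarrier L \<and> y \<in> lcarrier L}"

definition uea_ideal :: "('x::ab_group_add) lie_algebra \<Rightarrow> ('x list \<Rightarrow>\<^sub>0 complex) set" where
  "uea_ideal L = Idl\<^bsub>free_algebra (lcarrier L)\<^esub> (uea_relations L)"

definition uea :: "('x::ab_group_add) lie_algebra \<Rightarrow> (complex, ('x list \<Rightarrow>\<^sub>0 complex) set) module" where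
  "uea L = quot (free_algebra (lcarrier L)) (uea_ideal L)"

definition uea_class ::
  "('x::ab_group_add) lie_algebra \<Rightarrow> ('x list \<Rightarrow>\<^sub>0 complex) \<Rightarrow> ('x list \<Rightarrow>\<^sub>0 complex) set" where
  "uea_class L p = uea_ideal L +>\<^bsub>free_algebra (lcarrier L)\<^esub> p"

definition uea_incl :: "('x::ab_group_add) lie_algebra \<Rightarrow> 'x \<Rightarrow> ('x list \<Rightarrow>\<^sub>0 complex) set" where
  "uea_incl L x = uea_class L (gen x)"

text \<open>The algebra homomorphism into \<open>U(L)\<close> induced by a Lie algebra homomorphism \<open>\<phi>\<close> into \<open>L\<close>.\<close>

definition uea_map ::
  "('y::ab_group_add) lie_algebra \<Rightarrow> ('x \<Rightarrow> 'y) \<Rightarrow> ('x list \<Rightarrow>\<^sub>0 complex) set \<Rightarrow> ('y list \<Rightarrow>\<^sub>0 complex) set" where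
  "uea_map L \<phi> C = (\<Union>p\<in>C. uea_class L (push (map \<phi>) p))"

text \<open>
  \<open>U(L) \<otimes>\<^bsub>U(H)\<^esub> N\<close> for a Lie subalgebra \<open>H\<close> of \<open>L\<close> and an \<open>H\<close>-module \<open>N\<close>. The balancing
  relation is imposed for elements of \<open>H\<close>, which generate \<open>U(H)\<close>.
\<close>

definition induced_relations ::
  "('x::ab_group_add) lie_algebra \<Rightarrow> 'x set \<Rightarrow> (complex, 'm) module \<Rightarrow> ('x \<Rightarrow> 'm \<Rightarrow> 'm) \<Rightarrow>
     (('x list \<Rightarrow>\<^sub>0 complex) set \<times> 'm \<Rightarrow>\<^sub>0 complex) set" where
  "induced_relations L H N act =
     (let U = uea L; e = (\<lambda>a m. Poly_Mapping.single (a, m) (1::complex)) in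
       {e (a \<oplus>\<^bsub>U\<^esub> b) m - e a m - e b m | a b m. a \<in> carrier U \<and> b \<in> carrier U \<and> m \<in> carrier N} \<union>
       {e a (m \<oplus>\<^bsub>N\<^esub> m') - e a m - e a m' | a m m'. a \<in> carrier U \<and> m \<in> carrier N \<and> m' \<in> carrier N} \<union>
       {e (c \<odot>\<^bsub>U\<^esub> a) m - pm_scale c (e a m) | c a m. a \<in> carrier U \<and> m \<in> carrier N} \<union>
       {e a (c \<odot>\<^bsub>N\<^esub> m) - pm_scale c (e a m) | c a m. a \<in> carrier U \<and> m \<in> carrier N} \<union>
       {e (a \<otimes>\<^bsub>U\<^esub> uea_incl L x) m - e a (act x m) | a x m. a \<in> carrier U \<and> x \<in> H \<and> m \<in> carrier N})"

definition induced_kernel ::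
  "('x::ab_group_add) lie_algebra \<Rightarrow> 'x set \<Rightarrow> (complex, 'm) module \<Rightarrow> ('x \<Rightarrow> 'm \<Rightarrow> 'm) \<Rightarrow>
     (('x list \<Rightarrow>\<^sub>0 complex) set \<times> 'm \<Rightarrow>\<^sub>0 complex) set" where
  "induced_kernel L H N act =
     lin_span (free_space (carrier (uea L) \<times> carrier N)) (induced_relations L H N act)"

definition induced ::
  "('x::ab_group_add) lie_algebra \<Rightarrow> 'x set \<Rightarrow> (complex, 'm) module \<Rightarrow> ('x \<Rightarrow> 'm \<Rightarrow> 'm) \<Rightarrow>
     (complex, (('x list \<Rightarrow>\<^sub>0 complex) set \<times> 'm \<Rightarrow>\<^sub>0 complex) set) module" where
  "induced L H N act =
     quot (free_space (carrier (uea L) \<times> carrier N)) (induced_kernel L H N act)"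

definition induced_class ::
  "('x::ab_group_add) lie_algebra \<Rightarrow> 'x set \<Rightarrow> (complex, 'm) module \<Rightarrow> ('x \<Rightarrow> 'm \<Rightarrow> 'm) \<Rightarrow>
     (('x list \<Rightarrow>\<^sub>0 complex) set \<times> 'm \<Rightarrow>\<^sub>0 complex) \<Rightarrow>
     (('x list \<Rightarrow>\<^sub>0 complex) set \<times> 'm \<Rightarrow>\<^sub>0 complex) set" where
  "induced_class L H N act p =
     induced_kernel L H N act +>\<^bsub>free_space (carrier (uea L) \<times> carrier N)\<^esub> p"

definition induced_tensor ::
  "('x::ab_group_add) lie_algebra \<Rightarrow> 'x set \<Rightarrow> (complex, 'm) module \<Rightarrow> ('x \<Rightarrow> 'm \<Rightarrow> 'm) \<Rightarrow>
     ('x list \<Rightarrow>\<^sub>0 complex) set \<Rightarrow> 'm \<Rightarrow> (('x list \<Rightarrow>\<^sub>0 complex) set \<times> 'm \<Rightarrow>\<^sub>0 complex) set" where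
  "induced_tensor L H N act a m = induced_class L H N act (Poly_Mapping.single (a, m) 1)"

definition induced_action ::
  "('x::ab_group_add) lie_algebra \<Rightarrow> 'x set \<Rightarrow> (complex, 'm) module \<Rightarrow> ('x \<Rightarrow> 'm \<Rightarrow> 'm) \<Rightarrow>
     'x \<Rightarrow> (('x list \<Rightarrow>\<^sub>0 complex) set \<times> 'm \<Rightarrow>\<^sub>0 complex) set \<Rightarrow>
     (('x list \<Rightarrow>\<^sub>0 complex) set \<times> 'm \<Rightarrow>\<^sub>0 complex) set" where
  "induced_action L H N act x C =
     (\<Union>p\<in>C. induced_class L H N act (push (\<lambda>(a, m). (uea_incl L x \<otimes>\<^bsub>uea L\<^esub> a, m)) p))"


section \<open>Vector-valued rational functions\<close>

datatype place = At complex | Infty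

definition scalar_rational :: "complex set \<Rightarrow> (complex \<Rightarrow> complex) \<Rightarrow> bool" where
  "scalar_rational S r \<longleftrightarrow>
     (\<exists>p q. \<forall>t. t \<notin> S \<longrightarrow> poly q t \<noteq> 0 \<and> r t = poly p t / poly q t)"

text \<open>At infinity the local coordinate is \<open>1 / t\<close>.\<close>

definition scalar_expansion :: "(complex \<Rightarrow> complex) \<Rightarrow> place \<Rightarrow> complex fls" where
  "scalar_expansion r x = (case x of At z \<Rightarrow> laurent_expansion r z
     | Infty \<Rightarrow> laurent_expansion (\<lambda>s. r (1 / s)) 0)"

text \<open>
  A \<open>V\<close>-valued rational function with poles at most in \<open>S\<close> and at infinity is an element
  \<open>\<Sum>j<l. r j \<otimes> a j\<close> of the tensor product of the scalar ones with \<open>V\<close>; values inside the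
  finite set \<open>S\<close> are irrelevant.
\<close>

definition rational_repr :: "(complex, 'v) module \<Rightarrow> complex set \<Rightarrow> (complex \<Rightarrow> 'v) \<Rightarrow>
    nat \<Rightarrow> (nat \<Rightarrow> complex \<Rightarrow> complex) \<Rightarrow> (nat \<Rightarrow> 'v) \<Rightarrow> bool" where
  "rational_repr V S f l r a \<longleftrightarrow>
     (\<forall>j<l. scalar_rational S (r j) \<and> a j \<in> carrier V) \<and>
     (\<forall>t. t \<notin> S \<longrightarrow> f t = (\<Oplus>\<^bsub>V\<^esub> j\<in>{..<l}. r j t \<odot>\<^bsub>V\<^esub> a j))"

definition rational_function :: "(complex, 'v) module \<Rightarrow> complex set \<Rightarrow> (complex \<Rightarrow> 'v) \<Rightarrow> bool" where
  "rational_function V S f \<longleftrightarrow> (\<exists>l r a. rational_repr V S f l r a)"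

text \<open>The coefficient of the \<open>n\<close>-th power of the local coordinate at \<open>x\<close>.\<close>

definition laurent_coeff ::
  "(complex, 'v) module \<Rightarrow> complex set \<Rightarrow> (complex \<Rightarrow> 'v) \<Rightarrow> place \<Rightarrow> int \<Rightarrow> 'v" where
  "laurent_coeff V S f x n = (THE c. \<exists>l r a. rational_repr V S f l r a \<and>
     c = (\<Oplus>\<^bsub>V\<^esub> j\<in>{..<l}. fls_nth (scalar_expansion (r j) x) n \<odot>\<^bsub>V\<^esub> a j))"


section \<open>The data\<close>

text \<open>
  \<open>gform\<close> is the invariant form, \<open>gsigma\<close> the automorphism, \<open>period\<close> and \<open>omega\<close> are \<open>T\<close> and
  the root of unity, and \<open>marked\<close> is the set of the points \<open>z\<^sub>1, \<dots>, z\<^sub>N\<close>.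
\<close>

record 'g cyclotomic_data =
  gscale :: "complex \<Rightarrow> 'g \<Rightarrow> 'g"
  gbracket :: "'g \<Rightarrow> 'g \<Rightarrow> 'g"
  gform :: "'g \<Rightarrow> 'g \<Rightarrow> complex"
  gsigma :: "'g \<Rightarrow> 'g"
  period :: nat
  omega :: complex
  marked :: "complex set"

definition finite_dimensional_space :: "('g::ab_group_add) cyclotomic_data \<Rightarrow> bool" where
  "finite_dimensional_space D \<longleftrightarrow> vector_space (gscale D) \<and>
     (\<exists>B. finite B \<and> module.span (gscale D) B = UNIV)"

definition simple_lie_algebra :: "('g::ab_group_add) cyclotomic_data \<Rightarrow> bool" where
  "simple_lie_algebra D \<longleftrightarrow> vector_space (gscale D) \<and>
     (\<forall>x. Vector_Spaces.linear (gscale D) (gscale D) (\<lambda>y. gbracket D x y)) \<and>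
     (\<forall>y. Vector_Spaces.linear (gscale D) (gscale D) (\<lambda>x. gbracket D x y)) \<and>
     (\<forall>x. gbracket D x x = 0) \<and>
     (\<forall>x y z. gbracket D x (gbracket D y z) + gbracket D y (gbracket D z x)
        + gbracket D z (gbracket D x y) = 0) \<and>
     (\<exists>x y. gbracket D x y \<noteq> 0) \<and>
     (\<forall>I. module.subspace (gscale D) I \<and> (\<forall>x. \<forall>y\<in>I. gbracket D x y \<in> I) \<longrightarrow> I = {0} \<or> I = UNIV)"


definition invariant_form :: "('g::ab_group_add) cyclotomic_data \<Rightarrow> bool" where
  "invariant_form D \<longleftrightarrow>
     (\<forall>x. Vector_Spaces.linear (gscale D) (*) (\<lambda>y. gform D x y)) \<and>
     (\<forall>x y. gform D x y = gform D y x) \<and>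
     (\<forall>x y z. gform D (gbracket D x y) z = gform D x (gbracket D y z))"

definition lie_automorphism :: "('g::ab_group_add) cyclotomic_data \<Rightarrow> bool" where
  "lie_automorphism D \<longleftrightarrow>
     Vector_Spaces.linear (gscale D) (gscale D) (gsigma D) \<and> bij (gsigma D) \<and>
     (\<forall>x y. gsigma D (gbracket D x y) = gbracket D (gsigma D x) (gsigma D y))"

definition primitive_root_of_unity :: "nat \<Rightarrow> complex \<Rightarrow> bool" where
  "primitive_root_of_unity T w \<longleftrightarrow> w ^ T = 1 \<and> (\<forall>j. 0 < j \<and> j < T \<longrightarrow> w ^ j \<noteq> 1)"

definition Gamma_orbit :: "'g cyclotomic_data \<Rightarrow> complex \<Rightarrow> complex set" where
  "Gamma_orbit D z = {omega D ^ j * z | j. True}"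


subsection \<open>Roots, long roots and the dual Coxeter number\<close>

text \<open>Over the complex numbers the Cartan subalgebras of a semisimple Lie algebra are its maximal
  toral subalgebras.\<close>

definition toral_subalgebra :: "('g::ab_group_add) cyclotomic_data \<Rightarrow> 'g set \<Rightarrow> bool" where
  "toral_subalgebra D H \<longleftrightarrow> module.subspace (gscale D) H \<and>
     (\<forall>x\<in>H. \<forall>y\<in>H. gbracket D x y \<in> H) \<and>
     (\<forall>x\<in>H. module.span (gscale D) {y. \<exists>c. gbracket D x y = gscale D c y} = UNIV)"

definition cartan_subalgebra :: "('g::ab_group_add) cyclotomic_data \<Rightarrow> 'g set \<Rightarrow> bool" where
  "cartan_subalgebra D H \<longleftrightarrow> toral_subalgebra D H \<and>
     (\<forall>H'. toral_subalgebra D H' \<and> H \<subseteq> H' \<longrightarrow> H' = H)"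

text \<open>
  A root \<open>\<alpha>\<close> is represented by the element \<open>t\<^sub>\<alpha>\<close> of \<open>H\<close> with \<open>\<langle>t\<^sub>\<alpha>, h\<rangle> = \<alpha>(h)\<close> for \<open>h \<in> H\<close>. The form
  induced on the dual of \<open>H\<close> is then the restriction of the given one to \<open>H\<close>.
\<close>

definition roots :: "('g::ab_group_add) cyclotomic_data \<Rightarrow> 'g set \<Rightarrow> 'g set" where
  "roots D H = {t\<in>H. t \<noteq> 0 \<and> (\<exists>y. y \<noteq> 0 \<and> (\<forall>h\<in>H. gbracket D h y = gscale D (gform D t h) y))}"

text \<open>The largest square length of a root is 2.\<close>

definition normalised_form :: "('g::ab_group_add) cyclotomic_data \<Rightarrow> bool" where
  "normalised_form D \<longleftrightarrow> (\<exists>H. cartan_subalgebra D H \<and>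
     (\<forall>t\<in>roots D H. gform D t t \<in> \<real> \<and> Re (gform D t t) \<le> 2) \<and>
     (\<exists>t\<in>roots D H. gform D t t = 2))"

definition nonneg_combination :: "('g::ab_group_add) cyclotomic_data \<Rightarrow> 'g set \<Rightarrow> 'g \<Rightarrow> bool" where
  "nonneg_combination D B v \<longleftrightarrow> (\<exists>c :: 'g \<Rightarrow> nat. v = (\<Sum>b\<in>B. gscale D (of_nat (c b)) b))"

definition simple_roots :: "('g::ab_group_add) cyclotomic_data \<Rightarrow> 'g set \<Rightarrow> 'g set \<Rightarrow> bool" where
  "simple_roots D H B \<longleftrightarrow> B \<subseteq> roots D H \<and> \<not> module.dependent (gscale D) B \<and>
     (\<forall>t\<in>roots D H. nonneg_combination D B t \<or> nonneg_combination D B (- t))"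

definition highest_root :: "('g::ab_group_add) cyclotomic_data \<Rightarrow> 'g set \<Rightarrow> 'g set \<Rightarrow> 'g \<Rightarrow> bool" where
  "highest_root D H B \<theta> \<longleftrightarrow> \<theta> \<in> roots D H \<and> (\<forall>t\<in>roots D H. nonneg_combination D B (\<theta> - t))"

definition half_sum_positive :: "('g::ab_group_add) cyclotomic_data \<Rightarrow> 'g set \<Rightarrow> 'g set \<Rightarrow> 'g" where
  "half_sum_positive D H B = gscale D (1/2) (\<Sum>t | t \<in> roots D H \<and> nonneg_combination D B t. t)"

text \<open>\<open>1 + \<rho>(\<theta>\<^sup>\<or>)\<close>, where \<open>\<theta>\<^sup>\<or> = 2 \<theta> / \<langle>\<theta>, \<theta>\<rangle>\<close> is the coroot of the highest root.\<close>

definition dual_coxeter_number :: "('g::ab_group_add) cyclotomic_data \<Rightarrow> complex" where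
  "dual_coxeter_number D = (THE h. \<exists>H B \<theta>. cartan_subalgebra D H \<and> simple_roots D H B \<and>
     highest_root D H B \<theta> \<and>
     h = 1 + 2 * gform D (half_sum_positive D H B) \<theta> / gform D \<theta> \<theta>)"


section \<open>Loop algebras\<close>

text \<open>
  An element of \<open>\<gg> \<otimes> \<complex>((s))\<close> is a \<open>\<gg>\<close>-valued formal Laurent series.
\<close>

definition loop_scale :: "('g::ab_group_add) cyclotomic_data \<Rightarrow> complex \<Rightarrow> 'g fls \<Rightarrow> 'g fls" where
  "loop_scale D c f = Abs_fls (\<lambda>n. gscale D c (fls_nth f n))"

definition loop_bracket :: "('g::ab_group_add) cyclotomic_data \<Rightarrow> 'g fls \<Rightarrow> 'g fls \<Rightarrow> 'g fls" where
  "loop_bracket D f g = Abs_fls (\<lambda>n. \<Sum>i\<in>{fls_subdegree f..n - fls_subdegree g}.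
     gbracket D (fls_nth f i) (fls_nth g (n - i)))"

definition loop_form :: "('g::ab_group_add) cyclotomic_data \<Rightarrow> 'g fls \<Rightarrow> 'g fls \<Rightarrow> complex fls" where
  "loop_form D f g = Abs_fls (\<lambda>n. \<Sum>i\<in>{fls_subdegree f..n - fls_subdegree g}.
     gform D (fls_nth f i) (fls_nth g (n - i)))"

text \<open>\<open>\<partial>\<^sub>t\<close> on series in \<open>t - x\<close>, and on series in \<open>t\<^sup>-\<^sup>1\<close>.\<close>

definition loop_deriv :: "('g::ab_group_add) cyclotomic_data \<Rightarrow> 'g fls \<Rightarrow> 'g fls" where
  "loop_deriv D f = Abs_fls (\<lambda>n. gscale D (of_int (n + 1)) (fls_nth f (n + 1)))"

definition loop_deriv_inf :: "('g::ab_group_add) cyclotomic_data \<Rightarrow> 'g fls \<Rightarrow> 'g fls" where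
  "loop_deriv_inf D f = Abs_fls (\<lambda>n. gscale D (- of_int (n - 1)) (fls_nth f (n - 1)))"

type_synonym 'g multiloop = "place \<Rightarrow> 'g fls"

text \<open>
  Families \<open>(f\<^sub>\<infinity>; (f\<^sub>x)\<^sub>x\<^sub>\<in>\<^sub>S; f\<^sub>0)\<close>: the component at infinity is a series in \<open>t\<^sup>-\<^sup>1\<close>, the one at \<open>At x\<close> a
  series in \<open>t - x\<close>. The components at infinity and \<open>At 0\<close> are \<open>\<Gamma>\<close>-equivariant, and components
  outside \<open>S\<close>, \<open>0\<close> and infinity vanish.
\<close>

definition multiloop_space :: "('g::ab_group_add) cyclotomic_data \<Rightarrow> complex set \<Rightarrow> 'g multiloop set" where
  "multiloop_space D S = {f.
     (\<forall>n. gscale D (omega D powi (- n)) (fls_nth (f Infty) n) = gsigma D (fls_nth (f Infty) n)) \<and>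
     (\<forall>n. gscale D (omega D powi n) (fls_nth (f (At 0)) n) = gsigma D (fls_nth (f (At 0)) n)) \<and>
     (\<forall>x. x \<notin> S \<and> x \<noteq> 0 \<longrightarrow> f (At x) = 0)}"

definition multiloop_scale ::
  "('g::ab_group_add) cyclotomic_data \<Rightarrow> complex \<Rightarrow> 'g multiloop \<Rightarrow> 'g multiloop" where
  "multiloop_scale D c f = (\<lambda>x. loop_scale D c (f x))"

text \<open>The component at infinity carries the opposite bracket.\<close>

definition multiloop_bracket ::
  "('g::ab_group_add) cyclotomic_data \<Rightarrow> 'g multiloop \<Rightarrow> 'g multiloop \<Rightarrow> 'g multiloop" where
  "multiloop_bracket D f g = (\<lambda>x. case x of Infty \<Rightarrow> loop_bracket D (g x) (f x)
     | At _ \<Rightarrow> loop_bracket D (f x) (g x))"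

definition nonneg_multiloops :: "('g::ab_group_add) cyclotomic_data \<Rightarrow> complex set \<Rightarrow> 'g multiloop set" where
  "nonneg_multiloops D S = {f \<in> multiloop_space D S.
     (\<forall>n<1. fls_nth (f Infty) n = 0) \<and> (\<forall>x. \<forall>n<0. fls_nth (f (At x)) n = 0)}"

definition p_alg :: "('g::ab_group_add) cyclotomic_data \<Rightarrow> 'g multiloop lie_algebra" where
  "p_alg D = \<lparr>lcarrier = nonneg_multiloops D (marked D), lscale = multiloop_scale D,
     lbracket = multiloop_bracket D\<rparr>"

text \<open>Multiplication by \<open>t\<^sup>2\<close> on series in \<open>t\<^sup>-\<^sup>1\<close> is \<open>fls_shift 2\<close>.\<close>

definition cocycle ::
  "('g::ab_group_add) cyclotomic_data \<Rightarrow> complex set \<Rightarrow> 'g multiloop \<Rightarrow> 'g multiloop \<Rightarrow> complex" where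
  "cocycle D S f g =
     - (1 / of_nat (period D)) *
         fls_residue (fls_shift 2 (loop_form D (f Infty) (loop_deriv_inf D (g Infty))))
     + (\<Sum>x\<in>S. fls_residue (loop_form D (f (At x)) (loop_deriv D (g (At x)))))
     + (1 / of_nat (period D)) * fls_residue (loop_form D (f (At 0)) (loop_deriv D (g (At 0))))"

text \<open>The second component is the coefficient of the central element \<open>K\<close>.\<close>

definition g_hat ::
  "('g::ab_group_add) cyclotomic_data \<Rightarrow> complex \<Rightarrow> ('g multiloop \<times> complex) lie_algebra" where
  "g_hat D u = \<lparr>lcarrier = multiloop_space D (insert u (marked D)) \<times> UNIV,
     lscale = (\<lambda>c (f, a). (multiloop_scale D c f, c * a)),
     lbracket = (\<lambda>(f, a) (g, b).
       (multiloop_bracket D f g, cocycle D (insert u (marked D)) f g))\<rparr>"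

definition p_u :: "('g::ab_group_add) cyclotomic_data \<Rightarrow> complex \<Rightarrow> ('g multiloop \<times> complex) set" where
  "p_u D u = nonneg_multiloops D (insert u (marked D)) \<times> UNIV"

definition at_place :: "complex \<Rightarrow> ('g::zero) fls \<Rightarrow> 'g multiloop" where
  "at_place u f = (\<lambda>x. if x = At u then f else 0)"


subsection \<open>Equivariant rational functions\<close>

definition g_space :: "('g::ab_group_add) cyclotomic_data \<Rightarrow> (complex, 'g) module" where
  "g_space D = \<lparr>carrier = UNIV, monoid.mult = undefined, one = undefined, ring.zero = 0,
     add = (+), smult = gscale D\<rparr>"

definition g_expansion ::
  "('g::ab_group_add) cyclotomic_data \<Rightarrow> complex set \<Rightarrow> (complex \<Rightarrow> 'g) \<Rightarrow> place \<Rightarrow> 'g fls" where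
  "g_expansion D S f x = Abs_fls (laurent_coeff (g_space D) S f x)"

definition finite_poles :: "'g cyclotomic_data \<Rightarrow> complex set" where
  "finite_poles D = {0} \<union> (\<Union>z\<in>marked D. Gamma_orbit D z)"

text \<open>The image of \<open>\<gg>\<^sup>\<Gamma>\<^sub>\<infinity>\<^sub>,\<^sub>z\<^sub>,\<^sub>u\<^sub>,\<^sub>0\<close> in \<^term>\<open>g_hat D u\<close>.\<close>

definition global_embedding ::
  "('g::ab_group_add) cyclotomic_data \<Rightarrow> complex \<Rightarrow> complex set \<Rightarrow> (complex \<Rightarrow> 'g) \<Rightarrow> 'g multiloop \<times> complex" where
  "global_embedding D u S f = (\<lambda>x. case x of Infty \<Rightarrow> - g_expansion D S f Infty
     | At y \<Rightarrow> if y = 0 \<or> y = u \<or> y \<in> marked D then g_expansion D S f (At y) else 0, 0)"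

definition global_functions ::
  "('g::ab_group_add) cyclotomic_data \<Rightarrow> complex \<Rightarrow> ('g multiloop \<times> complex) set" where
  "global_functions D u = (let S = finite_poles D \<union> Gamma_orbit D u in
     {global_embedding D u S f | f. rational_function (g_space D) S f \<and>
        (\<forall>t. t \<notin> S \<longrightarrow> f (omega D * t) = gsigma D (f t))})"


section \<open>The algebras \<open>U\<^sub>n\<close> and their inverse limit\<close>

text \<open>
  The exponents \<open>n\<^sub>\<infinity>\<close>, \<open>n\<^sub>z\<close>, \<open>n\<^sub>0\<close> are the values of one function on places, which is set to
  \<open>0\<close> at all other places.
\<close>

definition U_places :: "'g cyclotomic_data \<Rightarrow> place set" where
  "U_places D = {Infty, At 0} \<union> At ` marked D"

definition exponents :: "'g cyclotomic_data \<Rightarrow> (place \<Rightarrow> nat) set" where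
  "exponents D = {n. (\<forall>x\<in>U_places D. n x \<ge> 1) \<and> (\<forall>x. x \<notin> U_places D \<longrightarrow> n x = 0)}"

type_synonym 'g Up_elem = "('g multiloop list \<Rightarrow>\<^sub>0 complex) set"
type_synonym 'g U_elem = "'g Up_elem set"

definition U_ideal :: "('g::ab_group_add) cyclotomic_data \<Rightarrow> (place \<Rightarrow> nat) \<Rightarrow> 'g Up_elem set" where
  "U_ideal D n = Idl\<^bsub>uea (p_alg D)\<^esub> {uea_incl (p_alg D) f | f x. x \<in> U_places D \<and>
     f \<in> lcarrier (p_alg D) \<and> (\<forall>y. y \<noteq> x \<longrightarrow> f y = 0) \<and> (\<forall>i < int (n x). fls_nth (f x) i = 0)}"

definition U_alg :: "('g::ab_group_add) cyclotomic_data \<Rightarrow> (place \<Rightarrow> nat) \<Rightarrow> (complex, 'g U_elem) module" where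
  "U_alg D n = quot (uea (p_alg D)) (U_ideal D n)"

definition U_class :: "('g::ab_group_add) cyclotomic_data \<Rightarrow> (place \<Rightarrow> nat) \<Rightarrow> 'g Up_elem \<Rightarrow> 'g U_elem" where
  "U_class D n a = U_ideal D n +>\<^bsub>uea (p_alg D)\<^esub> a"

text \<open>The natural projection onto \<^term>\<open>U_alg D n\<close> from any \<^term>\<open>U_alg D m\<close> with \<open>n \<le> m\<close>.\<close>

definition U_proj :: "('g::ab_group_add) cyclotomic_data \<Rightarrow> (place \<Rightarrow> nat) \<Rightarrow> 'g U_elem \<Rightarrow> 'g U_elem" where
  "U_proj D n C = (\<Union>a\<in>C. U_class D n a)"

definition U_lim :: "('g::ab_group_add) cyclotomic_data \<Rightarrow> (complex, (place \<Rightarrow> nat) \<Rightarrow> 'g U_elem) module" where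
  "U_lim D = \<lparr>
     carrier = {a \<in> (\<Pi>\<^sub>E n\<in>exponents D. carrier (U_alg D n)).
       \<forall>m\<in>exponents D. \<forall>n\<in>exponents D. n \<le> m \<longrightarrow> U_proj D n (a m) = a n},
     monoid.mult = (\<lambda>a b. \<lambda>n\<in>exponents D. a n \<otimes>\<^bsub>U_alg D n\<^esub> b n),
     one = (\<lambda>n\<in>exponents D. \<one>\<^bsub>U_alg D n\<^esub>),
     ring.zero = (\<lambda>n\<in>exponents D. \<zero>\<^bsub>U_alg D n\<^esub>),
     add = (\<lambda>a b. \<lambda>n\<in>exponents D. a n \<oplus>\<^bsub>U_alg D n\<^esub> b n),
     smult = (\<lambda>c a. \<lambda>n\<in>exponents D. c \<odot>\<^bsub>U_alg D n\<^esub> a n)\<rparr>"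


subsection \<open>The action of the fixed subalgebra\<close>

definition p_derivation :: "('g::ab_group_add) cyclotomic_data \<Rightarrow> 'g \<Rightarrow> 'g multiloop \<Rightarrow> 'g multiloop" where
  "p_derivation D X f = (\<lambda>x. Abs_fls (\<lambda>n. gbracket D X (fls_nth (f x) n)))"

text \<open>The derivation of a free algebra with prescribed values \<open>d\<close> on generators.\<close>

definition free_derivation :: "('x \<Rightarrow> 'x) \<Rightarrow> ('x list \<Rightarrow>\<^sub>0 complex) \<Rightarrow> 'x list \<Rightarrow>\<^sub>0 complex" where
  "free_derivation d p = (\<Sum>w\<in>Poly_Mapping.keys p. \<Sum>i<length w.
     Poly_Mapping.single (w[i := d (w ! i)]) (Poly_Mapping.lookup p w))"

definition Up_derivation :: "('g::ab_group_add) cyclotomic_data \<Rightarrow> 'g \<Rightarrow> 'g Up_elem \<Rightarrow> 'g Up_elem" where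
  "Up_derivation D X C = (\<Union>p\<in>C. uea_class (p_alg D) (free_derivation (p_derivation D X) p))"

definition U_derivation ::
  "('g::ab_group_add) cyclotomic_data \<Rightarrow> (place \<Rightarrow> nat) \<Rightarrow> 'g \<Rightarrow> 'g U_elem \<Rightarrow> 'g U_elem" where
  "U_derivation D n X C = (\<Union>a\<in>C. U_class D n (Up_derivation D X a))"

definition U_lim_derivation ::
  "('g::ab_group_add) cyclotomic_data \<Rightarrow> 'g \<Rightarrow> ((place \<Rightarrow> nat) \<Rightarrow> 'g U_elem) \<Rightarrow> (place \<Rightarrow> nat) \<Rightarrow> 'g U_elem" where
  "U_lim_derivation D X a = (\<lambda>n\<in>exponents D. U_derivation D n X (a n))"

definition U_invariants ::
  "('g::ab_group_add) cyclotomic_data \<Rightarrow> (place \<Rightarrow> nat) \<Rightarrow> (complex, 'g U_elem) module" where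
  "U_invariants D n = (U_alg D n)\<lparr>carrier := {a \<in> carrier (U_alg D n).
     \<forall>X. gsigma D X = X \<longrightarrow> U_derivation D n X a = \<zero>\<^bsub>U_alg D n\<^esub>}\<rparr>"

definition U_lim_invariants ::
  "('g::ab_group_add) cyclotomic_data \<Rightarrow> (complex, (place \<Rightarrow> nat) \<Rightarrow> 'g U_elem) module" where
  "U_lim_invariants D = (U_lim D)\<lparr>carrier := {a \<in> carrier (U_lim D).
     \<forall>X. gsigma D X = X \<longrightarrow> U_lim_derivation D X a = \<zero>\<^bsub>U_lim D\<^esub>}\<rparr>"


section \<open>The vacuum module and the elements \<open>X(u)\<close>\<close>

definition affine_alg :: "('g::ab_group_add) cyclotomic_data \<Rightarrow> ('g fls \<times> complex) lie_algebra" where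
  "affine_alg D = \<lparr>lcarrier = UNIV, lscale = (\<lambda>c (f, a). (loop_scale D c f, c * a)),
     lbracket = (\<lambda>(f, a) (g, b).
       (loop_bracket D f g, fls_residue (loop_form D f (loop_deriv D g))))\<rparr>"

definition affine_nonneg :: "(('g::ab_group_add) fls \<times> complex) set" where
  "affine_nonneg = {f. \<forall>n<0. fls_nth f n = 0} \<times> UNIV"

definition complex_line :: "(complex, complex) module" where
  "complex_line = \<lparr>carrier = UNIV, monoid.mult = undefined, one = undefined, ring.zero = 0,
     add = (+), smult = (*)\<rparr>"

definition vacuum_action :: "complex \<Rightarrow> 'g fls \<times> complex \<Rightarrow> complex \<Rightarrow> complex" where
  "vacuum_action k = (\<lambda>(f, a) c. a * k * c)"

type_synonym 'g vacuum_elem = "((('g fls \<times> complex) list \<Rightarrow>\<^sub>0 complex) set \<times> complex \<Rightarrow>\<^sub>0 complex) set"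

definition vacuum_module ::
  "('g::ab_group_add) cyclotomic_data \<Rightarrow> complex \<Rightarrow> (complex, 'g vacuum_elem) module" where
  "vacuum_module D k = induced (affine_alg D) affine_nonneg complex_line (vacuum_action k)"

definition singular_vectors ::
  "('g::ab_group_add) cyclotomic_data \<Rightarrow> complex \<Rightarrow> 'g vacuum_elem set" where
  "singular_vectors D k = {X \<in> carrier (vacuum_module D k).
     \<forall>f. finite {n. fls_nth f n \<noteq> 0} \<and> (\<forall>n<0. fls_nth f n = 0) \<longrightarrow>
       induced_action (affine_alg D) affine_nonneg complex_line (vacuum_action k) (f, 0) X
         = \<zero>\<^bsub>vacuum_module D k\<^esub>}"

text \<open>The Lie algebra \<open>\<gg> \<otimes> s\<^sup>-\<^sup>1 \<complex>[s\<^sup>-\<^sup>1]\<close> in a local coordinate \<open>s\<close>.\<close>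

definition negative_alg :: "('g::ab_group_add) cyclotomic_data \<Rightarrow> 'g fls lie_algebra" where
  "negative_alg D = \<lparr>lcarrier = {f. \<forall>n\<ge>0. fls_nth f n = 0}, lscale = loop_scale D,
     lbracket = loop_bracket D\<rparr>"

text \<open>\<open>P v\<^sub>0\<close> for \<open>P\<close> in the enveloping algebra of \<^term>\<open>negative_alg D\<close>.\<close>

definition vacuum_vector ::
  "('g::ab_group_add) cyclotomic_data \<Rightarrow> complex \<Rightarrow> ('g fls list \<Rightarrow>\<^sub>0 complex) set \<Rightarrow> 'g vacuum_elem" where
  "vacuum_vector D k P = induced_tensor (affine_alg D) affine_nonneg complex_line (vacuum_action k)
     (uea_map (affine_alg D) (\<lambda>f. (f, 0)) P) 1"

text \<open>
  The action of \<^term>\<open>p_u D u\<close> on \<open>M \<otimes> \<complex>v\<^sub>0\<close>, with \<open>m \<otimes> v\<^sub>0\<close> written as \<open>m\<close>.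
\<close>

definition M_action ::
  "('g::ab_group_add) cyclotomic_data \<Rightarrow> (place \<Rightarrow> nat) \<Rightarrow> complex \<Rightarrow> complex \<Rightarrow>
     'g multiloop \<times> complex \<Rightarrow> 'g U_elem \<Rightarrow> 'g U_elem" where
  "M_action D n k u = (\<lambda>(f, a) m.
     (U_class D n (uea_incl (p_alg D) (f(At u := 0))) \<otimes>\<^bsub>U_alg D n\<^esub> m)
       \<oplus>\<^bsub>U_alg D n\<^esub> ((a * k) \<odot>\<^bsub>U_alg D n\<^esub> m))"

type_synonym 'g M_elem =
  "((('g multiloop \<times> complex) list \<Rightarrow>\<^sub>0 complex) set \<times> 'g U_elem \<Rightarrow>\<^sub>0 complex) set"

definition M_u ::
  "('g::ab_group_add) cyclotomic_data \<Rightarrow> (place \<Rightarrow> nat) \<Rightarrow> complex \<Rightarrow> complex \<Rightarrow> (complex, 'g M_elem) module" where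
  "M_u D n k u = induced (g_hat D u) (p_u D u) (U_alg D n) (M_action D n k u)"

definition M_tensor ::
  "('g::ab_group_add) cyclotomic_data \<Rightarrow> (place \<Rightarrow> nat) \<Rightarrow> complex \<Rightarrow> complex \<Rightarrow>
     (('g multiloop \<times> complex) list \<Rightarrow>\<^sub>0 complex) set \<Rightarrow> 'g U_elem \<Rightarrow> 'g M_elem" where
  "M_tensor D n k u = induced_tensor (g_hat D u) (p_u D u) (U_alg D n) (M_action D n k u)"

definition coinvariant_kernel ::
  "('g::ab_group_add) cyclotomic_data \<Rightarrow> (place \<Rightarrow> nat) \<Rightarrow> complex \<Rightarrow> complex \<Rightarrow> 'g M_elem set" where
  "coinvariant_kernel D n k u = lin_span (M_u D n k u)
     {induced_action (g_hat D u) (p_u D u) (U_alg D n) (M_action D n k u) f v | f v.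
        f \<in> global_functions D u \<and> v \<in> carrier (M_u D n k u)}"

text \<open>The class of an element of \<open>M\<^sub>u\<close> in the space of coinvariants.\<close>

definition coinvariant_class ::
  "('g::ab_group_add) cyclotomic_data \<Rightarrow> (place \<Rightarrow> nat) \<Rightarrow> complex \<Rightarrow> complex \<Rightarrow> 'g M_elem \<Rightarrow> 'g M_elem set" where
  "coinvariant_class D n k u v = coinvariant_kernel D n k u +>\<^bsub>M_u D n k u\<^esub> v"

text \<open>
  The map \<open>X(u)\<close> on \<open>M\<close>, characterised by \<open>[m \<otimes> X] = [(X(u) m) \<otimes> v\<^sub>0]\<close>, where \<open>m \<otimes> X\<close> is
  \<open>P (m \<otimes> v\<^sub>0)\<close> with \<open>P\<close> acting at \<open>u\<close>, for the \<open>P\<close> with \<open>X = P v\<^sub>0\<close>.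
\<close>

definition X_map ::
  "('g::ab_group_add) cyclotomic_data \<Rightarrow> (place \<Rightarrow> nat) \<Rightarrow> complex \<Rightarrow> 'g vacuum_elem \<Rightarrow> complex \<Rightarrow>
     'g U_elem \<Rightarrow> 'g U_elem" where
  "X_map D n k X u m = (THE m'. m' \<in> carrier (U_alg D n) \<and>
     (\<exists>P\<in>carrier (uea (negative_alg D)). X = vacuum_vector D k P \<and>
        coinvariant_class D n k u
          (M_tensor D n k u (uea_map (g_hat D u) (\<lambda>f. (at_place u f, 0)) P) m)
        = coinvariant_class D n k u (M_tensor D n k u \<one>\<^bsub>uea (g_hat D u)\<^esub> m')))"

definition X_elem ::
  "('g::ab_group_add) cyclotomic_data \<Rightarrow> (place \<Rightarrow> nat) \<Rightarrow> complex \<Rightarrow> 'g vacuum_elem \<Rightarrow> complex \<Rightarrow> 'g U_elem" where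
  "X_elem D n k X u = X_map D n k X u \<one>\<^bsub>U_alg D n\<^esub>"


section \<open>Gaudin algebras\<close>

text \<open>
  At a finite point the singular terms have negative powers of \<open>u - x\<close>; at infinity they are the
  \<open>u\<^sup>p\<close> with \<open>p \<ge> 0\<close>, that is, nonpositive powers of the local coordinate \<open>u\<^sup>-\<^sup>1\<close>.
\<close>

definition singular_positions :: "'g cyclotomic_data \<Rightarrow> (place \<times> int) set" where
  "singular_positions D = (At ` finite_poles D) \<times> {..<0} \<union> {Infty} \<times> {..0}"

definition gaudin_algebra ::
  "('g::ab_group_add) cyclotomic_data \<Rightarrow> (place \<Rightarrow> nat) \<Rightarrow> 'g U_elem set" where
  "gaudin_algebra D n = (let k = - dual_coxeter_number D in lin_span (U_alg D n)
     {laurent_coeff (U_alg D n) (finite_poles D) (X_elem D n k Z) x q | Z x q.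
        Z \<in> singular_vectors D k \<and> (x, q) \<in> singular_positions D})"

definition universal_gaudin_algebra ::
  "('g::ab_group_add) cyclotomic_data \<Rightarrow> ((place \<Rightarrow> nat) \<Rightarrow> 'g U_elem) set" where
  "universal_gaudin_algebra D =
     {a \<in> carrier (U_lim D). \<forall>n\<in>exponents D. a n \<in> gaudin_algebra D n}"

end

theory Submission
  imports Defs "HOL-Computational_Algebra.Fundamental_Theorem_Algebra"
begin

text \<open>
  The idea. A word in the letters of the central extension attached to a finite set of points is
  evaluated in \<open>U\<close>: a global function at the left end gives zero, and an element of \<open>p\<close> at the left
  end is moved through the word to the right end, where it acts by right multiplication. This
  recursion (\<open>Psi\<close> in the locale \<open>split_lie\<close>) respects all relations of the enveloping algebra, so
  no basis theorem is needed, and its value on a word at \<open>u\<close> is \<open>X(u)\<close> (\<open>X_elem_theta\<close>).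

  Let \<open>F\<^sub>u(p)\<close> be the value of the word polynomial \<open>p\<close> placed at \<open>u\<close>. If \<open>q\<close> is singular, then the
  nonnegative letters that arise while \<open>p\<close> is evaluated annihilate \<open>q\<close>, hence \<open>q\<close> splits off
  (\<open>eval_product\<close>). With both words at \<open>u\<close> this gives \<open>F\<^sub>u(p q) = F\<^sub>u(q) F\<^sub>u(p)\<close>, and \<open>p q\<close> is again
  singular. With words at \<open>u\<close> and \<open>v\<close> in different orbits the letters commute, so the two
  orders give \<open>F\<^sub>u(p) F\<^sub>v(q) = F\<^sub>v(q) F\<^sub>u(p)\<close>; by propagation of vacua (\<open>ev_propagation\<close>) the factors are
  those computed with one point. Constant functions are global, which yields invariance.

  Explicit partial fractions show that \<open>F\<^sub>u(p)\<close> is rational in \<open>u\<close> with derivative \<open>F\<^sub>u(T p)\<close>, \<open>T\<close> the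
  translation of the vacuum module, which preserves singular vectors (\<open>DD_all\<close>). A rational function
  without singular terms vanishes, so the singular Laurent coefficients and the values span the
  same space (\<open>span_B0\<close>). A functional that annihilates this space annihilates all derivatives of
  \<open>F\<^sub>u(p) F\<^sub>v(q)\<close> at \<open>v = u\<close>, hence the function itself: the span is closed under products. In the same
  way commutativity extends from different orbits to all pairs of points.

  The functions form a Lie subalgebra of the central extension by the residue theorem, which needs
  that the form is \<open>\<sigma>\<close>-invariant. This holds because the Killing form is invariant under
  all automorphisms and is a nonzero multiple of the given form (\<open>form_sigma\<close>).

  Quotients are records without a type of their own; \<open>emb\<close> and \<open>unemb\<close> move their elements to
  formal linear combinations, where linear algebra is available.
\<close>

subsection \<open>Type-level linear algebra on finitely supported functions\<close>

abbreviation "lkp == Poly_Mapping.lookup"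
abbreviation "pkeys == Poly_Mapping.keys"
abbreviation "sgl k == Poly_Mapping.single k (1::complex)"
lemma lookup_pm_scale [simp]: "lkp (pm_scale c p) k = c * lkp p k"
	by (simp add: pm_scale_def Poly_Mapping.map.rep_eq when_def in_keys_iff)
type_synonym 'x pm = "'x \<Rightarrow>\<^sub>0  complex"
interpretation pm: vector_space "pm_scale :: complex => ('x pm) => _"
	by unfold_locales
	(auto simp: poly_mapping_eq_iff fun_eq_iff lookup_add algebra_simps)

abbreviation "vlin == Vector_Spaces.linear"
lemmas pm_lin_iff = Vector_Spaces.linear_iff pm.vector_space_axioms
abbreviation "pmlin == Vector_Spaces.linear pm_scale pm_scale"
abbreviation "pmfun == Vector_Spaces.linear pm_scale (*)"
lemma pm_scale_single [simp]: "pm_scale c (Poly_Mapping.single k a) = Poly_Mapping.single k (c * a)"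
	by (auto simp: poly_mapping_eq_iff fun_eq_iff lookup_single when_def)
lemma keys_pm_scale: "pkeys (pm_scale c p) <= pkeys p"
	by (auto simp: in_keys_iff)
definition lift :: "(complex => 'b => 'b) => ('x => 'b) => ('x pm) => 'b::ab_group_add" where
	"lift sc \<phi> p = (SUM k:pkeys p. sc (lkp p k) (\<phi> k))"
lemma lift_superset:
	assumes "vector_space sc" "finite K" "pkeys p <= K"
	shows "lift sc \<phi> p = (SUM k:K. sc (lkp p k) (\<phi> k))"
proof -
	interpret vector_space sc by fact
	show ?thesis unfolding lift_def using assms
	by (intro sum.mono_neutral_left) (auto simp: in_keys_iff)
qed
lemma linear_lift:
	assumes "vector_space sc"
	shows "vlin pm_scale sc (lift sc \<phi>)"
proof -
	interpret vector_space sc by fact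
	show ?thesis
	unfolding Vector_Spaces.linear_iff
	proof (intro conjI allI)
	fix p q :: "'b pm"
	let ?K = "pkeys p \<union> pkeys q"
	have "lift sc \<phi> (p + q) = (SUM k:?K. sc (lkp (p + q) k) (\<phi> k))"
	by (rule lift_superset[OF assms]) (use keys_add[of p q] in auto)
	also have "\<dots> = lift sc \<phi> p + lift sc \<phi> q"
	by (subst (1 2) lift_superset[OF assms, of ?K])
	(auto simp: lookup_add scale_left_distrib sum.distrib)
	finally show "lift sc \<phi> (p + q) = lift sc \<phi> p + lift sc \<phi> q" .
	next
	fix c :: complex and p :: "'b pm"
	have "lift sc \<phi> (pm_scale c p) = (SUM k:pkeys p. sc (lkp (pm_scale c p) k) (\<phi> k))"
	by (rule lift_superset[OF assms]) (auto simp: keys_pm_scale)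
	thus "lift sc \<phi> (pm_scale c p) = sc c (lift sc \<phi> p)"
	by (simp add: lift_def scale_sum_right)
	qed (rule pm.vector_space_axioms assms)+
qed
lemma lift_single:
	assumes "vector_space sc"
	shows "lift sc \<phi> (Poly_Mapping.single k c) = sc c (\<phi> k)"
proof -
	interpret vector_space sc by fact
	show ?thesis by (auto simp: lift_def)
qed
lemma pm_expand: "p = (SUM k:pkeys p. pm_scale (lkp p k) (sgl k))"
	by (rule poly_mapping_eqI)
	(auto simp: lookup_sum lookup_single when_def in_keys_iff if_distrib[of "(*) _"] sum.delta cong: if_cong)
lemma pm_subspace_memI:
	assumes "pm.subspace W" "!!k. k : pkeys p ==> sgl k : W"
	shows "p : W"
	by (subst pm_expand) (rule pm.subspace_sum[OF assms(1)], rule pm.subspace_scale[OF assms(1)], rule assms(2))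
lemma pm_linear_eq_on:
	assumes "vlin pm_scale sc f" "vlin pm_scale sc g"
	and "!!k. k : pkeys p ==> f (sgl k) = g (sgl k)"
	shows "f p = g p"
proof -
	interpret f: Vector_Spaces.linear pm_scale sc f by fact
	interpret g: Vector_Spaces.linear pm_scale sc g by fact
	show ?thesis
	by (subst (1 2) pm_expand) (simp add: f.sum g.sum f.scale g.scale assms(3) del: pm_scale_single)
qed
lemma push_eq_lift: "push \<phi> p = lift pm_scale (%k. sgl (\<phi> k)) p"
	by (simp add: push_def lift_def)
lemma linear_push: "pmlin (push \<phi>)"
	using linear_lift[OF pm.vector_space_axioms] unfolding push_eq_lift .
lemma push_single [simp]: "push \<phi> (Poly_Mapping.single k c) = Poly_Mapping.single (\<phi> k) c"
	by (simp add: push_def)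
lemma subspace_keys: "pm.subspace {q :: 'x pm. pkeys q <= K}"
	unfolding pm.subspace_def subset_iff in_keys_iff mem_Collect_eq
	by (auto simp: lookup_add) (metis add_0)
lemma keys_push: "pkeys (push \<phi> p) <= \<phi> ` pkeys p"
proof -
	have "push \<phi> p : {q. pkeys q <= \<phi> ` pkeys p}"
	unfolding push_def by (rule pm.subspace_sum[OF subspace_keys]) auto
	thus ?thesis by simp
qed
text \<open>A linear functional separates a vector from a subspace that does not contain it.\<close>
lemma separating_functional:
	assumes "vector_space sc" "module.subspace sc W" "x ~: W"
	shows "EX \<mu>. vlin sc (*) \<mu> & (ALL w:W. \<mu> w = (0::complex)) & \<mu> x ~= 0"
proof -
	interpret vector_space sc by fact
	interpret C: vector_space "(*) :: complex => _" by unfold_locales (auto simp: algebra_simps)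
	interpret vector_space_pair sc "(*) :: complex => _" ..
	obtain B where B: "B <= W" "independent B" "W <= span B"
	using maximal_independent_subset by blast
	have "span B = W" using B assms(2) by (metis span_subspace)
	hence "independent (insert x B)" using B assms(3) by (intro independent_insertI) auto
	then obtain g where g: "vlin sc (*) g" "!!y. y : insert x B ==> g y = (if y = x then 1 else 0)"
	using linear_independent_extend[of "insert x B" "%y. if y = x then 1 else 0"] by metis
	have "x ~: B" using B(1) assms(3) by auto
	hence "g y = 0" if "y : span B" for y
	using that g by (intro linear_eq_0_on_span[OF g(1), of B y]) auto
	thus ?thesis using g \<open>span B = W\<close> by (intro exI[of _ g]) auto
qed
lemma kernel_retraction:
	assumes "vector_space sc" "module.subspace sc K"
	shows "EX f. vlin sc sc f & (ALL x:K. f x = 0) & (ALL x. x - f x : K)"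
proof -
	interpret vector_space sc by fact
	interpret vector_space_pair sc sc ..
	obtain B where B: "B <= K" "independent B" "K <= span B"
	using maximal_independent_subset by blast
	have spB: "span B = K" using B assms(2) by (metis span_subspace)
	obtain B' where B': "B <= B'" "independent B'" "UNIV <= span B'"
	using maximal_independent_subset_extend[OF subset_UNIV B(2)] by metis
	obtain f where f: "vlin sc sc f" "!!y. y : B' ==> f y = (if y : B then 0 else y)"
	using linear_independent_extend[OF B'(2), of "%y. if y : B then 0 else y"] by metis
	interpret f: Vector_Spaces.linear sc sc f by fact
	have "f x = 0" if "x : K" for x
	using that spB B' f(2) by (intro linear_eq_0_on_span[OF f(1), of B x]) auto
	moreover have "x - f x : K" for x
	proof -
	have "x : span B'" using B' by auto
	thus ?thesis
	proof (induction x rule: span_induct_alt)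
	case base thus ?case using assms(2) by (simp add: subspace_0)
	next
	case (step c x y)
	have "x - f x : K" using step B B' assms(2) f(2) by (auto simp: subspace_0)
	hence "sc c (x - f x) + (y - f y) : K"
	using step assms(2) by (intro subspace_add subspace_scale) auto
	thus ?case by (simp add: f.add f.scale algebra_simps)
	qed
	qed
	ultimately show ?thesis using f(1) by blast
qed
section \<open>Complex vector spaces and algebras with a carrier\<close>
locale cspace = abelian_group V for V :: "(complex, 'v) module" (structure) +
	assumes sm_closed [simp, intro]: "x : carrier V ==> c \<odot> x : carrier V"
	and sm_l_distr: "x : carrier V ==> (c + d) \<odot> x = c \<odot> x \<oplus> d \<odot> x"
	and sm_r_distr: "x : carrier V ==> y : carrier V ==> c \<odot> (x \<oplus> y) = c \<odot> x \<oplus> c \<odot> y"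
	and sm_assoc: "x : carrier V ==> (c * d) \<odot> x = c \<odot> (d \<odot> x)"
	and sm_one [simp]: "x : carrier V ==> 1 \<odot> x = x"
locale calg = cspace A + ring A for A :: "(complex, 'v) module" (structure) +
	assumes sm_mult1: "x : carrier A ==> y : carrier A ==> (c \<odot> x) \<otimes> y = c \<odot> (x \<otimes> y)"
	and sm_mult2: "x : carrier A ==> y : carrier A ==> x \<otimes> (c \<odot> y) = c \<odot> (x \<otimes> y)"
context cspace begin
lemma sm_zero_left [simp]: assumes "x : carrier V" shows "0 \<odot> x = \<zero>"
proof -
	have "0 \<odot> x \<oplus> 0 \<odot> x = 0 \<odot> x" using sm_l_distr[of x 0 0] assms by simp
	thus ?thesis using assms by (metis add.r_cancel_one' sm_closed)
qed
lemma sm_zero_right [simp]: "c \<odot> \<zero> = \<zero>"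
	using sm_assoc[of \<zero> c 0] by simp
lemma a_inv_eq_sm: assumes "x : carrier V" shows "\<ominus> x = (-1) \<odot> x"
proof -
	have "(-1) \<odot> x \<oplus> x = (-1 + 1) \<odot> x" using sm_l_distr[OF assms, of "-1" 1] assms by simp
	hence "(-1) \<odot> x \<oplus> x = \<zero>" using assms by simp
	thus ?thesis using assms minus_equality by simp
qed
lemma sm_finsum:
	assumes "finite J" "!!j. j : J ==> g j : carrier V"
	shows "c \<odot> (\<Oplus>j\<in>J. g j) = (\<Oplus>j\<in>J. c \<odot> g j)"
	using assms
proof (induction J rule: finite_induct)
	case empty thus ?case by simp
next
	case (insert j J)
	hence "g : J \<rightarrow> carrier V" "(%j. c \<odot> g j) : J \<rightarrow> carrier V" by auto
	thus ?case using insert by (simp add: finsum_insert sm_r_distr finsum_closed)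
qed
end
definition csub :: "(complex, 'v) module => 'v set => bool" where
	"csub V W \<longleftrightarrow> W <= carrier V & \<zero>\<^bsub>V\<^esub> : W & (ALL x:W. ALL y:W. x \<oplus>\<^bsub>V\<^esub> y : W) &
	(ALL c. ALL x:W. c \<odot>\<^bsub>V\<^esub> x : W)"
lemma csub_finsum:
	assumes "cspace V" "csub V W" "finite J" "!!j. j : J ==> g j : W"
	shows "(\<Oplus>\<^bsub>V\<^esub> j\<in>J. g j) : W"
	using assms(3,4)
proof (induction J rule: finite_induct)
	case empty
	interpret cspace V by fact
	show ?case using assms(2) by (simp add: csub_def)
next
	case (insert j J)
	interpret cspace V by fact
	have "g : J \<rightarrow> carrier V" "g j : carrier V" using insert assms(2) by (auto simp: csub_def)
	thus ?case using insert assms(2) by (simp add: finsum_insert csub_def)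
qed
lemma (in cspace) additive_subgroup_csub:
	assumes "csub V W" shows "abelian_subgroup W V"
proof (rule abelian_subgroupI3[OF additive_subgroupI])
	show "subgroup W (add_monoid V)"
	proof (rule add.subgroupI)
	show "W ~= {}" using assms by (auto simp: csub_def)
	fix a assume a: "a : W"
	hence "a : carrier V" using assms by (auto simp: csub_def)
	hence "\<ominus> a = (-1) \<odot> a" by (rule a_inv_eq_sm)
	thus "\<ominus> a : W" using assms a by (auto simp: csub_def)
	qed (use assms in "auto simp: csub_def")
	show "abelian_group V" ..
qed
lemma cspaceI:
	assumes "abelian_group V"
	and "!!c x. x : carrier V ==> c \<odot>\<^bsub>V\<^esub> x : carrier V"
	and "!!c d x. x : carrier V ==> (c + d) \<odot>\<^bsub>V\<^esub> x = c \<odot>\<^bsub>V\<^esub> x \<oplus>\<^bsub>V\<^esub> d \<odot>\<^bsub>V\<^esub> x"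
	and "!!c x y. x : carrier V ==> y : carrier V ==> c \<odot>\<^bsub>V\<^esub> (x \<oplus>\<^bsub>V\<^esub> y) = c \<odot>\<^bsub>V\<^esub> x \<oplus>\<^bsub>V\<^esub> c \<odot>\<^bsub>V\<^esub> y"
	and "!!c d x. x : carrier V ==> (c * d) \<odot>\<^bsub>V\<^esub> x = c \<odot>\<^bsub>V\<^esub> (d \<odot>\<^bsub>V\<^esub> x)"
	and "!!x. x : carrier V ==> 1 \<odot>\<^bsub>V\<^esub> x = x"
	shows "cspace V"
	using assms by (simp add: cspace_def cspace_axioms_def)
lemma calgI:
	assumes "cspace A" "ring A"
	and "!!c x y. x : carrier A ==> y : carrier A ==> (c \<odot>\<^bsub>A\<^esub> x) \<otimes>\<^bsub>A\<^esub> y = c \<odot>\<^bsub>A\<^esub> (x \<otimes>\<^bsub>A\<^esub> y)"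
	and "!!c x y. x : carrier A ==> y : carrier A ==> x \<otimes>\<^bsub>A\<^esub> (c \<odot>\<^bsub>A\<^esub> y) = c \<odot>\<^bsub>A\<^esub> (x \<otimes>\<^bsub>A\<^esub> y)"
	shows "calg A"
	using assms by (simp add: calg_def calg_axioms_def)
lemma abelian_group_image:
	assumes "abelian_group A" and im: "h ` carrier A = carrier B"
	and ad: "!!x y. x : carrier A ==> y : carrier A ==> h x \<oplus>\<^bsub>B\<^esub> h y = h (x \<oplus>\<^bsub>A\<^esub> y)"
	and ze: "\<zero>\<^bsub>B\<^esub> = h \<zero>\<^bsub>A\<^esub>"
	shows "abelian_group B"
proof -
	interpret A: abelian_group A by fact
	show ?thesis
	proof (rule abelian_groupI)
	fix x assume "x : carrier B"
	then obtain a where "x = h a" "a : carrier A" using im by auto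
	thus "EX y:carrier B. y \<oplus>\<^bsub>B\<^esub> x = \<zero>\<^bsub>B\<^esub>"
	using im ad ze A.l_neg by (metis A.a_inv_closed image_eqI)
	qed (auto simp flip: im simp: A.a_ac ad ze)
qed
lemma cspace_image:
	assumes "cspace A" and im: "h ` carrier A = carrier B"
	and ad: "!!x y. x : carrier A ==> y : carrier A ==> h x \<oplus>\<^bsub>B\<^esub> h y = h (x \<oplus>\<^bsub>A\<^esub> y)"
	and ze: "\<zero>\<^bsub>B\<^esub> = h \<zero>\<^bsub>A\<^esub>"
	and sm: "!!c x. x : carrier A ==> c \<odot>\<^bsub>B\<^esub> h x = h (c \<odot>\<^bsub>A\<^esub> x)"
	shows "cspace B"
proof -
	interpret A: cspace A by fact
	have ab: "abelian_group B" by (rule abelian_group_image[OF _ im ad ze]) unfold_locales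
	show ?thesis
	by (rule cspaceI[OF ab])
	(auto simp flip: im simp: ad sm A.sm_l_distr A.sm_r_distr A.sm_assoc)
qed
lemma calg_image:
	assumes "calg A" and im: "h ` carrier A = carrier B"
	and ad: "!!x y. x : carrier A ==> y : carrier A ==> h x \<oplus>\<^bsub>B\<^esub> h y = h (x \<oplus>\<^bsub>A\<^esub> y)"
	and ze: "\<zero>\<^bsub>B\<^esub> = h \<zero>\<^bsub>A\<^esub>"
	and sm: "!!c x. x : carrier A ==> c \<odot>\<^bsub>B\<^esub> h x = h (c \<odot>\<^bsub>A\<^esub> x)"
	and mu: "!!x y. x : carrier A ==> y : carrier A ==> h x \<otimes>\<^bsub>B\<^esub> h y = h (x \<otimes>\<^bsub>A\<^esub> y)"
	and on: "\<one>\<^bsub>B\<^esub> = h \<one>\<^bsub>A\<^esub>"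
	shows "calg B"
proof -
	interpret A: calg A by fact
	have cs: "cspace B" by (rule cspace_image[OF _ im ad ze sm]) unfold_locales
	then interpret B: cspace B .
	have ri: "ring B"
	proof (rule ringI)
	show "Group.monoid B"
	by (rule monoidI) (auto simp flip: im simp: mu on A.m_assoc)
	qed (unfold_locales, auto simp flip: im simp: mu ad A.l_distr A.r_distr)
	show ?thesis
	by (rule calgI[OF cs ri]) (auto simp flip: im simp: sm mu A.sm_mult1 A.sm_mult2)
qed
text \<open>The restriction of an algebra, respectively of a vector space, to a subset closed under the operations.\<close>
lemma calg_restrict:
	assumes "calg A" "csub A H" "\<one>\<^bsub>A\<^esub> : H" "!!x y. x : H ==> y : H ==> x \<otimes>\<^bsub>A\<^esub> y : H"
	shows "calg (A\<lparr>carrier := H\<rparr>)"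
proof -
	interpret A: calg A by fact
	have H: "x : H ==> x : carrier A" for x using assms(2) by (auto simp: csub_def)
	have ab: "abelian_group (A\<lparr>carrier := H\<rparr>)"
	proof (rule abelian_groupI)
	fix x assume "x : carrier (A\<lparr>carrier := H\<rparr>)"
	hence "x : H" by simp
	hence "(-1) \<odot>\<^bsub>A\<^esub> x : H" "(-1) \<odot>\<^bsub>A\<^esub> x \<oplus>\<^bsub>A\<^esub> x = \<zero>\<^bsub>A\<^esub>"
	using assms(2) H[of x] A.l_neg[of x] A.a_inv_eq_sm[of x] by (auto simp: csub_def)
	thus "EX y:carrier (A\<lparr>carrier := H\<rparr>). y \<oplus>\<^bsub>A\<lparr>carrier := H\<rparr>\<^esub> x = \<zero>\<^bsub>A\<lparr>carrier := H\<rparr>\<^esub>"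
	by auto
	qed (use assms(2) H A.a_ac in "auto simp: csub_def")
	have cs: "cspace (A\<lparr>carrier := H\<rparr>)"
	by (rule cspaceI[OF ab]) (use assms(2) H in "auto simp: csub_def A.sm_l_distr A.sm_r_distr A.sm_assoc")
	have "ring (A\<lparr>carrier := H\<rparr>)"
	proof (rule ringI[OF ab])
	show "Group.monoid (A\<lparr>carrier := H\<rparr>)"
	by (rule monoidI) (use assms H in "auto simp: A.m_assoc")
	qed (use assms H in "auto simp: A.l_distr A.r_distr")
	thus ?thesis
	by (intro calgI cs) (use H in "auto simp: A.sm_mult1 A.sm_mult2")
qed
lemma comm_subalgebraI:
	assumes "calg A" "csub A H" "\<one>\<^bsub>A\<^esub> : H" "!!x y. x : H ==> y : H ==> x \<otimes>\<^bsub>A\<^esub> y : H"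
	and comm: "!!x y. x : H ==> y : H ==> x \<otimes>\<^bsub>A\<^esub> y = y \<otimes>\<^bsub>A\<^esub> x"
	shows "comm_subalgebra H A"
proof -
	interpret A: calg A by fact
	interpret H: calg "A\<lparr>carrier := H\<rparr>" by (rule calg_restrict) fact+
	have "cring (A\<lparr>carrier := H\<rparr>)"
	by (intro cring.intro comm_monoid.intro comm_monoid_axioms.intro)
	(unfold_locales, use comm in auto)
	hence "subcring H A" using A.subcring_iff[of H] assms(2) by (simp add: csub_def)
	thus ?thesis using assms(2) by (simp add: comm_subalgebra_def csub_def)
qed
subsection \<open>Quotients\<close>
lemma quot_simps:
	"carrier (quot A I) = (%a. I +>\<^bsub>A\<^esub> a) ` carrier A"
	"\<zero>\<^bsub>quot A I\<^esub> = I" "\<one>\<^bsub>quot A I\<^esub> = I +>\<^bsub>A\<^esub> \<one>\<^bsub>A\<^esub>"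
	"monoid.mult (quot A I) = rcoset_mult A I" "add (quot A I) = set_add A"
	"smult (quot A I) = (%c C. \<Union>a\<in>C. I +>\<^bsub>A\<^esub> (c \<odot>\<^bsub>A\<^esub> a))"
	by (auto simp: quot_def ring.extend_def module.fields_def FactRing_def A_RCOSETS_def'
	a_r_coset_def' ring.defs)
context cspace begin
lemma coset_eq_iff:
	assumes "csub V I" "x : carrier V" "y : carrier V"
	shows "I +> x = I +> y \<longleftrightarrow> x \<ominus> y : I"
proof -
	interpret I: abelian_subgroup I V by (rule additive_subgroup_csub) fact
	show ?thesis
	using assms I.a_rcos_module[of y x] I.a_repr_independence'[of x y] I.a_rcos_self[of x]
	by (auto simp: minus_eq)
qed
lemma quot_smult:
	assumes "csub V I" "x : carrier V"
	shows "c \<odot>\<^bsub>quot V I\<^esub> (I +> x) = I +> (c \<odot> x)"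
proof -
	interpret I: abelian_subgroup I V by (rule additive_subgroup_csub) fact
	have "I +> (c \<odot> a) = I +> (c \<odot> x)" if "a : I +> x" for a
	proof -
	obtain i where i: "i : I" "a = i \<oplus> x" using \<open>a : _\<close> by (auto simp: a_r_coset_def')
	hence [simp]: "i : carrier V" using assms by (auto simp: csub_def)
	have "c \<odot> a \<ominus> c \<odot> x = c \<odot> i"
	using i(2) assms(2) by (simp add: sm_r_distr minus_eq a_assoc r_neg)
	moreover have "c \<odot> i : I" using i(1) assms(1) by (simp add: csub_def)
	ultimately show ?thesis using coset_eq_iff[OF assms(1), of "c \<odot> a" "c \<odot> x"] i(2) assms(2) by simp
	qed
	moreover have "x : I +> x" using assms I.a_rcos_self by simp
	ultimately have "(\<Union>a\<in>I +> x. I +> (c \<odot> a)) = I +> (c \<odot> x)" by blast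
	thus ?thesis by (simp add: quot_simps)
qed
lemma quot_add:
	assumes "csub V I" "x : carrier V" "y : carrier V"
	shows "(I +> x) \<oplus>\<^bsub>quot V I\<^esub> (I +> y) = I +> (x \<oplus> y)"
proof -
	interpret I: abelian_subgroup I V by (rule additive_subgroup_csub) fact
	show ?thesis using assms by (simp add: quot_simps I.a_rcos_sum)
qed
lemma quot_zero: assumes "csub V I" shows "\<zero>\<^bsub>quot V I\<^esub> = I +> \<zero>"
	using assms by (simp add: quot_simps csub_def)
lemma cspace_quot: assumes "csub V I" shows "cspace (quot V I)"
	by (rule cspace_image[of V "%a. I +> a"])
	(use assms in "auto simp: quot_simps(1) quot_smult quot_add quot_zero intro: cspace_axioms")
lemma quot_UN:
	assumes "csub V I" "x : carrier V" "!!a. a : carrier V ==> a \<ominus> x : I ==> F a = F x"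
	shows "(\<Union>a\<in>I +> x. F a) = F x"
proof -
	interpret I: abelian_subgroup I V by (rule additive_subgroup_csub) fact
	have "x : I +> x" using assms I.a_rcos_self by simp
	moreover have "F a = F x" if "a : I +> x" for a
	proof -
	have "a : carrier V" using that assms(2) a_r_coset_subset_G I.a_subset by blast
	thus ?thesis using that assms I.a_rcos_module[of x a] by (simp add: minus_eq)
	qed
	ultimately show ?thesis by blast
qed
end
lemma (in calg) ideal_csub: assumes "ideal I A" shows "csub A I"
proof -
	interpret I: ideal I A by fact
	have "c \<odot> x : I" if "x : I" for c x
	proof -
	have "(c \<odot> \<one>) \<otimes> x : I" using that by (intro I.I_l_closed) auto
	thus ?thesis using that I.a_Hcarr by (simp add: sm_mult1)
	qed
	thus ?thesis using I.a_subset by (auto simp: csub_def)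
qed
lemma (in calg) quot_mult:
	assumes "ideal I A" "x : carrier A" "y : carrier A"
	shows "(I +> x) \<otimes>\<^bsub>quot A I\<^esub> (I +> y) = I +> (x \<otimes> y)"
	using assms by (simp add: quot_simps ideal.rcoset_mult_add)
lemma (in calg) calg_quot: assumes "ideal I A" shows "calg (quot A I)"
	by (rule calg_image[of A "%a. I +> a"])
	(use assms ideal_csub[OF assms] in "auto simp: quot_simps(1,3) quot_smult quot_add quot_zero quot_mult intro: calg_axioms")
lemma csub_lin_span:
	fixes V (structure)
	assumes "cspace V" "S <= carrier V"
	shows "csub V (lin_span V S)" "S <= lin_span V S"
	and "csub V W ==> S <= W ==> lin_span V S <= W"
proof -
	interpret cspace V by fact
	show "S <= lin_span V S"
	proof
	fix x assume "x : S"
	thus "x : lin_span V S" using assms(2)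
	unfolding lin_span_def
	by (intro CollectI exI[of _ 1] exI[of _ "%_. 1"] exI[of _ "%_. x"]) (auto simp: lessThan_Suc)
	qed
	show "csub V (lin_span V S)" unfolding csub_def
	proof (intro conjI ballI allI)
	show "lin_span V S <= carrier V" unfolding lin_span_def
	using assms(2) by (auto intro!: finsum_closed)
	show "\<zero> : lin_span V S" unfolding lin_span_def
	by (intro CollectI exI[of _ 0]) auto
	fix x assume "x : lin_span V S"
	then obtain l c a where x: "x = (\<Oplus>j\<in>{..<l::nat}. c j \<odot> a j)" "ALL j<l. a j : S"
	unfolding lin_span_def by blast
	{ fix y assume "y : lin_span V S"
	then obtain m d b where y: "y = (\<Oplus>j\<in>{..<m::nat}. d j \<odot> b j)" "ALL j<m. b j : S"
	unfolding lin_span_def by blast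
	let ?c = "%j. if j < l then c j else d (j - l)" and ?a = "%j. if j < l then a j else b (j - l)"
	have 1: "(\<Oplus>j\<in>{..<l}. ?c j \<odot> ?a j) = x" unfolding x
	by (rule finsum_cong') (use x assms(2) in auto)
	have inj: "inj_on ((+) l) {..<m}" by auto
	have im: "(+) l ` {..<m} = {l..<l+m}" by (auto simp: image_iff) (metis le_Suc_ex nat_add_left_cancel_less lessThan_iff)
	have aV: "a j : carrier V" if "j < l" for j using that x(2) assms(2) by auto
	have bV: "b (j - l) : carrier V" if "l <= j" "j < l + m" for j
	using that y(2) assms(2) by (auto simp: subset_iff)
	have "(\<Oplus>j\<in>{l..<l+m}. ?c j \<odot> ?a j) = (\<Oplus>j\<in>{..<m}. ?c (l+j) \<odot> ?a (l+j))"
	by (subst im[symmetric], rule finsum_reindex[OF _ inj]) (use aV bV im in auto)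
	also have "\<dots> = y" unfolding y
	by (rule finsum_cong') (use y assms(2) in auto)
	finally have 2: "(\<Oplus>j\<in>{l..<l+m}. ?c j \<odot> ?a j) = y" .
	have "{..<l+m} = {..<l} \<union> {l..<l+m}" by auto
	hence "(\<Oplus>j\<in>{..<l+m}. ?c j \<odot> ?a j) = x \<oplus> y"
	unfolding 1[symmetric] 2[symmetric]
	by (simp only:) (rule finsum_Un_disjoint, use aV bV in auto)
	thus "x \<oplus> y : lin_span V S" unfolding lin_span_def
	using x(2) y(2) by (intro CollectI exI[of _ "l+m"] exI[of _ ?c] exI[of _ ?a]) auto }
	fix e
	have "e \<odot> x = (\<Oplus>j\<in>{..<l}. (e * c j) \<odot> a j)" unfolding x
	using x(2) assms(2) by (subst sm_finsum) (auto intro!: finsum_cong' simp: sm_assoc)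
	thus "e \<odot> x : lin_span V S" unfolding lin_span_def
	using x(2) by (intro CollectI exI[of _ "l"] exI[of _ "%j. e * c j"] exI[of _ a]) auto
	qed
	assume W: "csub V W" "S <= W"
	show "lin_span V S <= W"
	proof
	fix x assume "x : lin_span V S"
	then obtain l c a where x: "x = (\<Oplus>j\<in>{..<l::nat}. c j \<odot> a j)" "ALL j<l. a j : S"
	unfolding lin_span_def by blast
	show "x : W" unfolding x
	by (rule csub_finsum[OF assms(1) W(1)]) (use W x in "auto simp: csub_def")
	qed
qed
subsection \<open>Coordinates\<close>
definition unemb :: "(complex, 'v) module => ('v pm) => 'v" where
	"unemb V p = (\<Oplus>\<^bsub>V\<^esub> k\<in>pkeys p \<inter> carrier V. lkp p k \<odot>\<^bsub>V\<^esub> k)"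
context cspace begin
lemma unemb_superset:
	assumes "finite K" "pkeys p <= K"
	shows "unemb V p = (\<Oplus>k\<in>K \<inter> carrier V. lkp p k \<odot> k)"
	unfolding unemb_def
	by (rule add.finprod_mono_neutral_cong_left) (use assms in "auto simp: in_keys_iff")
lemma unemb_closed [simp]: "unemb V p : carrier V"
	unfolding unemb_def by (rule finsum_closed) auto
lemma unemb_add: "unemb V (p + q) = unemb V p \<oplus> unemb V q"
proof -
	let ?K = "pkeys p \<union> pkeys q"
	have "unemb V (p + q) = (\<Oplus>k\<in>?K \<inter> carrier V. lkp (p + q) k \<odot> k)"
	by (rule unemb_superset) (use keys_add[of p q] in auto)
	also have "\<dots> = (\<Oplus>k\<in>?K \<inter> carrier V. lkp p k \<odot> k \<oplus> lkp q k \<odot> k)"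
	by (rule finsum_cong') (auto simp: lookup_add sm_l_distr)
	also have "\<dots> = unemb V p \<oplus> unemb V q"
	by (subst finsum_addf) (auto simp: unemb_superset[of ?K, symmetric])
	finally show ?thesis .
qed
lemma unemb_scale: "unemb V (pm_scale c p) = c \<odot> unemb V p"
proof -
	have "unemb V (pm_scale c p) = (\<Oplus>k\<in>pkeys p \<inter> carrier V. lkp (pm_scale c p) k \<odot> k)"
	by (rule unemb_superset) (use keys_pm_scale[of c p] in auto)
	also have "\<dots> = (\<Oplus>k\<in>pkeys p \<inter> carrier V. c \<odot> (lkp p k \<odot> k))"
	by (rule finsum_cong') (auto simp: sm_assoc)
	also have "\<dots> = c \<odot> unemb V p"
	unfolding unemb_def by (rule sm_finsum[symmetric]) auto
	finally show ?thesis .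
qed
lemma unemb_zero [simp]: "unemb V 0 = \<zero>"
	by (simp add: unemb_def)
lemma unemb_single: "x : carrier V ==> unemb V (Poly_Mapping.single x c) = c \<odot> x"
	by (subst unemb_superset[of "{x}"]) (auto simp: Int_absorb2 finsum_insert)
lemma unemb_sum: "unemb V (SUM j:J. g j) = (\<Oplus>j\<in>J. unemb V (g j))"
proof (induction J rule: infinite_finite_induct)
	case (insert j J)
	thus ?case by (simp add: unemb_add finsum_insert Pi_def)
qed (simp_all add: finsum_infinite)
lemma unemb_diff_eq_zero: "unemb V (p - q) = \<zero> \<longleftrightarrow> unemb V p = unemb V q"
proof -
	have "unemb V p = unemb V (p - q) \<oplus> unemb V q" by (simp flip: unemb_add)
	thus ?thesis using add.r_cancel_one'[of "unemb V q" "unemb V (p - q)"] by auto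
qed
lemma subspace_unemb_kernel: "pm.subspace {p. unemb V p = \<zero>}"
	by (auto simp: pm.subspace_def unemb_add unemb_scale)
end
text \<open>
  Every complex vector space with a carrier is isomorphic to a subspace of the space of finitely
  supported functions on it: a linear section of the evaluation of formal linear combinations.
  This makes the linear algebra of types available for it.
\<close>
definition section_of :: "(complex, 'v) module => ('v pm) => 'v pm" where
	"section_of V = (SOME f. pmlin f &
	(ALL p. unemb V p = \<zero>\<^bsub>V\<^esub> --> f p = 0) & (ALL p. unemb V (p - f p) = \<zero>\<^bsub>V\<^esub>))"
definition emb :: "(complex, 'v) module => 'v => ('v pm)" where
	"emb V x = section_of V (sgl x)"
context cspace begin
lemma section_of:
	"pmlin (section_of V)"
	"unemb V p = \<zero> ==> section_of V p = 0" "unemb V (p - section_of V p) = \<zero>"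
proof -
	have "EX f. pmlin f &
	(ALL p. unemb V p = \<zero> --> f p = 0) & (ALL p. unemb V (p - f p) = \<zero>)"
	using kernel_retraction[OF pm.vector_space_axioms subspace_unemb_kernel] by auto
	from someI_ex[OF this] show
	"pmlin (section_of V)"
	"unemb V p = \<zero> ==> section_of V p = 0" "unemb V (p - section_of V p) = \<zero>"
	unfolding section_of_def by blast+
qed
lemma section_of_cong: assumes "unemb V p = unemb V q" shows "section_of V p = section_of V q"
proof -
	interpret s: Vector_Spaces.linear pm_scale pm_scale "section_of V" by (rule section_of)
	have "section_of V (p - q) = 0" using assms by (intro section_of) (simp add: unemb_diff_eq_zero)
	thus ?thesis by (simp add: s.diff)
qed
lemma emb_unemb: "x : carrier V ==> unemb V p = x ==> emb V x = section_of V p"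
	unfolding emb_def by (rule section_of_cong) (simp add: unemb_single)
lemma unemb_emb [simp]: "x : carrier V ==> unemb V (emb V x) = x"
	using section_of(3)[of "sgl x"] unfolding emb_def unemb_diff_eq_zero by (simp add: unemb_single)
lemma emb_add: assumes "x : carrier V" "y : carrier V" shows "emb V (x \<oplus> y) = emb V x + emb V y"
proof -
	interpret s: Vector_Spaces.linear pm_scale pm_scale "section_of V" by (rule section_of)
	have "emb V (x \<oplus> y) = section_of V (sgl x + sgl y)"
	using assms by (intro emb_unemb) (auto simp: unemb_add unemb_single)
	thus ?thesis by (simp add: s.add emb_def)
qed
lemma emb_scale: assumes "x : carrier V" shows "emb V (c \<odot> x) = pm_scale c (emb V x)"
proof -
	interpret s: Vector_Spaces.linear pm_scale pm_scale "section_of V" by (rule section_of)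
	have "emb V (c \<odot> x) = section_of V (pm_scale c (sgl x))"
	using assms by (intro emb_unemb) (auto simp: unemb_single)
	thus ?thesis by (simp only: s.scale emb_def)
qed
lemma emb_zero [simp]: "emb V \<zero> = 0"
	using section_of(2)[of "sgl \<zero>"] by (simp add: emb_def unemb_single)
lemma emb_eq_iff: "x : carrier V ==> y : carrier V ==> emb V x = emb V y \<longleftrightarrow> x = y"
	by (metis unemb_emb)
lemma emb_finsum:
	assumes "!!j. j : J ==> g j : carrier V"
	shows "emb V (\<Oplus>j\<in>J. g j) = (SUM j:J. emb V (g j))"
	using assms
proof (induction J rule: infinite_finite_induct)
	case (insert j J)
	hence "g : J \<rightarrow> carrier V" by auto
	with insert show ?case by (simp add: emb_add finsum_insert finsum_closed)
qed (simp_all add: finsum_infinite)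
text \<open>A subspace is determined by the linear functionals that vanish on it.\<close>
lemma mem_csub_iff_functional:
	assumes W: "csub V W" and x: "x : carrier V"
	and func: "!!\<mu>. pmfun \<mu> ==> (ALL w:W. \<mu> (emb V w) = (0::complex)) ==> \<mu> (emb V x) = 0"
	shows "x : W"
proof (rule ccontr)
	assume "x ~: W"
	have Wc: "w : carrier V" if "w : W" for w using W that by (auto simp: csub_def)
	have sub: "pm.subspace (emb V ` W)"
	unfolding pm.subspace_def
	proof (intro conjI ballI allI)
	show "0 : emb V ` W" using W emb_zero by (force simp: csub_def image_iff)
	fix a assume "a : emb V ` W"
	then obtain w where w: "w : W" "a = emb V w" by auto
	{ fix b assume "b : emb V ` W"
	then obtain w' where w': "w' : W" "b = emb V w'" by auto
	have "a + b = emb V (w \<oplus> w')" using w w' Wc by (simp add: emb_add)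
	thus "a + b : emb V ` W" using W w w' by (auto simp: csub_def) }
	fix c
	have "pm_scale c a = emb V (c \<odot> w)" using w Wc by (simp add: emb_scale)
	thus "pm_scale c a : emb V ` W" using W w by (auto simp: csub_def)
	qed
	have "emb V x ~: emb V ` W" using \<open>x ~: W\<close> x Wc emb_eq_iff by blast
	from separating_functional[OF pm.vector_space_axioms sub this] func show False by auto
qed
end
section \<open>Words, free algebras and enveloping algebras\<close>
instantiation list :: (type) monoid_add
begin
definition zero_list :: "'a list" where "zero_list = []"
definition plus_list :: "'a list => 'a list => 'a list" where "plus_list = (@)"
instance by standard (auto simp: zero_list_def plus_list_def)
end
lemma sgl_times [simp]: "Poly_Mapping.single v a * Poly_Mapping.single w b = Poly_Mapping.single (v @ w) (a * b :: complex)"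
	by (simp add: mult_single plus_list_def)
lemma one_words: "(1 :: 'x list pm) = sgl []"
	by (simp add: zero_list_def flip: single_one)
lemma pm_sum_single: "(p :: 'x pm) = (SUM k:pkeys p. Poly_Mapping.single k (lkp p k))"
	using pm_expand[of p] by simp
lemma pm_scale_times: "pm_scale c p * q = pm_scale c (p * (q :: 'x list pm))"
	by (simp add: pm_scale_def mult_map_scale_conv_mult mult.assoc)
lemma times_pm_scale: "p * pm_scale c q = pm_scale c (p * (q :: 'x list pm))"
proof -
	have "p * Poly_Mapping.single [] c = Poly_Mapping.single [] c * p"
	by (rule ssubst[OF pm_sum_single[of p]]) (simp add: sum_distrib_left sum_distrib_right mult.commute)
	thus ?thesis
	by (simp add: pm_scale_def mult_map_scale_conv_mult zero_list_def flip: mult.assoc)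
qed
lemma pm_linear_times:
	fixes a b :: "'x list pm"
	shows "pmlin (%p. a * p)" "pmlin (%p. p * b)"
	"pmlin (%p. a * p * b)"
	unfolding Vector_Spaces.linear_iff
	by (auto simp: pm.vector_space_axioms algebra_simps pm_scale_times times_pm_scale)
definition supported :: "'x set => ('x pm) set" where
	"supported K = {p. pkeys p <= K}"
abbreviation word_polys :: "'x set => ('x list pm) set" where
	"word_polys S == supported (lists S)"
lemma subspace_supported: "pm.subspace (supported K)"
	unfolding supported_def by (rule subspace_keys)
lemma supported_keysD: "p : supported K ==> k : pkeys p ==> k : K"
	by (auto simp: supported_def)
lemma supported_single [simp, intro]: "k : K ==> Poly_Mapping.single k c : supported K"
	by (auto simp: supported_def split: if_splits)
lemma supported_zero [simp]: "0 : supported K"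
	by (rule pm.subspace_0[OF subspace_supported])
lemma supported_add [simp, intro]: "p : supported K ==> q : supported K ==> p + q : supported K"
	by (rule pm.subspace_add[OF subspace_supported])
lemma supported_diff [simp, intro]: "p : supported K ==> q : supported K ==> p - q : supported K"
	by (rule pm.subspace_diff[OF subspace_supported])
lemma supported_scale [simp, intro]: "p : supported K ==> pm_scale c p : supported K"
	by (rule pm.subspace_scale[OF subspace_supported])
lemma supported_sum [simp, intro]: "(!!j. j : J ==> f j : supported K) ==> sum f J : supported K"
	by (rule pm.subspace_sum[OF subspace_supported])
lemma supported_push: "p : supported K ==> \<phi> ` K <= K' ==> push \<phi> p : supported K'"
	using keys_push[of \<phi> p] unfolding supported_def by blast
lemma supported_memI:
	"pm.subspace W ==> p : supported K ==> (!!k. k : K ==> sgl k : W) ==> p : W"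
	by (rule pm_subspace_memI) (auto dest: supported_keysD)
lemma word_polys_times [simp, intro]:
	assumes "p : word_polys S" "q : word_polys S" shows "p * q : word_polys S"
proof -
	have "pkeys p <= lists S" "pkeys q <= lists S" using assms by (auto simp: supported_def)
	thus ?thesis using keys_mult[of p q] unfolding supported_def by (fastforce simp: plus_list_def)
qed
lemma word_polys_one [simp]: "1 : word_polys S"
	by (simp add: one_words)
lemma free_algebra_simps [simp]:
	"carrier (free_algebra S) = word_polys S" "\<zero>\<^bsub>free_algebra S\<^esub> = 0" "\<one>\<^bsub>free_algebra S\<^esub> = 1"
	"monoid.mult (free_algebra S) = (*)" "add (free_algebra S) = (+)" "smult (free_algebra S) = pm_scale"
proof -
	have "(SUM v:pkeys p. SUM w:pkeys q. Poly_Mapping.single (v @ w) (lkp p v * lkp q w)) = p * q"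
	for p q :: "'a list pm"
	proof -
	have "p * q = (SUM v:pkeys p. Poly_Mapping.single v (lkp p v)) * (SUM w:pkeys q. Poly_Mapping.single w (lkp q w))"
	by (intro arg_cong2[where f="(*)"] pm_sum_single)
	thus ?thesis by (simp add: sum_product)
	qed
	thus "monoid.mult (free_algebra S) = (*)" by (auto simp: free_algebra_def fun_eq_iff)
qed (auto simp: free_algebra_def one_words supported_def)
lemma cspace_pm:
	assumes "carrier V = (supported K :: ('x pm) set)" "\<zero>\<^bsub>V\<^esub> = 0" "add V = (+)" "smult V = pm_scale"
	shows "cspace V"
proof -
	have ab: "abelian_group V"
	proof (rule abelian_groupI)
	fix x assume "x : carrier V"
	thus "EX y:carrier V. y \<oplus>\<^bsub>V\<^esub> x = \<zero>\<^bsub>V\<^esub>"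
	using assms pm.subspace_neg[OF subspace_supported, of x K] by (intro bexI[of _ "- x"]) auto
	qed (use assms in "simp_all add: add.assoc add.commute")
	show ?thesis
	by (rule cspaceI[OF ab]) (use assms in "simp_all add: pm.scale_left_distrib pm.scale_right_distrib")
qed
lemma calg_free_algebra: "calg (free_algebra S)"
proof -
	have cs: "cspace (free_algebra S)" by (rule cspace_pm[where K="lists S"]) simp_all
	then interpret cspace "free_algebra S" .
	have "ring (free_algebra S)"
	by (rule ringI[OF abelian_group_axioms monoidI])
	(auto simp: algebra_simps)
	thus ?thesis by (intro calgI cs) (auto simp: pm_scale_times times_pm_scale)
qed
lemma pm_minus_eq:
	fixes V :: "(complex, 'x pm) module"
	assumes "carrier V = (supported K :: ('x pm) set)" "\<zero>\<^bsub>V\<^esub> = 0" "add V = (+)" "smult V = pm_scale"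
	and "p : carrier V" "q : carrier V"
	shows "p \<ominus>\<^bsub>V\<^esub> q = p - q"
proof -
	interpret cspace V by (rule cspace_pm) fact+
	show ?thesis using assms by (simp add: minus_eq a_inv_eq_sm)
qed
lemmas free_algebra_minus = pm_minus_eq[of "free_algebra S" "lists S" for S, simplified]
lemma free_space_simps [simp]:
	"carrier (free_space B) = supported B" "\<zero>\<^bsub>free_space B\<^esub> = 0"
	"add (free_space B) = (+)" "smult (free_space B) = pm_scale"
	by (auto simp: free_space_def supported_def)
lemmas cspace_free_space = cspace_pm[of "free_space B" B for B, simplified]
lemmas free_space_minus = pm_minus_eq[of "free_space B" B for B, simplified]
lemma csub_free_iff:
	fixes V :: "(complex, 'x pm) module"
	assumes "carrier V = (supported K :: ('x pm) set)" "\<zero>\<^bsub>V\<^esub> = 0" "add V = (+)" "smult V = pm_scale"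
	shows "csub V W \<longleftrightarrow> W <= carrier V & pm.subspace W"
	using assms by (auto simp: csub_def pm.subspace_def)
locale lie_space =
	fixes L :: "('x::ab_group_add) lie_algebra"
	assumes vs: "vector_space (lscale L)" and sub: "module.subspace (lscale L) (lcarrier L)"
	and br_closed: "x : lcarrier L ==> y : lcarrier L ==> lbracket L x y : lcarrier L"
begin
sublocale vs: vector_space "lscale L" by (rule vs)
sublocale FA: calg "free_algebra (lcarrier L)" by (rule calg_free_algebra)
abbreviation "WP == word_polys (lcarrier L)"
lemma uea_relationsI:
	"x : lcarrier L ==> y : lcarrier L ==> gen (x + y) - gen x - gen y : uea_relations L"
	"x : lcarrier L ==> gen (lscale L c x) - pm_scale c (gen x) : uea_relations L"
	"x : lcarrier L ==> y : lcarrier L ==> sgl [x, y] - sgl [y, x] - gen (lbracket L x y) : uea_relations L"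
	unfolding uea_relations_def by blast+
lemma uea_relations_cases:
	assumes "r : uea_relations L"
	obtains (add) x y where "r = gen (x + y) - gen x - gen y" "x : lcarrier L" "y : lcarrier L"
	| (scale) c x where "r = gen (lscale L c x) - pm_scale c (gen x)" "x : lcarrier L"
	| (bracket) x y where "r = sgl [x, y] - sgl [y, x] - gen (lbracket L x y)" "x : lcarrier L" "y : lcarrier L"
	using assms unfolding uea_relations_def by blast
lemma relations_subset: "uea_relations L <= WP"
proof -
	have 1: "gen x : WP" if "x : lcarrier L" for x using that by auto
	have 2: "sgl [x, y] : WP" if "x : lcarrier L" "y : lcarrier L" for x y using that by auto
	have 3: "gen (x + y) - gen x - gen y : WP" if "x : lcarrier L" "y : lcarrier L" for x y
	using that by (intro supported_diff 1 vs.subspace_add[OF sub])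
	have 4: "gen (lscale L c x) - pm_scale c (gen x) : WP" if "x : lcarrier L" for c x
	using that by (intro supported_diff supported_scale 1 vs.subspace_scale[OF sub])
	have 5: "sgl [x, y] - sgl [y, x] - gen (lbracket L x y) : WP" if "x : lcarrier L" "y : lcarrier L" for x y
	using that by (intro supported_diff 1 2 br_closed)
	show ?thesis
	unfolding uea_relations_def using 3 4 5 by blast
qed
lemma ideal_uea_ideal: "ideal (uea_ideal L) (free_algebra (lcarrier L))"
	unfolding uea_ideal_def by (rule FA.genideal_ideal) (use relations_subset in simp)
sublocale U: calg "uea L"
	unfolding uea_def by (rule FA.calg_quot[OF ideal_uea_ideal])
lemma csub_uea_ideal: "csub (free_algebra (lcarrier L)) (uea_ideal L)"
	by (rule FA.ideal_csub[OF ideal_uea_ideal])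
lemma uea_ideal_subspace: "pm.subspace (uea_ideal L)" "uea_ideal L <= WP"
	using csub_uea_ideal csub_free_iff[of "free_algebra (lcarrier L)" "lists (lcarrier L)"] by simp_all
lemma uea_ideal_rel: "r : uea_relations L ==> r : uea_ideal L"
	unfolding uea_ideal_def using FA.genideal_self relations_subset by auto
lemma uea_ideal_times: "r : uea_ideal L ==> p : WP ==> q : WP ==> p * r * q : uea_ideal L"
	using ideal.I_l_closed[OF ideal_uea_ideal, of r p] ideal.I_r_closed[OF ideal_uea_ideal, of "p * r" q] by auto
text \<open>The ideal is spanned by the relations with words on both sides.\<close>
lemma uea_ideal_minimal:
	assumes W: "pm.subspace W"
	and rel: "!!r u v. r : uea_relations L ==> u : lists (lcarrier L) ==> v : lists (lcarrier L) ==> sgl u * r * sgl v : W"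
	shows "uea_ideal L <= W"
proof -
	define I where "I = {p : WP. ALL u:lists (lcarrier L). ALL v:lists (lcarrier L). sgl u * p * sgl v : W}"
	have preimage: "pm.subspace {p. sgl u * p * sgl v : W}" for u v :: "'x list"
	proof -
	interpret l: Vector_Spaces.linear pm_scale pm_scale "%p. sgl u * p * sgl v" by (rule pm_linear_times)
	show ?thesis using W by (auto simp: pm.subspace_def l.add l.scale)
	qed
	have subI: "pm.subspace I"
	unfolding I_def using preimage
	by (auto simp: pm.subspace_def)
	have mul: "a * p * b : I" if p: "p : I" and a: "a : WP" and b: "b : WP" for a b p
	proof -
	have 1: "a * p * sgl v : I" if v: "v : lists (lcarrier L)" for v
	proof -
	interpret l: Vector_Spaces.linear pm_scale pm_scale "%a. a * (p * sgl v)" by (rule pm_linear_times)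
	have "pm.subspace {a. a * (p * sgl v) : I}"
	using subI by (auto simp: pm.subspace_def l.add l.scale)
	hence "a : {a. a * (p * sgl v) : I}" using a
	proof (rule supported_memI)
	fix k assume k: "k : lists (lcarrier L)"
	have "sgl u * (sgl k * (p * sgl v)) * sgl v' : W" if "u : lists (lcarrier L)" "v' : lists (lcarrier L)" for u v'
	proof -
	have "ALL u:lists (lcarrier L). ALL v:lists (lcarrier L). sgl u * p * sgl v : W"
	using p by (simp add: I_def)
	moreover have "u @ k : lists (lcarrier L)" "v @ v' : lists (lcarrier L)" using k v that by auto
	ultimately have "sgl (u @ k) * p * sgl (v @ v') : W" by blast
	moreover have "sgl (u @ k) = sgl u * sgl k" "sgl (v @ v') = sgl v * sgl v'" by simp_all
	ultimately show ?thesis by (simp only: mult.assoc)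
	qed
	moreover have "sgl k * (p * sgl v) : WP" using p k v unfolding I_def
	by (intro word_polys_times) auto
	ultimately show "sgl k : {a. a * (p * sgl v) : I}" by (simp add: I_def)
	qed
	thus ?thesis by (simp add: mult.assoc)
	qed
	interpret l: Vector_Spaces.linear pm_scale pm_scale "%b. a * p * b" by (rule pm_linear_times)
	have "pm.subspace {b. a * p * b : I}"
	using subI by (auto simp: pm.subspace_def l.add l.scale)
	hence "b : {b. a * p * b : I}"
	by (rule supported_memI[OF _ b]) (use 1 in auto)
	thus ?thesis by simp
	qed
	have one: "1 : WP" by simp
	have IW: "I <= W" unfolding I_def
	proof
	fix p assume "p : {p : WP. ALL u:lists (lcarrier L). ALL v:lists (lcarrier L). sgl u * p * sgl v : W}"
	hence "sgl [] * p * sgl [] : W" by blast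
	thus "p : W" by (simp flip: one_words)
	qed
	have "csub (free_algebra (lcarrier L)) I"
	using subI by (subst csub_free_iff[where K="lists (lcarrier L)"]) (auto simp: I_def)
	then interpret I: abelian_subgroup I "free_algebra (lcarrier L)" by (rule FA.additive_subgroup_csub)
	have "ideal I (free_algebra (lcarrier L))"
	proof (rule idealI[OF FA.ring_axioms I.a_subgroup])
	fix a x assume a: "a : I" "x : carrier (free_algebra (lcarrier L))"
	hence x: "x : WP" by simp
	show "x \<otimes>\<^bsub>free_algebra (lcarrier L)\<^esub> a : I" using mul[OF a(1) x one] by simp
	show "a \<otimes>\<^bsub>free_algebra (lcarrier L)\<^esub> x : I" using mul[OF a(1) one x] by simp
	qed
	moreover have "uea_relations L <= I"
	unfolding I_def using relations_subset rel by auto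
	ultimately have "uea_ideal L <= I" unfolding uea_ideal_def by (rule FA.genideal_minimal)
	thus ?thesis using IW by simp
qed
lemma uea_class_eq_iff: "p : WP ==> q : WP ==> uea_class L p = uea_class L q \<longleftrightarrow> p - q : uea_ideal L"
	unfolding uea_class_def
	by (subst FA.coset_eq_iff[OF csub_uea_ideal]) (simp_all add: free_algebra_minus)
lemma uea_carrier: "carrier (uea L) = uea_class L ` WP"
	by (simp add: uea_def quot_simps uea_class_def)
lemma uea_class_closed [simp, intro]: "p : WP ==> uea_class L p : carrier (uea L)"
	by (auto simp: uea_carrier)
lemma uea_class_ops:
	assumes "p : WP" "q : WP"
	shows "uea_class L p \<oplus>\<^bsub>uea L\<^esub> uea_class L q = uea_class L (p + q)"
	"uea_class L p \<otimes>\<^bsub>uea L\<^esub> uea_class L q = uea_class L (p * q)"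
	using FA.quot_add[OF csub_uea_ideal] FA.quot_mult[OF ideal_uea_ideal] assms
	by (simp_all add: uea_def uea_class_def)
lemma uea_class_scale:
	assumes "p : WP"
	shows "c \<odot>\<^bsub>uea L\<^esub> uea_class L p = uea_class L (pm_scale c p)"
	using FA.quot_smult[OF csub_uea_ideal] assms
	by (simp add: uea_def uea_class_def)
lemma uea_one_zero: "\<one>\<^bsub>uea L\<^esub> = uea_class L 1" "\<zero>\<^bsub>uea L\<^esub> = uea_class L 0"
	using FA.quot_zero[OF csub_uea_ideal] by (simp_all add: uea_def quot_simps uea_class_def)
lemma uea_class_UN:
	assumes "p : WP" "!!q. q : WP ==> q - p : uea_ideal L ==> G q = G p"
	shows "(\<Union>q\<in>uea_class L p. G q) = G p"
	unfolding uea_class_def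
	by (rule FA.quot_UN[OF csub_uea_ideal]) (use assms in "auto simp: free_algebra_minus")
lemma gen_WP [simp]: "x : lcarrier L ==> gen x : WP" by auto
lemma uea_incl_closed [simp]: "x : lcarrier L ==> uea_incl L x : carrier (uea L)"
	by (simp add: uea_incl_def uea_carrier)
lemma uea_incl_add:
	assumes "x : lcarrier L" "y : lcarrier L"
	shows "uea_incl L (x + y) = uea_incl L x \<oplus>\<^bsub>uea L\<^esub> uea_incl L y"
proof -
	have c: "x + y : lcarrier L" using assms vs.subspace_add[OF sub] by simp
	have "gen (x + y) - gen x - gen y : uea_ideal L"
	by (rule uea_ideal_rel[OF uea_relationsI(1)]) (use assms in simp_all)
	thus ?thesis unfolding uea_incl_def
	using assms c by (simp add: uea_class_ops uea_class_eq_iff algebra_simps)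
qed
lemma uea_incl_scale:
	assumes "x : lcarrier L"
	shows "uea_incl L (lscale L c x) = c \<odot>\<^bsub>uea L\<^esub> uea_incl L x"
proof -
	have c: "lscale L c x : lcarrier L" using assms vs.subspace_scale[OF sub] by simp
	have "gen (lscale L c x) - pm_scale c (gen x) : uea_ideal L"
	by (rule uea_ideal_rel[OF uea_relationsI(2)]) (use assms in simp_all)
	thus ?thesis unfolding uea_incl_def
	using assms c by (simp add: uea_class_scale uea_class_eq_iff)
qed
lemma uea_incl_bracket:
	assumes "x : lcarrier L" "y : lcarrier L"
	shows "uea_incl L x \<otimes>\<^bsub>uea L\<^esub> uea_incl L y =
	uea_incl L y \<otimes>\<^bsub>uea L\<^esub> uea_incl L x \<oplus>\<^bsub>uea L\<^esub> uea_incl L (lbracket L x y)"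
proof -
	have c: "lbracket L x y : lcarrier L" using assms br_closed by simp
	have "sgl [x, y] - sgl [y, x] - gen (lbracket L x y) : uea_ideal L"
	by (rule uea_ideal_rel[OF uea_relationsI(3)]) (use assms in simp_all)
	hence *: "sgl [x, y] - (sgl [y, x] + gen (lbracket L x y)) : uea_ideal L"
	by (simp add: algebra_simps)
	have W: "sgl [x, y] : WP" "sgl [y, x] : WP" "gen (lbracket L x y) : WP" using assms c by auto
	have "uea_class L (sgl [x, y]) = uea_class L (sgl [y, x] + gen (lbracket L x y))"
	using W * by (simp add: uea_class_eq_iff)
	thus ?thesis unfolding uea_incl_def using assms W
	by (simp add: uea_class_ops)
qed
end
lemma push_map_times: "push (map \<phi>) (p * q) = push (map \<phi>) p * push (map \<phi>) (q :: 'x list pm)"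
proof -
	interpret P: Vector_Spaces.linear pm_scale pm_scale "push (map \<phi>) :: ('x list pm) => _" by (rule linear_push)
	have 1: "push (map \<phi>) (sgl v * q) = push (map \<phi>) (sgl v) * push (map \<phi>) q" for v and q :: "'x list pm"
	by (rule pm_linear_eq_on[where p=q and sc=pm_scale])
	(auto simp: pm_lin_iff algebra_simps P.add P.scale times_pm_scale)
	show ?thesis
	by (rule pm_linear_eq_on[where p=p and sc=pm_scale])
	(auto simp: pm_lin_iff algebra_simps P.add P.scale pm_scale_times 1)
qed
lemma push_compose: "push \<phi> (push \<psi> p) = push (%x. \<phi> (\<psi> x)) p"
proof -
	interpret P: Vector_Spaces.linear pm_scale pm_scale "push \<phi>" by (rule linear_push)
	interpret Q: Vector_Spaces.linear pm_scale pm_scale "push \<psi>" by (rule linear_push)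
	interpret R: Vector_Spaces.linear pm_scale pm_scale "push (%x. \<phi> (\<psi> x))" by (rule linear_push)
	show ?thesis
	by (rule pm_linear_eq_on[where p=p and sc=pm_scale])
	(auto simp: pm_lin_iff P.add P.scale Q.add Q.scale R.add R.scale)
qed
lemma uea_map_class:
	fixes L :: "('x::ab_group_add) lie_algebra" and L' :: "('y::ab_group_add) lie_algebra"
	assumes "lie_space L" "lie_space L'"
	and car: "!!x. x : lcarrier L ==> \<phi> x : lcarrier L'"
	and add: "!!x y. x : lcarrier L ==> y : lcarrier L ==> \<phi> (x + y) = \<phi> x + \<phi> y"
	and sc: "!!c x. x : lcarrier L ==> \<phi> (lscale L c x) = lscale L' c (\<phi> x)"
	and br: "!!x y. x : lcarrier L ==> y : lcarrier L ==> \<phi> (lbracket L x y) = lbracket L' (\<phi> x) (\<phi> y)"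
	and p: "p : word_polys (lcarrier L)"
	shows "uea_map L' \<phi> (uea_class L p) = uea_class L' (push (map \<phi>) p)"
	and "push (map \<phi>) p : word_polys (lcarrier L')"
proof -
	interpret A: lie_space L by fact
	interpret B: lie_space L' by fact
	interpret P: Vector_Spaces.linear pm_scale pm_scale "push (map \<phi>) :: ('x list pm) => _" by (rule linear_push)
	have push: "push (map \<phi>) p : B.WP" if "p : A.WP" for p
	using that by (rule supported_push) (use car in auto)
	thus "push (map \<phi>) p : word_polys (lcarrier L')" using p .
	have "uea_ideal L <= {r. push (map \<phi>) r : uea_ideal L'}"
	proof (rule A.uea_ideal_minimal)
	show "pm.subspace {r. push (map \<phi>) r : uea_ideal L'}"
	using B.uea_ideal_subspace(1) by (auto simp: pm.subspace_def P.add P.scale)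
	fix r u v assume r: "r : uea_relations L" and uv: "u : lists (lcarrier L)" "v : lists (lcarrier L)"
	have "push (map \<phi>) r : uea_relations L'"
	using r
	proof (cases r rule: A.uea_relations_cases)
	case (add x y)
	thus ?thesis using B.uea_relationsI(1)[OF car car, of x y] by (simp add: P.diff assms(4))
	next
	case (scale c x)
	thus ?thesis using B.uea_relationsI(2)[OF car, of x c] by (simp add: P.diff sc)
	next
	case (bracket x y)
	thus ?thesis using B.uea_relationsI(3)[OF car car, of x y] by (simp add: P.diff br)
	qed
	hence "push (map \<phi>) r : uea_ideal L'" by (rule B.uea_ideal_rel)
	moreover have "sgl (map \<phi> u) : B.WP" "sgl (map \<phi> v) : B.WP"
	using uv car by (auto intro!: supported_single)
	ultimately show "sgl u * r * sgl v : {r. push (map \<phi>) r : uea_ideal L'}"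
	by (simp add: push_map_times B.uea_ideal_times)
	qed
	thus "uea_map L' \<phi> (uea_class L p) = uea_class L' (push (map \<phi>) p)"
	unfolding uea_map_def using p push
	by (intro A.uea_class_UN) (auto simp: B.uea_class_eq_iff P.diff)
qed
subsection \<open>Induced modules\<close>
locale induced_data = lie_space L + N: cspace N
	for L :: "('x::ab_group_add) lie_algebra" and N :: "(complex, 'm) module" +
	fixes H :: "'x set" and act :: "'x => 'm => 'm"
	assumes H_sub: "H <= lcarrier L"
	and act_closed: "x : H ==> m : carrier N ==> act x m : carrier N"
begin
abbreviation "FS == free_space (carrier (uea L) \<times> carrier N)"
abbreviation "Ind == induced L H N act"
abbreviation "tens == induced_tensor L H N act"
abbreviation "iact == induced_action L H N act"
sublocale FS: cspace FS by (rule cspace_free_space)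
lemma FS_mem: "a : carrier (uea L) ==> m : carrier N ==> Poly_Mapping.single (a, m) c : carrier FS"
	by auto
lemma FS_sub: "pm.subspace (carrier FS)"
	by (simp add: subspace_supported)
lemma induced_relations_cases:
	assumes "r : induced_relations L H N act"
	obtains (add1) a b m where "r = sgl (a \<oplus>\<^bsub>uea L\<^esub> b, m) - sgl (a, m) - sgl (b, m)" "a : carrier (uea L)" "b : carrier (uea L)" "m : carrier N"
	| (add2) a m m' where "r = sgl (a, m \<oplus>\<^bsub>N\<^esub> m') - sgl (a, m) - sgl (a, m')" "a : carrier (uea L)" "m : carrier N" "m' : carrier N"
	| (sc1) c a m where "r = sgl (c \<odot>\<^bsub>uea L\<^esub> a, m) - pm_scale c (sgl (a, m))" "a : carrier (uea L)" "m : carrier N"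
	| (sc2) c a m where "r = sgl (a, c \<odot>\<^bsub>N\<^esub> m) - pm_scale c (sgl (a, m))" "a : carrier (uea L)" "m : carrier N"
	| (bal) a x m where "r = sgl (a \<otimes>\<^bsub>uea L\<^esub> uea_incl L x, m) - sgl (a, act x m)" "a : carrier (uea L)" "x : H" "m : carrier N"
	using assms unfolding induced_relations_def Let_def by blast
lemma induced_relationsI:
	"a : carrier (uea L) ==> b : carrier (uea L) ==> m : carrier N ==>
	sgl (a \<oplus>\<^bsub>uea L\<^esub> b, m) - sgl (a, m) - sgl (b, m) : induced_relations L H N act"
	"a : carrier (uea L) ==> m : carrier N ==> m' : carrier N ==>
	sgl (a, m \<oplus>\<^bsub>N\<^esub> m') - sgl (a, m) - sgl (a, m') : induced_relations L H N act"
	"a : carrier (uea L) ==> m : carrier N ==>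
	sgl (c \<odot>\<^bsub>uea L\<^esub> a, m) - pm_scale c (sgl (a, m)) : induced_relations L H N act"
	"a : carrier (uea L) ==> m : carrier N ==>
	sgl (a, c \<odot>\<^bsub>N\<^esub> m) - pm_scale c (sgl (a, m)) : induced_relations L H N act"
	"a : carrier (uea L) ==> x : H ==> m : carrier N ==>
	sgl (a \<otimes>\<^bsub>uea L\<^esub> uea_incl L x, m) - sgl (a, act x m) : induced_relations L H N act"
	unfolding induced_relations_def Let_def by blast+
lemma induced_relations_subset: "induced_relations L H N act <= carrier FS"
proof
	fix r assume "r : induced_relations L H N act"
	thus "r : carrier FS"
	using H_sub
	by (cases r rule: induced_relations_cases)
	(auto intro!: supported_diff supported_single supported_scale act_closed U.m_closed uea_incl_closed simp del: pm_scale_single)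
qed
lemmas csub_kernel = csub_lin_span(1)[OF FS.cspace_axioms induced_relations_subset, folded induced_kernel_def]
lemmas kernel_rel = csub_lin_span(2)[OF FS.cspace_axioms induced_relations_subset, folded induced_kernel_def, THEN subsetD]
lemma kernel_minimal:
	assumes "pm.subspace W" "induced_relations L H N act <= W"
	shows "induced_kernel L H N act <= W"
proof -
	have "csub FS (W \<inter> carrier FS)"
	using assms(1) FS_sub by (subst csub_free_iff) (auto simp: pm.subspace_def)
	from csub_lin_span(3)[OF FS.cspace_axioms induced_relations_subset this] show ?thesis
	using assms(2) induced_relations_subset unfolding induced_kernel_def by auto
qed
sublocale Ind: cspace Ind
	unfolding induced_def by (rule FS.cspace_quot[OF csub_kernel])
lemma Ind_carrier: "carrier Ind = induced_class L H N act ` carrier FS"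
	by (simp add: induced_def quot_simps(1) induced_class_def)
lemma class_eq_iff:
	"p : carrier FS ==> q : carrier FS ==>
	induced_class L H N act p = induced_class L H N act q \<longleftrightarrow> p - q : induced_kernel L H N act"
	unfolding induced_class_def
	by (subst FS.coset_eq_iff[OF csub_kernel]) (simp_all add: free_space_minus)
lemma class_ops:
	assumes "p : carrier FS" "q : carrier FS"
	shows "induced_class L H N act p \<oplus>\<^bsub>Ind\<^esub> induced_class L H N act q = induced_class L H N act (p + q)"
	using FS.quot_add[OF csub_kernel assms]
	by (simp add: induced_def induced_class_def)
lemma class_scale:
	assumes "p : carrier FS"
	shows "c \<odot>\<^bsub>Ind\<^esub> induced_class L H N act p = induced_class L H N act (pm_scale c p)"
	using FS.quot_smult[OF csub_kernel assms]
	by (simp add: induced_def induced_class_def)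
lemma tens_closed [simp]: "a : carrier (uea L) ==> m : carrier N ==> tens a m : carrier Ind"
	unfolding induced_tensor_def Ind_carrier by (rule imageI[OF FS_mem])
lemma tens_add1:
	assumes "a : carrier (uea L)" "b : carrier (uea L)" "m : carrier N"
	shows "tens (a \<oplus>\<^bsub>uea L\<^esub> b) m = tens a m \<oplus>\<^bsub>Ind\<^esub> tens b m"
	unfolding induced_tensor_def
	using assms kernel_rel[OF induced_relationsI(1)[OF assms]]
	by (simp add: class_ops class_eq_iff diff_diff_eq)
lemma tens_add2:
	assumes "a : carrier (uea L)" "m : carrier N" "m' : carrier N"
	shows "tens a (m \<oplus>\<^bsub>N\<^esub> m') = tens a m \<oplus>\<^bsub>Ind\<^esub> tens a m'"
	unfolding induced_tensor_def
	using assms kernel_rel[OF induced_relationsI(2)[OF assms]]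
	by (simp add: class_ops class_eq_iff diff_diff_eq)
lemma tens_scale1:
	assumes "a : carrier (uea L)" "m : carrier N"
	shows "tens (c \<odot>\<^bsub>uea L\<^esub> a) m = c \<odot>\<^bsub>Ind\<^esub> tens a m"
	unfolding induced_tensor_def
	using assms kernel_rel[OF induced_relationsI(3)[OF assms, of c]]
	by (simp add: class_scale class_eq_iff)
lemma tens_scale2:
	assumes "a : carrier (uea L)" "m : carrier N"
	shows "tens a (c \<odot>\<^bsub>N\<^esub> m) = c \<odot>\<^bsub>Ind\<^esub> tens a m"
	unfolding induced_tensor_def
	using assms kernel_rel[OF induced_relationsI(4)[OF assms, of c]]
	by (simp add: class_scale class_eq_iff)
lemma tens_bal:
	assumes "a : carrier (uea L)" "x : H" "m : carrier N"
	shows "tens (a \<otimes>\<^bsub>uea L\<^esub> uea_incl L x) m = tens a (act x m)"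
	unfolding induced_tensor_def
	using assms kernel_rel[OF induced_relationsI(5)[OF assms]] H_sub
	by (subst class_eq_iff) (auto simp: act_closed)
lemma Ind_induct:
	assumes "csub Ind W" "!!a m. a : carrier (uea L) ==> m : carrier N ==> tens a m : W" "X : carrier Ind"
	shows "X : W"
proof -
	obtain p where p: "p : carrier FS" "X = induced_class L H N act p" using assms(3) Ind_carrier by auto
	have "pm.subspace {p : carrier FS. induced_class L H N act p : W}"
	using assms(1) FS_sub unfolding pm.subspace_def csub_def
	by (auto simp flip: class_ops class_scale simp: FS.quot_zero[OF csub_kernel, folded induced_def, folded induced_class_def, simplified])
	hence "p : {p : carrier FS. induced_class L H N act p : W}"
	by (rule supported_memI) (use assms(2) p(1) in "auto simp: induced_tensor_def")
	thus ?thesis using p by simp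
qed
lemma Ind_lift:
	assumes vsc: "vector_space sc"
	and add1: "!!a b m. a : carrier (uea L) ==> b : carrier (uea L) ==> m : carrier N ==> \<Phi> (a \<oplus>\<^bsub>uea L\<^esub> b) m = \<Phi> a m + \<Phi> b m"
	and add2: "!!a m m'. a : carrier (uea L) ==> m : carrier N ==> m' : carrier N ==> \<Phi> a (m \<oplus>\<^bsub>N\<^esub> m') = \<Phi> a m + \<Phi> a m'"
	and sc1: "!!c a m. a : carrier (uea L) ==> m : carrier N ==> \<Phi> (c \<odot>\<^bsub>uea L\<^esub> a) m = sc c (\<Phi> a m)"
	and sc2: "!!c a m. a : carrier (uea L) ==> m : carrier N ==> \<Phi> a (c \<odot>\<^bsub>N\<^esub> m) = sc c (\<Phi> a m)"
	and bal: "!!a x m. a : carrier (uea L) ==> x : H ==> m : carrier N ==> \<Phi> (a \<otimes>\<^bsub>uea L\<^esub> uea_incl L x) m = \<Phi> a (act x m)"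
	shows "EX F. (ALL X:carrier Ind. ALL Y:carrier Ind. F (X \<oplus>\<^bsub>Ind\<^esub> Y) = F X + F Y) &
	(ALL c. ALL X:carrier Ind. F (c \<odot>\<^bsub>Ind\<^esub> X) = sc c (F X)) &
	(ALL a:carrier (uea L). ALL m:carrier N. F (tens a m) = \<Phi> a m)"
proof -
	interpret vector_space sc by fact
	define G where "G = lift sc (%(a, m). \<Phi> a m)"
	interpret G: Vector_Spaces.linear pm_scale sc G unfolding G_def by (rule linear_lift) fact
	have Gs: "G (sgl (a, m)) = \<Phi> a m" for a m by (simp add: G_def lift_single[OF vsc])
	have "induced_kernel L H N act <= {p. G p = 0}"
	proof (rule kernel_minimal)
	show "pm.subspace {p. G p = 0}" by (auto simp: pm.subspace_def G.add G.scale)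
	show "induced_relations L H N act <= {p. G p = 0}"
	proof
	fix r assume "r : induced_relations L H N act"
	thus "r : {p. G p = 0}"
	by (cases r rule: induced_relations_cases)
	(auto simp: G.diff G.scale Gs add1 add2 sc1 sc2 bal simp del: pm_scale_single)
	qed
	qed
	hence cong: "G p = G q" if "p : carrier FS" "q : carrier FS" "induced_class L H N act p = induced_class L H N act q" for p q
	using that class_eq_iff[OF that(1,2)] by (auto simp: G.diff)
	define r where "r X = (SOME p. p : carrier FS & induced_class L H N act p = X)" for X
	have r: "r X : carrier FS" "induced_class L H N act (r X) = X" if "X : carrier Ind" for X
	proof -
	have "EX p. p : carrier FS & induced_class L H N act p = X" using that unfolding Ind_carrier by blast
	from someI_ex[OF this] show "r X : carrier FS" "induced_class L H N act (r X) = X" unfolding r_def by auto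
	qed
	have rG: "G (r (induced_class L H N act p)) = G p" if "p : carrier FS" for p
	by (rule cong) (use r[of "induced_class L H N act p"] that Ind_carrier in auto)
	have "G (r (X \<oplus>\<^bsub>Ind\<^esub> Y)) = G (r X) + G (r Y)" if "X : carrier Ind" "Y : carrier Ind" for X Y
	proof -
	have "X \<oplus>\<^bsub>Ind\<^esub> Y = induced_class L H N act (r X + r Y)" using r[OF that(1)] r[OF that(2)] class_ops[of "r X" "r Y"] by simp
	moreover have "r X + r Y : carrier FS" using r(1)[OF that(1)] r(1)[OF that(2)] by (rule pm.subspace_add[OF FS_sub])
	ultimately show ?thesis using rG G.add by simp
	qed
	moreover have "G (r (c \<odot>\<^bsub>Ind\<^esub> X)) = sc c (G (r X))" if "X : carrier Ind" for c X
	proof -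
	have "c \<odot>\<^bsub>Ind\<^esub> X = induced_class L H N act (pm_scale c (r X))" using r[OF that] class_scale[of "r X" c] by simp
	moreover have "pm_scale c (r X) : carrier FS" using r(1)[OF that] by (rule pm.subspace_scale[OF FS_sub])
	ultimately show ?thesis using rG G.scale by simp
	qed
	moreover have "G (r (tens a m)) = \<Phi> a m" if "a : carrier (uea L)" "m : carrier N" for a m
	unfolding induced_tensor_def using rG[OF FS_mem[OF that, of 1]] Gs by simp
	ultimately show ?thesis by (intro exI[of _ "%X. G (r X)"]) blast
qed
context
	fixes x assumes x: "x : lcarrier L"
begin
lemma iact_class:
	assumes "p : carrier FS"
	shows "iact x (induced_class L H N act p) =
	induced_class L H N act (push (%(a, m). (uea_incl L x \<otimes>\<^bsub>uea L\<^esub> a, m)) p)" (is "_ = induced_class L H N act (?P p)")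
	and "push (%(a, m). (uea_incl L x \<otimes>\<^bsub>uea L\<^esub> a, m)) p : carrier FS"
proof -
	have inc: "uea_incl L x : carrier (uea L)" using x by simp
	interpret P: Vector_Spaces.linear pm_scale pm_scale ?P by (rule linear_push)
	have PFS: "?P p : carrier FS" if "p : carrier FS" for p
	using that unfolding free_space_simps by (rule supported_push) (use inc in auto)
	thus "?P p : carrier FS" using assms .
	have "induced_kernel L H N act <= {p. ?P p : induced_kernel L H N act}"
	proof (rule kernel_minimal)
	have "pm.subspace (induced_kernel L H N act)" using csub_kernel csub_free_iff[of FS "carrier (uea L) \<times> carrier N"] by simp
	thus "pm.subspace {p. ?P p : induced_kernel L H N act}" by (auto simp: pm.subspace_def P.add P.scale)
	show "induced_relations L H N act <= {p. ?P p : induced_kernel L H N act}"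
	proof
	fix r assume "r : induced_relations L H N act"
	hence "?P r : induced_relations L H N act"
	proof (cases r rule: induced_relations_cases)
	case (add1 a b m)
	thus ?thesis using induced_relationsI(1)[of "uea_incl L x \<otimes>\<^bsub>uea L\<^esub> a" "uea_incl L x \<otimes>\<^bsub>uea L\<^esub> b" m] inc
	by (simp add: P.diff U.r_distr)
	next
	case (add2 a m m')
	thus ?thesis using induced_relationsI(2)[of "uea_incl L x \<otimes>\<^bsub>uea L\<^esub> a" m m'] inc
	by (simp add: P.diff)
	next
	case (sc1 c a m)
	thus ?thesis using induced_relationsI(3)[of "uea_incl L x \<otimes>\<^bsub>uea L\<^esub> a" m c] inc
	by (simp add: P.diff U.sm_mult2)
	next
	case (sc2 c a m)
	thus ?thesis using induced_relationsI(4)[of "uea_incl L x \<otimes>\<^bsub>uea L\<^esub> a" m c] inc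
	by (simp add: P.diff)
	next
	case (bal a y m)
	moreover have "uea_incl L y : carrier (uea L)" using bal H_sub by auto
	ultimately show ?thesis using induced_relationsI(5)[of "uea_incl L x \<otimes>\<^bsub>uea L\<^esub> a" y m] inc
	by (simp add: P.diff U.m_assoc)
	qed
	thus "r : {p. ?P p : induced_kernel L H N act}" using kernel_rel by blast
	qed
	qed
	hence "(\<Union>q\<in>induced_class L H N act p. induced_class L H N act (?P q)) = induced_class L H N act (?P p)"
	using PFS assms unfolding induced_class_def
	by (intro FS.quot_UN[OF csub_kernel])
	(auto simp: free_space_minus P.diff simp flip: induced_class_def simp: class_eq_iff)
	thus "iact x (induced_class L H N act p) = induced_class L H N act (?P p)"
	by (simp add: induced_action_def)
qed
lemma iact_closed: "X : carrier Ind ==> iact x X : carrier Ind"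
	using iact_class by (auto simp: Ind_carrier simp del: free_space_simps)
lemma iact_ops:
	assumes "X : carrier Ind" "Y : carrier Ind"
	shows "iact x (X \<oplus>\<^bsub>Ind\<^esub> Y) = iact x X \<oplus>\<^bsub>Ind\<^esub> iact x Y" "iact x (c \<odot>\<^bsub>Ind\<^esub> X) = c \<odot>\<^bsub>Ind\<^esub> iact x X"
proof -
	interpret P: Vector_Spaces.linear pm_scale pm_scale "push (%(a, m). (uea_incl L x \<otimes>\<^bsub>uea L\<^esub> a, m)) :: _ => (_ \<times> 'm) \<Rightarrow>\<^sub>0 _" by (rule linear_push)
	obtain p q where pq: "p : carrier FS" "X = induced_class L H N act p" "q : carrier FS" "Y = induced_class L H N act q"
	using assms Ind_carrier by auto
	have c: "p + q : carrier FS" "pm_scale c p : carrier FS" for c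
	using pq pm.subspace_add[OF FS_sub] pm.subspace_scale[OF FS_sub] by blast+
	show "iact x (X \<oplus>\<^bsub>Ind\<^esub> Y) = iact x X \<oplus>\<^bsub>Ind\<^esub> iact x Y" "iact x (c \<odot>\<^bsub>Ind\<^esub> X) = c \<odot>\<^bsub>Ind\<^esub> iact x X"
	using pq c iact_class by (simp_all del: free_space_simps add: class_ops class_scale P.add P.scale)
qed
lemma iact_tens:
	assumes "a : carrier (uea L)" "m : carrier N"
	shows "iact x (tens a m) = tens (uea_incl L x \<otimes>\<^bsub>uea L\<^esub> a) m"
	using iact_class[OF FS_mem[OF assms, of 1]] by (simp add: induced_tensor_def)
end
end
section \<open>The projection onto coinvariants\<close>
subsection \<open>Derivations on words\<close>
primrec dsum :: "('h => 'h) => 'h list => ('h list => 'a::ab_group_add) => 'a" where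
	"dsum d [] F = 0"
| "dsum d (y # w) F = F (d y # w) + dsum d w (%v. F (y # v))"
lemma dsum_cong [fundef_cong]:
	"w = w' ==> (!!v. length v = length w' ==> F v = G v) ==> dsum d w F = dsum d w' G"
proof -
	assume w: "w = w'" and FG: "!!v. length v = length w' ==> F v = G v"
	have "(!!v. length v = length w' ==> F v = G v) ==> dsum d w' F = dsum d w' G"
	proof (induction w' arbitrary: F G)
	case (Cons y w')
	have "dsum d w' (%v. F (y # v)) = dsum d w' (%v. G (y # v))"
	by (rule Cons.IH) (simp add: Cons.prems)
	thus ?case using Cons.prems[of "d y # w'"] by simp
	qed simp
	thus ?thesis using w FG by blast
qed
lemma dsum_cong_lists:
	assumes "w : lists S" "!!x. x : S ==> d x : S" "!!v. v : lists S ==> length v = length w ==> F v = G v"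
	shows "dsum d w F = dsum d w G"
	using assms(1,3)
proof (induction w arbitrary: F G rule: list.induct)
	case (Cons y w)
	have y: "y : S" "w : lists S" using Cons.prems(1) by auto
	have "dsum d w (%v. F (y # v)) = dsum d w (%v. G (y # v))"
	by (rule Cons.IH[OF y(2)], rule Cons.prems(2)) (use y in auto)
	moreover have "F (d y # w) = G (d y # w)" by (rule Cons.prems(2)) (use y assms(2) in auto)
	ultimately show ?case by simp
qed simp
lemma dsum_append: "dsum d (v @ w) F = dsum d v (%v'. F (v' @ w)) + dsum d w (%w'. F (v @ w'))"
	by (induction v arbitrary: F) (auto simp: add.assoc)
lemma dsum_add: "dsum d w (%v. F v + G v) = dsum d w F + dsum d w G"
	by (induction w arbitrary: F G) (auto simp: algebra_simps)
lemma dsum_linear: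
	assumes "vlin sc sc' l"
	shows "dsum d w (%v. l (F v)) = l (dsum d w F)"
proof -
	interpret Vector_Spaces.linear sc sc' l by fact
	show ?thesis by (induction w arbitrary: F) (auto simp: add)
qed
lemma dsum_zero [simp]: "dsum d w (%v. 0) = 0"
	by (induction w) auto
lemma dsum_eq_sum: "dsum d w F = (\<Sum>i<length w. F (w[i := d (w ! i)]))"
	by (induction w arbitrary: F) (auto simp: sum.lessThan_Suc_shift simp del: sum.lessThan_Suc)
lemma dsum_map:
	assumes "!!x. d' (\<phi> x) = \<phi> (d x)"
	shows "dsum d' (map \<phi> w) F = dsum d w (%v. F (map \<phi> v))"
	by (induction w arbitrary: F) (auto simp: assms)
abbreviation "fder == free_derivation"
lemma fder_eq_lift: "fder d p = lift pm_scale (%w. dsum d w (%v. sgl v)) p"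
	by (simp add: free_derivation_def lift_def dsum_eq_sum pm.scale_sum_right)
lemma linear_free_derivation: "pmlin (fder d)"
	using linear_lift[OF pm.vector_space_axioms] unfolding fder_eq_lift .
lemma fder_sgl: "fder d (sgl w) = dsum d w (%v. sgl v)"
	by (simp add: fder_eq_lift lift_single[OF pm.vector_space_axioms])
lemma lift_free_derivation:
	assumes "vector_space sc"
	shows "lift sc F (fder d p) = lift sc (%w. dsum d w F) p"
proof -
	interpret vector_space sc by fact
	interpret l: Vector_Spaces.linear pm_scale sc "lift sc F" by (rule linear_lift) fact
	interpret D: Vector_Spaces.linear pm_scale pm_scale "fder d" by (rule linear_free_derivation)
	interpret r: Vector_Spaces.linear pm_scale sc "lift sc (%w. dsum d w F)" by (rule linear_lift) fact
	have "lift sc F (fder d (sgl k)) = dsum d k F" for k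
	unfolding fder_sgl
	by (subst dsum_linear[OF l.linear_axioms, symmetric]) (simp add: lift_single[OF assms])
	moreover have "vlin pm_scale sc (%p. lift sc F (fder d p))"
	unfolding Vector_Spaces.linear_iff
	using pm.vector_space_axioms assms by (intro conjI allI) (simp_all only: l.add l.scale D.add D.scale)
	ultimately show ?thesis
	by (intro pm_linear_eq_on[OF _ r.linear_axioms, where p=p]) (simp_all add: lift_single[OF assms])
qed
lemma fder_times:
	"fder d (p * q) = fder d p * q + p * fder d q"
proof -
	interpret D: Vector_Spaces.linear pm_scale pm_scale "fder d" by (rule linear_free_derivation)
	have 0: "fder d (sgl (v @ w)) = fder d (sgl v) * sgl w + sgl v * fder d (sgl w)" for v w
	unfolding fder_sgl dsum_append
	using dsum_linear[OF pm_linear_times(2)[of "sgl w"], of d v "%v. sgl v"]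
	dsum_linear[OF pm_linear_times(1)[of "sgl v"], of d w "%v. sgl v"] by simp
	have 1: "fder d (sgl v * q) = fder d (sgl v) * q + sgl v * fder d q" for v q
	by (rule pm_linear_eq_on[where p=q and sc=pm_scale])
	(auto simp: pm_lin_iff algebra_simps D.add D.scale times_pm_scale pm.scale_right_distrib 0)
	show ?thesis
	by (rule pm_linear_eq_on[where p=p and sc=pm_scale])
	(auto simp: pm_lin_iff algebra_simps D.add D.scale pm_scale_times pm.scale_right_distrib 1)
qed
lemma fder_supported:
	assumes "p : word_polys S" "!!x. x : S ==> d x : S"
	shows "fder d p : word_polys S"
proof -
	interpret D: Vector_Spaces.linear pm_scale pm_scale "fder d" by (rule linear_free_derivation)
	have "pm.subspace {p. fder d p : word_polys S}"
	by (auto simp: pm.subspace_def D.add D.scale)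
	hence "p : {p. fder d p : word_polys S}" using assms(1)
	proof (rule supported_memI)
	fix w assume w: "w : lists S"
	have "w[i := d (w ! i)] : lists S" if "i < length w" for i
	proof -
	have "d (w ! i) : S" using w that assms(2) by (auto simp: in_lists_conv_set)
	moreover have "set w <= S" using w by (simp add: lists_eq_set)
	ultimately have "set (w[i := d (w ! i)]) <= S" using set_update_subset_insert[of w i "d (w ! i)"] by blast
	thus ?thesis by (simp add: lists_eq_set)
	qed
	thus "sgl w : {p. fder d p : word_polys S}"
	by (auto simp: fder_sgl dsum_eq_sum)
	qed
	thus ?thesis by simp
qed
text \<open>Multilinearity of a function on the words of a given length.\<close>
definition mlin :: "(complex => 'h => 'h) => (complex => 'a => 'a) => nat =>
	('h::ab_group_add list => 'a::ab_group_add) => bool" where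
	"mlin ls sc n F \<longleftrightarrow> (ALL v w. length v + length w + 1 = n --> vlin ls sc (%x. F (v @ x # w)))"
lemma mlinD: "mlin ls sc (length v + length w + 1) F ==> vlin ls sc (%x. F (v @ x # w))"
	by (simp add: mlin_def)
lemma mlin_Cons: assumes "mlin ls sc (Suc n) F" shows "mlin ls sc n (%w. F (y # w))"
	unfolding mlin_def
proof (intro allI impI)
	fix v w :: "'a list" assume "length v + length w + 1 = n"
	thus "vlin ls sc (%x. F (y # v @ x # w))"
	using assms[unfolded mlin_def, rule_format, of "y # v" w] by simp
qed
lemma dsum_linear_param:
	assumes "vector_space ls" "vector_space sc"
	and "!!v'. length v' = length v ==> vlin ls sc (%x. H v' x)"
	shows "vlin ls sc (%x. dsum d v (%v'. H v' x))"
	using assms(3)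
proof (induction v arbitrary: H)
	case Nil
	interpret vector_space sc by fact
	show ?case using assms by (auto simp: Vector_Spaces.linear_iff)
next
	case (Cons y v)
	have 1: "vlin ls sc (%x. dsum d v (%v'. H (y # v') x))"
	by (rule Cons.IH) (use Cons.prems in auto)
	have 2: "vlin ls sc (%x. H (d y # v) x)" using Cons.prems by auto
	show ?case using 1 2 vector_space.vector_space_assms(1)[OF assms(2)]
	by (auto simp: Vector_Spaces.linear_iff)
qed
lemma mlin_dsum:
	assumes "vector_space ls" "vector_space sc" "mlin ls sc n F" "vlin ls ls d"
	shows "mlin ls sc n (%w. dsum d w F)"
	unfolding mlin_def
proof (intro allI impI)
	fix v w :: "'a list" assume n: "length v + length w + 1 = n"
	have 1: "vlin ls sc (%x. dsum d v (%v'. F (v' @ x # w)))"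
	by (rule dsum_linear_param) (use assms n in "auto simp: mlin_def")
	have 2: "vlin ls sc (%x. dsum d w (%w'. F (v @ x # w')))"
	by (rule dsum_linear_param) (use assms n in "auto simp: mlin_def")
	have 3: "vlin ls sc (%x. F (v @ d x # w))"
	using assms(3,4) n by (auto simp: mlin_def Vector_Spaces.linear_iff)
	show "vlin ls sc (%x. dsum d (v @ x # w) F)"
	using 1 2 3 vector_space.vector_space_assms(1)[OF assms(2)]
	by (auto simp: dsum_append Vector_Spaces.linear_iff algebra_simps)
qed
lemma dsum_derivation_combination:
	assumes "vector_space ls" "vector_space sc" "mlin ls sc (length w) F"
	shows "dsum (%x. d x + d' x) w F = dsum d w F + dsum d' w F"
	"dsum (%x. ls c (d x)) w F = sc c (dsum d w F)"
	"dsum (%x. 0) w F = 0"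
	"dsum (%x. d x - d' x) w F = dsum d w F - dsum d' w F"
proof -
	interpret vector_space sc by fact
	have "dsum (%x. d x + d' x) w F = dsum d w F + dsum d' w F &
	dsum (%x. ls c (d x)) w F = sc c (dsum d w F) & dsum (%x. 0) w F = 0 &
	dsum (%x. d x - d' x) w F = dsum d w F - dsum d' w F"
	using assms(3)
	proof (induction w arbitrary: F)
	case (Cons y w)
	interpret l: Vector_Spaces.linear ls sc "%x. F (x # w)" using mlinD[of ls sc "[]" w F] Cons.prems by simp
	show ?case using Cons.IH[OF mlin_Cons[of ls sc _ F y]] Cons.prems
	by (auto simp: l.add l.scale l.diff scale_right_distrib)
	qed auto
	thus "dsum (%x. d x + d' x) w F = dsum d w F + dsum d' w F"
	"dsum (%x. ls c (d x)) w F = sc c (dsum d w F)"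
	"dsum (%x. 0) w F = 0"
	"dsum (%x. d x - d' x) w F = dsum d w F - dsum d' w F" by auto
qed
lemma dsum_commutator:
	assumes "vector_space ls" "vector_space sc" "mlin ls sc (length w) F"
	shows "dsum d w (%v. dsum d' v F) - dsum d' w (%v. dsum d v F) = dsum (%x. d' (d x) - d (d' x)) w F"
	using assms(3)
proof (induction w arbitrary: F)
	case (Cons y w)
	interpret l: Vector_Spaces.linear ls sc "%x. F (x # w)" using mlinD[of ls sc "[]" w F] Cons.prems by simp
	have "dsum d w (%v. dsum d' v (%u. F (y # u))) - dsum d' w (%v. dsum d v (%u. F (y # u)))
	= dsum (%x. d' (d x) - d (d' x)) w (%u. F (y # u))"
	by (rule Cons.IH) (use Cons.prems mlin_Cons in auto)
	thus ?case by (simp add: dsum_add l.diff algebra_simps)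
qed simp
subsection \<open>Lie algebras that split as a sum of two subalgebras\<close>
locale total_lie =
	fixes ls :: "complex => 'h::ab_group_add => 'h" and br :: "'h => 'h => 'h"
	assumes vls: "vector_space ls"
	and br1: "!!x. vlin ls ls (%y. br x y)"
	and br_anti: "!!x y. br x y = - br y x"
	and jacobi: "!!x y z. br x (br y z) = br (br x y) z + br y (br x z)"
begin
sublocale vls: vector_space ls by (rule vls)
lemma br_add: "br x (y + z) = br x y + br x z" "br (y + z) x = br y x + br z x"
proof -
	show *: "br x (y + z) = br x y + br x z" for x y z using br1 unfolding Vector_Spaces.linear_iff by blast
	have "br (y + z) x = - br x (y + z)" by (rule br_anti)
	also have "\<dots> = - br x y + - br x z" by (simp add: *)
	also have "\<dots> = br y x + br z x" using br_anti[of y x] br_anti[of z x] by metis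
	finally show "br (y + z) x = br y x + br z x" .
qed
lemma br_scale: "br x (ls c y) = ls c (br x y)" "br (ls c y) x = ls c (br y x)"
proof -
	show 1: "br x (ls c y) = ls c (br x y)" for x y using br1 unfolding Vector_Spaces.linear_iff by blast
	show "br (ls c y) x = ls c (br y x)" by (metis 1 br_anti vls.scale_minus_right)
qed
lemma br_zero [simp]: "br x 0 = 0" "br 0 x = 0"
	using br_scale(1)[of x 0 0] br_scale(2)[of 0 0 x] by auto
lemma br_minus: "br x (- y) = - br x y" "br (- y) x = - br y x"
	using br_scale(1)[of x "-1" y] br_scale(2)[of "-1" y x] by auto
lemma br_diff: "br x (y - z) = br x y - br x z" "br (y - z) x = br y x - br z x"
	using br_add(1)[of x y "- z"] br_add(2)[of y "- z" x] br_minus by auto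
lemma br_self [simp]: "br x x = 0"
proof -
	have "ls 2 (br x x) = br x x + br x x" using vls.scale_left_distrib[of 1 1 "br x x"] by simp
	hence "ls 2 (br x x) = 0" using br_anti[of x x] by (metis ab_group_add_class.ab_left_minus)
	thus ?thesis by simp
qed
end
locale split_lie = total_lie ls br for ls :: "complex => 'h::ab_group_add => 'h" and br +
	fixes L G P :: "'h set" and sc :: "complex => 'a::ab_group_add => 'a" and R :: "'h => 'a => 'a"
	assumes sL: "vls.subspace L" and sG: "vls.subspace G" and sP: "vls.subspace P"
	and PL: "P <= L" and GL: "G <= L"
	and br_L: "x : L ==> y : L ==> br x y : L"
	and br_G: "x : G ==> y : G ==> br x y : G"
	and br_P: "x : P ==> y : P ==> br x y : P"
	and split: "x : L ==> EX p:P. x - p : G" and disjoint: "x : G ==> x : P ==> x = 0"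
	and vsc: "vector_space sc"
	and R_linear: "p : P ==> vlin sc sc (R p)"
	and R_add: "p : P ==> q : P ==> R (p + q) a = R p a + R q a"
	and R_scale: "p : P ==> R (ls c p) a = sc c (R p a)"
	and R_br: "p : P ==> q : P ==> R (br p q) a = R q (R p a) - R p (R q a)"
begin
sublocale vsc: vector_space sc by (rule vsc)
definition proj :: "'h => 'h" where
	"proj = (SOME f. vlin ls ls f & (ALL x. f x : P) & (ALL p:P. f p = p) &
	(ALL g:G. f g = 0))"
lemma proj:
	"vlin ls ls proj" "proj x : P" "p : P ==> proj p = p" "g : G ==> proj g = 0"
proof -
	obtain f where f: "vlin ls ls f" "!!x. x : L ==> f x = 0" "!!x. x - f x : L"
	using kernel_retraction[OF vls sL] by blast
	interpret f: Vector_Spaces.linear ls ls f by fact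
	define r where "r x = x - f x" for x
	have r: "r x : L" "x : L ==> r x = x" "r (x + y) = r x + r y" "r (ls c x) = ls c (r x)" for x y c
	using f by (auto simp: r_def f.add f.scale vls.scale_right_diff_distrib)
	define g where "g x = (THE p. p : P & r x - p : G)" for x
	have uniq: "p = q" if "p : P" "r x - p : G" "q : P" "r x - q : G" for x p q
	proof -
	have "(r x - q) - (r x - p) : G" "p - q : P" using that sG sP vls.subspace_diff by blast+
	thus ?thesis using disjoint[of "p - q"] by simp
	qed
	have geq: "g x = p" if "p : P" "r x - p : G" for x p
	unfolding g_def using that uniq by blast
	have g: "g x : P" "r x - g x : G" for x
	using split[OF r(1)[of x]] geq by auto
	have "g (x + y) = g x + g y" for x y
	proof (rule geq)
	have "(r x - g x) + (r y - g y) : G" using g sG vls.subspace_add by blast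
	thus "r (x + y) - (g x + g y) : G" by (simp add: r algebra_simps)
	qed (use g sP vls.subspace_add in blast)
	moreover have "g (ls c x) = ls c (g x)" for c x
	proof (rule geq)
	have "ls c (r x - g x) : G" using g sG vls.subspace_scale by blast
	thus "r (ls c x) - ls c (g x) : G" by (simp add: r vls.scale_right_diff_distrib)
	qed (use g sP vls.subspace_scale in blast)
	moreover have "g p = p" if "p : P" for p
	using that PL r(2)[of p] vls.subspace_0[OF sG] by (intro geq) auto
	moreover have "g x = 0" if "x : G" for x
	using that GL r(2)[of x] vls.subspace_0[OF sP] by (intro geq) auto
	ultimately have "EX f. vlin ls ls f & (ALL x. f x : P) & (ALL p:P. f p = p) & (ALL g:G. f g = 0)"
	using g(1) vls by (intro exI[of _ g]) (auto simp: Vector_Spaces.linear_iff)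
	from someI_ex[OF this] show
	"vlin ls ls proj" "proj x : P" "p : P ==> proj p = p" "g' : G ==> proj g' = 0" for g'
	unfolding proj_def by blast+
qed
lemma proj_eqI: assumes "p : P" "x - p : G" shows "proj x = p"
proof -
	interpret Vector_Spaces.linear ls ls proj by (rule proj)
	have "proj x = proj (x - p) + proj p" by (simp flip: add)
	thus ?thesis using assms proj by simp
qed
lemma diff_proj: assumes "x : L" shows "x - proj x : G"
	using split[OF assms] proj_eqI by metis
lemma R_zero [simp]: "R 0 a = 0"
	using R_scale[OF vls.subspace_0[OF sP], of 0 a] by simp
lemma R_zero_right: "p : P ==> R p 0 = 0"
	using R_linear[of p] by (metis Vector_Spaces.linear_iff vsc.scale_zero_left)
text \<open>
  The value of a word: a letter in \<open>G\<close> at the left end gives zero, and a letter in \<open>P\<close> at the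
  left end is moved to the right end, where it acts by \<open>R\<close>.
\<close>
fun Psi :: "'a => 'h list => 'a" where
	"Psi e [] = e"
| "Psi e (x # w) = R (proj x) (Psi e w) + dsum (br (proj x)) w (Psi e)"
declare Psi.simps(2) [simp del]
lemmas Psi_Cons = Psi.simps(2)
lemma Psi_mlin: "mlin ls sc n (Psi e)"
proof (induction n rule: less_induct)
	case (less n)
	interpret pr: Vector_Spaces.linear ls ls proj by (rule proj)
	show ?case unfolding mlin_def
	proof (intro allI impI)
	fix v w :: "'h list" assume n: "length v + length w + 1 = n"
	have IH: "mlin ls sc (length w) (Psi e)" using less n by simp
	show "vlin ls sc (%x. Psi e (v @ x # w))"
	proof (cases v)
	case Nil
	have "R (proj (x + y)) a = R (proj x) a + R (proj y) a" "R (proj (ls c x)) a = sc c (R (proj x) a)" for x y c a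
	by (simp_all add: pr.add pr.scale R_add R_scale proj(2))
	moreover have "dsum (br (proj (x + y))) w (Psi e) = dsum (br (proj x)) w (Psi e) + dsum (br (proj y)) w (Psi e)"
	"dsum (br (proj (ls c x))) w (Psi e) = sc c (dsum (br (proj x)) w (Psi e))" for x y c
	using dsum_derivation_combination(1)[OF vls vsc IH, of "br (proj x)" "br (proj y)"]
	dsum_derivation_combination(2)[OF vls vsc IH, of c "br (proj x)"]
	by (simp_all add: pr.add pr.scale br_add[abs_def] br_scale[abs_def])
	ultimately show ?thesis using Nil vls vsc
	by (auto simp: Psi_Cons Vector_Spaces.linear_iff vsc.scale_right_distrib algebra_simps)
	next
	case (Cons y v')
	let ?n = "length v' + length w + 1"
	have IH: "mlin ls sc ?n (Psi e)" using less n Cons by simp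
	have 1: "vlin ls sc (%x. Psi e (v' @ x # w))" using IH by (rule mlinD)
	have 2: "vlin ls sc (%x. dsum (br (proj y)) (v' @ x # w) (Psi e))"
	using mlin_dsum[OF vls vsc IH br1[of "proj y"]] by (rule mlinD)
	have 3: "vlin sc sc (R (proj y))" by (rule R_linear[OF proj(2)])
	show ?thesis using 1 2 3 Cons
	by (auto simp: Psi_Cons Vector_Spaces.linear_iff vsc.scale_right_distrib algebra_simps)
	qed
	qed
qed
lemma Psi_linear_letter: "vlin ls sc (%x. Psi e (v @ x # w))"
	using Psi_mlin by (rule mlinD)
lemma Psi_letter:
	"Psi e (v @ (x + y) # w) = Psi e (v @ x # w) + Psi e (v @ y # w)"
	"Psi e (v @ ls c x # w) = sc c (Psi e (v @ x # w))"
	"Psi e (v @ (- x) # w) = - Psi e (v @ x # w)"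
	"Psi e (v @ (x - y) # w) = Psi e (v @ x # w) - Psi e (v @ y # w)"
	"Psi e (v @ 0 # w) = 0"
proof -
	interpret Vector_Spaces.linear ls sc "%x. Psi e (v @ x # w)" by (rule Psi_linear_letter)
	show "Psi e (v @ (x + y) # w) = Psi e (v @ x # w) + Psi e (v @ y # w)"
	"Psi e (v @ ls c x # w) = sc c (Psi e (v @ x # w))"
	"Psi e (v @ (- x) # w) = - Psi e (v @ x # w)"
	"Psi e (v @ (x - y) # w) = Psi e (v @ x # w) - Psi e (v @ y # w)"
	"Psi e (v @ 0 # w) = 0" by (rule add scale neg diff zero)+
qed
lemma Psi_G: assumes "g : G" shows "Psi e (g # w) = 0"
proof -
	have "br 0 = (%x. 0)" by (rule ext) simp
	thus ?thesis
	using assms dsum_derivation_combination(3)[OF vls vsc Psi_mlin[of "length w"]]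
	by (simp add: Psi_Cons proj)
qed
lemma Psi_snoc: "p : P ==> Psi e (w @ [p]) = R p (Psi e w)"
proof (induction "length w" arbitrary: w p rule: less_induct)
	case less
	show ?case
	proof (cases w)
	case Nil
	thus ?thesis using less.prems by (simp add: Psi_Cons proj)
	next
	case (Cons x w')
	let ?q = "proj x"
	have "dsum (br ?q) w' (%v. Psi e (v @ [p])) = dsum (br ?q) w' (%v. R p (Psi e v))"
	by (rule dsum_cong) (use less Cons in auto)
	also have "\<dots> = R p (dsum (br ?q) w' (Psi e))" by (rule dsum_linear[OF R_linear[OF less.prems]])
	finally have 1: "dsum (br ?q) w' (%v. Psi e (v @ [p])) = R p (dsum (br ?q) w' (Psi e))" .
	have 2: "Psi e (w' @ [p]) = R p (Psi e w')" "Psi e (w' @ [br ?q p]) = R (br ?q p) (Psi e w')"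
	using less Cons br_P[OF proj(2)[of x]] by auto
	show ?thesis using Cons 1 2 R_br[OF proj(2)[of x] less.prems] R_linear[OF less.prems]
	by (simp add: Psi_Cons dsum_append Vector_Spaces.linear_iff)
	qed
qed
lemma Psi_swap_Nil:
	assumes "x \<in> L" "y \<in> L"
	shows "Psi e (x # y # w) - Psi e (y # x # w) = Psi e (br x y # w)"
proof -
	note IH = Psi_mlin[of "length w" e]
	have PG: "Psi e (p # g # w) - Psi e (g # p # w) = Psi e (br p g # w)" if p: "p \<in> P" and g: "g \<in> G" for p g
	using p Psi_G[OF g, of e] by (simp add: Psi_Cons[of e p] proj R_zero_right)
	have PP: "Psi e (p # q # w) - Psi e (q # p # w) = Psi e (br p q # w)" if p: "p \<in> P" and q: "q \<in> P" for p q
	proof -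
	have lin: "R p (a + b) = R p a + R p b" "R q (a + b) = R q a + R q b" for a b
	using R_linear[OF p] R_linear[OF q] by (auto simp: Vector_Spaces.linear_iff)
	have e: "Psi e (p # v) = R p (Psi e v) + dsum (br p) v (Psi e)" if "p \<in> P" for p v
	using that by (simp add: Psi_Cons proj)
	have c: "dsum (br p) w (\<lambda>v. dsum (br q) v (Psi e)) - dsum (br q) w (\<lambda>v. dsum (br p) v (Psi e))
	= - dsum (br (br p q)) w (Psi e)"
	proof -
	have "(\<lambda>x. br q (br p x) - br p (br q x)) = (\<lambda>x. 0 - br (br p q) x)"
	by (rule ext) (simp add: jacobi[of p q])
	then show ?thesis using dsum_commutator[OF vls vsc IH, of "br p" "br q"]
	dsum_derivation_combination(3)[OF vls vsc IH]
	dsum_derivation_combination(4)[OF vls vsc IH, of "\<lambda>x. 0" "br (br p q)"] by simp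
	qed
	have "dsum (br p) (q # w) (Psi e) = Psi e (br p q # w) + dsum (br p) w (\<lambda>v. R q (Psi e v) + dsum (br q) v (Psi e))"
	by (simp add: e[OF q])
	also have "\<dots> = Psi e (br p q # w) + R q (dsum (br p) w (Psi e)) + dsum (br p) w (\<lambda>v. dsum (br q) v (Psi e))"
	by (simp add: dsum_add dsum_linear[OF R_linear[OF q]] add.assoc)
	finally have 1: "Psi e (p # q # w) = R p (R q (Psi e w)) + R p (dsum (br q) w (Psi e)) + Psi e (br p q # w)
	+ R q (dsum (br p) w (Psi e)) + dsum (br p) w (\<lambda>v. dsum (br q) v (Psi e))"
	by (simp add: e p q lin add.assoc)
	have "dsum (br q) (p # w) (Psi e) = Psi e (br q p # w) + dsum (br q) w (\<lambda>v. R p (Psi e v) + dsum (br p) v (Psi e))"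
	by (simp add: e[OF p])
	also have "\<dots> = Psi e (br q p # w) + R p (dsum (br q) w (Psi e)) + dsum (br q) w (\<lambda>v. dsum (br p) v (Psi e))"
	by (simp add: dsum_add dsum_linear[OF R_linear[OF p]] add.assoc)
	finally have 2: "Psi e (q # p # w) = R q (R p (Psi e w)) + R q (dsum (br p) w (Psi e)) + Psi e (br q p # w)
	+ R p (dsum (br q) w (Psi e)) + dsum (br q) w (\<lambda>v. dsum (br p) v (Psi e))"
	by (simp add: e p q lin add.assoc)
	have 3: "Psi e (br q p # w) = - Psi e (br p q # w)"
	using Psi_letter(3)[of e "[]" "br p q" w] br_anti[of q p] by simp
	have 4: "Psi e (br p q # w) = R q (R p (Psi e w)) - R p (R q (Psi e w)) + dsum (br (br p q)) w (Psi e)"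
	by (simp add: e br_P[OF p q] R_br[OF p q])
	show ?thesis using c unfolding 1 2 3 by (simp add: 4 algebra_simps)
	qed
	obtain p q where pq: "p \<in> P" "x - p \<in> G" "q \<in> P" "y - q \<in> G" using split assms by metis
	define g h where "g = x - p" and "h = y - q"
	have x: "x = g + p" and y: "y = h + q" and G: "g \<in> G" "h \<in> G" using pq by (auto simp: g_def h_def)
	have add: "Psi e ((a + b) # v) = Psi e (a # v) + Psi e (b # v)" "Psi e (c # (a + b) # v) = Psi e (c # a # v) + Psi e (c # b # v)" for a b c v
	using Psi_letter(1)[of e "[]" a b v] Psi_letter(1)[of e "[c]" a b v] by simp_all
	have neg: "Psi e (br b a # v) = - Psi e (br a b # v)" for a b v
	using Psi_letter(3)[of e "[]" "br a b" v] br_anti[of b a] by simp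
	have gg: "Psi e (g # h # w) - Psi e (h # g # w) = Psi e (br g h # w)"
	using Psi_G G br_G by simp
	show ?thesis unfolding x y
	using gg PG[OF pq(1) G(2)] PG[OF pq(3) G(1)] PP[OF pq(1,3)]
	by (simp add: add br_add neg[of g q] algebra_simps)
qed
lemma Psi_swap:
	"x \<in> L \<Longrightarrow> y \<in> L \<Longrightarrow> Psi e (v @ x # y # w) - Psi e (v @ y # x # w) = Psi e (v @ br x y # w)"
proof (induction "length v" arbitrary: v w x y rule: less_induct)
	case less
	show ?case
	proof (cases v)
	case Nil
	then show ?thesis using Psi_swap_Nil less.prems by simp
	next
	case (Cons z v')
	let ?q = "proj z"
	have qL: "br ?q u \<in> L" if "u \<in> L" for u using that br_L proj(2) PL by blast
	have IH: "Psi e (u @ a # b # w') - Psi e (u @ b # a # w') = Psi e (u @ br a b # w')"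
	if "length u = length v'" "a \<in> L" "b \<in> L" for u a b w'
	using less(1)[of u a b w'] that Cons by simp
	have lin: "R ?q (a - b) = R ?q a - R ?q b" for a b
	proof -
	interpret Vector_Spaces.linear sc sc "R ?q" by (rule R_linear[OF proj(2)])
	show ?thesis by (rule diff)
	qed
	have sub: "dsum d u F - dsum d u H = dsum d u (\<lambda>v. F v - H v)" for d u and F H :: "'h list \<Rightarrow> 'a"
	using dsum_add[of d u "\<lambda>v. F v - H v" H] by (simp add: algebra_simps)
	have 1: "dsum (br ?q) v' (\<lambda>u. Psi e (u @ x # y # w)) - dsum (br ?q) v' (\<lambda>u. Psi e (u @ y # x # w))
	= dsum (br ?q) v' (\<lambda>u. Psi e (u @ br x y # w))"
	unfolding sub by (rule dsum_cong) (use IH less.prems in auto)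
	have 2: "dsum (br ?q) w (\<lambda>u. Psi e (v' @ x # y # u)) - dsum (br ?q) w (\<lambda>u. Psi e (v' @ y # x # u))
	= dsum (br ?q) w (\<lambda>u. Psi e (v' @ br x y # u))"
	unfolding sub by (rule dsum_cong) (use IH less.prems in auto)
	have 3: "Psi e (v' @ br ?q x # y # w) - Psi e (v' @ y # br ?q x # w) = Psi e (v' @ br (br ?q x) y # w)"
	"Psi e (v' @ x # br ?q y # w) - Psi e (v' @ br ?q y # x # w) = Psi e (v' @ br x (br ?q y) # w)"
	using IH less.prems qL by auto
	have 4: "Psi e (v' @ br ?q (br x y) # w) = Psi e (v' @ br (br ?q x) y # w) + Psi e (v' @ br x (br ?q y) # w)"
	by (simp only: jacobi[of ?q x y] Psi_letter)
	have 5: "R ?q (Psi e (v' @ x # y # w)) - R ?q (Psi e (v' @ y # x # w)) = R ?q (Psi e (v' @ br x y # w))"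
	unfolding lin[symmetric] by (simp add: IH less.prems)
	show ?thesis unfolding Cons
	using 1 2 3 4 5 by (simp add: Psi_Cons dsum_append algebra_simps)
	qed
qed
end
context split_lie begin
text \<open>The Lie algebra \<open>L\<close> as a record, and the extension of \<open>Psi\<close> to its enveloping algebra.\<close>
definition "LL = \<lparr>lcarrier = L, lscale = ls, lbracket = br\<rparr>"
lemma LL_simps [simp]: "lcarrier LL = L" "lscale LL = ls" "lbracket LL = br"
	by (auto simp: LL_def)
lemma lie_space_LL: "lie_space LL"
	by unfold_locales (use sL br_L in "auto simp: vls.subspace_def vls.scale_right_distrib vls.scale_left_distrib")
definition PsiL :: "'a => ('h list pm) => 'a" where
	"PsiL e = lift sc (Psi e)"
lemma PsiL_linear: "vlin pm_scale sc (PsiL e)"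
	unfolding PsiL_def by (rule linear_lift[OF vsc])
sublocale PsiL: Vector_Spaces.linear pm_scale sc "PsiL e" for e
	by (rule PsiL_linear)
lemma PsiL_sgl [simp]: "PsiL e (sgl w) = Psi e w"
	by (simp add: PsiL_def lift_single[OF vsc])
lemma PsiL_scale: "PsiL e (pm_scale c p) = sc c (PsiL e p)"
	by (rule PsiL.scale)
lemma PsiL_rel:
	assumes "r : uea_relations LL"
	shows "PsiL e (sgl u * r * sgl v) = 0"
proof -
	interpret LL: lie_space LL by (rule lie_space_LL)
	show ?thesis using assms
	proof (cases r rule: LL.uea_relations_cases)
	case (add x y)
	have "sgl u * r * sgl v = sgl (u @ (x + y) # v) - sgl (u @ x # v) - sgl (u @ y # v)"
	unfolding add(1) by (simp add: algebra_simps)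
	thus ?thesis by (simp only: PsiL.diff PsiL_sgl Psi_letter) simp
next
	case (scale c x)
	have "sgl u * r * sgl v = sgl (u @ ls c x # v) - pm_scale c (sgl (u @ x # v))"
	unfolding scale(1) by (simp add: algebra_simps)
	thus ?thesis by (simp only: PsiL.diff PsiL_scale PsiL_sgl Psi_letter) simp
next
	case (bracket x y)
	hence L: "x : L" "y : L" by simp_all
	have "sgl u * r * sgl v = sgl (u @ x # y # v) - sgl (u @ y # x # v) - sgl (u @ br x y # v)"
	unfolding bracket(1) by (simp add: algebra_simps)
	thus ?thesis using Psi_swap[OF L, of e u v] by (simp only: PsiL.diff PsiL_sgl) simp
qed
qed
lemma PsiL_ideal: "uea_ideal LL <= {p. PsiL e p = 0}"
	by (rule lie_space.uea_ideal_minimal[OF lie_space_LL])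
	(use PsiL_rel in "auto simp: pm.subspace_def PsiL.add PsiL_scale")
lemma PsiL_cong: "p - q : uea_ideal LL ==> PsiL e p = PsiL e q"
	using PsiL_ideal[of e] by (auto simp: PsiL.diff)
lemma PsiL_snoc: assumes "h : P" shows "PsiL e (p * gen h) = R h (PsiL e p)"
proof -
	interpret R: Vector_Spaces.linear sc sc "R h" by (rule R_linear) fact
	show ?thesis
	by (rule pm_linear_eq_on[where p=p and sc=sc])
	(auto simp: pm_lin_iff vsc PsiL.add PsiL_scale algebra_simps
	pm_scale_times R.add R.scale Psi_snoc[OF assms])
qed
lemma PsiL_G: assumes "g : G" shows "PsiL e (gen g * p) = 0"
proof -
	have "pm.subspace {p. PsiL e (gen g * p) = 0}"
	by (auto simp: pm.subspace_def PsiL.add PsiL_scale algebra_simps times_pm_scale)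
	hence "p : {p. PsiL e (gen g * p) = 0}"
	by (rule pm_subspace_memI) (simp add: Psi_G[OF assms])
	thus ?thesis by simp
qed
text \<open>Endomorphisms of the right \<open>P\<close>-module commute with \<open>Psi\<close>.\<close>
lemma Psi_endo:
	assumes l: "vlin sc sc l" and comm: "!!p a. p : P ==> l (R p a) = R p (l a)"
	shows "l (Psi e w) = Psi (l e) w"
proof (induction "length w" arbitrary: w rule: less_induct)
	case less
	interpret l: Vector_Spaces.linear sc sc l by fact
	show ?case
	proof (cases w)
	case (Cons x w')
	have "dsum (br (proj x)) w' (%v. l (Psi e v)) = dsum (br (proj x)) w' (Psi (l e))"
	by (rule dsum_cong) (use less Cons in auto)
	thus ?thesis using less Cons
	by (simp add: Psi_Cons l.add comm[OF proj(2)] dsum_linear[OF l])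
	qed simp
qed
text \<open>
  If the derivation \<open>[\<pi> x, -]\<close> annihilates \<open>q\<close> under \<open>Psi\<close> for every letter \<open>x\<close> of a set \<open>S\<close>,
  then \<open>q\<close> can be split off: the words in \<open>S\<close> only see the value of \<open>q\<close>.
\<close>
lemma Psi_split_off:
	assumes S: "!!x y. x : S ==> y : S ==> br (proj x) y : S"
	and q: "!!x w. x : S ==> w : lists S ==> PsiL e (sgl w * fder (br (proj x)) q) = 0"
	and w: "w : lists S"
	shows "PsiL e (sgl w * q) = Psi (PsiL e q) w"
	using w
proof (induction "length w" arbitrary: w rule: less_induct)
	case less
	show ?case
	proof (cases w)
	case Nil
	thus ?thesis by (simp flip: one_words)
	next
	case (Cons x w')
	hence x: "x : S" and w': "w' : lists S" using less.prems by auto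
	let ?d = "br (proj x)"
	have step: "PsiL e (sgl (x # w') * q) = R (proj x) (PsiL e (sgl w' * q)) + PsiL e (fder ?d (sgl w' * q))"
	proof -
	interpret R: Vector_Spaces.linear sc sc "R (proj x)" by (rule R_linear[OF proj(2)])
	interpret D: Vector_Spaces.linear pm_scale pm_scale "fder ?d" by (rule linear_free_derivation)
	have D: "PsiL e (fder ?d (sgl v)) = dsum ?d v (Psi e)" for v
	unfolding PsiL_def by (simp add: lift_free_derivation[OF vsc] lift_single[OF vsc])
	show ?thesis
	by (rule pm_linear_eq_on[where p=q and sc=sc])
	(simp_all add: pm_lin_iff vsc PsiL.add PsiL_scale algebra_simps
	times_pm_scale R.add R.scale D.add D.scale Psi_Cons D vsc.scale_right_distrib)
	qed
	have "PsiL e (fder ?d (sgl w' * q)) = PsiL e (fder ?d (sgl w') * q)"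
	by (simp add: fder_times PsiL.add q[OF x w'])
	also have "\<dots> = dsum ?d w' (%v. PsiL e (sgl v * q))"
	proof -
	have "vlin pm_scale sc (%p. PsiL e (p * q))"
	unfolding Vector_Spaces.linear_iff using pm.vector_space_axioms vsc
	by (simp add: PsiL.add PsiL_scale algebra_simps pm_scale_times)
	from dsum_linear[OF this, of ?d w' "%v. sgl v"] show ?thesis by (simp add: fder_sgl)
	qed
	also have "\<dots> = dsum ?d w' (Psi (PsiL e q))"
	by (rule dsum_cong_lists[OF w' S[OF x]]) (use less Cons in auto)
	finally show ?thesis using step less Cons w' by (simp add: Psi_Cons)
	qed
qed
end
text \<open>In an enveloping algebra a letter can be moved through a word at the cost of a derivation.\<close>
lemma move_letter:
	fixes F :: "'h list => 'b::ab_group_add"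
	assumes swap: "!!v x y w. v : lists L ==> w : lists L ==> x : L ==> y : L ==>
	F (v @ x # y # w) = F (v @ y # x # w) + F (v @ br x y # w)"
	and "x : L" "w : lists L"
	shows "F (x # w) = F (w @ [x]) + dsum (br x) w F"
	using assms(3,1)
proof (induction w arbitrary: F rule: list.induct)
	case (Cons y w)
	have yw: "y : L" "w : lists L" using Cons.prems(1) by auto
	have "F (y # x # w) = F (y # w @ [x]) + dsum (br x) w (%v. F (y # v))"
	proof (rule Cons.IH[where F="%v. F (y # v)"])
	fix v x' y' w' assume "v : lists L" "w' : lists L" "x' : L" "y' : L"
	thus "F (y # v @ x' # y' # w') = F (y # v @ y' # x' # w') + F (y # v @ br x' y' # w')"
	using Cons.prems(2)[of "y # v" w' x' y'] yw by simp
	qed (use yw in auto)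
	thus ?case using Cons.prems(2)[of "[]" w x y] yw assms(2) by simp
qed simp
section \<open>The invariant form is preserved by the automorphism\<close>
locale fin_space = vector_space sc for sc :: "complex => 'g::ab_group_add => 'g" +
	fixes B :: "'g set"
	assumes finB: "finite B" and indB: "independent B" and spanB: "span B = UNIV"
begin
sublocale fd: finite_dimensional_vector_space sc B
	by unfold_locales (use finB indB spanB in auto)
definition co :: "'g => 'g => complex" where "co v b = representation B v b"
lemma co_add: "co (v + w) b = co v b + co w b"
	and co_diff: "co (v - w) b = co v b - co w b"
	and co_scale: "co (sc c v) b = c * co v b"
	and co_sum: "co (sum g I) b = (SUM i:I. co (g i) b)"
	and co_basis: "b' : B ==> co b' b = (if b = b' then 1 else 0)"
	unfolding co_def using indB spanB
	by (simp_all add: representation_add representation_diff representation_scale representation_sum representation_basis)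
lemma co_zero [simp]: "co 0 b = 0"
	by (simp add: co_def representation_zero)
lemma expand: "v = (SUM b:B. sc (co v b) b)"
	unfolding co_def using sum_representation_eq[OF indB, of v B] finB spanB by simp
lemma co_eqI: "(!!b. b : B ==> co v b = co w b) ==> v = w"
	by (subst expand, subst (2) expand) simp
lemma co_linear: assumes "vlin sc sc f" shows "co (f v) c = (SUM b:B. co v b * co (f b) c)"
proof -
	interpret f: Vector_Spaces.linear sc sc f by fact
	have "f v = (SUM b:B. sc (co v b) (f b))" by (subst (1) expand) (simp add: f.sum f.scale)
	thus ?thesis by (simp add: co_sum co_scale)
qed
definition tr :: "('g => 'g) => complex" where "tr f = (SUM b:B. co (f b) b)"
lemma tr_add: "tr (%v. f v + g v) = tr f + tr g"
	and tr_diff: "tr (%v. f v - g v) = tr f - tr g"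
	and tr_scale: "tr (%v. sc c (f v)) = c * tr f"
	by (simp_all add: tr_def co_add co_diff co_scale sum.distrib sum_subtractf sum_distrib_left)
lemma tr_comm:
	assumes "vlin sc sc f" "vlin sc sc g"
	shows "tr (%v. f (g v)) = tr (%v. g (f v))"
proof -
	have "tr (%v. f (g v)) = (SUM b:B. SUM c:B. co (g b) c * co (f c) b)"
	unfolding tr_def by (simp add: co_linear[OF assms(1), of "g _"])
	also have "\<dots> = (SUM c:B. SUM b:B. co (f c) b * co (g b) c)"
	by (subst sum.swap) (simp add: mult.commute)
	also have "\<dots> = tr (%v. g (f v))"
	unfolding tr_def by (simp add: co_linear[OF assms(2), of "f _"])
	finally show ?thesis .
qed
text \<open>Every endomorphism has an eigenvector.\<close>
definition pact :: "('g \<Rightarrow> 'g) \<Rightarrow> complex poly \<Rightarrow> 'g \<Rightarrow> 'g" where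
	"pact f p x = (\<Sum>i\<le>Polynomial.degree p. sc (Polynomial.coeff p i) ((f ^^ i) x))"
lemma pact_superset: "Polynomial.degree p \<le> n \<Longrightarrow> pact f p x = (\<Sum>i\<le>n. sc (Polynomial.coeff p i) ((f ^^ i) x))"
	unfolding pact_def by (rule sum.mono_neutral_left) (auto simp: coeff_eq_0)
lemma pact_add: "pact f (p + q) x = pact f p x + pact f q x"
proof -
	let ?n = "max (Polynomial.degree p) (Polynomial.degree q)"
	have "Polynomial.degree (p + q) <= ?n" by (rule degree_add_le_max)
	thus ?thesis by (simp add: pact_superset[of _ ?n] scale_left_distrib sum.distrib)
qed
lemma pact_smult: "pact f (Polynomial.smult c p) x = sc c (pact f p x)"
	by (simp add: pact_superset[of "Polynomial.smult c p" "Polynomial.degree p"] pact_def scale_sum_right)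
lemma pact_pCons_0:
	assumes "vlin sc sc f"
	shows "pact f (pCons 0 p) x = f (pact f p x)"
proof -
	interpret f: Vector_Spaces.linear sc sc f by fact
	have "pact f (pCons 0 p) x = (\<Sum>i\<le>Suc (Polynomial.degree p). sc (Polynomial.coeff (pCons 0 p) i) ((f ^^ i) x))"
	by (rule pact_superset) (simp add: degree_pCons_le)
	also have "\<dots> = (\<Sum>i\<le>Polynomial.degree p. sc (Polynomial.coeff p i) ((f ^^ Suc i) x))"
	by (subst sum.atMost_Suc_shift) simp
	also have "\<dots> = f (pact f p x)" by (simp add: pact_def f.sum f.scale)
	finally show ?thesis .
qed
lemma eigenvector_exists:
	fixes x :: 'g
	assumes f: "vlin sc sc f" and x: "x \<noteq> 0"
	shows "\<exists>v m. v \<noteq> 0 \<and> f v = sc m v"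
proof -
	have "\<exists>p. p \<noteq> 0 \<and> pact f p x = 0"
	proof (cases "inj (\<lambda>i::nat. (f ^^ i) x)")
	case False
	then obtain i j where ij: "i \<noteq> j" "(f ^^ i) x = (f ^^ j) x" by (auto simp: inj_def)
	let ?p = "Polynomial.monom (1::complex) i + Polynomial.smult (-1) (Polynomial.monom 1 j)"
	have m: "pact f (Polynomial.monom 1 i) x = (f ^^ i) x" for i
	by (subst pact_superset[of _ i]) (auto simp: degree_monom_le if_distrib[of "\<lambda>c. sc c _"] sum.delta cong: if_cong)
	have "Polynomial.coeff ?p i \<noteq> Polynomial.coeff (0 :: complex poly) i" using ij(1) by simp
	then have "?p \<noteq> 0" by (rule contrapos_nn) (simp only:)
	moreover have "pact f ?p x = 0" unfolding pact_add pact_smult m using ij by simp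
	ultimately show ?thesis by blast
	next
	case True
	then have "infinite (range (\<lambda>i::nat. (f ^^ i) x))" by (rule range_inj_infinite)
	then have "dependent (range (\<lambda>i::nat. (f ^^ i) x))" using fd.finiteI_independent by blast
	then obtain t u where t: "finite t" "t \<subseteq> range (\<lambda>i::nat. (f ^^ i) x)" "(\<Sum>v\<in>t. sc (u v) v) = 0" "\<exists>v\<in>t. u v \<noteq> 0"
	unfolding dependent_explicit by blast
	obtain I where I: "finite I" "t = (\<lambda>i::nat. (f ^^ i) x) ` I"
	using t(1,2) by (metis finite_subset_image)
	let ?c = "\<lambda>i. if i \<in> I then u ((f ^^ i) x) else 0"
	define p where "p = (\<Sum>i\<in>I. Polynomial.monom (u ((f ^^ i) x)) i)"
	have cp: "Polynomial.coeff p i = ?c i" for i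
	using I(1) by (simp add: p_def coeff_sum sum.delta)
	have "pact f p x = (\<Sum>i\<le>max (Polynomial.degree p) (Max (insert 0 I)). sc (Polynomial.coeff p i) ((f ^^ i) x))"
	by (rule pact_superset) simp
	also have "\<dots> = (\<Sum>i\<in>I. sc (u ((f ^^ i) x)) ((f ^^ i) x))"
	using I(1) by (intro sum.mono_neutral_cong_right) (auto simp: cp le_max_iff_disj)
	also have "\<dots> = (\<Sum>v\<in>t. sc (u v) v)"
	unfolding I(2) using True by (subst sum.reindex) (auto intro: inj_on_subset)
	finally have "pact f p x = 0" using t(3) by simp
	moreover have "p \<noteq> 0"
	proof -
	obtain i where "i \<in> I" "u ((f ^^ i) x) \<noteq> 0" using t(4) I(2) by auto
	then have "Polynomial.coeff p i \<noteq> 0" by (simp add: cp)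
	then show ?thesis by auto
	qed
	ultimately show ?thesis by blast
	qed
	then obtain p where p: "p \<noteq> 0" "pact f p x = 0"
	and least: "\<And>q. q \<noteq> 0 \<Longrightarrow> pact f q x = 0 \<Longrightarrow> Polynomial.degree p \<le> Polynomial.degree q"
	using exists_least_iff[of "\<lambda>n. \<exists>p. p \<noteq> 0 \<and> pact f p x = 0 \<and> Polynomial.degree p = n"]
	by (metis (mono_tags, lifting) not_le)
	have "Polynomial.degree p \<noteq> 0"
	proof
	assume "Polynomial.degree p = 0"
	then have "Polynomial.coeff p 0 \<noteq> 0" "sc (Polynomial.coeff p 0) x = 0"
	using p Polynomial.leading_coeff_neq_0[of p] by (simp_all add: pact_def)
	then show False using x by simp
	qed
	then have "\<not> constant (poly p)" by (simp add: constant_degree)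
	then obtain r where "poly p r = 0" using fundamental_theorem_of_algebra by blast
	then obtain q where q: "p = [:- r, 1:] * q" by (auto simp: poly_eq_0_iff_dvd dvd_def)
	then have q0: "q \<noteq> 0" using p by auto
	have "Polynomial.degree p = Suc (Polynomial.degree q)" using q0 unfolding q by (subst degree_mult_eq) auto
	then have "pact f q x \<noteq> 0" using least[OF q0] by auto
	moreover have "p = pCons 0 q + Polynomial.smult (- r) q" unfolding q by simp
	then have "f (pact f q x) = sc r (pact f q x)"
	using p(2) by (simp add: pact_add pact_smult pact_pCons_0[OF f] del: smult_minus_left)
	ultimately show ?thesis by blast
qed
end
locale simple_data =
	fixes D :: "('g::ab_group_add) cyclotomic_data"
	assumes fin: "finite_dimensional_space D" and simple: "simple_lie_algebra D"
	and inv: "invariant_form D" and norm: "normalised_form D" and aut: "lie_automorphism D"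
begin
abbreviation "gs == gscale D"
abbreviation "gb == gbracket D"
abbreviation "gf == gform D"
abbreviation "sig == gsigma D"
sublocale g: vector_space gs using simple by (simp add: simple_lie_algebra_def)
lemma gb_linear: "vlin gs gs (gb x)" "vlin gs gs (%x. gb x y)"
	using simple unfolding simple_lie_algebra_def by auto
sublocale gb: Vector_Spaces.linear gs gs "gb x" for x by (rule gb_linear)
sublocale gb': Vector_Spaces.linear gs gs "%x. gb x y" for y by (rule gb_linear)
lemma gb_self [simp]: "gb x x = 0"
	using simple unfolding simple_lie_algebra_def by auto
lemma gb_anti: "gb x y = - gb y x"
proof -
	have "gb (x + y) (x + y) = 0" by simp
	hence "gb x y + gb y x = 0" by (simp only: gb.add gb'.add) (simp add: add.commute)
	thus ?thesis by (simp add: eq_neg_iff_add_eq_0)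
qed
lemma gb_jacobi: "gb x (gb y z) = gb (gb x y) z + gb y (gb x z)"
proof -
	have "gb x (gb y z) + gb y (gb z x) + gb z (gb x y) = 0"
	using simple unfolding simple_lie_algebra_def by auto
	moreover have "gb z (gb x y) = - gb (gb x y) z" "gb y (gb z x) = - gb y (gb x z)"
	using gb_anti[of z "gb x y"] gb_anti[of z x] by (simp_all add: gb.neg)
	ultimately show ?thesis by (simp add: algebra_simps)
qed
lemma ideal: "g.subspace I ==> (!!x y. y : I ==> gb x y : I) ==> v : I ==> v ~= 0 ==> I = UNIV"
	using simple unfolding simple_lie_algebra_def by blast
lemma gf_linear: "vlin gs (*) (gf x)"
	using inv by (simp add: invariant_form_def)
lemma gf_sym: "gf x y = gf y x" using inv by (simp add: invariant_form_def)
lemma gf_inv: "gf (gb x y) z = gf x (gb y z)" using inv unfolding invariant_form_def by blast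
lemma gf_add: "gf x (y + z) = gf x y + gf x z" "gf (y + z) x = gf y x + gf z x"
	using gf_linear gf_sym by (auto simp: Vector_Spaces.linear_iff)
lemma gf_scale: "gf x (gs c y) = c * gf x y" "gf (gs c y) x = c * gf y x"
	using gf_linear gf_sym by (auto simp: Vector_Spaces.linear_iff)
lemma sigma_linear: "vlin gs gs sig" using aut by (simp add: lie_automorphism_def)
lemma sigma_bij: "bij sig" using aut by (simp add: lie_automorphism_def)
lemma sigma_br: "sig (gb x y) = gb (sig x) (sig y)" using aut by (simp add: lie_automorphism_def)
sublocale sg: Vector_Spaces.linear gs gs sig by (rule sigma_linear)
text \<open>An element \<open>t\<close> that acts diagonalizably, with a nonzero eigenvalue.\<close>
lemma diagonal_element:
	obtains t y where "gf t t ~= 0" "y ~= 0" "gb t y = gs 2 y" "g.span {y. EX c. gb t y = gs c y} = UNIV"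
proof -
	obtain H t where H: "cartan_subalgebra D H" "t : roots D H" "gf t t = 2"
	using norm unfolding normalised_form_def by blast
	then obtain y where "t : H" "y ~= 0" "ALL h:H. gb h y = gs (gf t h) y" unfolding roots_def by blast
	moreover have "toral_subalgebra D H" using H(1) unfolding cartan_subalgebra_def by blast
	ultimately show ?thesis using H(3) that[of t y] unfolding toral_subalgebra_def by simp
qed
lemma gf_nondegenerate: assumes "!!y. gf x y = 0" shows "x = 0"
proof (rule ccontr)
	assume "x ~= 0"
	have "{x. ALL y. gf x y = 0} = UNIV"
	proof (rule ideal[OF _ _ _ \<open>x ~= 0\<close>])
	show "g.subspace {x. ALL y. gf x y = 0}"
	using gf_scale(1)[of _ 0 0] by (auto simp: g.subspace_def gf_add gf_scale gf_sym[of 0])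
	fix a b assume b: "b : {x. ALL y. gf x y = 0}"
	show "gb a b : {x. ALL y. gf x y = 0}"
	using b gf_inv[of b a] gf_scale(2)[of "-1" "gb b a"] gb_anti[of a b] by auto
	qed (use assms in auto)
	moreover obtain t y where "gf t t ~= 0" "y ~= 0" "gb t y = gs 2 y" "g.span {y. EX c. gb t y = gs c y} = UNIV"
	by (rule diagonal_element)
	ultimately show False by blast
qed
text \<open>A basis of eigenvectors of such an element.\<close>
lemma eigenbasis:
	obtains t y B where "fin_space gs B" "y ~= 0" "gb t y = gs 2 y" "!!b. b : B ==> EX c. gb t b = gs c b"
proof -
	obtain t y where ty0: "gf t t ~= 0" and ty: "y ~= 0" "gb t y = gs 2 y" "g.span {y. EX c. gb t y = gs c y} = UNIV"
	by (rule diagonal_element)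
	obtain B where B: "B <= {y. EX c. gb t y = gs c y}" "g.independent B" "{y. EX c. gb t y = gs c y} <= g.span B"
	by (rule g.maximal_independent_subset)
	have sp: "g.span B = UNIV" using g.span_minimal[OF B(3)] ty(3) by auto
	obtain C where "finite C" "g.span C = UNIV" using fin unfolding finite_dimensional_space_def by blast
	hence "finite B" using g.independent_span_bound[OF _ B(2)] by blast
	hence "fin_space gs B" by unfold_locales (use B(2) sp in auto)
	thus ?thesis using that[of B y t] ty B(1) by blast
qed
end
locale simple_basis = simple_data D + fs: fin_space "gscale D" B for D :: "('g::ab_group_add) cyclotomic_data" and B
begin
definition killing :: "'g => 'g => complex" where
	"killing x y = fs.tr (%v. gb x (gb y v))"
lemma killing_add: "killing x (y + z) = killing x y + killing x z" "killing (y + z) x = killing y x + killing z x"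
	and killing_scale: "killing x (gs c y) = c * killing x y" "killing (gs c y) x = c * killing y x"
	by (simp_all add: killing_def gb.add gb'.add fs.tr_add gb.scale gb'.scale fs.tr_scale)
lemma linear_comp: "vlin gs gs f ==> vlin gs gs h ==> vlin gs gs (%v. f (h v))"
	by (simp add: Vector_Spaces.linear_iff)
lemma killing_inv: "killing (gb x y) z = killing x (gb y z)"
proof -
	have 1: "gb (gb x y) v = gb x (gb y v) - gb y (gb x v)" for x y v using gb_jacobi[of x y v] by simp
	have "fs.tr (%v. gb y (gb x (gb z v))) = fs.tr (%v. gb x (gb z (gb y v)))"
	by (rule fs.tr_comm[OF gb_linear(1) linear_comp[OF gb_linear(1) gb_linear(1)]])
	thus ?thesis
	unfolding killing_def 1 by (simp add: gb.diff fs.tr_diff)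
qed
lemma killing_sigma: "killing (sig x) (sig y) = killing x y"
proof -
	define \<tau> where "\<tau> = inv_into UNIV sig"
	have st: "sig (\<tau> v) = v" "\<tau> (sig v) = v" for v
	using sigma_bij by (auto simp: \<tau>_def bij_is_surj surj_f_inv_f bij_is_inj inv_f_f)
	have a: "\<tau> (v + w) = \<tau> v + \<tau> w" for v w
	by (rule injD[OF bij_is_inj[OF sigma_bij]]) (simp add: st sg.add)
	have s: "\<tau> (gs c v) = gs c (\<tau> v)" for c v
	by (rule injD[OF bij_is_inj[OF sigma_bij]]) (simp add: st sg.scale)
	have \<tau>: "vlin gs gs \<tau>"
	by (simp add: Vector_Spaces.linear_iff g.vector_space_axioms a s)
	have "gb (sig x) (gb (sig y) v) = sig (gb x (gb y (\<tau> v)))" for v by (simp add: sigma_br st)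
	hence "killing (sig x) (sig y) = fs.tr (%v. sig (gb x (gb y (\<tau> v))))" by (simp add: killing_def)
	also have "\<dots> = fs.tr (%v. gb x (gb y (\<tau> (sig v))))"
	by (rule fs.tr_comm[OF sigma_linear]) (intro linear_comp[OF gb_linear(1)] \<tau>)
	finally show ?thesis by (simp add: st killing_def)
qed
text \<open>
  The Killing form does not vanish. Cartan's trick: an additive function \<open>f\<close> on the complex
  numbers, with rational values, turns the eigenvalue grading of \<open>t\<close> into a derivation \<open>\<delta>\<close>. If the
  Killing form vanished, then \<open>tr (ad t \<circ> \<delta>) = \<Sum>\<lambda> f(\<lambda>)\<close> would vanish, hence \<open>\<Sum>f(\<lambda>)\<^sup>2\<close> as well.
\<close>
lemma killing_nonzero:
	assumes y: "y ~= 0" "gb t y = gs 2 y" and ev: "!!b. b : B ==> EX c. gb t b = gs c b"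
	shows "EX x z. killing x z ~= 0"
proof (rule ccontr)
	assume "\<not> ?thesis"
	hence K: "killing x z = 0" for x z by auto
	obtain ew where l: "!!b. b : B ==> gb t b = gs (ew b) b" using ev by metis
	obtain f :: "complex => rat" where f: "!!a b. f (a + b) = f a + f b" "!!q a. f (of_rat q * a) = q * f a" "f 2 = 1"
	proof -
	interpret Q: vector_space "%q (x::complex). of_rat q * x" by unfold_locales (auto simp: algebra_simps of_rat_add of_rat_mult)
	interpret R: vector_space "(*) :: rat => rat => rat" by unfold_locales (auto simp: algebra_simps)
	interpret vector_space_pair "%q (x::complex). of_rat q * x" "(*) :: rat => rat => rat" ..
	have "Q.independent {2}" by simp
	from linear_independent_extend[OF this, of "%_. 1"] obtain h where
	"vlin (%q (x::complex). of_rat q * x) ((*) :: rat => _) h" "h 2 = 1" by auto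
	thus ?thesis using that[of h] by (auto simp: Vector_Spaces.linear_iff)
	qed
	have f0: "f 0 = 0" using f(1)[of 0 0] by simp
	have fsum: "f (sum h A) = (SUM a:A. f (h a))" for h and A :: "'g set"
	by (induction A rule: infinite_finite_induct) (auto simp: f f0)
	define \<delta> where "\<delta> v = (SUM b:B. gs (fs.co v b * of_rat (f (ew b))) b)" for v
	have \<delta>: "vlin gs gs \<delta>"
	unfolding Vector_Spaces.linear_iff using g.vector_space_axioms
	by (simp add: \<delta>_def fs.co_add fs.co_scale g.scale_left_distrib sum.distrib algebra_simps g.scale_sum_right)
	interpret \<delta>: Vector_Spaces.linear gs gs \<delta> by (rule \<delta>)
	have co_t: "fs.co (gb t v) b = fs.co v b * ew b" if "b : B" for v b
	using that fs.finB by (subst fs.co_linear[OF gb_linear(1)])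
	(simp add: l fs.co_scale fs.co_basis if_distrib[of "(*) _"] sum.delta cong: if_cong sum.cong)
	have eig: "\<delta> v = gs (of_rat (f c)) v" if "gb t v = gs c v" for v c
	proof (rule fs.co_eqI)
	fix b assume b: "b : B"
	have "c * fs.co v b = fs.co v b * ew b" using co_t[OF b, of v] that by (simp add: fs.co_scale)
	hence "fs.co v b = 0 | c = ew b" by auto
	moreover have "fs.co (\<delta> v) b = fs.co v b * of_rat (f (ew b))"
	using b fs.finB unfolding \<delta>_def by (simp add: fs.co_sum fs.co_scale fs.co_basis if_distrib[of "(*) _"] sum.delta cong: if_cong sum.cong)
	ultimately show "fs.co (\<delta> v) b = fs.co (gs (of_rat (f c)) v) b" by (auto simp: fs.co_scale)
	qed
	have der_basis: "\<delta> (gb b c) = gb (\<delta> b) c + gb b (\<delta> c)" if "b : B" "c : B" for b c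
	proof -
	have "gb t (gb b c) = gs (ew b + ew c) (gb b c)"
	by (simp add: gb_jacobi[of t b c] l that gb.scale gb'.scale g.scale_left_distrib)
	hence "\<delta> (gb b c) = gs (of_rat (f (ew b + ew c))) (gb b c)" by (rule eig)
	thus ?thesis
	by (simp add: eig[OF l[OF that(1)]] eig[OF l[OF that(2)]] gb.scale gb'.scale f of_rat_add g.scale_left_distrib)
	qed
	have der: "\<delta> (gb v w) = gb (\<delta> v) w + gb v (\<delta> w)" for v w
	proof -
	have 1: "\<delta> (gb v c) = gb (\<delta> v) c + gb v (\<delta> c)" if c: "c : B" for v c
	proof -
	have "v : g.span B" using fs.spanB by simp
	thus ?thesis
	by (induction v rule: g.span_induct_alt)
	(auto simp: gb.add gb'.add gb.scale gb'.scale \<delta>.add \<delta>.scale der_basis c g.scale_right_distrib algebra_simps)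
	qed
	have "w : g.span B" using fs.spanB by simp
	thus ?thesis
	by (induction w rule: g.span_induct_alt)
	(auto simp: gb.add gb'.add gb.scale gb'.scale \<delta>.add \<delta>.scale 1 g.scale_right_distrib algebra_simps)
	qed
	have Q: "fs.tr (%v. gb (gb x z) (\<delta> v)) = 0" for x z
	proof -
	have "gb (gb x z) (\<delta> v) = gb x (gb z (\<delta> v)) - gb z (gb x (\<delta> v))" for v using gb_jacobi[of x z "\<delta> v"] by simp
	moreover have "fs.tr (%v. gb z (gb x (\<delta> v))) = fs.tr (%v. gb x (\<delta> (gb z v)))"
	by (rule fs.tr_comm[OF gb_linear(1) linear_comp[OF gb_linear(1) \<delta>]])
	ultimately have "fs.tr (%v. gb (gb x z) (\<delta> v)) = fs.tr (%v. gb x (gb z (\<delta> v))) - fs.tr (%v. gb x (\<delta> (gb z v)))"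
	by (simp add: fs.tr_diff)
	also have "\<dots> = - killing x (\<delta> z)" by (simp add: der gb.add fs.tr_add killing_def)
	finally show ?thesis using K by simp
	qed
	have "g.span {gb x z | x z. True} = UNIV"
	proof -
	have "EX x z. gb x z ~= 0" using simple by (simp add: simple_lie_algebra_def)
	then obtain x z where xz: "gb x z ~= 0" by blast
	show ?thesis
	by (rule ideal[OF g.subspace_span _ _ xz]; rule g.span_base; blast)
	qed
	hence "t : g.span {gb x z | x z. True}" by simp
	moreover have "g.subspace {s. fs.tr (%v. gb s (\<delta> v)) = 0}"
	by (simp add: g.subspace_def gb'.add gb'.scale gb'.zero fs.tr_add fs.tr_scale) (simp add: fs.tr_def)
	hence "g.span {gb x z | x z. True} <= {s. fs.tr (%v. gb s (\<delta> v)) = 0}"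
	using Q by (intro g.span_minimal) blast+
	ultimately have "fs.tr (%v. gb t (\<delta> v)) = 0" by blast
	moreover have "fs.tr (%v. gb t (\<delta> v)) = (SUM b:B. of_rat (f (ew b)) * ew b)"
	unfolding fs.tr_def by (simp add: co_t eig[OF l] fs.co_scale fs.co_basis)
	ultimately have "f (SUM b:B. of_rat (f (ew b)) * ew b) = 0" using f0 by simp
	hence "(SUM b:B. f (ew b) * f (ew b)) = 0" by (simp add: fsum f)
	hence z: "f (ew b) = 0" if "b : B" for b
	using that fs.finB by (subst (asm) sum_nonneg_eq_0_iff) auto
	have "\<delta> y = gs 1 y" using eig[OF y(2)] f(3) by simp
	moreover have "\<delta> y = 0" unfolding \<delta>_def by (simp add: z)
	ultimately show False using y(1) by simp
qed
lemma killing_proportional: "EX m. ALL x y. killing x y = m * gf x y"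
proof -
	define T where "T x = (SUM b:B. gs (gf x b) b)" for x
	define S where "S x = (SUM b:B. gs (killing x b) b)" for x
	have T: "vlin gs gs T"
	unfolding Vector_Spaces.linear_iff using g.vector_space_axioms
	by (simp add: T_def gf_add gf_scale g.scale_left_distrib sum.distrib g.scale_sum_right)
	interpret T: Vector_Spaces.linear gs gs T by (rule T)
	have coT: "fs.co (T x) b = gf x b" "fs.co (S x) b = killing x b" if "b : B" for x b
	using that fs.finB unfolding T_def S_def
	by (simp_all add: fs.co_sum fs.co_scale fs.co_basis if_distrib[of "(*) _"] sum.delta cong: if_cong sum.cong)
	have ext: "\<beta> y = 0" if "!!b. b : B ==> \<beta> b = 0" "vlin gs (*) \<beta>" for \<beta> :: "'g => complex" and y
	proof -
	interpret b: Vector_Spaces.linear gs "(*)" \<beta> by fact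
	show ?thesis by (subst fs.expand[of y]) (simp add: b.sum b.scale that(1))
	qed
	have "inj T"
	proof (rule injI)
	fix a b assume "T a = T b"
	define x where "x = a - b"
	have "T x = 0" using \<open>T a = T b\<close> by (simp add: x_def T.diff)
	hence "gf x b = 0" if "b : B" for b using coT(1)[OF that, of x] by simp
	hence "gf x y = 0" for y using ext[of "gf x"] gf_linear by blast
	hence "x = 0" by (rule gf_nondegenerate)
	thus "a = b" by (simp add: x_def)
	qed
	hence "surj T" using fs.fd.linear_inj_imp_surj[OF T] by simp
	define \<phi> where "\<phi> x = inv_into UNIV T (S x)" for x
	have \<phi>T: "T (\<phi> x) = S x" for x using \<open>surj T\<close> by (simp add: \<phi>_def surj_f_inv_f)
	have S: "S (v + w) = S v + S w" "S (gs c v) = gs c (S v)" for v w c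
	by (simp_all add: S_def killing_add killing_scale g.scale_left_distrib sum.distrib g.scale_sum_right)
	have a: "\<phi> (v + w) = \<phi> v + \<phi> w" for v w
	by (rule injD[OF \<open>inj T\<close>]) (simp add: \<phi>T T.add S)
	have s: "\<phi> (gs c v) = gs c (\<phi> v)" for c v
	by (rule injD[OF \<open>inj T\<close>]) (simp add: \<phi>T T.scale S)
	have phi: "vlin gs gs \<phi>"
	by (simp add: Vector_Spaces.linear_iff g.vector_space_axioms a s)
	have kf: "killing x y = gf (\<phi> x) y" for x y
	proof -
	have C: "vector_space ((*) :: complex => _)" by unfold_locales (auto simp: algebra_simps)
	have "killing x y - gf (\<phi> x) y = 0"
	proof (rule ext)
	fix b assume b: "b : B"
	show "killing x b - gf (\<phi> x) b = 0" by (simp add: \<phi>T flip: coT[OF b])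
	qed (auto simp: Vector_Spaces.linear_iff g.vector_space_axioms C killing_add killing_scale gf_add gf_scale algebra_simps)
	thus ?thesis by simp
	qed
	obtain t x where "gf t t ~= 0" "x ~= 0" "gb t x = gs 2 x" "g.span {y. EX c. gb t y = gs c y} = UNIV"
	by (rule diagonal_element)
	then obtain v m where v: "v ~= 0" "\<phi> v = gs m v" using fs.eigenvector_exists[OF phi] by blast
	have "{x. ALL y. killing x y = m * gf x y} = UNIV"
	proof (rule ideal[OF _ _ _ v(1)])
	have "killing 0 y = 0" "gf 0 y = 0" for y using killing_scale(2)[of 0 0] gf_scale(2)[of 0 0] by auto
	thus "g.subspace {x. ALL y. killing x y = m * gf x y}"
	by (auto simp: g.subspace_def gf_add gf_scale killing_add killing_scale algebra_simps)
	fix a b assume b: "b : {x. ALL y. killing x y = m * gf x y}"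
	show "gb a b : {x. ALL y. killing x y = m * gf x y}"
	proof (intro CollectI allI)
	fix y
	have "killing (gb b a) y = m * gf (gb b a) y" using b by (simp add: killing_inv gf_inv)
	thus "killing (gb a b) y = m * gf (gb a b) y"
	using killing_scale(2)[of "-1" "gb b a" y] gf_scale(2)[of "-1" "gb b a" y] gb_anti[of a b] by simp
	qed
	qed (simp add: kf v gf_scale)
	thus ?thesis by blast
qed
end
context simple_data begin
theorem form_sigma: "gf (sig x) (sig y) = gf x y"
proof -
	obtain t z and B :: "'g set" where B: "fin_space gs B" "z ~= 0" "gb t z = gs 2 z" "!!b. b : B ==> EX c. gb t b = gs c b"
	by (rule eigenbasis) blast
	interpret simple_basis D B by (intro simple_basis.intro B(1) simple_data_axioms)
	obtain m where m: "!!x y. killing x y = m * gf x y" using killing_proportional by blast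
	have "m ~= 0" using killing_nonzero[OF B(2-4)] m by auto
	thus ?thesis using killing_sigma[of x y] unfolding m by simp
qed
end
section \<open>Scalar rational functions\<close>
abbreviation "srat == scalar_rational"
abbreviation "sexp == scalar_expansion"
lemma sr_cong: "srat S r ==> (!!t. t ~: S ==> r t = r' t) ==> srat S r'"
	unfolding scalar_rational_def by metis
lemma sr_mono: "srat S r ==> S <= S' ==> srat S' r"
	unfolding scalar_rational_def by (meson subsetD)
lemma sr_poly: "srat S (poly p)"
	unfolding scalar_rational_def by (intro exI[of _ p] exI[of _ 1]) auto
lemma sr_const [simp, intro]: "srat S (%t. c)"
	using sr_poly[of S "[:c:]"] by (rule sr_cong) simp
lemma sr_id [simp, intro]: "srat S (%t. t)"
	using sr_poly[of S "[:0, 1:]"] by (rule sr_cong) simp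
lemma sr_add [intro]:
	assumes "srat S f" "srat S g"
	shows "srat S (%t. f t + g t)"
proof -
	obtain p q p' q' where "ALL t. t ~: S --> poly q t ~= 0 & f t = poly p t / poly q t"
	"ALL t. t ~: S --> poly q' t ~= 0 & g t = poly p' t / poly q' t"
	using assms unfolding scalar_rational_def by blast
	thus ?thesis unfolding scalar_rational_def
	by (intro exI[of _ "p * q' + p' * q"] exI[of _ "q * q'"]) (auto simp: field_simps)
qed
lemma sr_mult [intro]:
	assumes "srat S f" "srat S g"
	shows "srat S (%t. f t * g t)"
proof -
	obtain p q p' q' where "ALL t. t ~: S --> poly q t ~= 0 & f t = poly p t / poly q t"
	"ALL t. t ~: S --> poly q' t ~= 0 & g t = poly p' t / poly q' t"
	using assms unfolding scalar_rational_def by blast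
	thus ?thesis unfolding scalar_rational_def
	by (intro exI[of _ "p * p'"] exI[of _ "q * q'"]) (auto simp: field_simps)
qed
lemma sr_uminus [intro]: "srat S f ==> srat S (%t. - f t)"
	using sr_mult[OF sr_const[of S "-1"], of f] by simp
lemma sr_diff [intro]: "srat S f ==> srat S g ==> srat S (%t. f t - g t)"
	using sr_add[OF _ sr_uminus, of S f g] by simp
lemma sr_power [intro]: "srat S f ==> srat S (%t. f t ^ n)"
	by (induction n) auto
lemma sr_sum [intro]: "(!!j. j : J ==> srat S (f j)) ==> srat S (%t. SUM j:J. f j t)"
	by (induction J rule: infinite_finite_induct) auto
lemma sr_inverse_affine:
	assumes "!!t. t ~: S ==> a + b * t ~= 0"
	shows "srat S (%t. inverse (a + b * t))"
	unfolding scalar_rational_def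
	by (intro exI[of _ 1] exI[of _ "[:a, b:]"]) (use assms in "auto simp: field_simps")
lemma sr_inverse [intro]: "z : S ==> srat S (%t. inverse (t - z))"
	using sr_inverse_affine[of S "- z" 1] by (auto simp: algebra_simps)
lemma sr_compose_mult:
	assumes "srat S r" "!!t. t ~: S ==> c * t ~: S"
	shows "srat S (%t. r (c * t))"
proof -
	obtain p q where "ALL t. t ~: S --> poly q t ~= 0 & r t = poly p t / poly q t"
	using assms unfolding scalar_rational_def by blast
	thus ?thesis unfolding scalar_rational_def using assms(2)
	by (intro exI[of _ "pcompose p [:0, c:]"] exI[of _ "pcompose q [:0, c:]"]) (simp add: poly_pcompose mult.commute)
qed
lemma sr_analytic:
	assumes "finite S" "srat S r"
	shows "r holomorphic_on (- S)" "!!t. t ~: S ==> r analytic_on {t}"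
proof -
	obtain p q where pq: "!!t. t ~: S ==> poly q t ~= 0 & r t = poly p t / poly q t"
	using assms unfolding scalar_rational_def by blast
	have "(%t. poly p t / poly q t) holomorphic_on (- S)"
	using pq by (intro holomorphic_intros) auto
	thus h: "r holomorphic_on (- S)"
	by (rule holomorphic_transform) (use pq in auto)
	have "open (- S)" using assms(1) by (simp add: finite_imp_closed open_Compl)
	thus "r analytic_on {t}" if "t ~: S" for t
	using h that unfolding analytic_at by (intro exI[of _ "- S"]) auto
qed
lemma sr_deriv:
	assumes "finite S" "srat S r"
	shows "srat S (deriv r)"
proof -
	obtain p q where pq: "!!t. t ~: S ==> poly q t ~= 0 & r t = poly p t / poly q t"
	using assms unfolding scalar_rational_def by blast
	have op: "open (- S)" using assms(1) by (simp add: finite_imp_closed open_Compl)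
	have "poly (q * q) t ~= 0 & deriv r t = poly (pderiv p * q - p * pderiv q) t / poly (q * q) t" if t: "t ~: S" for t
	proof -
	have ev: "eventually (%w. r w = poly p w / poly q w) (nhds t)"
	using eventually_nhds_in_open[OF op, of t] t by (auto elim!: eventually_mono simp: pq)
	have "((%w. poly p w / poly q w) has_field_derivative (poly (pderiv p) t * poly q t - poly p t * poly (pderiv q) t) / (poly q t * poly q t)) (at t)"
	using pq[OF t] by (intro DERIV_divide poly_DERIV) auto
	hence "deriv r t = (poly (pderiv p) t * poly q t - poly p t * poly (pderiv q) t) / (poly q t * poly q t)"
	using deriv_cong_ev[OF ev refl] DERIV_imp_deriv by fastforce
	thus ?thesis using pq[OF t] by simp
	qed
	thus ?thesis unfolding scalar_rational_def by blast
qed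
subsection \<open>Partial fractions\<close>
inductive partial_fraction :: "complex set => (complex => complex) => bool" for S where
	pf_pow: "partial_fraction S (%t. t ^ n)"
| pf_inv: "z : S ==> partial_fraction S (%t. inverse (t - z) ^ Suc n)"
| pf_add: "partial_fraction S f ==> partial_fraction S g ==> partial_fraction S (%t. f t + g t)"
| pf_scale: "partial_fraction S f ==> partial_fraction S (%t. c * f t)"
definition pf_equiv :: "complex set => (complex => complex) => bool" where
	"pf_equiv S f \<longleftrightarrow> (EX g. partial_fraction S g & (ALL t. t ~: S --> f t = g t))"
lemma pfe_base: "partial_fraction S f ==> pf_equiv S f" by (auto simp: pf_equiv_def)
lemma pfe_cong: "pf_equiv S f ==> (!!t. t ~: S ==> f t = g t) ==> pf_equiv S g"
	unfolding pf_equiv_def by metis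
lemma pfe_add: assumes "pf_equiv S f" "pf_equiv S g" shows "pf_equiv S (%t. f t + g t)"
proof -
	obtain f' g' where "partial_fraction S f'" "ALL t. t ~: S --> f t = f' t" "partial_fraction S g'" "ALL t. t ~: S --> g t = g' t"
	using assms by (auto simp: pf_equiv_def)
	thus ?thesis unfolding pf_equiv_def by (intro exI[of _ "%t. f' t + g' t"]) (auto intro: pf_add)
qed
lemma pfe_scale: assumes "pf_equiv S f" shows "pf_equiv S (%t. c * f t)"
proof -
	obtain f' where "partial_fraction S f'" "ALL t. t ~: S --> f t = f' t"
	using assms by (auto simp: pf_equiv_def)
	thus ?thesis unfolding pf_equiv_def by (intro exI[of _ "%t. c * f' t"]) (auto intro: pf_scale)
qed
lemma pfe_inv_power: "z : S ==> pf_equiv S (%t. inverse (t - z) ^ n)"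
	by (cases n) (use pfe_base[OF pf_pow[of S 0]] in "auto intro!: pfe_base intro: pf_inv simp del: power_Suc")
lemma pf_mult_t: "partial_fraction S f ==> pf_equiv S (%t. t * f t)"
proof (induction rule: partial_fraction.induct)
	case (pf_pow n)
	thus ?case using pfe_base[OF partial_fraction.pf_pow[of S "Suc n"]] by simp
next
	case (pf_inv z n)
	have "pf_equiv S (%t. inverse (t - z) ^ n + z * inverse (t - z) ^ Suc n)"
	using pf_inv by (intro pfe_add pfe_scale pfe_inv_power)
	thus ?case
	proof (rule pfe_cong)
	fix t assume "t ~: S"
	hence "t - z ~= 0" using pf_inv by auto
	hence "1 + z * inverse (t - z) = t * inverse (t - z)" by (simp add: field_simps)
	hence "(1 + z * inverse (t - z)) * inverse (t - z) ^ n = t * inverse (t - z) * inverse (t - z) ^ n" by simp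
	thus "inverse (t - z) ^ n + z * inverse (t - z) ^ Suc n = t * inverse (t - z) ^ Suc n"
	by (simp add: algebra_simps)
	qed
next
	case (pf_add f g)
	have "pf_equiv S (%t. t * f t + t * g t)" by (rule pfe_add) fact+
	thus ?case by (rule pfe_cong) (simp add: algebra_simps)
next
	case (pf_scale f c)
	have "pf_equiv S (%t. c * (t * f t))" by (rule pfe_scale) fact
	thus ?case by (rule pfe_cong) (simp add: algebra_simps)
qed
lemma pf_mult_inv: assumes z: "z : S" shows "partial_fraction S f ==> pf_equiv S (%t. inverse (t - z) * f t)"
proof (induction rule: partial_fraction.induct)
	case (pf_pow n)
	show ?case
	proof (induction n)
	case 0
	thus ?case using pfe_inv_power[OF z, of 1] by simp
	next
	case (Suc n)
	have "pf_equiv S (%t. t ^ n + z * (inverse (t - z) * t ^ n))"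
	using Suc by (intro pfe_add pfe_scale pfe_base[OF partial_fraction.pf_pow])
	thus ?case
	proof (rule pfe_cong)
	fix t assume "t ~: S"
	hence "t - z ~= 0" using z by auto
	hence "1 + z * inverse (t - z) = t * inverse (t - z)" by (simp add: field_simps)
	hence "(1 + z * inverse (t - z)) * t ^ n = t * inverse (t - z) * t ^ n" by simp
	thus "t ^ n + z * (inverse (t - z) * t ^ n) = inverse (t - z) * t ^ Suc n"
	by (simp add: algebra_simps)
	qed
	qed
next
	case (pf_inv w n)
	show ?case
	proof (cases "w = z")
	case True
	thus ?thesis using pfe_inv_power[OF z, of "Suc (Suc n)"] by simp
	next
	case False
	have "pf_equiv S (%t. inverse (t - z) * inverse (t - w) ^ m)" for m
	proof (induction m)
	case 0
	thus ?case using pfe_inv_power[OF z, of 1] by simp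
	next
	case (Suc m)
	have "pf_equiv S (%t. inverse (z - w) * (inverse (t - z) * inverse (t - w) ^ m) + (- inverse (z - w)) * inverse (t - w) ^ Suc m)"
	using Suc pf_inv by (intro pfe_add pfe_scale pfe_inv_power)
	thus ?case
	proof (rule pfe_cong)
	fix t assume "t ~: S"
	hence "t - z ~= 0" "t - w ~= 0" "z - w ~= 0" using z pf_inv False by auto
	hence e: "inverse (t - z) * inverse (t - w) = inverse (z - w) * inverse (t - z) - inverse (z - w) * inverse (t - w)"
	proof -
	have "inverse (t - z) - inverse (t - w) = (z - w) * (inverse (t - z) * inverse (t - w))"
	using \<open>t - z ~= 0\<close> \<open>t - w ~= 0\<close> by (simp add: division_ring_inverse_diff)
	hence "inverse (z - w) * (inverse (t - z) - inverse (t - w)) = inverse (t - z) * inverse (t - w)"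
	using left_inverse[OF \<open>z - w ~= 0\<close>] by (metis mult.assoc mult_1)
	thus ?thesis by (simp only: right_diff_distrib)
	qed
	have "inverse (t - z) * inverse (t - w) ^ Suc m = (inverse (t - z) * inverse (t - w)) * inverse (t - w) ^ m" by simp
	thus "inverse (z - w) * (inverse (t - z) * inverse (t - w) ^ m) + (- inverse (z - w)) * inverse (t - w) ^ Suc m
	= inverse (t - z) * inverse (t - w) ^ Suc m" unfolding e by (simp add: algebra_simps)
	qed
	qed
	thus ?thesis .
	qed
next
	case (pf_add f g)
	have "pf_equiv S (%t. inverse (t - z) * f t + inverse (t - z) * g t)" by (rule pfe_add) fact+
	thus ?case by (rule pfe_cong) (simp add: algebra_simps)
next
	case (pf_scale f c)
	have "pf_equiv S (%t. c * (inverse (t - z) * f t))" by (rule pfe_scale) fact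
	thus ?case by (rule pfe_cong) (simp add: algebra_simps)
qed
lemma pfe_mult_t: "pf_equiv S f ==> pf_equiv S (%t. t * f t)"
	unfolding pf_equiv_def[of S f] by (auto intro: pfe_cong[OF pf_mult_t])
lemma pfe_mult_inv: "z : S ==> pf_equiv S f ==> pf_equiv S (%t. inverse (t - z) * f t)"
	unfolding pf_equiv_def[of S f] by (auto intro: pfe_cong[OF pf_mult_inv])
lemma pfe_mult_poly: "pf_equiv S f ==> pf_equiv S (%t. poly p t * f t)"
proof (induction p)
	case 0
	thus ?case using pfe_scale[of S f 0] by simp
next
	case (pCons a p)
	have "pf_equiv S (%t. a * f t + t * (poly p t * f t))"
	using pCons by (intro pfe_add pfe_scale pfe_mult_t)
	thus ?case by (rule pfe_cong) (simp add: algebra_simps)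
qed
lemma pfe_inverse_poly: "(!!t. t ~: S ==> poly q t ~= 0) ==> q ~= 0 ==> pf_equiv S (%t. inverse (poly q t))"
proof (induction "Polynomial.degree q" arbitrary: q)
	case 0
	then obtain c where "q = [:c:]" by (metis degree_eq_zeroE)
	thus ?case using pfe_scale[OF pfe_base[OF pf_pow[of S 0]], of "inverse c"] by simp
next
	case (Suc n)
	then obtain a where a: "poly q a = 0" using alg_closed_imp_poly_has_root[of q] by auto
	then obtain q' where q': "q = [:- a, 1:] * q'" by (auto simp: poly_eq_0_iff_dvd dvd_def)
	have "a : S" using a Suc by auto
	moreover have "q' ~= 0" using q' Suc by auto
	moreover have "Polynomial.degree q' = n" using Suc(2) \<open>q' ~= 0\<close> unfolding q' by (subst (asm) degree_mult_eq) auto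
	ultimately have "pf_equiv S (%t. inverse (t - a) * inverse (poly q' t))"
	using Suc q' by (intro pfe_mult_inv Suc(1)) auto
	moreover have "poly q t = (t - a) * poly q' t" for t by (simp add: q' algebra_simps)
	ultimately show ?case by (elim pfe_cong) simp
qed
lemma partial_fractions:
	assumes "finite S" "srat S r"
	shows "EX g. partial_fraction S g & (ALL t. t ~: S --> r t = g t)"
proof -
	obtain p q where pq: "!!t. t ~: S ==> poly q t ~= 0 & r t = poly p t / poly q t"
	using assms unfolding scalar_rational_def by blast
	have "S ~= UNIV" using assms(1) infinite_UNIV_char_0 by auto
	then obtain t where "t ~: S" by auto
	hence "q ~= 0" using pq by auto
	hence "pf_equiv S (%t. poly p t * inverse (poly q t))"
	using pq by (intro pfe_mult_poly pfe_inverse_poly) auto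
	hence "pf_equiv S r" by (rule pfe_cong) (use pq in "auto simp: field_simps")
	thus ?thesis by (simp add: pf_equiv_def)
qed
lemma partial_fraction_sr: "partial_fraction S f ==> srat S f"
	by (induction rule: partial_fraction.induct) (auto intro!: sr_power sr_inverse simp del: power_Suc)
subsection \<open>Expansions\<close>
definition point_expansion :: "(complex => complex) => place => complex fls => bool" where
	"point_expansion r x F \<longleftrightarrow> (case x of At z => (%w. r (z + w)) has_laurent_expansion F
	| Infty => (%s. r (1 / s)) has_laurent_expansion F)"
lemma point_expansion_eq: "point_expansion r x F ==> sexp r x = F"
	unfolding point_expansion_def scalar_expansion_def
	by (cases x) (auto intro!: laurent_expansion_eqI)
lemma poly_has_laurent: "g has_laurent_expansion G ==> EX F. (%w. poly p (g w)) has_laurent_expansion F"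
proof (induction p)
	case (pCons a p)
	then obtain F where "(%w. poly p (g w)) has_laurent_expansion F" by auto
	with pCons.prems have "(%w. a + g w * poly p (g w)) has_laurent_expansion (fls_const a + G * F)"
	by (intro laurent_expansion_intros)
	thus ?case by auto
qed (auto intro: has_laurent_expansion_0)
lemma eventually_not_in_finite:
	assumes "finite S"
	shows "eventually (%w. z + w ~: S) (at (0::complex))" "eventually (%s. 1 / s ~: S) (at (0::complex))"
proof -
	have *: "eventually (%w. w ~: A) (at (0::complex))" if "finite A" for A
	using islimpt_finite[OF that, of 0] unfolding islimpt_conv_frequently_at frequently_def by simp
	show "eventually (%w. z + w ~: S) (at 0)"
	by (rule eventually_mono[OF *[of "(%a. a - z) ` S"]]) (use assms in "auto simp: image_iff algebra_simps")
	show "eventually (%s. 1 / s ~: S) (at 0)"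
	by (rule eventually_mono[OF *[of "(%a. 1 / a) ` S"]]) (use assms in "auto simp: image_iff")
qed
lemma laurent_expansion_1_over: "(%s. 1 / s) has_laurent_expansion fls_X_inv"
	using has_laurent_expansion_fls_X_inv unfolding inverse_eq_divide[abs_def] .
lemma laurent_expansion_shift_id: "(%w. z + w) has_laurent_expansion (fls_const z + fls_X)"
	using has_laurent_expansion_fps_X by (intro laurent_expansion_intros)
lemma point_expansion_scalar:
	assumes "finite S" "srat S r"
	shows "point_expansion r x (sexp r x)"
proof -
	obtain p q where pq: "!!t. t ~: S ==> poly q t ~= 0 & r t = poly p t / poly q t"
	using assms unfolding scalar_rational_def by blast
	have "EX F. point_expansion r x F"
	proof (cases x)
	case (At z)
	obtain F G where "(%w. poly p (z + w)) has_laurent_expansion F" "(%w. poly q (z + w)) has_laurent_expansion G"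
	using poly_has_laurent[OF laurent_expansion_shift_id] by metis
	hence l: "(%w. poly p (z + w) / poly q (z + w)) has_laurent_expansion F / G"
	by (rule has_laurent_expansion_divide)
	have ev: "eventually (%w. poly p (z + w) / poly q (z + w) = r (z + w)) (at 0)"
	using eventually_not_in_finite(1)[OF assms(1), of z] by eventually_elim (simp add: pq)
	have "(%w. r (z + w)) has_laurent_expansion F / G"
	using l has_laurent_expansion_cong[OF ev refl] by blast
	thus ?thesis using At by (auto simp: point_expansion_def)
	next
	case Infty
	obtain F G where "(%w. poly p (1 / w)) has_laurent_expansion F" "(%w. poly q (1 / w)) has_laurent_expansion G"
	using poly_has_laurent[OF laurent_expansion_1_over] by metis
	hence l: "(%w. poly p (1 / w) / poly q (1 / w)) has_laurent_expansion F / G"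
	by (rule has_laurent_expansion_divide)
	have ev: "eventually (%w. poly p (1 / w) / poly q (1 / w) = r (1 / w)) (at 0)"
	using eventually_not_in_finite(2)[OF assms(1)] by eventually_elim (simp add: pq)
	have "(%w. r (1 / w)) has_laurent_expansion F / G"
	using l has_laurent_expansion_cong[OF ev refl] by blast
	thus ?thesis using Infty by (auto simp: point_expansion_def)
	qed
	thus ?thesis using point_expansion_eq by blast
qed
lemma se_cong:
	assumes "finite S" "srat S f" "!!t. t ~: S ==> f t = g t"
	shows "sexp f x = sexp g x"
proof -
	have "point_expansion g x (sexp f x)"
	proof (cases x)
	case (At z)
	have ev: "eventually (%w. f (z + w) = g (z + w)) (at 0)"
	using eventually_not_in_finite(1)[OF assms(1), of z] by eventually_elim (simp add: assms)
	thus ?thesis using point_expansion_scalar[OF assms(1,2), of x] At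
	unfolding point_expansion_def by (simp add: has_laurent_expansion_cong[OF ev refl])
	next
	case Infty
	have ev: "eventually (%w. f (1 / w) = g (1 / w)) (at 0)"
	using eventually_not_in_finite(2)[OF assms(1)] by eventually_elim (simp add: assms)
	thus ?thesis using point_expansion_scalar[OF assms(1,2), of x] Infty
	unfolding point_expansion_def by (simp add: has_laurent_expansion_cong[OF ev refl])
	qed
	thus ?thesis by (simp add: point_expansion_eq)
qed
lemma se_add:
	assumes "finite S" "srat S f" "srat S g"
	shows "sexp (%t. f t + g t) x = sexp f x + sexp g x"
	using point_expansion_scalar[OF assms(1,2), of x] point_expansion_scalar[OF assms(1,3), of x]
	by (intro point_expansion_eq) (auto simp: point_expansion_def intro!: laurent_expansion_intros split: place.splits)
lemma se_mult:
	assumes "finite S" "srat S f" "srat S g"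
	shows "sexp (%t. f t * g t) x = sexp f x * sexp g x"
	using point_expansion_scalar[OF assms(1,2), of x] point_expansion_scalar[OF assms(1,3), of x]
	by (intro point_expansion_eq) (auto simp: point_expansion_def intro!: laurent_expansion_intros split: place.splits)
lemma se_const [simp]: "sexp (%t. c) x = fls_const c"
	by (intro point_expansion_eq) (auto simp: point_expansion_def intro!: laurent_expansion_intros split: place.splits)
lemma se_scale:
	assumes "finite S" "srat S f"
	shows "sexp (%t. c * f t) x = fls_const c * sexp f x"
	using se_mult[OF assms(1) sr_const assms(2)] by simp
lemma se_sum:
	assumes "finite S" "!!j. j : J ==> srat S (f j)"
	shows "sexp (%t. SUM j:J. f j t) x = (SUM j:J. sexp (f j) x)"
	using assms(2)
	by (induction J rule: infinite_finite_induct) (auto simp: se_add[OF assms(1) _ sr_sum])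
lemma se_power:
	assumes "finite S" "srat S f"
	shows "sexp (%t. f t ^ n) x = sexp f x ^ n"
	by (induction n) (auto simp: se_mult[OF assms(1,2) sr_power[OF assms(2)]])
lemma se_id: "sexp (%t. t) (At z) = fls_const z + fls_X" "sexp (%t. t) Infty = fls_X_inv"
	by (intro point_expansion_eq; simp add: point_expansion_def laurent_expansion_shift_id laurent_expansion_1_over)+
lemma se_inverse:
	"sexp (%t. inverse (t - z)) (At y) = inverse (fls_const (y - z) + fls_X)"
	"sexp (%t. inverse (t - z)) Infty = inverse (fls_X_inv - fls_const z)"
proof -
	have "(%w. inverse ((y - z) + w)) has_laurent_expansion inverse (fls_const (y - z) + fls_X)"
	by (intro laurent_expansion_intros has_laurent_expansion_fps_X)
	thus "sexp (%t. inverse (t - z)) (At y) = inverse (fls_const (y - z) + fls_X)"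
	by (intro point_expansion_eq) (simp add: point_expansion_def algebra_simps)
	have "(%s. inverse (1 / s - z)) has_laurent_expansion inverse (fls_X_inv - fls_const z)"
	by (intro laurent_expansion_intros laurent_expansion_1_over)
	thus "sexp (%t. inverse (t - z)) Infty = inverse (fls_X_inv - fls_const z)"
	by (intro point_expansion_eq) (simp add: point_expansion_def)
qed
lemma se_deriv_At:
	assumes "finite S" "srat S f"
	shows "sexp (deriv f) (At z) = fls_deriv (sexp f (At z))"
proof (rule point_expansion_eq)
	have "(%w. f (z + w)) has_laurent_expansion sexp f (At z)"
	using point_expansion_scalar[OF assms, of "At z"] by (simp add: point_expansion_def)
	moreover have "open (- ((%s. s - z) ` (S - {z})))"
	using assms(1) by (intro open_Compl finite_imp_closed) auto
	moreover have "((%w. f (z + w)) has_field_derivative deriv f (z + w)) (at w)"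
	if "w : - ((%s. s - z) ` (S - {z})) - {0}" for w
	proof -
	have "z + w ~: S" using that by (force simp: image_iff)
	hence "f field_differentiable at (z + w)"
	using sr_analytic(2)[OF assms] analytic_on_imp_differentiable_at by blast
	hence "(f has_field_derivative deriv f (z + w)) (at (z + w))" by (rule field_differentiable_derivI)
	thus ?thesis by (simp add: DERIV_shift add.commute)
	qed
	ultimately have "(%w. deriv f (z + w)) has_laurent_expansion fls_deriv (sexp f (At z))"
	by (intro has_laurent_expansion_deriv'[where A="- ((%s. s - z) ` (S - {z}))"]) auto
	thus "point_expansion (deriv f) (At z) (fls_deriv (sexp f (At z)))"
	by (simp add: point_expansion_def)
qed
lemma se_deriv_Infty:
	assumes "finite S" "srat S f"
	shows "fls_deriv (sexp f Infty) = - (fls_X_inv ^ 2 * sexp (deriv f) Infty)"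
proof -
	have S': "finite ((%a. 1 / a) ` S)" using assms(1) by simp
	have "(%s. f (1 / s)) has_laurent_expansion sexp f Infty"
	using point_expansion_scalar[OF assms, of Infty] by (simp add: point_expansion_def)
	moreover have "open (- ((%a. 1 / a) ` S - {0}))"
	using S' by (intro open_Compl finite_imp_closed) auto
	moreover have "((%s. f (1 / s)) has_field_derivative deriv f (1 / s) * (- ((1 / s) ^ 2))) (at s)"
	if "s : - ((%a. 1 / a) ` S - {0}) - {0}" for s
	proof -
	have s: "s ~= 0" "1 / s ~: S" using that by (auto simp: image_iff)
	hence "f field_differentiable at (1 / s)"
	using sr_analytic(2)[OF assms] analytic_on_imp_differentiable_at by blast
	hence 1: "(f has_field_derivative deriv f (1 / s)) (at (1 / s))" by (rule field_differentiable_derivI)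
	have "((%s. 1 / s) has_field_derivative (- ((1 / s) ^ 2))) (at s)"
	using s by (auto intro!: derivative_eq_intros simp: power2_eq_square)
	from DERIV_chain2[OF 1 this] show ?thesis .
	qed
	ultimately have 1: "(%s. deriv f (1 / s) * (- ((1 / s) ^ 2))) has_laurent_expansion fls_deriv (sexp f Infty)"
	by (intro has_laurent_expansion_deriv'[where A="- ((%a. 1 / a) ` S - {0})"]) auto
	have "(%s. deriv f (1 / s)) has_laurent_expansion sexp (deriv f) Infty"
	using point_expansion_scalar[OF assms(1) sr_deriv[OF assms], of Infty] by (simp add: point_expansion_def)
	hence "(%s. deriv f (1 / s) * (- ((1 / s) ^ 2))) has_laurent_expansion sexp (deriv f) Infty * (- (fls_X_inv ^ 2))"
	by (intro laurent_expansion_intros laurent_expansion_1_over)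
	thus ?thesis using 1 has_laurent_expansion_unique by (fastforce simp: mult.commute)
qed
text \<open>Coefficients of negative powers of \<open>c + s\<close> and of \<open>1 - c s\<close>.\<close>
definition neg_binom :: "nat => nat => complex => complex" where
	"neg_binom n m c = (-1) ^ m * of_nat ((n + m - 1) choose m) * inverse c ^ (n + m)"
lemma neg_binom_0 [simp]: "neg_binom 0 m c = (if m = 0 then 1 else 0)"
	by (auto simp: neg_binom_def binomial_eq_0)
lemma neg_binom_rec: "c ~= 0 ==> c * neg_binom (Suc n) (Suc m) c + neg_binom (Suc n) m c = neg_binom n (Suc m) c"
proof -
	assume c: "c ~= 0"
	have b: "(n + Suc m) choose (Suc m) = ((n + m) choose m) + ((n + m) choose Suc m)" by simp
	have i: "c * inverse c ^ Suc k = inverse c ^ k" for k using c by simp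
	have "c * neg_binom (Suc n) (Suc m) c = (-1) ^ Suc m * of_nat ((n + Suc m) choose (Suc m)) * (c * inverse c ^ Suc (n + Suc m))"
	by (simp add: neg_binom_def)
	hence 1: "c * neg_binom (Suc n) (Suc m) c = (-1) ^ Suc m * of_nat (((n + m) choose m) + ((n + m) choose Suc m)) * inverse c ^ (n + Suc m)"
	unfolding i b .
	show ?thesis unfolding 1 by (simp add: neg_binom_def algebra_simps)
qed
lemma neg_binom_head: "neg_binom n 0 c = inverse c ^ n"
	by (simp add: neg_binom_def)
lemma fps_neg_binom:
	assumes "c ~= 0"
	shows "inverse (fls_const c + fls_X) ^ n = fps_to_fls (Abs_fps (%m. neg_binom n m c))"
proof -
	define B where "B n = Abs_fps (%m. neg_binom n m c)" for n
	have rec: "(fps_const c + fps_X) * B (Suc n) = B n" for n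
	proof (rule fps_ext)
	fix m show "fps_nth ((fps_const c + fps_X) * B (Suc n)) m = fps_nth (B n) m"
	proof (cases m)
	case 0
	thus ?thesis using assms by (simp add: B_def neg_binom_head algebra_simps)
	next
	case (Suc k)
	thus ?thesis using neg_binom_rec[OF assms, of n k] by (simp add: B_def algebra_simps)
	qed
	qed
	have X: "fls_const c + fls_X = fps_to_fls (fps_const c + fps_X)"
	by simp
	have X0: "fls_const c + fls_X ~= (0 :: complex fls)"
	proof
	assume "fls_const c + fls_X = (0 :: complex fls)"
	hence "fls_nth (fls_const c + fls_X) 0 = (0 :: complex)" by simp
	thus False using assms by simp
	qed
	have "fps_to_fls (B n) = inverse (fls_const c + fls_X) ^ n"
	proof (induction n)
	case 0
	have "B 0 = 1" by (rule fps_ext) (simp add: B_def)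
	thus ?case by simp
	next
	case (Suc n)
	have "(fls_const c + fls_X) * fps_to_fls (B (Suc n)) = fps_to_fls (B n)"
	unfolding X by (metis rec fls_times_fps_to_fls)
	hence "fps_to_fls (B (Suc n)) = inverse (fls_const c + fls_X) * fps_to_fls (B n)"
	using X0 by (metis left_inverse mult.assoc mult_1)
	thus ?case using Suc by simp
	qed
	thus ?thesis by (simp add: B_def)
qed
lemma se_neg_power_At:
	"y ~= z ==> sexp (%t. inverse (t - z) ^ n) (At y) = fps_to_fls (Abs_fps (%m. neg_binom n m (y - z)))"
	"sexp (%t. inverse (t - z) ^ n) (At z) = fls_X_inv ^ n"
proof -
	have e: "sexp (%t. inverse (t - z) ^ n) (At y) = inverse (fls_const (y - z) + fls_X) ^ n" for y
	by (subst se_power[of "{z}"]) (auto simp: se_inverse)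
	show "y ~= z ==> sexp (%t. inverse (t - z) ^ n) (At y) = fps_to_fls (Abs_fps (%m. neg_binom n m (y - z)))"
	unfolding e by (rule fps_neg_binom) simp
	show "sexp (%t. inverse (t - z) ^ n) (At z) = fls_X_inv ^ n"
	unfolding e by (simp add: fls_inverse_X)
qed
lemma se_neg_power_Infty:
	"sexp (%t. inverse (t - z) ^ n) Infty =
	fps_to_fls (Abs_fps (%m. if m < n then 0 else of_nat ((m - 1) choose (m - n)) * z ^ (m - n)))"
proof -
	define B where "B n = Abs_fps (%m. of_nat ((n + m - 1) choose m) * z ^ m)" for n
	have rec: "(1 - fps_const z * fps_X) * B (Suc n) = B n" for n
	proof (rule fps_ext)
	fix m show "fps_nth ((1 - fps_const z * fps_X) * B (Suc n)) m = fps_nth (B n) m"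
	proof (cases m)
	case 0
	thus ?thesis by (simp add: B_def algebra_simps)
	next
	case (Suc k)
	have b: "(n + Suc k) choose (Suc k) = ((n + k) choose k) + ((n + k) choose Suc k)" by simp
	show ?thesis unfolding Suc by (simp add: B_def b algebra_simps)
	qed
	qed
	have ne: "(1 - fls_const z * fls_X) ~= (0 :: complex fls)"
	proof
	assume "1 - fls_const z * fls_X = (0 :: complex fls)"
	hence "fls_nth (1 - fls_const z * fls_X) 0 = (0 :: complex)" by simp
	thus False by simp
	qed
	have X: "1 - fls_const z * fls_X = fps_to_fls (1 - fps_const z * fps_X)"
	by (simp add: fls_times_fps_to_fls)
	have B: "fps_to_fls (B n) = inverse (1 - fls_const z * fls_X) ^ n"
	proof (induction n)
	case 0
	have "B 0 = 1" by (rule fps_ext) (auto simp: B_def binomial_eq_0)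
	thus ?case by simp
	next
	case (Suc n)
	have "(1 - fls_const z * fls_X) * fps_to_fls (B (Suc n)) = fps_to_fls (B n)"
	unfolding X by (metis rec fls_times_fps_to_fls)
	hence "fps_to_fls (B (Suc n)) = inverse (1 - fls_const z * fls_X) * fps_to_fls (B n)"
	using ne by (metis left_inverse mult.assoc mult_1)
	thus ?case using Suc by simp
	qed
	have "fls_X * (fls_X_inv - fls_const z) = 1 - fls_const z * fls_X"
	by (simp add: algebra_simps flip: fls_inverse_X)
	hence "inverse (fls_X_inv - fls_const z) = fls_X * inverse (1 - fls_const z * fls_X)"
	proof -
	assume e: "fls_X * (fls_X_inv - fls_const z) = 1 - fls_const z * fls_X"
	have "inverse fls_X * (fls_X * (fls_X_inv - fls_const z)) = fls_X_inv - fls_const z"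
	by (simp add: mult.assoc[symmetric])
	hence "inverse (fls_X_inv - fls_const z) = inverse (inverse fls_X * (1 - fls_const z * fls_X))"
	unfolding e by simp
	also have "\<dots> = fls_X * inverse (1 - fls_const z * fls_X)"
	by (simp only: inverse_mult_distrib inverse_inverse_eq)
	finally show ?thesis .
	qed
	hence "sexp (%t. inverse (t - z) ^ n) Infty = fls_X ^ n * fps_to_fls (B n)"
	unfolding B by (subst se_power[of "{z}"]) (auto simp: se_inverse power_mult_distrib)
	also have "\<dots> = fps_to_fls (fps_X ^ n * B n)"
	by (simp add: fls_times_fps_to_fls fps_to_fls_power)
	also have "fps_X ^ n * B n = Abs_fps (%m. if m < n then 0 else of_nat ((m - 1) choose (m - n)) * z ^ (m - n))"
	by (rule fps_ext) (auto simp: B_def fps_X_power_mult_nth)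
	finally show ?thesis .
qed
text \<open>The residue theorem; the coefficient of \<open>t\<^sup>-\<^sup>1\<close> at infinity is that of the first power of \<open>1/t\<close>.\<close>
lemma sum_residues:
	assumes "finite S" "srat S r"
	shows "(SUM x:S. fls_residue (sexp r (At x))) = fls_nth (sexp r Infty) 1"
proof -
	obtain g where g: "partial_fraction S g" "!!t. t ~: S ==> r t = g t" using partial_fractions[OF assms] by blast
	have eq: "sexp r x = sexp g x" for x using se_cong[OF assms] g(2) by blast
	show ?thesis unfolding eq using g(1)
	proof (induction rule: partial_fraction.induct)
	case (pf_pow n)
	have "fls_residue ((fls_const x + fls_X) ^ n) = (0 :: complex)" for x
	proof -
	have "(fls_const x + fls_X) ^ n = fps_to_fls ((fps_const x + fps_X) ^ n)"
	by (simp add: fps_to_fls_power)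
	thus ?thesis by simp
	qed
	moreover have "fls_nth (fls_X_inv ^ n) 1 = (0 :: complex)"
	by (simp add: fls_X_inv_power_nth)
	ultimately show ?case by (simp add: se_power[OF assms(1)] se_id)
	next
	case (pf_inv z n)
	have "fls_residue (sexp (%t. inverse (t - z) ^ Suc n) (At x)) = (if x = z then (if n = 0 then 1 else 0) else 0)" for x
	using se_neg_power_At(1)[of x z "Suc n"] se_neg_power_At(2)[of z "Suc n"] by (simp add: fls_X_inv_power_nth del: power_Suc)
	moreover have "fls_nth (sexp (%t. inverse (t - z) ^ Suc n) Infty) 1 = (if n = 0 then 1 else 0)"
	unfolding se_neg_power_Infty by simp
	ultimately show ?case using pf_inv assms(1) by (simp add: sum.delta del: power_Suc)
	next
	case (pf_add f g)
	thus ?case by (simp add: se_add[OF assms(1) partial_fraction_sr partial_fraction_sr] sum.distrib)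
	next
	case (pf_scale f c)
	thus ?case by (simp add: se_scale[OF assms(1) partial_fraction_sr] flip: sum_distrib_left)
	qed
qed
lemma se_regular:
	assumes "finite S" "srat S r" "t ~: S"
	shows "n < 0 ==> fls_nth (sexp r (At t)) n = 0" "fls_nth (sexp r (At t)) 0 = r t"
proof -
	have "r analytic_on {t}" using sr_analytic(2)[OF assms(1,2)] assms(3) .
	hence "(%w. r (t + w)) has_fps_expansion fps_expansion r t"
	by (rule analytic_at_imp_has_fps_expansion)
	hence "(%w. r (t + w)) has_laurent_expansion fps_to_fls (fps_expansion r t)"
	by (rule has_laurent_expansion_fps)
	hence e: "sexp r (At t) = fps_to_fls (fps_expansion r t)"
	by (intro point_expansion_eq) (simp add: point_expansion_def)
	show "n < 0 ==> fls_nth (sexp r (At t)) n = 0" "fls_nth (sexp r (At t)) 0 = r t"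
	unfolding e by (auto simp: fps_expansion_def)
qed
text \<open>Apply the residue theorem to \<open>r(s) / (s - t)\<close>.\<close>
lemma no_poles_imp_zero:
	assumes "finite S" "srat S r"
	and "!!x n. x : S ==> n < 0 ==> fls_nth (sexp r (At x)) n = 0"
	and "!!n. n <= 0 ==> fls_nth (sexp r Infty) n = 0"
	and "t ~: S"
	shows "r t = 0"
proof -
	let ?S = "insert t S" and ?g = "%s. inverse (s - t)"
	have S: "finite ?S" "srat ?S r" "srat ?S ?g"
	using assms sr_mono[OF assms(2), of ?S] sr_inverse[of t ?S] by auto
	have "fls_residue (sexp (%s. r s * ?g s) (At x)) = (if x = t then r t else 0)" if "x : ?S" for x
	proof (cases "x = t")
	case True
	have "fls_residue (sexp r (At t) * fls_X_inv) = fls_nth (sexp r (At t)) 0"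
	by (simp add: fls_X_inv_times_conv_shift)
	thus ?thesis using True se_regular(2)[OF assms(1,2,5)] se_neg_power_At(2)[of t 1]
	by (simp add: se_mult[OF S])
	next
	case False
	let ?E = "sexp r (At x)"
	have "?E = fps_to_fls (fls_regpart ?E)"
	by (rule fls_eqI) (use assms(3) that False in auto)
	hence "?E * fps_to_fls G = fps_to_fls (fls_regpart ?E * G)" for G
	by (metis fls_times_fps_to_fls)
	hence "fls_residue (?E * fps_to_fls G) = 0" for G by simp
	thus ?thesis using False se_neg_power_At(1)[of x t 1] by (simp add: se_mult[OF S])
	qed
	hence "(SUM x:?S. fls_residue (sexp (%s. r s * ?g s) (At x))) = (SUM x:?S. if x = t then r t else 0)"
	by (intro sum.cong) auto
	also have "\<dots> = r t" using S(1) by (subst sum.delta) auto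
	finally have 1: "(SUM x:?S. fls_residue (sexp (%s. r s * ?g s) (At x))) = r t" .
	have "fls_nth (sexp (%s. r s * ?g s) Infty) 1 = 0"
	proof -
	let ?E = "sexp r Infty" and ?G = "sexp ?g Infty"
	have g: "fls_nth ?G n = 0" if "n <= 0" for n
	using se_neg_power_Infty[of t 1] that by auto
	have "?E * ?G = fps_to_fls (fls_regpart ?E) * fps_to_fls (fls_regpart ?G)"
	by (intro arg_cong2[where f="(*)"] fls_eqI) (use assms(4) g in auto)
	also have "\<dots> = fps_to_fls (fls_regpart ?E * fls_regpart ?G)" by (simp add: fls_times_fps_to_fls)
	finally have "fls_nth (?E * ?G) 1 = fps_nth (fls_regpart ?E * fls_regpart ?G) 1" by simp
	also have "\<dots> = 0" using assms(4)[of 0] g[of 0] by (simp add: fps_mult_nth)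
	finally show ?thesis by (simp add: se_mult[OF S])
	qed
	thus ?thesis using sum_residues[OF S(1) sr_mult[OF S(2,3)]] 1 by simp
qed
lemma sr_zero_of_derivatives:
	assumes "finite S" "srat S r" "u ~: S" "!!n. (deriv ^^ n) r u = 0" "t ~: S"
	shows "r t = 0"
proof (rule holomorphic_fun_eq_0_on_connected[of r "- S" u t])
	show "r holomorphic_on (- S)" by (rule sr_analytic(1)[OF assms(1,2)])
	show "open (- S)" using assms(1) by (simp add: finite_imp_closed open_Compl)
	have "connected (UNIV - S)"
	by (rule connected_open_diff_countable) (use assms(1) in "auto simp: countable_finite")
	thus "connected (- S)" by (simp add: Compl_eq_Diff_UNIV)
qed (use assms in auto)
section \<open>Loop algebras\<close>
subsection \<open>Convolution of Laurent series with vector coefficients\<close>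
definition conv :: "('a => 'b => 'c) => 'a::ab_group_add fls => 'b::ab_group_add fls => 'c::ab_group_add fls" where
	"conv \<beta> f g = Abs_fls (%n. SUM i:{fls_subdegree f..n - fls_subdegree g}. \<beta> (fls_nth f i) (fls_nth g (n - i)))"
locale biadditive =
	fixes \<beta> :: "'a::ab_group_add => 'b::ab_group_add => 'c::ab_group_add"
	assumes ladd: "\<beta> (x + x') y = \<beta> x y + \<beta> x' y" and radd: "\<beta> x (y + y') = \<beta> x y + \<beta> x y'"
begin
lemma zero [simp]: "\<beta> 0 y = 0" "\<beta> x 0 = 0"
	using ladd[of 0 0 y] radd[of x 0 0] by auto
lemma conv_nth:
	assumes "!!i. i < a ==> fls_nth f i = 0" "!!i. i < b ==> fls_nth g i = 0"
	shows "fls_nth (conv \<beta> f g) n = (SUM i:{a..n - b}. \<beta> (fls_nth f i) (fls_nth g (n - i)))"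
proof -
	let ?h = "%n i. \<beta> (fls_nth f i) (fls_nth g (n - i))"
	have "fls_nth (conv \<beta> f g) n = (SUM i:{fls_subdegree f..n - fls_subdegree g}. ?h n i)"
	unfolding conv_def
	by (subst nth_Abs_fls_lower_bound[of "fls_subdegree f + fls_subdegree g"]) auto
	also have "\<dots> = (SUM i:{fls_subdegree f..n - fls_subdegree g} \<union> {a..n - b}. ?h n i)"
	by (rule sum.mono_neutral_left) (auto simp: not_le)
	also have "\<dots> = (SUM i:{a..n - b}. ?h n i)"
	by (rule sum.mono_neutral_right) (use assms in "auto simp: not_le")
	finally show ?thesis .
qed
lemma conv_add1: "conv \<beta> (f + f') g = conv \<beta> f g + conv \<beta> f' g"
proof (rule fls_eqI)
	fix n
	define a where "a = min (fls_subdegree f) (fls_subdegree f')"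
	have a: "fls_nth f i = 0" "fls_nth f' i = 0" "fls_nth (f + f') i = 0" if "i < a" for i
	using that by (auto simp: a_def)
	have b: "fls_nth g i = 0" if "i < fls_subdegree g" for i using that by simp
	show "fls_nth (conv \<beta> (f + f') g) n = fls_nth (conv \<beta> f g + conv \<beta> f' g) n"
	using conv_nth[of a f "fls_subdegree g" g n] conv_nth[of a f' "fls_subdegree g" g n] conv_nth[of a "f + f'" "fls_subdegree g" g n] a b
	by (simp add: ladd sum.distrib)
qed
lemma conv_add2: "conv \<beta> f (g + g') = conv \<beta> f g + conv \<beta> f g'"
proof (rule fls_eqI)
	fix n
	define b where "b = min (fls_subdegree g) (fls_subdegree g')"
	have b: "fls_nth g i = 0" "fls_nth g' i = 0" "fls_nth (g + g') i = 0" if "i < b" for i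
	using that by (auto simp: b_def)
	have a: "fls_nth f i = 0" if "i < fls_subdegree f" for i using that by simp
	show "fls_nth (conv \<beta> f (g + g')) n = fls_nth (conv \<beta> f g + conv \<beta> f g') n"
	using conv_nth[of "fls_subdegree f" f b g n] conv_nth[of "fls_subdegree f" f b g' n] conv_nth[of "fls_subdegree f" f b "g + g'" n] a b
	by (simp add: radd sum.distrib)
qed
end
interpretation times_biadditive: biadditive "(*) :: complex => _" by unfold_locales (auto simp: algebra_simps)
declare fls_residue_def [simp del]
lemma residue_simps [simp]:
	fixes f h :: "complex fls"
	shows "fls_residue (f + h) = fls_residue f + fls_residue h" "fls_residue (- f) = - fls_residue f"
	"fls_residue (fls_const c * f) = c * fls_residue f" "fls_residue 0 = (0 :: complex)"
	"fls_residue (fls_deriv f) = 0"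
	by (simp_all add: fls_residue_def)
lemma conv_times: "conv (*) f g = f * (g :: complex fls)"
proof (rule fls_eqI)
	fix n show "fls_nth (conv (*) f g) n = fls_nth (f * g) n"
	by (subst times_biadditive.conv_nth[of "fls_subdegree f" f "fls_subdegree g" g]) (auto simp: fls_times_nth(2))
qed
locale gaudin_data = simple_data D for D :: "('g::ab_group_add) cyclotomic_data" +
	assumes period: "period D >= 1" and prim: "primitive_root_of_unity (period D) (omega D)"
	and sigma_period: "(gsigma D ^^ period D) = id"
	and fin_marked: "finite (marked D)" and zero_marked: "0 ~: marked D"
	and orbits: "!!z w. z : marked D ==> w : marked D ==> z ~= w ==> Gamma_orbit D z \<inter> Gamma_orbit D w = {}"
begin
abbreviation "om == omega D"
abbreviation "T == period D"
abbreviation "lsc == loop_scale D"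
abbreviation "lb == loop_bracket D"
abbreviation "lf == loop_form D"
abbreviation "ld == loop_deriv D"
definition basis :: "'g set" where "basis = (SOME B. fin_space gs B)"
lemma fin_space_basis: "fin_space gs basis"
proof -
	have "EX B. fin_space gs B" by (rule eigenbasis) blast
	thus ?thesis unfolding basis_def by (rule someI_ex)
qed
sublocale fs: fin_space gs basis by (rule fin_space_basis)
sublocale gbb: biadditive gb by unfold_locales (simp_all add: gb.add gb'.add)
sublocale gfb: biadditive gf by unfold_locales (simp_all add: gf_add)
definition ten :: "complex fls => 'g => 'g fls" where
	"ten c x = Abs_fls (%n. gs (fls_nth c n) x)"
lemma ten_nth [simp]: "fls_nth (ten c x) n = gs (fls_nth c n) x"
	unfolding ten_def by (subst nth_Abs_fls_lower_bound[of "fls_subdegree c"]) auto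
lemma lsc_nth [simp]: "fls_nth (lsc c f) n = gs c (fls_nth f n)"
	unfolding loop_scale_def by (subst nth_Abs_fls_lower_bound[of "fls_subdegree f"]) auto
lemma ld_nth [simp]: "fls_nth (ld f) n = gs (of_int (n + 1)) (fls_nth f (n + 1))"
	unfolding loop_deriv_def by (subst nth_Abs_fls_lower_bound[of "fls_subdegree f - 1"]) auto
lemma ten_add: "ten (c + d) x = ten c x + ten d x" "ten c (x + y) = ten c x + ten c y"
	by (auto intro!: fls_eqI simp: g.scale_left_distrib g.scale_right_distrib)
lemma ten_scale: "ten (fls_const a * c) x = lsc a (ten c x)" "ten c (gs a x) = lsc a (ten c x)"
	by (auto intro!: fls_eqI simp: mult.commute)
lemma ten_zero [simp]: "ten 0 x = 0" "ten c 0 = 0"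
	by (auto intro!: fls_eqI)
lemma fls_nth_sum: "fls_nth (sum F A) n = (SUM a:A. fls_nth (F a) n)"
	by (induction A rule: infinite_finite_induct) auto
definition cofls :: "'g fls => 'g => complex fls" where
	"cofls f b = Abs_fls (%n. fs.co (fls_nth f n) b)"
lemma cofls_nth [simp]: "fls_nth (cofls f b) n = fs.co (fls_nth f n) b"
	unfolding cofls_def by (subst nth_Abs_fls_lower_bound[of "fls_subdegree f"]) auto
lemma fls_expand: "f = (SUM b:basis. ten (cofls f b) b)"
	by (rule fls_eqI) (simp add: fls_nth_sum fs.expand[symmetric])
lemma fls_vec_induct:
	fixes f :: "'g fls"
	assumes "!!c x. P (ten c x)" "!!f g. P f ==> P g ==> P (f + g)"
	shows "P f"
proof -
	have "P (SUM b:A. ten (cofls f b) b)" for A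
	proof (induction A rule: infinite_finite_induct)
	case (infinite A)
	thus ?case using assms(1)[of 0 0] by simp
	next
	case empty
	thus ?case using assms(1)[of 0 0] by simp
	qed (auto simp: assms)
	thus ?thesis by (metis fls_expand)
qed
lemma lb_conv: "lb = conv gb" and lf_conv: "lf = conv gf"
	by (auto simp: fun_eq_iff loop_bracket_def loop_form_def conv_def)
lemma lb_add: "lb (f + f') h = lb f h + lb f' h" "lb f (h + h') = lb f h + lb f h'"
	unfolding lb_conv by (rule gbb.conv_add1 gbb.conv_add2)+
lemma lf_add: "lf (f + f') h = lf f h + lf f' h" "lf f (h + h') = lf f h + lf f h'"
	unfolding lf_conv by (rule gfb.conv_add1 gfb.conv_add2)+
lemma lb_ten: "lb (ten c x) (ten d y) = ten (c * d) (gb x y)"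
proof (rule fls_eqI)
	fix n
	show "fls_nth (lb (ten c x) (ten d y)) n = fls_nth (ten (c * d) (gb x y)) n"
	unfolding lb_conv conv_times[symmetric]
	using gbb.conv_nth[of "fls_subdegree c" "ten c x" "fls_subdegree d" "ten d y" n]
	times_biadditive.conv_nth[of "fls_subdegree c" c "fls_subdegree d" d n]
	by (simp add: gb.scale gb'.scale g.scale_sum_left mult.commute)
qed
lemma lf_ten: "lf (ten c x) (ten d y) = fls_const (gf x y) * (c * d)"
proof (rule fls_eqI)
	fix n
	show "fls_nth (lf (ten c x) (ten d y)) n = fls_nth (fls_const (gf x y) * (c * d)) n"
	unfolding lf_conv conv_times[symmetric, of c d]
	using gfb.conv_nth[of "fls_subdegree c" "ten c x" "fls_subdegree d" "ten d y" n]
	times_biadditive.conv_nth[of "fls_subdegree c" c "fls_subdegree d" d n]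
	by (simp add: gf_scale sum_distrib_left mult_ac)
qed
lemma ld_add: "ld (f + h) = ld f + ld h"
	by (rule fls_eqI) (simp add: g.scale_right_distrib)
lemma ld_ten: "ld (ten c x) = ten (fls_deriv c) x"
	by (rule fls_eqI) simp
lemma lsc_add: "lsc c (f + h) = lsc c f + lsc c h"
	by (rule fls_eqI) (simp add: g.scale_right_distrib)
lemma ld_scale: "ld (lsc c f) = lsc c (ld f)"
	by (rule fls_eqI) (simp add: g.scale_left_commute)
sublocale lv: vector_space lsc
	by unfold_locales (auto intro!: fls_eqI simp: g.scale_right_distrib g.scale_left_distrib)
lemma lb_scale: "lb (lsc c f) h = lsc c (lb f h)" "lb f (lsc c h) = lsc c (lb f h)"
proof -
	show "lb (lsc c f) h = lsc c (lb f h)"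
	proof (induction f rule: fls_vec_induct)
	case (1 a x)
	show ?case by (induction h rule: fls_vec_induct) (simp_all add: lb_add lsc_add lb_ten mult.assoc flip: ten_scale(1))
	qed (simp add: lb_add lsc_add)
	show "lb f (lsc c h) = lsc c (lb f h)"
	proof (induction f rule: fls_vec_induct)
	case (1 a x)
	show ?case by (induction h rule: fls_vec_induct) (simp_all add: lb_add lsc_add lb_ten mult_ac flip: ten_scale(1))
	qed (simp add: lb_add lsc_add)
qed
lemma lf_scale: "lf (lsc c f) h = fls_const c * lf f h" "lf f (lsc c h) = fls_const c * lf f h"
proof -
	show "lf (lsc c f) h = fls_const c * lf f h"
	proof (induction f rule: fls_vec_induct)
	case (1 a x)
	show ?case by (induction h rule: fls_vec_induct) (simp_all add: lf_add lf_ten algebra_simps flip: ten_scale(1))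
	qed (simp add: lf_add lsc_add algebra_simps)
	show "lf f (lsc c h) = fls_const c * lf f h"
	proof (induction f rule: fls_vec_induct)
	case (1 a x)
	show ?case by (induction h rule: fls_vec_induct) (simp_all add: lf_add lsc_add lf_ten algebra_simps flip: ten_scale(1))
	qed (simp add: lf_add lsc_add algebra_simps)
qed
lemma lb_anti: "lb f h = - lb h f"
proof (induction f rule: fls_vec_induct)
	case (1 a x)
	show ?case
	proof (induction h rule: fls_vec_induct)
	case (1 b y)
	have "ten (a * b) (gb x y) + ten (b * a) (gb y x) = 0"
	using gb_anti[of x y] by (simp add: mult.commute flip: ten_add(2))
	thus ?case by (simp add: lb_ten eq_neg_iff_add_eq_0)
	qed (simp add: lb_add)
qed (simp add: lb_add)
lemma lb_jacobi: "lb f (lb h k) = lb (lb f h) k + lb h (lb f k)"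
proof (induction f rule: fls_vec_induct)
	case (1 a x)
	show ?case
	proof (induction h rule: fls_vec_induct)
	case (1 b y)
	show ?case
	proof (induction k rule: fls_vec_induct)
	case (1 c z)
	have "a * (b * c) = b * (a * c)" "a * b * c = b * (a * c)" by (simp_all add: mult_ac)
	thus ?case using gb_jacobi[of x y z] by (simp only: lb_ten ten_add(2))
	qed (simp add: lb_add)
	qed (simp add: lb_add)
qed (simp add: lb_add)
text \<open>The residue pairing \<open>res \<langle>f, dh\<rangle>\<close>.\<close>
definition rp :: "'g fls => 'g fls => complex" where
	"rp f h = fls_residue (lf f (ld h))"
lemma rp_add: "rp (f + f') h = rp f h + rp f' h" "rp f (h + h') = rp f h + rp f h'"
	by (simp_all add: rp_def lf_add ld_add)
lemma rp_scale: "rp (lsc c f) h = c * rp f h" "rp f (lsc c h) = c * rp f h"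
	by (simp_all add: rp_def lf_scale ld_scale)
lemma rp_ten: "rp (ten c x) (ten d y) = gf x y * fls_residue (c * fls_deriv d)"
	by (simp add: rp_def ld_ten lf_ten)
lemma rp_anti: "rp f h = - rp h f"
proof (induction f rule: fls_vec_induct)
	case (1 a x)
	show ?case
	proof (induction h rule: fls_vec_induct)
	case (1 b y)
	have "fls_deriv (a * b) = a * fls_deriv b + b * fls_deriv a" by (simp add: mult.commute)
	hence "fls_residue (a * fls_deriv b) + fls_residue (b * fls_deriv a) = 0"
	using fls_residue_deriv[of "a * b"] unfolding fls_residue_def by (metis fls_plus_nth)
	hence "fls_residue (a * fls_deriv b) = - fls_residue (b * fls_deriv a)"
	by (simp add: eq_neg_iff_add_eq_0)
	thus ?case using gf_sym[of x y] by (simp add: rp_ten)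
	qed (simp add: rp_add)
qed (simp add: rp_add)
lemma rp_cocycle: "rp f (lb h k) = rp (lb f h) k + rp h (lb f k)"
proof (induction f rule: fls_vec_induct)
	case (1 a x)
	show ?case
	proof (induction h rule: fls_vec_induct)
	case (1 b y)
	show ?case
	proof (induction k rule: fls_vec_induct)
	case (1 c z)
	have g: "gf x (gb y z) = gf (gb x y) z" "gf y (gb x z) = - gf (gb x y) z"
	using gf_inv[of x y z] gf_inv[of y x z] gb_anti[of y x] gf_scale(2)[of "-1" "gb x y" z] by simp_all
	have r: "fls_residue (a * fls_deriv (b * c)) = fls_residue (a * b * fls_deriv c) - fls_residue (b * fls_deriv (a * c))"
	proof -
	define X Y Z W where "X = fls_residue (a * fls_deriv (b * c))" and "Y = fls_residue (a * b * fls_deriv c)"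
	and "Z = fls_residue (b * fls_deriv (a * c))" and "W = fls_residue (b * c * fls_deriv a)"
	have "fls_deriv (a * (b * c)) = a * fls_deriv (b * c) + b * c * fls_deriv a"
	by (subst fls_deriv_mult) (simp add: mult.commute)
	hence 1: "X + W = 0"
	using fls_residue_deriv[of "a * (b * c)"] unfolding X_def W_def fls_residue_def by (metis fls_plus_nth)
	have "b * fls_deriv (a * c) = a * b * fls_deriv c + b * c * fls_deriv a"
	by (subst fls_deriv_mult) (simp add: algebra_simps)
	hence 2: "Z = Y + W" unfolding Z_def Y_def W_def fls_residue_def by (metis fls_plus_nth)
	have "X = Y - Z" using 1 2 by (simp add: eq_neg_iff_add_eq_0[symmetric])
	thus ?thesis unfolding X_def Y_def Z_def .
	qed
	show ?case by (simp only: lb_ten rp_ten g r) (simp add: algebra_simps)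
	qed (simp add: rp_add lb_add)
	qed (simp add: rp_add lb_add)
qed (simp add: rp_add lb_add)
lemma rp_zero [simp]: "rp 0 f = 0" "rp f 0 = 0"
	using rp_scale(1)[of 0 0 f] rp_scale(2)[of f 0 0] by simp_all
lemma rp_minus: "rp (- f) h = - rp f h" "rp f (- h) = - rp f h"
	using rp_add(1)[of f "- f" h] rp_add(2)[of f h "- h"] by (simp_all add: eq_neg_iff_add_eq_0 add.commute)
lemma lb_zero [simp]: "lb 0 f = 0" "lb f 0 = 0"
	using lb_scale(1)[of 0 0 f] lb_scale(2)[of f 0 0] by simp_all
lemma ld_inf: "fls_residue (fls_shift 2 (lf f (loop_deriv_inf D h))) = - rp f h"
proof -
	have di: "fls_nth (loop_deriv_inf D h) n = gs (- of_int (n - 1)) (fls_nth h (n - 1))" for h n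
	unfolding loop_deriv_inf_def by (subst nth_Abs_fls_lower_bound[of "fls_subdegree h + 1"]) auto
	have di_add: "loop_deriv_inf D (h + h') = loop_deriv_inf D h + loop_deriv_inf D h'" for h h'
	by (rule fls_eqI) (simp add: di g.scale_right_distrib)
	have di_ten: "loop_deriv_inf D (ten c x) = ten (- fls_shift (-2) (fls_deriv c)) x" for c x
	by (rule fls_eqI) (simp add: di flip: g.scale_minus_left mult_minus_left)
	show ?thesis
	proof (induction f rule: fls_vec_induct)
	case (1 a x)
	show ?case
	proof (induction h rule: fls_vec_induct)
	case (1 b y)
	have "fls_shift 2 (fls_const (gf x y) * (a * - fls_shift (-2) (fls_deriv b))) = - (fls_const (gf x y) * (a * fls_deriv b))"
	by (simp add: fls_shifted_times_simps)
	thus ?case by (simp add: di_ten lf_ten rp_ten del: fls_const_mult_const)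
	qed (simp add: di_add lf_add rp_add)
	qed (simp add: lf_add rp_add)
qed
lemma cocycle_eq:
	"cocycle D S f h = rp (f Infty) (h Infty) / of_nat T + (SUM x:S. rp (f (At x)) (h (At x))) + rp (f (At 0)) (h (At 0)) / of_nat T"
	unfolding cocycle_def ld_inf by (simp add: rp_def)
subsection \<open>The Lie algebras of multiloops\<close>
abbreviation "msc == multiloop_scale D"
abbreviation "mb == multiloop_bracket D"
sublocale mv: vector_space msc
	by unfold_locales
	(auto simp: multiloop_scale_def fun_eq_iff lv.scale_right_distrib lv.scale_left_distrib)
lemma msc_apply [simp]: "msc c f x = lsc c (f x)" by (simp add: multiloop_scale_def)
lemma mb_At [simp]: "mb f h (At x) = lb (f (At x)) (h (At x))" and mb_Infty: "mb f h Infty = lb (h Infty) (f Infty)"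
	by (simp_all add: multiloop_bracket_def)
lemma mb_lie: "total_lie msc mb"
proof (rule total_lie.intro[OF mv.vector_space_axioms])
	show "vlin msc msc (mb x)" for x
	unfolding Vector_Spaces.linear_iff
	by (auto simp: mv.vector_space_axioms fun_eq_iff multiloop_bracket_def lb_add lb_scale split: place.splits)
	show "mb x y = - mb y x" for x y
	by (auto simp: fun_eq_iff multiloop_bracket_def intro: lb_anti split: place.splits)
	show "mb x (mb y z) = mb (mb x y) z + mb y (mb x z)" for x y z
	proof (rule ext)
	fix p show "mb x (mb y z) p = (mb (mb x y) z + mb y (mb x z)) p"
	proof (cases p)
	case (At a)
	thus ?thesis using lb_jacobi[of "x (At a)" "y (At a)" "z (At a)"] by simp
	next
	case Infty
	let ?x = "x Infty" and ?y = "y Infty" and ?z = "z Infty"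
	have "lb (lb ?z ?y) ?x = lb ?z (lb ?y ?x) + lb (lb ?z ?x) ?y"
	using lb_jacobi[of ?z ?y ?x] lb_anti[of ?y "lb ?z ?x"] by simp
	thus ?thesis using Infty by (simp add: mb_Infty)
	qed
	qed
qed
sublocale ml: total_lie msc mb by (rule mb_lie)
definition hsc :: "complex => 'g multiloop \<times> complex => 'g multiloop \<times> complex" where
	"hsc = (%c (f, a). (msc c f, c * a))"
definition hbr :: "complex set => 'g multiloop \<times> complex => 'g multiloop \<times> complex => 'g multiloop \<times> complex" where
	"hbr S = (%(f, a) (h, b). (mb f h, cocycle D S f h))"
lemma hsc_simp [simp]: "hsc c (f, a) = (msc c f, c * a)" by (simp add: hsc_def)
lemma hbr_simp [simp]: "hbr S (f, a) (h, b) = (mb f h, cocycle D S f h)" by (simp add: hbr_def)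
lemma cocycle_add: "cocycle D S (f + f') h = cocycle D S f h + cocycle D S f' h"
	"cocycle D S f (h + h') = cocycle D S f h + cocycle D S f h'"
	and cocycle_scale: "cocycle D S f (msc c h) = c * cocycle D S f h" "cocycle D S (msc c f) h = c * cocycle D S f h"
	and cocycle_anti: "cocycle D S f h = - cocycle D S h f"
proof -
	show "cocycle D S f h = - cocycle D S h f"
	unfolding cocycle_eq using rp_anti[of "f _" "h _"] by (simp add: sum_negf algebra_simps)
qed (simp_all add: cocycle_eq rp_add rp_scale sum.distrib add_divide_distrib sum_distrib_left algebra_simps)
lemma cocycle_jacobi: "cocycle D S f (mb h k) = cocycle D S (mb f h) k + cocycle D S h (mb f k)"
proof -
	have "rp (f Infty) (lb (k Infty) (h Infty)) = rp (lb (h Infty) (f Infty)) (k Infty) + rp (h Infty) (lb (k Infty) (f Infty))"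
	proof -
	have 1: "rp (h Infty) (lb (k Infty) (f Infty)) = rp (lb (h Infty) (k Infty)) (f Infty) + rp (k Infty) (lb (h Infty) (f Infty))"
	by (rule rp_cocycle)
	have 2: "rp (lb (h Infty) (k Infty)) (f Infty) = rp (f Infty) (lb (k Infty) (h Infty))"
	using rp_anti[of "lb (h Infty) (k Infty)" "f Infty"] lb_anti[of "k Infty" "h Infty"] by (simp add: rp_minus)
	have 3: "rp (k Infty) (lb (h Infty) (f Infty)) = - rp (lb (h Infty) (f Infty)) (k Infty)" by (rule rp_anti)
	show ?thesis unfolding 1 2 3 by simp
	qed
	moreover have "(SUM x:S. rp (f (At x)) (lb (h (At x)) (k (At x)))) =
	(SUM x:S. rp (lb (f (At x)) (h (At x))) (k (At x))) + (SUM x:S. rp (h (At x)) (lb (f (At x)) (k (At x))))"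
	unfolding sum.distrib[symmetric] by (intro sum.cong refl rp_cocycle)
	ultimately show ?thesis
	unfolding cocycle_eq mb_At mb_Infty rp_cocycle[of "f (At 0)" "h (At 0)" "k (At 0)"]
	by (simp add: add_divide_distrib)
qed
lemma hv: "vector_space hsc"
	by unfold_locales (auto simp: mv.scale_right_distrib mv.scale_left_distrib distrib_left distrib_right)
lemma h_lie: "total_lie hsc (hbr S)"
proof (rule total_lie.intro[OF hv])
	show "vlin hsc hsc (hbr S x)" for x
	unfolding Vector_Spaces.linear_iff
	by (cases x) (auto simp: hv ml.br_add ml.br_scale cocycle_add cocycle_scale)
	show "hbr S x y = - hbr S y x" for x y
	proof -
	obtain f a h b where e: "x = (f, a)" "y = (h, b)" by (cases x; cases y) blast
	show ?thesis unfolding e hbr_simp uminus_prod_def fst_conv snd_conv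
	using ml.br_anti[of f h] cocycle_anti[of S f h] by metis
	qed
	show "hbr S x (hbr S y z) = hbr S (hbr S x y) z + hbr S y (hbr S x z)" for x y z
	proof -
	obtain f a h b k c where e: "x = (f, a)" "y = (h, b)" "z = (k, c)" by (cases x; cases y; cases z) blast
	show ?thesis unfolding e using ml.jacobi[of f h k] cocycle_jacobi[of S f h k] by simp
	qed
qed
definition asc :: "complex => 'g fls \<times> complex => 'g fls \<times> complex" where
	"asc = (%c (f, a). (lsc c f, c * a))"
definition abr :: "'g fls \<times> complex => 'g fls \<times> complex => 'g fls \<times> complex" where
	"abr = (%(f, a) (h, b). (lb f h, rp f h))"
lemma asc_simp [simp]: "asc c (f, a) = (lsc c f, c * a)" by (simp add: asc_def)
lemma abr_simp [simp]: "abr (f, a) (h, b) = (lb f h, rp f h)" by (simp add: abr_def)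
lemma affine_alg_simps [simp]:
	"lcarrier (affine_alg D) = UNIV" "lscale (affine_alg D) = asc" "lbracket (affine_alg D) = abr"
	by (auto simp: affine_alg_def asc_def abr_def rp_def fun_eq_iff)
lemma av: "vector_space asc"
	by unfold_locales (auto simp: lv.scale_right_distrib lv.scale_left_distrib distrib_left distrib_right)
lemma a_lie: "total_lie asc abr"
proof (rule total_lie.intro[OF av])
	show "vlin asc asc (abr x)" for x
	unfolding Vector_Spaces.linear_iff
	by (cases x) (auto simp: av lb_add lb_scale rp_add rp_scale)
	show "abr x y = - abr y x" for x y
	proof -
	obtain f a h b where e: "x = (f, a)" "y = (h, b)" by (cases x; cases y) blast
	show ?thesis unfolding e abr_simp uminus_prod_def fst_conv snd_conv
	using lb_anti[of f h] rp_anti[of f h] by metis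
	qed
	show "abr x (abr y z) = abr (abr x y) z + abr y (abr x z)" for x y z
	proof -
	obtain f a h b k c where e: "x = (f, a)" "y = (h, b)" "z = (k, c)" by (cases x; cases y; cases z) blast
	show ?thesis unfolding e using lb_jacobi[of f h k] rp_cocycle[of f h k] by simp
	qed
qed
sublocale al: total_lie asc abr by (rule a_lie)
lemma lie_space_affine: "lie_space (affine_alg D)"
	by unfold_locales (auto simp: al.vls.scale_right_distrib al.vls.scale_left_distrib)
text \<open>Vanishing of the coefficients of a bracket.\<close>
lemma lb_order:
	assumes "!!i. i < a ==> fls_nth f i = 0" "!!i. i < b ==> fls_nth h i = 0" "n < a + b"
	shows "fls_nth (lb f h) n = 0"
	unfolding lb_conv by (subst gbb.conv_nth[OF assms(1,2)]) (use assms(3) in auto)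
lemma rp_order:
	assumes "!!i. i < a ==> fls_nth f i = 0" "!!i. i < b ==> fls_nth h i = 0" "0 < a + b"
	shows "rp f h = 0"
proof -
	have "fls_nth (ld h) i = 0" if "i < b - 1" for i using assms(2)[of "i + 1"] that by simp
	thus ?thesis unfolding rp_def lf_conv fls_residue_def
	by (subst gfb.conv_nth[OF assms(1)]) (use assms(3) in auto)
qed
definition equivariant :: "complex => 'g fls => bool" where
	"equivariant c f \<longleftrightarrow> (ALL n. gs (c powi n) (fls_nth f n) = sig (fls_nth f n))"
lemma equivariant_add: "equivariant c f ==> equivariant c h ==> equivariant c (f + h)"
	and equivariant_zero [simp]: "equivariant c 0"
	by (auto simp: equivariant_def g.scale_right_distrib sg.add)
lemma equivariant_scale: assumes "equivariant c f" shows "equivariant c (lsc a f)"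
	unfolding equivariant_def
proof
	fix n
	have "gs (c powi n) (gs a (fls_nth f n)) = gs a (gs (c powi n) (fls_nth f n))" by (rule g.scale_left_commute)
	thus "gs (c powi n) (fls_nth (lsc a f) n) = sig (fls_nth (lsc a f) n)"
	using assms unfolding equivariant_def lsc_nth sg.scale by metis
qed
lemma equivariant_lb: assumes "equivariant c f" "equivariant c h" "c ~= 0" shows "equivariant c (lb f h)"
	unfolding equivariant_def
proof
	fix n
	have e: "fls_nth (lb f h) n = (SUM i:{fls_subdegree f..n - fls_subdegree h}. gb (fls_nth f i) (fls_nth h (n - i)))"
	unfolding lb_conv by (rule gbb.conv_nth) auto
	have p: "c powi n = c powi i * c powi (n - i)" for i
	using assms(3) by (simp flip: power_int_add)
	have "sig (gb (fls_nth f i) (fls_nth h (n - i))) = gs (c powi n) (gb (fls_nth f i) (fls_nth h (n - i)))" for i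
	proof -
	have "sig (fls_nth f i) = gs (c powi i) (fls_nth f i)" "sig (fls_nth h (n - i)) = gs (c powi (n - i)) (fls_nth h (n - i))"
	using assms by (auto simp: equivariant_def)
	thus ?thesis by (simp add: sigma_br gb.scale gb'.scale p[of i] mult.commute)
	qed
	thus "gs (c powi n) (fls_nth (lb f h) n) = sig (fls_nth (lb f h) n)"
	unfolding e by (simp add: sg.sum g.scale_sum_right)
qed
lemma omega_nonzero: "om ~= 0"
	using prim period by (auto simp: primitive_root_of_unity_def power_0_left split: if_splits)
lemma multiloop_space_eq:
	"multiloop_space D S = {f. equivariant (inverse om) (f Infty) & equivariant om (f (At 0)) &
	(ALL x. x ~: S & x ~= 0 --> f (At x) = 0)}"
	by (simp add: multiloop_space_def equivariant_def power_int_minus power_int_inverse)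
lemma multiloop_subspace: "mv.subspace (multiloop_space D S)"
	unfolding mv.subspace_def multiloop_space_eq
	by (auto simp: equivariant_add equivariant_scale)
lemma multiloop_bracket_closed:
	"f : multiloop_space D S ==> h : multiloop_space D S ==> mb f h : multiloop_space D S"
	unfolding multiloop_space_eq by (auto simp: mb_Infty equivariant_lb omega_nonzero)
lemma nonneg_subspace: "mv.subspace (nonneg_multiloops D S)"
	using multiloop_subspace[of S] unfolding mv.subspace_def nonneg_multiloops_def by auto
lemma nonneg_bracket_closed:
	assumes "f : nonneg_multiloops D S" "h : nonneg_multiloops D S"
	shows "mb f h : nonneg_multiloops D S"
proof -
	have "fls_nth (mb f h Infty) n = 0" if "n < 1" for n
	unfolding mb_Infty by (rule lb_order[of 1 _ 1]) (use assms that in "auto simp: nonneg_multiloops_def")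
	moreover have "fls_nth (mb f h (At x)) n = 0" if "n < 0" for n x
	unfolding mb_At by (rule lb_order[of 0 _ 0]) (use assms that in "auto simp: nonneg_multiloops_def")
	ultimately show ?thesis
	using assms multiloop_bracket_closed by (auto simp: nonneg_multiloops_def)
qed
lemma p_alg_simps [simp]:
	"lcarrier (p_alg D) = nonneg_multiloops D (marked D)" "lscale (p_alg D) = msc" "lbracket (p_alg D) = mb"
	by (auto simp: p_alg_def)
lemma lie_space_p: "lie_space (p_alg D)"
proof (rule lie_space.intro)
	show "vector_space (lscale (p_alg D))" by (simp add: mv.vector_space_axioms)
	show "module.subspace (lscale (p_alg D)) (lcarrier (p_alg D))" by (simp add: nonneg_subspace)
qed (simp add: nonneg_bracket_closed)
lemma negative_alg_simps [simp]:
	"lcarrier (negative_alg D) = {f. ALL n>=0. fls_nth f n = 0}" "lscale (negative_alg D) = lsc" "lbracket (negative_alg D) = lb"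
	by (auto simp: negative_alg_def)
lemma neg_lb:
	assumes "ALL n>=0. fls_nth f n = 0" "ALL n>=0. fls_nth h n = 0"
	shows "ALL n>=0. fls_nth (lb f h) n = 0" "rp f h = 0"
proof -
	have "gb (fls_nth f i) (fls_nth h (n - i)) = 0" if "n >= 0" for i n
	using assms that by (cases "i >= 0") auto
	thus "ALL n>=0. fls_nth (lb f h) n = 0"
	using gbb.conv_nth[of "fls_subdegree f" f "fls_subdegree h" h, OF fls_eq0_below_subdegree fls_eq0_below_subdegree] by (simp add: lb_conv)
	have "gf (fls_nth f i) (fls_nth (ld h) (- 1 - i)) = 0" for i
	using assms by (cases "i >= 0") (auto simp: gf_scale)
	thus "rp f h = 0"
	using gfb.conv_nth[of "fls_subdegree f" f "fls_subdegree (ld h)" "ld h" "-1", OF fls_eq0_below_subdegree fls_eq0_below_subdegree]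
	by (simp add: lf_conv rp_def fls_residue_def del: ld_nth)
qed
lemma lie_space_neg: "lie_space (negative_alg D)"
proof (rule lie_space.intro)
	show "vector_space (lscale (negative_alg D))" by (simp add: lv.vector_space_axioms)
	show "module.subspace (lscale (negative_alg D)) (lcarrier (negative_alg D))" by (auto simp: lv.subspace_def)
qed (use neg_lb in simp)
end
section \<open>Equivariant rational functions\<close>
subsection \<open>Rescaling the variable\<close>
definition fls_rescale :: "complex => complex fls => complex fls" where
	"fls_rescale c F = Abs_fls (%n. c powi n * fls_nth F n)"
lemma fls_rescale_nth [simp]: "fls_nth (fls_rescale c F) n = c powi n * fls_nth F n"
	unfolding fls_rescale_def by (subst nth_Abs_fls_lower_bound[of "fls_subdegree F"]) auto
lemma fls_rescale_add: "fls_rescale c (F + G) = fls_rescale c F + fls_rescale c G"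
	by (rule fls_eqI) (simp add: algebra_simps)
lemma fls_rescale_zero [simp]: "fls_rescale c 0 = 0"
	by (rule fls_eqI) simp
lemma fls_rescale_const [simp]: "fls_rescale c (fls_const a) = fls_const a"
	by (rule fls_eqI) simp
lemma fls_rescale_mult:
	assumes "c ~= 0" shows "fls_rescale c (F * G) = fls_rescale c F * fls_rescale c G"
proof (rule fls_eqI)
	fix n
	have 1: "fls_nth (F * G) n = (SUM i:{fls_subdegree F..n - fls_subdegree G}. fls_nth F i * fls_nth G (n - i))"
	by (rule fls_times_nth(2))
	have 2: "fls_nth (fls_rescale c F * fls_rescale c G) n =
	(SUM i:{fls_subdegree F..n - fls_subdegree G}. fls_nth (fls_rescale c F) i * fls_nth (fls_rescale c G) (n - i))"
	unfolding conv_times[symmetric] by (rule times_biadditive.conv_nth) auto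
	have "c powi n = c powi i * c powi (n - i)" for i
	using assms by (simp flip: power_int_add)
	thus "fls_nth (fls_rescale c (F * G)) n = fls_nth (fls_rescale c F * fls_rescale c G) n"
	unfolding fls_rescale_nth[of c "F * G"] 1 2 by (simp add: sum_distrib_left mult_ac)
qed
definition rotate_place :: "complex => place => place" where
	"rotate_place c x = (case x of At z => At (c * z) | Infty => Infty)"
definition rotate_factor :: "complex => place => complex" where
	"rotate_factor c x = (case x of At z => c | Infty => inverse c)"
lemma se_rescale:
	assumes S: "finite S" "srat S r" "c ~= 0" "finite S'" "!!t. t ~: S' ==> c * t ~: S"
	shows "sexp (%t. r (c * t)) x = fls_rescale (rotate_factor c x) (sexp r (rotate_place c x))"
proof -
	let ?c = "rotate_factor c x" and ?x = "rotate_place c x"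
	have c0: "?c ~= 0" using S(3) by (cases x) (auto simp: rotate_factor_def)
	have id: "sexp (%t. c * t) x = fls_rescale ?c (sexp (%t. t) ?x)"
	by (subst se_scale[of "{}"]; cases x)
	(auto intro!: fls_eqI simp: se_id rotate_place_def rotate_factor_def assms power_int_minus)
	have comp: "srat S' (%t. f (c * t))" if "srat S f" for f
	proof -
	obtain p q where pq: "!!t. t ~: S ==> poly q t ~= 0 & f t = poly p t / poly q t"
	using \<open>srat S f\<close> unfolding scalar_rational_def by metis
	hence "ALL t. t ~: S' --> poly (pcompose q [:0, c:]) t ~= 0 & f (c * t) = poly (pcompose p [:0, c:]) t / poly (pcompose q [:0, c:]) t"
	using S(5) pq by (simp add: poly_pcompose mult.commute)
	thus ?thesis unfolding scalar_rational_def by blast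
	qed
	have poly: "sexp (%t. poly p (c * t)) x = fls_rescale ?c (sexp (poly p) ?x)" for p
	proof (induction p)
	case 0
	have z: "poly 0 = (%t::complex. 0)" by (simp add: fun_eq_iff)
	show ?case unfolding z by simp
	next
	case (pCons a p)
	have e: "poly (pCons a p) = (%t. a + t * poly p t)" by (simp add: fun_eq_iff)
	have p: "srat {} (poly p)" "srat {} (%t. poly p (c * t))" "srat {} (%t. c * t)"
	using sr_poly[of "{}" p] sr_compose_mult[of "{}" "poly p" c] by (auto intro: sr_mult)
	have "sexp (%t. a + (c * t) * poly p (c * t)) x =
	fls_const a + sexp (%t. c * t) x * sexp (%t. poly p (c * t)) x"
	by (subst se_add[of "{}"]) (auto simp: p intro!: sr_mult se_mult[of "{}"] simp del: mult_cancel_left)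
	moreover have "sexp (%t. a + t * poly p t) ?x = fls_const a + sexp (%t. t) ?x * sexp (poly p) ?x"
	by (subst se_add[of "{}"]) (auto simp: p intro!: sr_mult se_mult[of "{}"])
	ultimately show ?case unfolding e by (simp add: pCons id fls_rescale_add fls_rescale_mult[OF c0])
	qed
	obtain p q where pq: "!!t. t ~: S ==> poly q t ~= 0 & r t = poly p t / poly q t"
	using S(2) unfolding scalar_rational_def by blast
	have q': "srat S (%t. inverse (poly q t))"
	unfolding scalar_rational_def by (rule exI[of _ 1], rule exI[of _ q]) (use pq in "auto simp: field_simps")
	have A: "sexp r ?x * sexp (poly q) ?x = sexp (poly p) ?x"
	by (subst se_mult[OF S(1,2) sr_poly, symmetric], rule se_cong[OF S(1) sr_mult[OF S(2) sr_poly]]) (use pq in auto)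
	have B: "sexp (%t. r (c * t)) x * sexp (%t. poly q (c * t)) x = sexp (%t. poly p (c * t)) x"
	by (subst se_mult[OF S(4) comp[OF S(2)] comp[OF sr_poly], symmetric],
	rule se_cong[OF S(4) sr_mult[OF comp[OF S(2)] comp[OF sr_poly]]]) (use pq S(5) in auto)
	have C: "sexp (%t. poly q (c * t)) x * sexp (%t. inverse (poly q (c * t))) x = sexp (%t. 1) x"
	by (subst se_mult[OF S(4) comp[OF sr_poly] comp[OF q'], symmetric],
	rule se_cong[OF S(4) sr_mult[OF comp[OF sr_poly] comp[OF q']]]) (use pq S(5) in auto)
	hence nz: "sexp (%t. poly q (c * t)) x ~= 0" by auto
	have "sexp (%t. r (c * t)) x * sexp (%t. poly q (c * t)) x =
	fls_rescale ?c (sexp r ?x) * sexp (%t. poly q (c * t)) x"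
	by (simp only: B) (simp only: poly A[symmetric] fls_rescale_mult[OF c0])
	thus ?thesis by (rule mult_right_cancel[OF nz, THEN iffD1])
qed
subsection \<open>The functions with poles at a finite set of orbits\<close>
locale gaudin_points = gaudin_data D for D :: "('g::ab_group_add) cyclotomic_data" +
	fixes E :: "complex set"
	assumes finE: "finite E" and E0: "0 ~: E" and E_marked: "E \<inter> marked D = {}"
	and E_orbits: "!!z w. z : E \<union> marked D ==> w : E \<union> marked D ==> z ~= w ==>
	Gamma_orbit D z \<inter> Gamma_orbit D w = {}"
begin
definition SE :: "complex set" where "SE = E \<union> marked D"
definition PS :: "complex set" where "PS = {0} \<union> (\<Union>z\<in>SE. Gamma_orbit D z)"
lemma omega_period: "om ^ T = 1" using prim by (simp add: primitive_root_of_unity_def)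
lemma Gamma_orbit_eq: "Gamma_orbit D z = (%k. om ^ k * z) ` {..<T}"
proof -
	have 1: "om ^ j = om ^ (j mod T)" for j
	by (metis div_mult_mod_eq mult.commute mult_1 omega_period power_add power_mult power_one)
	have 2: "j mod T < T" for j using period by simp
	have "om ^ j * z : (%k. om ^ k * z) ` {..<T}" for j
	using 1[of j] 2[of j] by (intro image_eqI[of _ _ "j mod T"]) simp_all
	thus ?thesis unfolding Gamma_orbit_def by auto
qed
lemma finSE: "finite SE" using finE fin_marked by (simp add: SE_def)
lemma SE0: "0 ~: SE" using E0 zero_marked by (simp add: SE_def)
lemma finPS: "finite PS" unfolding PS_def Gamma_orbit_eq using finSE by auto
lemma orbit_self: "z : Gamma_orbit D z"
	unfolding Gamma_orbit_def by (auto intro: exI[of _ 0])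
lemma SE_PS: "SE <= PS" "0 : PS" using orbit_self by (auto simp: PS_def)
lemma PS_rotate: "t : PS ==> om * t : PS" "om * t : PS ==> t : PS"
proof -
	show 1: "om * t : PS" if "t : PS" for t
	using that unfolding PS_def Gamma_orbit_def
	by (auto simp: mult.assoc[symmetric] intro: exI[of _ "Suc _"]) (metis power_Suc mult.assoc)
	have "om ^ k * t : PS" if "t : PS" for k t
	using that 1 by (induction k) (auto simp: mult.assoc)
	from this[of "om * t" "T - 1"] show "om * t : PS ==> t : PS"
	using period omega_period by (simp add: mult.assoc[symmetric] flip: power_Suc2)
qed
lemma PS_rotate_iff: "om * t : PS \<longleftrightarrow> t : PS" using PS_rotate by blast
lemma orbit_inj: assumes "z ~= 0" shows "inj_on (%k. om ^ k * z) {..<T}"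
proof -
	have "i = j" if "i <= j" "j < T" "om ^ i = om ^ j" for i j
	proof -
	have "om ^ i * om ^ (j - i) = om ^ (i + (j - i))" by (simp only: power_add)
	also have "\<dots> = om ^ i * 1" using that by simp
	finally have "om ^ (j - i) = 1" using omega_nonzero by simp
	thus ?thesis using prim that by (auto simp: primitive_root_of_unity_def) (metis diff_is_0_eq le_antisym less_imp_diff_less zero_less_diff not_le)
	qed
	thus ?thesis using assms by (intro inj_onI) (metis lessThan_iff linear mult_cancel_right)
qed
text \<open>Sums over the poles, of a function that is constant on orbits.\<close>
lemma sum_PS:
	fixes \<phi> :: "complex => complex"
	assumes "!!x. x ~= 0 ==> \<phi> (om * x) = \<phi> x"
	shows "(SUM x:PS. \<phi> x) = \<phi> 0 + of_nat T * (SUM x:SE. \<phi> x)"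
proof -
	have orb: "(SUM y:Gamma_orbit D x. \<phi> y) = of_nat T * \<phi> x" if "x : SE" for x
	proof -
	have x: "x ~= 0" using that SE0 by auto
	have "\<phi> (om ^ k * x) = \<phi> x" for k
	proof (induction k)
	case (Suc k)
	have "\<phi> (om * (om ^ k * x)) = \<phi> (om ^ k * x)" by (rule assms) (use x omega_nonzero in auto)
	thus ?case using Suc by (simp add: mult.assoc)
	qed simp
	thus ?thesis unfolding Gamma_orbit_eq by (subst sum.reindex[OF orbit_inj[OF x]]) simp
	qed
	have "(SUM x:PS. \<phi> x) = \<phi> 0 + (SUM x:(\<Union>z\<in>SE. Gamma_orbit D z). \<phi> x)"
	unfolding PS_def using finSE SE0 omega_nonzero
	by (subst sum.union_disjoint) (auto simp: Gamma_orbit_eq)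
	also have "(SUM x:(\<Union>z\<in>SE. Gamma_orbit D z). \<phi> x) = (SUM z:SE. SUM x:Gamma_orbit D z. \<phi> x)"
	by (rule sum.UNION_disjoint) (use finSE E_orbits in \<open>auto simp: Gamma_orbit_eq[of "_"] SE_def\<close>)
	also have "\<dots> = of_nat T * (SUM x:SE. \<phi> x)" by (simp add: orb sum_distrib_left)
	finally show ?thesis .
qed
lemma cspace_g: "cspace (g_space D)"
	by (rule cspaceI, rule abelian_groupI)
	(auto simp: g_space_def add_ac g.scale_right_distrib g.scale_left_distrib intro: exI[of _ "- _"])
lemma g_space_simps [simp]: "carrier (g_space D) = UNIV" "add (g_space D) = (+)" "\<zero>\<^bsub>g_space D\<^esub> = 0" "smult (g_space D) = gs"
	by (simp_all add: g_space_def)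
lemma g_finsum: "(\<Oplus>\<^bsub>g_space D\<^esub> j\<in>J. h j) = (SUM j:J. h j)"
proof -
	interpret V: cspace "g_space D" by (rule cspace_g)
	show ?thesis
	by (induction J rule: infinite_finite_induct) (auto simp: V.finsum_infinite V.finsum_insert)
qed
definition crd :: "(complex => 'g) => 'g => complex => complex" where
	"crd f b = (%t. fs.co (f t) b)"
definition ratg :: "(complex => 'g) => bool" where
	"ratg f \<longleftrightarrow> (ALL b:basis. srat PS (crd f b))"
definition GE :: "(complex => 'g) => place => 'g fls" where
	"GE f x = (SUM b:basis. ten (sexp (crd f b) x) b)"
lemma rational_repr_crd:
	assumes "rational_repr (g_space D) PS f l r a"
	shows "t ~: PS ==> crd f b t = (\<Sum>j<l. fs.co (a j) b * r j t)" "srat PS (crd f b)"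
proof -
	show 1: "crd f b t = (\<Sum>j<l. fs.co (a j) b * r j t)" if "t ~: PS" for t
	using assms that by (simp add: rational_repr_def g_finsum crd_def fs.co_sum fs.co_scale mult.commute)
	have "srat PS (%t. \<Sum>j<l. fs.co (a j) b * r j t)"
	using assms by (intro sr_sum sr_mult) (auto simp: rational_repr_def)
	thus "srat PS (crd f b)" by (rule sr_cong) (simp add: 1)
qed
lemma ratg_iff: "rational_function (g_space D) PS f \<longleftrightarrow> ratg f"
proof
	assume "rational_function (g_space D) PS f"
	thus "ratg f" unfolding rational_function_def ratg_def using rational_repr_crd(2) by blast
next
	assume f: "ratg f"
	obtain e where e: "bij_betw e {..<card basis} basis"
	using ex_bij_betw_nat_finite[OF fs.finB] by (auto simp: atLeast0LessThan)
	have "rational_repr (g_space D) PS f (card basis) (%j. crd f (e j)) e"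
	unfolding rational_repr_def g_finsum
	proof (intro conjI allI impI)
	show "srat PS (crd f (e j))" if "j < card basis" for j
	using f e that by (auto simp: ratg_def bij_betw_def)
	fix t
	show "f t = (\<Sum>j<card basis. crd f (e j) t \<odot>\<^bsub>g_space D\<^esub> e j)"
	using sum.reindex_bij_betw[OF e, of "%b. gs (crd f b t) b"] fs.expand[of "f t"] by (simp add: crd_def)
	qed simp
	thus "rational_function (g_space D) PS f" by (auto simp: rational_function_def)
qed
lemma g_expansion_eq:
	assumes "ratg f" shows "g_expansion D PS f x = GE f x"
proof -
	have "laurent_coeff (g_space D) PS f x n = fls_nth (GE f x) n" for n
	unfolding laurent_coeff_def
	proof (rule the_equality)
	have *: "c = fls_nth (GE f x) n" if "rational_repr (g_space D) PS f l r a"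
	"c = (\<Oplus>\<^bsub>g_space D\<^esub> j\<in>{..<l}. fls_nth (sexp (r j) x) n \<odot>\<^bsub>g_space D\<^esub> a j)" for c l r a
	proof (rule fs.co_eqI)
	fix b assume b: "b : basis"
	have r: "!!j. j < l ==> srat PS (r j)" using that(1) by (simp add: rational_repr_def)
	have "fs.co c b = (\<Sum>j<l. fls_nth (sexp (r j) x) n * fs.co (a j) b)"
	unfolding that(2) g_finsum by (simp add: fs.co_sum fs.co_scale)
	also have "\<dots> = fls_nth (\<Sum>j<l. fls_const (fs.co (a j) b) * sexp (r j) x) n"
	by (simp add: fls_nth_sum mult.commute)
	also have "(\<Sum>j<l. fls_const (fs.co (a j) b) * sexp (r j) x) = sexp (%t. \<Sum>j<l. fs.co (a j) b * r j t) x"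
	using r by (subst se_sum[OF finPS]) (auto intro!: sr_mult sum.cong simp: se_scale[OF finPS])
	also have "\<dots> = sexp (crd f b) x"
	by (rule se_cong[OF finPS]) (use r rational_repr_crd(1)[OF that(1)] in "auto intro!: sr_sum sr_mult")
	also have "fls_nth (sexp (crd f b) x) n = fs.co (fls_nth (GE f x) n) b"
	using b fs.finB by (simp add: GE_def fls_nth_sum fs.co_sum fs.co_scale fs.co_basis if_distrib[of "(*) _"] sum.delta cong: if_cong sum.cong)
	finally show "fs.co c b = fs.co (fls_nth (GE f x) n) b" .
	qed
	have "rational_function (g_space D) PS f" using assms ratg_iff by simp
	then obtain l r a where lra: "rational_repr (g_space D) PS f l r a" by (auto simp: rational_function_def)
	from *[OF lra refl] lra show "EX l r a. rational_repr (g_space D) PS f l r a &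
	fls_nth (GE f x) n = (\<Oplus>\<^bsub>g_space D\<^esub> j\<in>{..<l}. fls_nth (sexp (r j) x) n \<odot>\<^bsub>g_space D\<^esub> a j)" by metis
	show "c = fls_nth (GE f x) n" if "EX l r a. rational_repr (g_space D) PS f l r a &
	c = (\<Oplus>\<^bsub>g_space D\<^esub> j\<in>{..<l}. fls_nth (sexp (r j) x) n \<odot>\<^bsub>g_space D\<^esub> a j)" for c
	using that * by blast
	qed
	thus ?thesis unfolding g_expansion_def by (metis (no_types, lifting) ext fls_nth_inverse)
qed
lemma crd_add: "crd (%t. f t + h t) b = (%t. crd f b t + crd h b t)"
	and crd_scale: "crd (%t. gs (r t) (f t)) b = (%t. r t * crd f b t)"
	and crd_zero: "crd (%t. 0) b = (%t. 0)"
	and crd_const: "crd (%t. a) b = (%t. fs.co a b)"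
	by (auto simp: crd_def fs.co_add fs.co_scale)
lemma ratg_add: "ratg f ==> ratg h ==> ratg (%t. f t + h t)"
	and ratg_scale: "ratg f ==> srat PS r ==> ratg (%t. gs (r t) (f t))"
	and ratg_zero: "ratg (%t. 0)"
	and ratg_const: "ratg (%t. a)"
	by (auto simp: ratg_def crd_add crd_scale crd_zero crd_const intro!: sr_mult)
lemma ratg_sum: "(!!j. j : J ==> ratg (f j)) ==> ratg (%t. SUM j:J. f j t)"
	by (induction J rule: infinite_finite_induct) (auto intro: ratg_add ratg_zero)
lemma GE_cong: "ratg f ==> (!!t. t ~: PS ==> f t = h t) ==> GE f x = GE h x"
	unfolding GE_def ratg_def by (intro sum.cong refl arg_cong2[where f=ten] se_cong[OF finPS]) (auto simp: crd_def)
lemma GE_add: "ratg f ==> ratg h ==> GE (%t. f t + h t) x = GE f x + GE h x"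
	by (simp add: GE_def crd_add ratg_def se_add[OF finPS] ten_add sum.distrib)
lemma GE_zero: "GE (%t. 0) x = 0"
	by (simp add: GE_def crd_zero)
lemma GE_sum: "(!!j. j : J ==> ratg (f j)) ==> GE (%t. SUM j:J. f j t) x = (SUM j:J. GE (f j) x)"
	by (induction J rule: infinite_finite_induct) (auto simp: GE_zero GE_add ratg_sum)
lemma GE_tensor: assumes "srat PS r" shows "GE (%t. gs (r t) a) x = ten (sexp r x) a"
proof -
	have "GE (%t. gs (r t) a) x = (SUM b:basis. ten (fls_const (fs.co a b) * sexp r x) b)"
	unfolding GE_def crd_scale crd_const
	by (intro sum.cong refl) (simp add: se_mult[OF finPS assms sr_const] mult.commute)
	also have "\<dots> = (SUM b:basis. ten (sexp r x) (gs (fs.co a b) b))"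
	by (simp only: ten_scale)
	also have "\<dots> = ten (sexp r x) (SUM b:basis. gs (fs.co a b) b)"
	by (rule fls_eqI) (simp add: fls_nth_sum g.scale_sum_right)
	finally show ?thesis by (simp flip: fs.expand)
qed
lemma f_expand: "f t = (SUM b:basis. gs (crd f b t) b)"
	using fs.expand[of "f t"] by (simp add: crd_def)
lemma gb_expand: "gb (f t) (h t) = (SUM b:basis. SUM c:basis. gs (crd f b t * crd h c t) (gb b c))"
	by (subst f_expand[of f t], subst f_expand[of h t])
	(simp add: gb.sum gb'.sum gb.scale gb'.scale g.scale_sum_right, subst sum.swap, simp add: mult.commute)
lemma ratg_gb: assumes "ratg f" "ratg h" shows "ratg (%t. gb (f t) (h t))"
	unfolding gb_expand using assms by (intro ratg_sum ratg_scale ratg_const sr_mult) (auto simp: ratg_def)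
lemma lb_sum: "lb (SUM b:A. F b) h = (SUM b:A. lb (F b) h)" "lb h (SUM b:A. F b) = (SUM b:A. lb h (F b))"
	by (induction A rule: infinite_finite_induct) (auto simp: lb_add)
lemma GE_gb: assumes "ratg f" "ratg h" shows "GE (%t. gb (f t) (h t)) x = lb (GE f x) (GE h x)"
proof -
	have r: "b : basis ==> srat PS (crd f b)" "b : basis ==> srat PS (crd h b)" for b
	using assms by (auto simp: ratg_def)
	have "GE (%t. gb (f t) (h t)) x = (SUM b:basis. SUM c:basis. ten (sexp (crd f b) x * sexp (crd h c) x) (gb b c))"
	unfolding gb_expand
	by (subst GE_sum, intro ratg_sum ratg_scale ratg_const sr_mult r, assumption, assumption)
	(intro sum.cong refl, subst GE_sum, auto intro!: ratg_scale ratg_const sr_mult r sum.cong simp: GE_tensor[OF sr_mult[OF r]] se_mult[OF finPS r])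
	also have "\<dots> = lb (GE f x) (GE h x)"
	unfolding GE_def by (subst sum.swap) (simp add: lb_sum lb_ten)
	finally show ?thesis .
qed
definition equivariant_fun :: "(complex => 'g) => bool" where
	"equivariant_fun f \<longleftrightarrow> (ALL t. t ~: PS --> f (om * t) = sig (f t))"
lemma crd_rotate:
	assumes "equivariant_fun f" "t ~: PS"
	shows "crd f b (om * t) = (SUM d:basis. fs.co (sig d) b * crd f d t)"
	using assms fs.co_linear[OF sigma_linear, of "f t" b] by (simp add: equivariant_fun_def crd_def mult.commute)
lemma se_crd_rotate:
	assumes "ratg f" "equivariant_fun f" "b : basis"
	shows "fls_rescale (rotate_factor om x) (sexp (crd f b) (rotate_place om x)) =
	(SUM d:basis. fls_const (fs.co (sig d) b) * sexp (crd f d) x)"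
proof -
	have r: "d : basis ==> srat PS (crd f d)" for d using assms by (auto simp: ratg_def)
	have "fls_rescale (rotate_factor om x) (sexp (crd f b) (rotate_place om x)) = sexp (%t. crd f b (om * t)) x"
	by (rule se_rescale[OF finPS r[OF assms(3)] omega_nonzero finPS, symmetric]) (simp add: PS_rotate_iff)
	also have "\<dots> = sexp (%t. SUM d:basis. fs.co (sig d) b * crd f d t) x"
	by (rule se_cong[OF finPS sr_compose_mult[OF r[OF assms(3)]]]) (simp_all add: PS_rotate_iff crd_rotate[OF assms(2)])
	also have "\<dots> = (SUM d:basis. fls_const (fs.co (sig d) b) * sexp (crd f d) x)"
	using r by (subst se_sum[OF finPS]) (auto intro!: sr_mult sum.cong simp: se_scale[OF finPS])
	finally show ?thesis .
qed
lemma GE_equivariant: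
	assumes "ratg f" "equivariant_fun f"
	shows "equivariant om (GE f (At 0))" "equivariant (inverse om) (GE f Infty)"
proof -
	have "gs (rotate_factor om x powi n) (fls_nth (GE f x) n) = sig (fls_nth (GE f x) n)" if "rotate_place om x = x" for x n
	proof (rule fs.co_eqI)
	fix b assume b: "b : basis"
	have co: "fs.co (fls_nth (GE f x) n) d = fls_nth (sexp (crd f d) x) n" if "d : basis" for d
	using that fs.finB by (simp add: GE_def fls_nth_sum fs.co_sum fs.co_scale fs.co_basis if_distrib[of "(*) _"] sum.delta cong: if_cong sum.cong)
	show "fs.co (gs (rotate_factor om x powi n) (fls_nth (GE f x) n)) b = fs.co (sig (fls_nth (GE f x) n)) b"
	using arg_cong[OF se_crd_rotate[OF assms b, of x], of "%F. fls_nth F n"] that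
	by (simp add: fs.co_scale co[OF b] fs.co_linear[OF sigma_linear, of "fls_nth (GE f x) n"] co fls_nth_sum mult.commute)
	qed
	from this[of "At 0"] this[of Infty] show "equivariant om (GE f (At 0))" "equivariant (inverse om) (GE f Infty)"
	by (simp_all add: equivariant_def rotate_factor_def rotate_place_def)
qed
definition gemb :: "(complex => 'g) => 'g multiloop \<times> complex" where
	"gemb f = (%x. case x of Infty => - GE f Infty | At y => if y = 0 | y : SE then GE f (At y) else 0, 0)"
definition GG :: "('g multiloop \<times> complex) set" where
	"GG = {gemb f | f. ratg f & equivariant_fun f}"
lemma gemb_simps: "fst (gemb f) Infty = - GE f Infty"
	"fst (gemb f) (At y) = (if y = 0 | y : SE then GE f (At y) else 0)" "snd (gemb f) = 0"
	by (simp_all add: gemb_def)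
lemma GE_scale: "ratg f ==> GE (%t. gs c (f t)) x = lsc c (GE f x)"
	unfolding GE_def crd_scale ratg_def
	by (simp add: se_scale[OF finPS] ten_scale lv.scale_sum_right)
lemma multiloop_eqI: "(!!x. f x = h x) ==> a = b ==> (f, a) = (h, b)" by auto
sublocale hv: vector_space hsc by (rule hv)
lemma GG_subspace: "hv.subspace GG"
	unfolding hv.subspace_def
proof (intro conjI ballI allI)
	have "gemb (%t. 0) = 0" by (auto simp: gemb_def GE_zero zero_prod_def fun_eq_iff split: place.splits)
	thus "0 : GG" unfolding GG_def
	by (intro CollectI exI[of _ "%t. 0"]) (auto simp: ratg_zero equivariant_fun_def sg.zero)
	fix x assume "x : GG"
	then obtain f where f: "x = gemb f" "ratg f" "equivariant_fun f" by (auto simp: GG_def)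
	{ fix y assume "y : GG"
	then obtain h where h: "y = gemb h" "ratg h" "equivariant_fun h" by (auto simp: GG_def)
	have "x + y = gemb (%t. f t + h t)"
	unfolding f h gemb_def using f h by (auto simp: fun_eq_iff GE_add split: place.splits)
	thus "x + y : GG" unfolding GG_def
	using f h by (auto simp: ratg_add equivariant_fun_def sg.add intro!: exI[of _ "%t. f t + h t"]) }
	fix c
	have "hsc c x = gemb (%t. gs c (f t))"
	unfolding f gemb_def using f by (auto simp: fun_eq_iff GE_scale lv.scale_minus_right split: place.splits)
	thus "hsc c x : GG" unfolding GG_def
	using f by (auto simp: ratg_scale equivariant_fun_def sg.scale intro!: exI[of _ "%t. gs c (f t)"])
qed
definition LE :: "('g multiloop \<times> complex) set" where "LE = multiloop_space D SE \<times> UNIV"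
definition PE :: "('g multiloop \<times> complex) set" where "PE = nonneg_multiloops D SE \<times> UNIV"
lemma GG_LE: "GG <= LE"
proof
	fix x assume "x : GG"
	then obtain f where f: "x = gemb f" "ratg f" "equivariant_fun f" by (auto simp: GG_def)
	have "- GE f Infty = lsc (-1) (GE f Infty)" by (rule fls_eqI) simp
	hence "equivariant (inverse om) (- GE f Infty)"
	using equivariant_scale[OF GE_equivariant(2)[OF f(2,3)], of "-1"] by metis
	thus "x : LE" using GE_equivariant(1)[OF f(2,3)]
	unfolding LE_def multiloop_space_eq f(1) by (auto simp: gemb_def)
qed
text \<open>The residue theorem makes the functions an isotropic subalgebra.\<close>
lemma rp_sum: "rp (SUM b:A. F b) h = (SUM b:A. rp (F b) h)" "rp h (SUM b:A. F b) = (SUM b:A. rp h (F b))"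
	by (induction A rule: infinite_finite_induct) (auto simp: rp_add)
lemma cocycle_gemb:
	assumes f: "ratg f" "equivariant_fun f" and h: "ratg h" "equivariant_fun h"
	shows "cocycle D SE (fst (gemb f)) (fst (gemb h)) = 0"
proof -
	have rf: "b : basis ==> srat PS (crd f b)" and rh: "b : basis ==> srat PS (crd h b)" for b
	using f(1) h(1) by (auto simp: ratg_def)
	note rh' = sr_deriv[OF finPS rh]
	define H where "H t = (SUM b:basis. SUM c:basis. gf b c * (crd f b t * deriv (crd h c) t))" for t
	have H: "srat PS H" unfolding H_def by (intro sr_sum sr_mult sr_const rf rh')
	have seH: "sexp H x = (SUM b:basis. SUM c:basis. fls_const (gf b c) * (sexp (crd f b) x * sexp (deriv (crd h c)) x))" for x
	unfolding H_def
	by (subst se_sum[OF finPS], intro sr_sum sr_mult sr_const rf rh', assumption, assumption, intro sum.cong refl,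
	subst se_sum[OF finPS], intro sr_mult sr_const rf rh', assumption, assumption, intro sum.cong refl)
	(simp add: se_scale[OF finPS sr_mult[OF rf rh']] se_mult[OF finPS rf rh'])
	have resA: "rp (GE f (At x)) (GE h (At x)) = fls_residue (sexp H (At x))" for x
	unfolding seH GE_def
	by (simp add: rp_sum rp_ten fls_residue_def fls_nth_sum se_deriv_At[OF finPS rh]) (subst sum.swap, simp)
	have "rp (GE f Infty) (GE h Infty) = (SUM b:basis. SUM c:basis. gf b c * fls_residue (sexp (crd f b) Infty * fls_deriv (sexp (crd h c) Infty)))"
	unfolding GE_def by (simp add: rp_sum rp_ten) (subst sum.swap, simp)
	also have "\<dots> = fls_residue (- (fls_X_inv ^ 2 * sexp H Infty))"
	unfolding seH
	by (simp add: se_deriv_Infty[OF finPS rh] fls_residue_def fls_nth_sum sum_distrib_left sum_negf mult_ac)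
	also have "\<dots> = - fls_nth (sexp H Infty) 1"
	by (simp add: fls_residue_def fls_X_inv_power_times_conv_shift)
	finally have resI: "rp (GE f Infty) (GE h Infty) = - fls_nth (sexp H Infty) 1" .
	define h' where "h' t = (SUM c:basis. gs (deriv (crd h c) t) c)" for t
	have Hgf: "H t = gf (f t) (h' t)" for t
	proof -
	interpret l: Vector_Spaces.linear gs "(*)" "gf a" for a by (rule gf_linear)
	have l2: "gf (SUM b:A. F b) a = (SUM b:A. gf (F b) a)" for F A a
	by (simp add: gf_sym[of _ a] l.sum)
	show ?thesis unfolding H_def h'_def
	by (subst f_expand[of f t]) (simp add: l.sum l2 gf_scale mult_ac sum_distrib_left, subst sum.swap, simp)
	qed
	have op: "open (- PS)" using finPS by (simp add: finite_imp_closed open_Compl)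
	have h'rot: "gs om (h' (om * t)) = sig (h' t)" if t: "t ~: PS" for t
	proof (rule fs.co_eqI)
	fix b assume b: "b : basis"
	have d: "(crd h c has_field_derivative deriv (crd h c) s) (at s)" if "c : basis" "s ~: PS" for c s
	using sr_analytic(2)[OF finPS rh[OF that(1)] that(2)] analytic_on_imp_differentiable_at
	field_differentiable_derivI by blast
	have 1: "((%s. crd h b (om * s)) has_field_derivative deriv (crd h b) (om * t) * om) (at t)"
	by (rule DERIV_chain2[OF d[OF b]]) (use t PS_rotate_iff in "auto intro!: derivative_eq_intros")
	have 2: "((%s. SUM c:basis. fs.co (sig c) b * crd h c s) has_field_derivative (SUM c:basis. fs.co (sig c) b * deriv (crd h c) t)) (at t)"
	by (intro DERIV_sum DERIV_cmult d t)
	have "((%s. crd h b (om * s)) has_field_derivative (SUM c:basis. fs.co (sig c) b * deriv (crd h c) t)) (at t)"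
	by (rule has_field_derivative_transform_within_open[OF 2 op]) (use t crd_rotate[OF h(2)] in auto)
	from DERIV_unique[OF 1 this] have "om * deriv (crd h b) (om * t) = (SUM c:basis. deriv (crd h c) t * fs.co (sig c) b)"
	by (simp add: mult.commute)
	moreover have "fs.co (h' s) c = deriv (crd h c) s" if "c : basis" for s c
	using that fs.finB by (simp add: h'_def fs.co_sum fs.co_scale fs.co_basis if_distrib[of "(*) _"] sum.delta cong: if_cong sum.cong)
	ultimately show "fs.co (gs om (h' (om * t))) b = fs.co (sig (h' t)) b"
	using b by (simp add: fs.co_scale fs.co_linear[OF sigma_linear, of "h' t"])
	qed
	have Hrot: "H (om * t) = inverse om * H t" if t: "t ~: PS" for t
	proof -
	have "om * H (om * t) = gf (f (om * t)) (gs om (h' (om * t)))" by (simp add: Hgf gf_scale)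
	also have "\<dots> = gf (sig (f t)) (sig (h' t))" using h'rot[OF t] f(2) t by (simp add: equivariant_fun_def)
	also have "\<dots> = H t" by (simp add: form_sigma Hgf)
	finally show ?thesis using omega_nonzero by (simp add: field_simps)
	qed
	have "fls_residue (sexp H (At (om * x))) = fls_residue (sexp H (At x))" for x
	proof -
	have "fls_rescale om (sexp H (At (om * x))) = sexp (%t. H (om * t)) (At x)"
	using se_rescale[OF finPS H omega_nonzero finPS, of "At x"] PS_rotate_iff by (simp add: rotate_factor_def rotate_place_def)
	also have "\<dots> = sexp (%t. inverse om * H t) (At x)"
	by (rule se_cong[OF finPS sr_compose_mult[OF H]]) (simp_all add: PS_rotate_iff Hrot)
	also have "\<dots> = fls_const (inverse om) * sexp H (At x)" by (rule se_scale[OF finPS H])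
	finally have "inverse om * fls_nth (sexp H (At (om * x))) (-1) = inverse om * fls_nth (sexp H (At x)) (-1)"
	by (metis fls_rescale_nth fls_mult_const_nth(1) power_int_minus1_right)
	thus ?thesis using omega_nonzero by (simp add: fls_residue_def)
	qed
	hence "fls_nth (sexp H Infty) 1 = fls_residue (sexp H (At 0)) + of_nat T * (SUM x:SE. fls_residue (sexp H (At x)))"
	using sum_residues[OF finPS H] sum_PS[of "%x. fls_residue (sexp H (At x))"] by simp
	moreover have "(SUM x:SE. rp (fst (gemb f) (At x)) (fst (gemb h) (At x))) = (SUM x:SE. fls_residue (sexp H (At x)))"
	by (rule sum.cong) (auto simp: gemb_simps resA)
	moreover have "of_nat T ~= (0 :: complex)" using period by simp
	ultimately show ?thesis unfolding cocycle_eq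
	by (simp add: gemb_simps rp_minus resI resA) (simp add: field_simps)
qed
lemma GG_bracket: assumes "x : GG" "y : GG" shows "hbr SE x y : GG"
proof -
	obtain f where f: "x = gemb f" "ratg f" "equivariant_fun f" using assms by (auto simp: GG_def)
	obtain h where h: "y = gemb h" "ratg h" "equivariant_fun h" using assms by (auto simp: GG_def)
	have "hbr SE x y = (mb (fst (gemb f)) (fst (gemb h)), 0)"
	using cocycle_gemb[OF f(2,3) h(2,3)] unfolding f(1) h(1) hbr_def by (simp add: case_prod_beta)
	also have "\<dots> = gemb (%t. gb (f t) (h t))"
	unfolding gemb_def[of "%t. gb (f t) (h t)"]
	proof (rule multiloop_eqI)
	fix p show "mb (fst (gemb f)) (fst (gemb h)) p = (case p of Infty => - GE (%t. gb (f t) (h t)) Infty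
	| At y => if y = 0 | y : SE then GE (%t. gb (f t) (h t)) (At y) else 0)"
	proof (cases p)
	case (At y)
	thus ?thesis using f h by (simp add: gemb_simps GE_gb)
	next
	case Infty
	have "lb (- GE h Infty) (- GE f Infty) = - lb (GE f Infty) (GE h Infty)"
	using lb_scale(1)[of "-1" "GE h Infty" "- GE f Infty"] lb_scale(2)[of "GE h Infty" "-1" "GE f Infty"] lb_anti[of "GE h Infty" "GE f Infty"]
	by simp
	thus ?thesis using f h Infty by (simp add: gemb_simps GE_gb mb_Infty)
	qed
	qed simp
	finally show ?thesis unfolding GG_def
	using f h ratg_gb[OF f(2) h(2)] by (auto simp: equivariant_fun_def sigma_br intro!: exI[of _ "%t. gb (f t) (h t)"])
qed
lemma PE_LE: "PE <= LE" by (auto simp: PE_def LE_def nonneg_multiloops_def)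
lemma LE_subspace: "hv.subspace LE" and PE_subspace: "hv.subspace PE"
	using multiloop_subspace[of SE] nonneg_subspace[of SE]
	by (auto simp: hv.subspace_def mv.subspace_def LE_def PE_def zero_prod_def)
lemma LE_bracket: "x : LE ==> y : LE ==> hbr SE x y : LE"
	and PE_bracket: "x : PE ==> y : PE ==> hbr SE x y : PE"
	by (auto simp: LE_def PE_def hbr_def multiloop_bracket_closed nonneg_bracket_closed)
text \<open>An equivariant function without poles that vanishes at infinity is zero.\<close>
lemma co_GE: "b : basis ==> fs.co (fls_nth (GE f x) n) b = fls_nth (sexp (crd f b) x) n"
	using fs.finB by (simp add: GE_def fls_nth_sum fs.co_sum fs.co_scale fs.co_basis if_distrib[of "(*) _"] sum.delta cong: if_cong sum.cong)
lemma GG_PE_disjoint: assumes "x : GG" "x : PE" shows "x = 0"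
proof -
	obtain f where f: "x = gemb f" "ratg f" "equivariant_fun f" using assms by (auto simp: GG_def)
	have nn: "!!n. n < 1 ==> fls_nth (GE f Infty) n = 0"
	"!!z n. z = 0 | z : SE ==> n < 0 ==> fls_nth (GE f (At z)) n = 0"
	using assms(2) unfolding PE_def nonneg_multiloops_def f(1) gemb_def
	by (force dest: spec[of _ "At _"] simp: fun_eq_iff split: if_splits)+
	have r: "b : basis ==> srat PS (crd f b)" for b using f by (auto simp: ratg_def)
	have orb: "fls_nth (sexp (crd f b) (At (om ^ k * z))) n = 0"
	if "z = 0 | z : SE" "n < 0" "b : basis" for z n b k
	using that(3)
	proof (induction k arbitrary: b)
	case 0
	thus ?case using nn(2)[OF that(1,2)] co_GE[of b f "At z" n] by simp
	next
	case (Suc k)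
	have "om powi n * fls_nth (sexp (crd f b) (At (om * (om ^ k * z)))) n = 0"
	using arg_cong[OF se_crd_rotate[OF f(2,3) Suc.prems, of "At (om ^ k * z)"], of "%F. fls_nth F n"] Suc.IH
	by (simp add: rotate_factor_def rotate_place_def fls_nth_sum)
	thus ?case using omega_nonzero by (simp add: mult.assoc)
	qed
	have "crd f b t = 0" if "b : basis" "t ~: PS" for b t
	proof (rule no_poles_imp_zero[OF finPS r[OF that(1)] _ _ that(2)])
	show "fls_nth (sexp (crd f b) (At x)) n = 0" if "x : PS" "n < 0" for x n
	using that orb[of 0 n b 0] orb[OF _ _ \<open>b : basis\<close>] \<open>b : basis\<close> unfolding PS_def Gamma_orbit_def by auto
	show "fls_nth (sexp (crd f b) Infty) n = 0" if "n <= 0" for n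
	using nn(1)[of n] that co_GE[OF \<open>b : basis\<close>, of f Infty n] by simp
	qed
	hence "f t = 0" if "t ~: PS" for t using f_expand[of f t] that by simp
	hence "GE f y = 0" for y using GE_cong[OF f(2), of "%t. 0"] by (simp add: GE_zero)
	thus ?thesis unfolding f(1) by (auto simp: gemb_def zero_prod_def fun_eq_iff split: place.splits)
qed
text \<open>The equivariant function with prescribed polar part at the orbit of \<open>z\<close>.\<close>
definition gpt :: "complex => nat => 'g => complex => 'g" where
	"gpt z n a t = (\<Sum>k<T. gs (om ^ (k * n) * inverse (t - om ^ k * z) ^ n) ((sig ^^ k) a))"
lemma sr_pole: "z : SE ==> srat PS (%t. inverse (t - om ^ k * z))"
	by (rule sr_inverse) (auto simp: PS_def Gamma_orbit_def)
lemma gpt_ratg: assumes "z : SE" shows "ratg (gpt z n a)"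
	unfolding gpt_def[abs_def] using assms
	by (intro ratg_sum ratg_scale ratg_const sr_mult sr_const sr_power sr_pole)
lemma gpt_equivariant: "equivariant_fun (gpt z n a)"
	unfolding equivariant_fun_def
proof (intro allI impI)
	fix t
	define h where "h k = gs (om ^ (k * n) * inverse (om * t - om ^ k * z) ^ n) ((sig ^^ k) a)" for k
	have per: "h T = h 0" using omega_period sigma_period by (simp add: h_def power_mult)
	obtain T' where T': "T = Suc T'" using period by (metis Suc_le_D One_nat_def)
	have "sig (gs (om ^ (k * n) * inverse (t - om ^ k * z) ^ n) ((sig ^^ k) a)) = h (Suc k)" for k
	proof -
	have "om * t - om * om ^ k * z = om * (t - om ^ k * z)" by (simp add: algebra_simps)
	hence "om ^ (Suc k * n) * inverse (om * t - om * om ^ k * z) ^ n = om ^ (k * n) * inverse (t - om ^ k * z) ^ n"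
	using omega_nonzero by (simp add: power_add power_mult_distrib flip: power_mult_distrib[of om "inverse om"])
	thus ?thesis by (simp add: h_def sg.scale)
	qed
	hence "sig (gpt z n a t) = (\<Sum>k<T. h (Suc k))" unfolding gpt_def sg.sum by simp
	also have "\<dots> = (\<Sum>k<T. h k)"
	using per unfolding T' sum.lessThan_Suc_shift[of h] sum.lessThan_Suc[of "%k. h (Suc k)"] by (simp add: add.commute)
	finally show "gpt z n a (om * t) = sig (gpt z n a t)" by (simp add: gpt_def h_def)
qed
lemma GE_gpt: assumes "z : SE"
	shows "GE (gpt z n a) x = (\<Sum>k<T. ten (fls_const (om ^ (k * n)) * sexp (%t. inverse (t - om ^ k * z) ^ n) x) ((sig ^^ k) a))"
	unfolding gpt_def[abs_def] using assms
	by (subst GE_sum, intro ratg_scale ratg_const sr_mult sr_const sr_power sr_pole, assumption)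
	(intro sum.cong refl, subst GE_tensor, auto intro!: sr_mult sr_power sr_pole
	simp: se_scale[OF finPS sr_power[OF sr_pole]])
lemma gemb_GG: "ratg f ==> equivariant_fun f ==> gemb f : GG" by (auto simp: GG_def)
definition at_pl :: "place => 'g fls => 'g multiloop" where
	"at_pl x f = (%y. if y = x then f else 0)"
lemma fls_polar_decomposition:
	fixes f :: "'g fls"
	obtains N r where "f = r + (\<Sum>n<N. ten (fls_X_inv ^ n) (fls_nth f (- int n)))" "!!n. n <= 0 ==> fls_nth r n = 0"
proof -
	define N where "N = nat (1 - fls_subdegree f)"
	define r where "r = f - (\<Sum>n<N. ten (fls_X_inv ^ n) (fls_nth f (- int n)))"
	have "fls_nth r m = 0" if "m <= 0" for m
	proof (cases "nat (- m) < N")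
	case True
	have "fls_nth (\<Sum>n<N. ten (fls_X_inv ^ n) (fls_nth f (- int n))) m = (\<Sum>n<N. if n = nat (- m) then fls_nth f m else 0)"
	unfolding fls_nth_sum using that by (intro sum.cong refl) (auto simp: fls_X_inv_power_nth)
	thus ?thesis using True by (simp add: r_def)
	next
	case False
	hence "m < fls_subdegree f" using that unfolding N_def by linarith
	moreover have "fls_nth (\<Sum>n<N. ten (fls_X_inv ^ n) (fls_nth f (- int n))) m = 0"
	unfolding fls_nth_sum using that False by (intro sum.neutral) (auto simp: fls_X_inv_power_nth)
	ultimately show ?thesis by (simp add: r_def)
	qed
	moreover have "f = r + (\<Sum>n<N. ten (fls_X_inv ^ n) (fls_nth f (- int n)))" by (simp only: r_def diff_add_cancel)
	ultimately show ?thesis using that by blast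
qed
lemma GE_t_power:
	"GE (%t. gs (t ^ n) a) x = ten (sexp (%t. t) x ^ n) a"
	"GE (%t. gs (inverse t ^ n) a) x = ten (sexp (%t. inverse t) x ^ n) a"
proof -
	have "srat PS (%t. inverse (t - 0))" by (rule sr_inverse) (simp add: SE_PS)
	hence i: "srat PS inverse" by simp
	show "GE (%t. gs (t ^ n) a) x = ten (sexp (%t. t) x ^ n) a"
	by (subst GE_tensor) (auto simp: se_power[OF finPS])
	show "GE (%t. gs (inverse t ^ n) a) x = ten (sexp (%t. inverse t) x ^ n) a"
	using i by (subst GE_tensor) (auto simp: se_power[OF finPS])
qed
lemma PE_I: "x : LE ==> (!!n. n < 1 ==> fls_nth (fst x Infty) n = 0) ==>
	(!!z n. n < 0 ==> fls_nth (fst x (At z)) n = 0) ==> x : PE"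
	by (auto simp: LE_def PE_def nonneg_multiloops_def)
lemma pole_distinct:
	assumes "z : SE" "y = 0 | y : SE" "y = om ^ k * z" "k < T"
	shows "y = z & k = 0"
proof -
	have z0: "z ~= 0" using assms(1) SE0 by auto
	hence y: "y : SE" using assms omega_nonzero by auto
	have "y : Gamma_orbit D z" using assms by (auto simp: Gamma_orbit_eq)
	hence "y = z" using E_orbits[of y z] y assms(1) orbit_self[of y] by (auto simp: SE_def)
	moreover have "k = 0"
	using inj_onD[OF orbit_inj[OF z0], of k 0] \<open>y = z\<close> assms by simp
	ultimately show ?thesis by simp
qed
lemma GE_gpt_regular:
	assumes z: "z : SE" and n: "n >= 1"
	shows "m < 1 ==> fls_nth (GE (gpt z n a) Infty) m = 0"
	"y = 0 | y : SE ==> m < 0 ==> fls_nth (GE (gpt z n a) (At y)) m = (if y = z then fls_nth (ten (fls_X_inv ^ n) a) m else 0)"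
proof -
	show "fls_nth (GE (gpt z n a) Infty) m = 0" if "m < 1"
	using that n by (auto simp: GE_gpt[OF z] fls_nth_sum se_neg_power_Infty nat_less_iff intro!: sum.neutral)
	assume y: "y = 0 | y : SE" and m: "m < 0"
	have "fls_nth (GE (gpt z n a) (At y)) m = (\<Sum>k<T. if k = 0 & y = z then fls_nth (ten (fls_X_inv ^ n) a) m else 0)"
	unfolding GE_gpt[OF z] fls_nth_sum
	proof (rule sum.cong)
	fix k assume "k : {..<T}"
	hence "y = om ^ k * z \<longleftrightarrow> y = z & k = 0" using pole_distinct[OF z y, of k] by auto
	thus "fls_nth (ten (fls_const (om ^ (k * n)) * sexp (%t. inverse (t - om ^ k * z) ^ n) (At y)) ((sig ^^ k) a)) m
	= (if k = 0 & y = z then fls_nth (ten (fls_X_inv ^ n) a) m else 0)"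
	using m by (cases "y = om ^ k * z") (auto simp: se_neg_power_At)
	qed simp
	also have "\<dots> = (if y = z then fls_nth (ten (fls_X_inv ^ n) a) m else 0)"
	using period by (cases "y = z") auto
	finally show "fls_nth (GE (gpt z n a) (At y)) m = (if y = z then fls_nth (ten (fls_X_inv ^ n) a) m else 0)" .
qed
lemma gpt_split:
	assumes z: "z : SE" and n: "n >= 1"
	shows "(at_pl (At z) (ten (fls_X_inv ^ n) a), 0) - gemb (gpt z n a) : PE"
proof (rule PE_I)
	have "(at_pl (At z) (ten (fls_X_inv ^ n) a), 0) : LE"
	using z SE0 unfolding LE_def multiloop_space_eq by (auto simp: at_pl_def)
	thus "(at_pl (At z) (ten (fls_X_inv ^ n) a), 0) - gemb (gpt z n a) : LE"
	using GG_LE gemb_GG[OF gpt_ratg[OF z] gpt_equivariant] hv.subspace_diff[OF LE_subspace] by blast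
qed (use z GE_gpt_regular[OF z n] in "auto simp: gemb_simps at_pl_def")
definition gsum :: "('g multiloop \<times> complex) set" where "gsum = {x + y | x y. x : GG & y : PE}"
lemma gsum_subspace: "hv.subspace gsum"
	unfolding gsum_def by (rule hv.subspace_sums[OF GG_subspace PE_subspace])
lemma gsum_I: "g : GG ==> x - g : PE ==> x : gsum"
	unfolding gsum_def by (intro CollectI exI[of _ g] exI[of _ "x - g"]) simp
lemma PE_gsum: "PE <= gsum"
	using gsum_I[OF hv.subspace_0[OF GG_subspace]] by auto
lemma at_pl_LE:
	"(at_pl (At z) f, 0) : LE \<longleftrightarrow> (z = 0 & equivariant om f) | (z ~= 0 & z : SE) | (z ~= 0 & f = 0)"
	"(at_pl Infty f, 0) : LE \<longleftrightarrow> equivariant (inverse om) f"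
	unfolding LE_def multiloop_space_eq using SE0 by (auto simp: at_pl_def)
lemma monomial_gsum:
	assumes "(at_pl x (ten (fls_X_inv ^ n) a), 0) : LE"
	shows "(at_pl x (ten (fls_X_inv ^ n) a), 0) : gsum"
proof -
	have ev: "equivariant c (ten (fls_X_inv ^ n) a) ==> sig a = gs (c powi (- int n)) a" for c
	by (auto simp: equivariant_def dest: spec[of _ "- int n"])
	have diff: "(at_pl x (ten (fls_X_inv ^ n) a), 0) - gemb f : LE" if "ratg f" "equivariant_fun f" for f
	using that assms GG_LE gemb_GG hv.subspace_diff[OF LE_subspace] by blast
	show ?thesis
	proof (cases x)
	case Infty
	have s: "sig a = gs (om ^ n) a" using ev[of "inverse om"] assms at_pl_LE(2) Infty by (simp add: power_int_minus power_inverse)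
	define f where "f t = gs (t ^ n) (- a)" for t
	have f: "ratg f" "equivariant_fun f" using s
	unfolding f_def[abs_def] by (intro ratg_scale ratg_const sr_power sr_id)
	(auto simp: equivariant_fun_def sg.scale sg.neg power_mult_distrib s mult.commute)
	have GE: "GE f y = - ten (sexp (%t. t) y ^ n) a" for y
	unfolding f_def[abs_def] GE_t_power by (rule fls_eqI) simp
	have reg: "fls_nth (sexp (%t. t) (At z) ^ n) m = 0" if "m < 0" for z m
	using se_regular(1)[of "{}" "%t. t ^ n" z m] that by (simp add: se_power[of "{}"] sr_power)
	have "(at_pl x (ten (fls_X_inv ^ n) a), 0) - gemb f : PE"
	by (rule PE_I[OF diff[OF f]]) (simp_all add: gemb_simps at_pl_def Infty GE reg se_id(2))
	thus ?thesis using gsum_I gemb_GG[OF f] by blast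
	next
	case (At z)
	consider "z : SE" "n >= 1" | "n = 0" | "z = 0" "n >= 1" | "z ~: SE" "z ~= 0" by force
	thus ?thesis
	proof cases
	case 1
	thus ?thesis using gpt_split[OF 1] At gsum_I gemb_GG[OF gpt_ratg[OF 1(1)] gpt_equivariant] by blast
	next
	case 2
	have "(at_pl x (ten (fls_X_inv ^ n) a), 0) : PE" by (rule PE_I[OF assms]) (simp_all add: At at_pl_def 2)
	thus ?thesis using PE_gsum by blast
	next
	case 3
	have s: "sig a = gs (inverse om ^ n) a" using ev[of om] assms at_pl_LE(1) At 3 by (simp add: power_int_minus power_inverse)
	define f where "f t = gs (inverse t ^ n) a" for t
	have i: "srat {0} inverse" using sr_inverse[of 0 "{0}"] by simp
	hence i': "srat PS inverse" by (rule sr_mono) (simp add: SE_PS)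
	have f: "ratg f" "equivariant_fun f" using s i'
	unfolding f_def[abs_def] by (intro ratg_scale ratg_const sr_power i')
	(auto simp: equivariant_fun_def sg.scale power_mult_distrib s mult.commute)
	have GE: "GE f y = ten (sexp (%t. inverse (t - 0) ^ n) y) a" for y
	unfolding f_def[abs_def] by (subst GE_tensor) (auto intro: sr_power i')
	have reg: "fls_nth (sexp (%t. inverse (t - 0) ^ n) (At y)) m = 0" if "m < 0" "y ~= 0" for y m
	using se_regular(1)[of "{0}" "%t. inverse t ^ n" y m] that i by (simp add: sr_power)
	have inf: "fls_nth (sexp (%t. inverse (t - 0) ^ n) Infty) m = 0" if "m < 1" for m
	unfolding se_neg_power_Infty using that 3 by auto
	have "(at_pl x (ten (fls_X_inv ^ n) a), 0) - gemb f : PE"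
	using se_neg_power_At(2)[of 0 n] reg inf
	by (intro PE_I[OF diff[OF f]]) (auto simp: gemb_simps at_pl_def At GE 3 simp del: diff_zero)
	thus ?thesis using gsum_I gemb_GG[OF f] by blast
	next
	case 4
	hence "(at_pl x (ten (fls_X_inv ^ n) a), 0) = 0" using assms At at_pl_LE(1) by (auto simp: at_pl_def zero_prod_def fun_eq_iff)
	thus ?thesis using hv.subspace_0[OF gsum_subspace] by metis
	qed
	qed
qed
lemma at_pl_add: "at_pl x (f + h) = at_pl x f + at_pl x h" and at_pl_zero: "at_pl x 0 = 0"
	by (auto simp: at_pl_def fun_eq_iff)
lemma at_pl_sum: "(at_pl x (SUM n:A. F n), 0) = (SUM n:A. (at_pl x (F n), 0 :: complex))"
proof (induction A rule: infinite_finite_induct)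
	case (insert n A)
	have "(at_pl x (F n + sum F A), 0) = (at_pl x (F n), 0 :: complex) + (at_pl x (sum F A), 0)"
	by (simp only: at_pl_add add_Pair add_0_left)
	thus ?case using insert by (simp only: sum.insert[OF insert(1,2)])
qed (simp_all add: at_pl_zero zero_prod_def zero_fun_def)
lemma equivariant_monomial:
	assumes "equivariant c f" shows "equivariant c (ten (fls_X_inv ^ n) (fls_nth f (- int n)))"
	using assms by (auto simp: equivariant_def dest: spec[of _ "- int n"])
lemma at_pl_gsum:
	assumes "(at_pl x f, 0) : LE" shows "(at_pl x f, 0) : gsum"
proof -
	obtain N r where r: "f = r + (\<Sum>n<N. ten (fls_X_inv ^ n) (fls_nth f (- int n)))" "!!n. n <= 0 ==> fls_nth r n = 0"
	using fls_polar_decomposition[of f] by blast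
	let ?m = "%n. (at_pl x (ten (fls_X_inv ^ n) (fls_nth f (- int n))), 0 :: complex)"
	have m: "?m n : LE" for n
	using assms equivariant_monomial by (cases x) (auto simp: at_pl_LE)
	have e: "(at_pl x f, 0) = (at_pl x r, 0) + (\<Sum>n<N. ?m n)"
	by (subst r(1)) (simp add: at_pl_add flip: at_pl_sum)
	have "(at_pl x r, 0) = (at_pl x f, 0) - (\<Sum>n<N. ?m n)" unfolding e by simp
	also have "\<dots> : LE"
	by (intro hv.subspace_diff[OF LE_subspace] assms hv.subspace_sum[OF LE_subspace] m)
	finally have "(at_pl x r, 0) : PE" by (rule PE_I) (simp_all add: at_pl_def r(2))
	hence "(at_pl x r, 0) : gsum" using PE_gsum by blast
	thus ?thesis unfolding e
	by (intro hv.subspace_add[OF gsum_subspace] hv.subspace_sum[OF gsum_subspace] monomial_gsum m)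
qed
lemma LE_split: assumes "x : LE" shows "EX p:PE. x - p : GG"
proof -
	obtain f a where x: "x = (f, a)" by (cases x)
	have f: "equivariant (inverse om) (f Infty)" "equivariant om (f (At 0))" "!!z. z ~: SE ==> z ~= 0 ==> f (At z) = 0"
	using assms unfolding x LE_def multiloop_space_eq by auto
	have fs: "fst (SUM z:A. (F z, 0 :: complex)) = (SUM z:A. F z)" "snd (SUM z:A. (F z :: 'g multiloop, 0 :: complex)) = 0" for F :: "complex => 'g multiloop" and A
	by (induction A rule: infinite_finite_induct) auto
	have ap: "(SUM z:A. F z) y = (SUM z:A. F z y)" for F :: "complex => 'g multiloop" and A y
	by (induction A rule: infinite_finite_induct) auto
	have "x = (0, a) + (at_pl Infty (f Infty), 0) + (at_pl (At 0) (f (At 0)), 0) + (SUM z:SE. (at_pl (At z) (f (At z)), 0))"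
	proof (rule prod_eqI)
	show "fst x = fst ((0, a) + (at_pl Infty (f Infty), 0) + (at_pl (At 0) (f (At 0)), 0) + (SUM z:SE. (at_pl (At z) (f (At z)), 0)))"
	unfolding x fst_add fs fst_conv
	proof (rule ext)
	fix y
	show "f y = (0 + at_pl Infty (f Infty) + at_pl (At 0) (f (At 0)) + (SUM z:SE. at_pl (At z) (f (At z)))) y"
	proof (cases y)
	case (At w)
	have "(SUM z:SE. at_pl (At z) (f (At z)) (At w)) = (SUM z:SE. if z = w then f (At w) else 0)"
	by (rule sum.cong) (auto simp: at_pl_def)
	thus ?thesis using f(3)[of w] finSE SE0 by (auto simp: At ap at_pl_def)
	qed (simp add: ap at_pl_def)
	qed
	qed (simp add: x fs)
	also have "\<dots> : gsum"
	proof (intro hv.subspace_add[OF gsum_subspace] hv.subspace_sum[OF gsum_subspace] at_pl_gsum)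
	have "(0 :: 'g multiloop, a) : PE" by (rule PE_I) (auto simp: LE_def multiloop_space_eq)
	thus "(0, a) : gsum" using PE_gsum by blast
	qed (use f SE0 in "auto simp: at_pl_LE")
	finally obtain g p where "x = g + p" "g : GG" "p : PE" unfolding gsum_def by blast
	thus ?thesis by (intro bexI[of _ p]) simp_all
qed
end
section \<open>The vacuum module\<close>
lemma (in lie_space) fder_uea_ideal:
	assumes car: "!!x. x : lcarrier L ==> d x : lcarrier L"
	and add: "!!x y. x : lcarrier L ==> y : lcarrier L ==> d (x + y) = d x + d y"
	and sc: "!!c x. x : lcarrier L ==> d (lscale L c x) = lscale L c (d x)"
	and br: "!!x y. x : lcarrier L ==> y : lcarrier L ==> d (lbracket L x y) = lbracket L (d x) y + lbracket L x (d y)"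
	and r: "r : uea_ideal L"
	shows "fder d r : uea_ideal L"
proof -
	interpret D: Vector_Spaces.linear pm_scale pm_scale "fder d" by (rule linear_free_derivation)
	have "uea_ideal L <= {r. fder d r : uea_ideal L}"
	proof (rule uea_ideal_minimal)
	show "pm.subspace {r. fder d r : uea_ideal L}"
	using uea_ideal_subspace(1) by (auto simp: pm.subspace_def D.add D.scale)
	fix r u v assume r: "r : uea_relations L" and uv: "u : lists (lcarrier L)" "v : lists (lcarrier L)"
	have "fder d r : uea_ideal L"
	using r
	proof (cases r rule: uea_relations_cases)
	case (add x y)
	thus ?thesis using uea_ideal_rel[OF uea_relationsI(1)[OF car car, of x y]] assms(2)
	by (simp add: D.diff fder_sgl)
	next
	case (scale c x)
	thus ?thesis using uea_ideal_rel[OF uea_relationsI(2)[OF car, of x c]] sc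
	by (simp add: D.diff D.scale fder_sgl del: pm_scale_single)
	next
	case (bracket x y)
	let ?b = "lbracket L"
	have cl: "?b (d x) y : lcarrier L" "?b x (d y) : lcarrier L" using bracket car br_closed by auto
	have "fder d r = (sgl [d x, y] - sgl [y, d x] - gen (?b (d x) y)) +
	(sgl [x, d y] - sgl [d y, x] - gen (?b x (d y))) - (gen (?b (d x) y + ?b x (d y)) - gen (?b (d x) y) - gen (?b x (d y)))"
	unfolding bracket(1) using bracket by (simp add: D.diff fder_sgl br)
	also have "\<dots> : uea_ideal L"
	using bracket car cl
	by (intro pm.subspace_diff[OF uea_ideal_subspace(1)] pm.subspace_add[OF uea_ideal_subspace(1)] uea_ideal_rel uea_relationsI)
	finally show ?thesis .
	qed
	moreover have "sgl u : WP" "sgl v : WP" "fder d (sgl u) : WP" "fder d (sgl v) : WP"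
	using uv car by (auto intro!: supported_single fder_supported)
	ultimately show "sgl u * r * sgl v : {r. fder d r : uea_ideal L}"
	using uea_ideal_rel[OF r] pm.subspace_add[OF uea_ideal_subspace(1)] uea_ideal_times
	by (simp add: fder_times distrib_right)
	qed
	thus ?thesis using r by auto
qed
lemma complex_line_simps [simp]: "carrier complex_line = UNIV" "add complex_line = (+)" "\<zero>\<^bsub>complex_line\<^esub> = 0" "smult complex_line = (*)"
	by (simp_all add: complex_line_def)
lemma cspace_complex_line: "cspace complex_line"
	by (rule cspaceI, rule abelian_groupI) (auto simp: algebra_simps intro: exI[of _ "- _"])
lemma all_words [simp]: "p : supported UNIV" by (simp add: supported_def)
locale gaudin_level = gaudin_data D for D :: "('g::ab_group_add) cyclotomic_data" + fixes k :: complex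
begin
sublocale AL: lie_space "affine_alg D" by (rule lie_space_affine)
sublocale V: induced_data "affine_alg D" complex_line affine_nonneg "vacuum_action k"
	by (intro induced_data.intro lie_space_affine cspace_complex_line induced_data_axioms.intro) auto
abbreviation "AI == uea_ideal (affine_alg D)"
definition kap :: "'g fls \<times> complex => complex" where "kap x = snd x * k"
definition theta :: "(('g fls \<times> complex) list pm) => 'g vacuum_elem" where
	"theta p = V.tens (uea_class (affine_alg D) p) 1"
definition th where "th p = emb V.Ind (theta p)"
lemma cls_closed [simp]: "uea_class (affine_alg D) p : carrier (uea (affine_alg D))"
	by (rule AL.uea_class_closed) simp
lemma theta_closed [simp]: "theta p : carrier V.Ind"
	unfolding theta_def by (rule V.tens_closed) simp_all
lemma theta_add: "theta (p + q) = theta p \<oplus>\<^bsub>V.Ind\<^esub> theta q"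
	unfolding theta_def by (simp add: V.tens_add1[symmetric] AL.uea_class_ops)
lemma theta_scale: "theta (pm_scale c p) = c \<odot>\<^bsub>V.Ind\<^esub> theta p"
	unfolding theta_def by (simp add: V.tens_scale1[symmetric] AL.uea_class_scale)
lemma th_linear: "pmlin th"
	unfolding Vector_Spaces.linear_iff th_def
	by (simp add: pm.vector_space_axioms theta_add theta_scale V.Ind.emb_add V.Ind.emb_scale)
sublocale th: Vector_Spaces.linear pm_scale pm_scale th by (rule th_linear)
lemma th_eq_iff: "th p = th q \<longleftrightarrow> theta p = theta q"
	unfolding th_def by (simp add: V.Ind.emb_eq_iff)
lemma theta_zero: "theta 0 = \<zero>\<^bsub>V.Ind\<^esub>"
	using theta_scale[of 0 0] by simp
lemma th_zero_iff: "th p = 0 \<longleftrightarrow> theta p = \<zero>\<^bsub>V.Ind\<^esub>"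
	using th_eq_iff[of p 0] by (simp add: theta_zero)
lemma theta_surj: assumes "X : carrier V.Ind" shows "EX p. X = theta p"
proof -
	have "csub V.Ind (range theta)"
	unfolding csub_def using theta_zero theta_add theta_scale by (auto simp: image_iff) metis+
	hence "X : range theta"
	proof (rule V.Ind_induct)
	fix a and m :: complex assume a: "a : carrier (uea (affine_alg D))"
	then obtain p where p: "a = uea_class (affine_alg D) p" by (auto simp: AL.uea_carrier)
	have "V.tens a m = V.tens a (m \<odot>\<^bsub>complex_line\<^esub> 1)" by simp
	also have "\<dots> = m \<odot>\<^bsub>V.Ind\<^esub> V.tens a 1" by (rule V.tens_scale2) (use a in auto)
	also have "\<dots> = theta (pm_scale m p)" by (simp only: theta_scale p) (simp only: theta_def)
	finally show "V.tens a m : range theta" by simp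
	qed fact
	thus ?thesis by auto
qed
lemma th_ideal: assumes "r : AI" shows "th r = 0"
proof -
	have "uea_class (affine_alg D) r = uea_class (affine_alg D) 0" using assms by (subst AL.uea_class_eq_iff) auto
	thus ?thesis using th_eq_iff[of r 0] by (simp add: theta_def)
qed
lemma iact_theta: "V.iact x (theta p) = theta (gen x * p)"
	unfolding theta_def by (subst V.iact_tens) (simp_all add: uea_incl_def AL.uea_class_ops)
lemma th_gen_zero: assumes "th p = 0" shows "th (gen x * p) = 0"
proof -
	have "theta (gen x * p) = V.iact x (theta p)" by (rule iact_theta[symmetric])
	also have "\<dots> = V.iact x (theta (pm_scale 0 p))" using assms by (simp add: th_zero_iff theta_zero)
	also have "\<dots> = theta (pm_scale 0 (gen x * p))" by (simp only: iact_theta times_pm_scale)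
	also have "\<dots> = \<zero>\<^bsub>V.Ind\<^esub>" by (simp add: theta_zero)
	finally show ?thesis by (simp add: th_zero_iff)
qed
lemma th_left_zero: assumes "th p = 0" shows "th (q * p) = 0"
proof -
	have "th (sgl w * p) = 0" for w
	proof (induction w)
	case Nil
	thus ?case using assms by (simp flip: one_words)
	next
	case (Cons x w)
	have "sgl (x # w) * p = gen x * (sgl w * p)" by (simp flip: mult.assoc)
	thus ?case using th_gen_zero[OF Cons] by simp
	qed
	moreover have "pm.subspace {q. th (q * p) = 0}"
	by (auto simp: pm.subspace_def distrib_right pm_scale_times th.add th.scale)
	ultimately have "q : {q. th (q * p) = 0}" by (rule_tac pm_subspace_memI) simp_all
	thus ?thesis by simp
qed
lemma th_left_cong: "th p = th p' ==> th (q * p) = th (q * p')"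
	using th_left_zero[of "p - p'" q] by (simp add: right_diff_distrib th.diff)
lemma th_snoc: assumes "x : affine_nonneg" shows "th (p * gen x) = pm_scale (kap x) (th p)"
proof -
	have "theta (p * gen x) = V.tens (uea_class (affine_alg D) p \<otimes>\<^bsub>uea (affine_alg D)\<^esub> uea_incl (affine_alg D) x) 1"
	by (simp add: theta_def uea_incl_def AL.uea_class_ops)
	also have "\<dots> = V.tens (uea_class (affine_alg D) p) (kap x \<odot>\<^bsub>complex_line\<^esub> 1)"
	by (subst V.tens_bal) (use assms in "auto simp: vacuum_action_def kap_def split: prod.splits")
	also have "\<dots> = kap x \<odot>\<^bsub>V.Ind\<^esub> theta p" unfolding theta_def by (rule V.tens_scale2) auto
	finally show ?thesis by (simp add: th_def V.Ind.emb_scale)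
qed
text \<open>The universal property of the vacuum module, in terms of word polynomials.\<close>
definition vacuum_map :: "(complex => 'a => 'a) => ((('g fls \<times> complex) list pm) => 'a::ab_group_add) => bool" where
	"vacuum_map sc \<phi> \<longleftrightarrow> vlin pm_scale sc \<phi> & (ALL r:AI. \<phi> r = 0) &
	(ALL p. ALL x:affine_nonneg. \<phi> (p * gen x) = sc (kap x) (\<phi> p))"
lemma vacuum_map_zero:
	assumes vm: "vacuum_map sc \<phi>" and p: "th p = 0" shows "\<phi> p = 0"
proof -
	interpret \<phi>: Vector_Spaces.linear pm_scale sc \<phi> using vm by (simp add: vacuum_map_def)
	let ?c = "uea_class (affine_alg D)"
	define r where "r C = (SOME p. C = ?c p)" for C
	have rc: "\<phi> (r (?c p)) = \<phi> p" for p
	proof -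
	have "?c p = ?c (r (?c p))" unfolding r_def by (rule someI[of _ p]) simp
	hence "p - r (?c p) : AI" by (subst (asm) AL.uea_class_eq_iff) auto
	hence "\<phi> (p - r (?c p)) = 0" using vm by (simp add: vacuum_map_def)
	thus ?thesis by (simp add: \<phi>.diff)
	qed
	have C: "a : carrier (uea (affine_alg D)) ==> EX p. a = ?c p" for a by (auto simp: AL.uea_carrier)
	have "EX F. (ALL X:carrier V.Ind. ALL Y:carrier V.Ind. F (X \<oplus>\<^bsub>V.Ind\<^esub> Y) = F X + F Y) &
	(ALL c. ALL X:carrier V.Ind. F (c \<odot>\<^bsub>V.Ind\<^esub> X) = sc c (F X)) &
	(ALL a:carrier (uea (affine_alg D)). ALL m:carrier complex_line. F (V.tens a m) = sc m (\<phi> (r a)))"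
	proof (rule V.Ind_lift)
	show "vector_space sc" by (rule \<phi>.vs2.vector_space_axioms)
	fix a b x and m :: complex and c assume a: "a : carrier (uea (affine_alg D))"
	obtain p where p: "a = ?c p" using C[OF a] by blast
	show "sc m (\<phi> (r (c \<odot>\<^bsub>uea (affine_alg D)\<^esub> a))) = sc c (sc m (\<phi> (r a)))"
	unfolding p by (simp add: AL.uea_class_scale rc \<phi>.scale mult.commute)
	show "x : affine_nonneg ==> sc m (\<phi> (r (a \<otimes>\<^bsub>uea (affine_alg D)\<^esub> uea_incl (affine_alg D) x))) = sc (vacuum_action k x m) (\<phi> (r a))"
	unfolding p using vm by (simp add: uea_incl_def AL.uea_class_ops rc vacuum_map_def vacuum_action_def kap_def split_beta mult_ac)
	assume "b : carrier (uea (affine_alg D))"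
	then obtain q where q: "b = ?c q" using C by blast
	show "sc m (\<phi> (r (a \<oplus>\<^bsub>uea (affine_alg D)\<^esub> b))) = sc m (\<phi> (r a)) + sc m (\<phi> (r b))"
	unfolding p q by (simp add: AL.uea_class_ops rc \<phi>.add \<phi>.vs2.scale_right_distrib)
	qed (simp_all add: \<phi>.vs2.scale_left_distrib)
	then obtain F where F: "!!c X. X : carrier V.Ind ==> F (c \<odot>\<^bsub>V.Ind\<^esub> X) = sc c (F X)"
	"ALL a:carrier (uea (affine_alg D)). ALL m:carrier complex_line. F (V.tens a m) = sc m (\<phi> (r a))" by blast
	have F2: "F (theta p) = \<phi> p"
	using F(2)[rule_format, of "?c p" 1] by (simp add: theta_def rc)
	have "\<phi> p = F (0 \<odot>\<^bsub>V.Ind\<^esub> theta p)" using p F2 by (simp add: th_zero_iff)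
	thus ?thesis by (simp only: F(1)[OF theta_closed] \<phi>.vs2.scale_zero_left)
qed
lemma vacuum_map_cong: assumes "vacuum_map sc \<phi>" "th p = th q" shows "\<phi> p = \<phi> q"
proof -
	interpret \<phi>: Vector_Spaces.linear pm_scale sc \<phi> using assms by (simp add: vacuum_map_def)
	show ?thesis using vacuum_map_zero[OF assms(1), of "p - q"] assms(2) by (simp add: th.diff \<phi>.diff)
qed
lemma AI_times: "r : AI ==> p * r * q : AI" by (rule AL.uea_ideal_times) simp_all
lemma th_swap: "th (u * (sgl [x, y] - sgl [y, x] - gen (abr x y)) * v) = 0"
	using th_ideal[OF AI_times[OF AL.uea_ideal_rel[OF AL.uea_relationsI(3)]]] by simp
lemma th_word_swap: "th (sgl (v @ x # y # w)) = th (sgl (v @ y # x # w)) + th (sgl (v @ abr x y # w))"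
	using th_swap[of "sgl v" x y "sgl w"] by (simp add: algebra_simps th.diff th.add)
lemma th_letter:
	"th (sgl (v @ (x + y) # w)) = th (sgl (v @ x # w)) + th (sgl (v @ y # w))"
	"th (sgl (v @ asc c x # w)) = pm_scale c (th (sgl (v @ x # w)))"
proof -
	have "th (sgl v * (gen (x + y) - gen x - gen y) * sgl w) = 0" "th (sgl v * (gen (asc c x) - pm_scale c (gen x)) * sgl w) = 0"
	using th_ideal[OF AI_times[OF AL.uea_ideal_rel[OF AL.uea_relationsI(1)]]]
	th_ideal[OF AI_times[OF AL.uea_ideal_rel[OF AL.uea_relationsI(2)]]] by simp_all
	thus "th (sgl (v @ (x + y) # w)) = th (sgl (v @ x # w)) + th (sgl (v @ y # w))"
	"th (sgl (v @ asc c x # w)) = pm_scale c (th (sgl (v @ x # w)))"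
	by (simp_all add: algebra_simps th.diff th.add pm_scale_times times_pm_scale th.scale flip: th.scale)
qed
lemma th_ad: "th (fder (abr x) p) = th (gen x * p) - th (p * gen x)"
proof -
	interpret D: Vector_Spaces.linear pm_scale pm_scale "fder (abr x)" by (rule linear_free_derivation)
	show ?thesis
	proof (rule pm_linear_eq_on[where p=p and sc=pm_scale])
	fix w
	have "th (sgl (x # w)) = th (sgl (w @ [x])) + dsum (abr x) w (%v. th (sgl v))"
	by (rule move_letter[where L=UNIV, OF th_word_swap]) simp_all
	thus "th (fder (abr x) (sgl w)) = th (gen x * sgl w) - th (sgl w * gen x)"
	by (simp add: fder_sgl dsum_linear[OF th_linear])
	qed (auto simp: pm_lin_iff D.add D.scale th.add th.scale algebra_simps
	pm_scale_times times_pm_scale pm.scale_right_distrib)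
qed
lemma nonneg_iff: "(f, a) : affine_nonneg \<longleftrightarrow> (ALL n<0. fls_nth f n = 0)" by (simp add: affine_nonneg_def)
text \<open>Elements of high order annihilate a given vector.\<close>
lemma th_smooth: "EX N. ALL f. (ALL n<N. fls_nth f n = 0) --> th (gen (f, 0) * p) = 0"
proof -
	have word: "EX N. ALL f. (ALL n<N. fls_nth f n = 0) --> th (sgl ((f, 0) # w)) = 0" for w
	proof (induction w)
	case Nil
	have "th (sgl [(f, 0)]) = 0" if "ALL n<0. fls_nth f n = 0" for f
	using th_snoc[of "(f, 0)" 1] that by (simp add: nonneg_iff kap_def one_words)
	thus ?case by blast
	next
	case (Cons y w)
	then obtain N where N: "!!f. (ALL n<N. fls_nth f n = 0) ==> th (sgl ((f, 0) # w)) = 0" by blast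
	obtain h b where y: "y = (h, b)" by (cases y)
	let ?m = "fls_subdegree h"
	have "th (sgl ((f, 0) # y # w)) = 0" if f: "ALL n < max N (max (N - ?m) (1 - ?m)). fls_nth f n = 0" for f
	proof -
	have "rp f h = 0" by (rule rp_order[of "1 - ?m" _ ?m]) (use f in auto)
	moreover have "ALL n<N. fls_nth (lb f h) n = 0"
	using lb_order[of "N - ?m" f ?m h] f by auto
	ultimately have "th (sgl (abr (f, 0) y # w)) = 0" using N y by simp
	moreover have "th (sgl (y # (f, 0) # w)) = 0"
	using th_gen_zero[OF N[of f], of y] f by simp
	ultimately show ?thesis using th_word_swap[of "[]" "(f, 0)" y w] by simp
	qed
	thus ?case by blast
	qed
	have "pm.subspace {p. EX N. ALL f. (ALL n<N. fls_nth f n = 0) --> th (gen (f, 0) * p) = 0}" (is "pm.subspace ?W")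
	unfolding pm.subspace_def
	proof (intro conjI ballI allI)
	fix x y assume "x : ?W" "y : ?W"
	then obtain M N where "ALL f. (ALL n<M. fls_nth f n = 0) --> th (gen (f, 0) * x) = 0" "ALL f. (ALL n<N. fls_nth f n = 0) --> th (gen (f, 0) * y) = 0" by blast
	thus "x + y : ?W" by (intro CollectI exI[of _ "max M N"]) (auto simp: distrib_left th.add)
	qed (auto simp: times_pm_scale th.scale)
	hence "p : ?W" by (rule pm_subspace_memI) (use word in simp)
	thus ?thesis by simp
qed
subsection \<open>Singular vectors\<close>
definition sing :: "(('g fls \<times> complex) list pm) => bool" where
	"sing p \<longleftrightarrow> (ALL x:affine_nonneg. th (gen x * p) = pm_scale (kap x) (th p))"
lemma th_central: "th (gen (0, a) * p) = pm_scale (a * k) (th p)"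
proof -
	have "abr (0, a) = (%y. 0)" by (auto simp: fun_eq_iff abr_def zero_prod_def)
	moreover have "fder (%y. 0) p = fder (abr 0) p"
	by (rule arg_cong[where f="%d. fder d p"], rule ext) (simp add: al.br_zero)
	moreover have "th (gen 0 * p) = 0" "th (p * gen 0) = 0"
	proof -
	have z: "gen (0 :: 'g fls \<times> complex) - pm_scale 0 (gen 0) : AI"
	using AL.uea_ideal_rel[OF AL.uea_relationsI(2)[of 0 0]] by simp
	show "th (gen 0 * p) = 0" "th (p * gen 0) = 0"
	using th_ideal[OF AI_times[OF z, of 1 p]] th_ideal[OF AI_times[OF z, of p 1]] by simp_all
	qed
	ultimately have "th (fder (abr (0, a)) p) = 0" using th_ad[of 0 p] by simp
	hence "th (gen (0, a) * p) = th (p * gen (0, a))" using th_ad[of "(0, a)" p] by simp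
	also have "\<dots> = pm_scale (a * k) (th p)" by (subst th_snoc) (simp_all add: nonneg_iff kap_def)
	finally show ?thesis .
qed
lemma th_gen_add: "th (gen (x + y) * p) = th (gen x * p) + th (gen y * p)"
proof -
	have "th (1 * (gen (x + y) - gen x - gen y) * p) = 0"
	using th_ideal[OF AI_times[OF AL.uea_ideal_rel[OF AL.uea_relationsI(1)]], of x y 1 p] by simp
	thus ?thesis by (simp add: algebra_simps th.diff th.add)
qed
lemma sing_iff:
	"sing p \<longleftrightarrow> (ALL f. finite {n. fls_nth f n ~= 0} & (ALL n<0. fls_nth f n = 0) --> th (gen (f, 0) * p) = 0)"
proof
	assume "sing p"
	thus "ALL f. finite {n. fls_nth f n ~= 0} & (ALL n<0. fls_nth f n = 0) --> th (gen (f, 0) * p) = 0"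
	by (auto simp: sing_def kap_def nonneg_iff)
next
	assume poly: "ALL f. finite {n. fls_nth f n ~= 0} & (ALL n<0. fls_nth f n = 0) --> th (gen (f, 0) * p) = 0"
	obtain N where N: "!!f. (ALL n<N. fls_nth f n = 0) ==> th (gen (f, 0) * p) = 0" using th_smooth[of p] by blast
	show "sing p" unfolding sing_def
	proof
	fix x :: "'g fls \<times> complex" assume "x : affine_nonneg"
	then obtain f a where x: "x = (f, a)" "ALL n<0. fls_nth f n = 0" by (auto simp: affine_nonneg_def)
	define g where "g = Abs_fls (%n. if n < N then fls_nth f n else 0)"
	have g: "fls_nth g n = (if n < N then fls_nth f n else 0)" for n
	unfolding g_def by (subst nth_Abs_fls_lower_bound[of 0]) (use x in auto)
	have "{n. fls_nth g n ~= 0} <= {0..<N}" using x by (auto simp: g) (meson not_le)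
	hence "finite {n. fls_nth g n ~= 0}" by (rule finite_subset) simp
	moreover have "ALL n<0. fls_nth g n = 0" using x by (simp add: g)
	ultimately have "th (gen (g, 0) * p) = 0" using poly by blast
	moreover have "th (gen (f - g, 0) * p) = 0" by (rule N) (simp add: g)
	moreover have "x = (0, a) + ((g, 0) + (f - g, 0))" by (simp add: x)
	ultimately show "th (gen x * p) = pm_scale (kap x) (th p)"
	using th_gen_add[of "(0, a)" "(g, 0) + (f - g, 0)" p] th_gen_add[of "(g, 0)" "(f - g, 0)" p] th_central[of a p]
	by (simp add: x kap_def)
	qed
qed
lemma singular_vectors_eq: "singular_vectors D k = theta ` {p. sing p}"
proof -
	have "theta p : singular_vectors D k \<longleftrightarrow> sing p" for p
	unfolding singular_vectors_def vacuum_module_def sing_iff by (simp add: iact_theta th_zero_iff)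
	moreover have "EX p. Z = theta p" if "Z : singular_vectors D k" for Z
	using that theta_surj unfolding singular_vectors_def vacuum_module_def by blast
	ultimately show ?thesis by blast
qed
lemma sing_one: "sing 1"
	unfolding sing_def using th_snoc[of _ 1] by simp
lemma right_mult_vacuum_map: assumes "sing s" shows "vacuum_map pm_scale (%p. th (p * s))"
	unfolding vacuum_map_def
proof (intro conjI ballI allI)
	show "pmlin (%p. th (p * s))"
	by (auto simp: pm_lin_iff th.add th.scale algebra_simps pm_scale_times)
	show "th (r * s) = 0" if "r : AI" for r using th_ideal[OF AI_times[OF that, of 1 s]] by simp
	fix p and x :: "'g fls \<times> complex" assume x: "x : affine_nonneg"
	have "th (gen x * s) = th (pm_scale (kap x) s)" using assms x by (simp add: sing_def th.scale)
	from th_left_cong[OF this, of p] show "th (p * gen x * s) = pm_scale (kap x) (th (p * s))"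
	by (simp add: mult.assoc times_pm_scale th.scale)
qed
lemma sing_times: assumes "sing p" "sing s" shows "sing (p * s)"
	unfolding sing_def
proof
	fix x :: "'g fls \<times> complex" assume x: "x : affine_nonneg"
	have "th (gen x * p) = th (pm_scale (kap x) p)" using assms x by (simp add: sing_def th.scale)
	from vacuum_map_cong[OF right_mult_vacuum_map[OF assms(2)] this]
	show "th (gen x * (p * s)) = pm_scale (kap x) (th (p * s))" by (simp add: mult.assoc pm_scale_times th.scale)
qed
lemma sing_ad: assumes "sing p" "x : affine_nonneg" shows "th (fder (abr x) p) = 0"
	using assms th_ad[of x p] th_snoc[OF assms(2), of p] by (simp add: sing_def)
text \<open>Translation.\<close>
definition dT :: "'g fls \<times> complex => 'g fls \<times> complex" where "dT x = (- ld (fst x), 0)"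
definition trans where "trans = fder dT"
lemma ld_lb: "ld (lb f h) = lb (ld f) h + lb f (ld h)"
proof (induction f rule: fls_vec_induct)
	case (1 c x)
	show ?case
	by (induction h rule: fls_vec_induct) (simp_all add: lb_ten ld_ten lb_add ld_add mult.commute flip: ten_add(1))
qed (simp add: lb_add ld_add)
lemma rp_ld: "rp (ld f) h + rp f (ld h) = 0"
proof -
	have "lf (ld f) (ld h) + lf f (ld (ld h)) = fls_deriv (lf f (ld h))" for f h
	proof (induction f rule: fls_vec_induct)
	case (1 c x)
	show ?case
	by (induction h rule: fls_vec_induct) (simp_all add: lf_ten ld_ten lf_add ld_add algebra_simps)
	qed (simp add: lf_add ld_add algebra_simps)
	from arg_cong[OF this[of f h], of fls_residue] show ?thesis by (simp add: rp_def)
qed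
lemma lb_minus: "lb (- f) h = - lb f h" "lb f (- h) = - lb f h"
	using lb_add(1)[of f "- f" h] lb_add(2)[of f h "- h"] by (simp_all add: eq_neg_iff_add_eq_0 add.commute)
lemma trans_ideal: "r : AI ==> trans r : AI"
	unfolding trans_def
proof (rule AL.fder_uea_ideal)
	fix x y :: "'g fls \<times> complex"
	obtain f a h b where e: "x = (f, a)" "y = (h, b)" by (cases x; cases y) blast
	show "dT (lbracket (affine_alg D) x y) = lbracket (affine_alg D) (dT x) y + lbracket (affine_alg D) x (dT y)"
	using rp_ld[of f h] by (simp add: e dT_def ld_lb lb_minus rp_minus) (metis add.inverse_inverse add_eq_0_iff neg_equal_0_iff_equal)
	show "dT (x + y) = dT x + dT y" by (simp add: dT_def ld_add)
	show "dT (lscale (affine_alg D) c x) = lscale (affine_alg D) c (dT x)" for c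
	by (simp add: e dT_def ld_scale)
qed auto
sublocale trans: Vector_Spaces.linear pm_scale pm_scale trans
	unfolding trans_def by (rule linear_free_derivation)
lemma trans_times: "trans (p * q) = trans p * q + p * trans q"
	unfolding trans_def by (rule fder_times)
lemma trans_gen: "trans (gen x) = gen (dT x)" by (simp add: trans_def fder_sgl)
lemma dT_nonneg: "x : affine_nonneg ==> dT x : affine_nonneg"
proof -
	assume x: "x : affine_nonneg"
	have "fls_nth (ld (fst x)) n = 0" if "n < 0" for n
	using x that by (cases "n = -1") (auto simp: affine_nonneg_def)
	thus ?thesis by (simp add: affine_nonneg_def dT_def)
qed
lemma trans_vacuum_map: "vacuum_map pm_scale (%p. th (trans p))"
	unfolding vacuum_map_def
proof (intro conjI ballI allI)
	show "pmlin (%p. th (trans p))"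
	by (auto simp: pm_lin_iff th.add th.scale trans.add trans.scale)
	show "r : AI ==> th (trans r) = 0" for r by (rule th_ideal[OF trans_ideal])
	fix p and x :: "'g fls \<times> complex" assume x: "x : affine_nonneg"
	have "th (p * gen (dT x)) = 0" using th_snoc[OF dT_nonneg[OF x], of p] by (simp add: kap_def dT_def)
	thus "th (trans (p * gen x)) = pm_scale (kap x) (th (trans p))"
	using th_snoc[OF x] by (simp add: trans_times trans_gen th.add)
qed
lemma sing_trans: assumes "sing p" shows "sing (trans p)"
	unfolding sing_iff
proof (intro allI impI)
	fix f :: "'g fls" assume f: "finite {n. fls_nth f n ~= 0} & (ALL n<0. fls_nth f n = 0)"
	have x: "(f, 0) : affine_nonneg" using f by (simp add: nonneg_iff)
	have "th (gen (f, 0) * p) = 0" using assms x by (simp add: sing_def kap_def)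
	from vacuum_map_zero[OF trans_vacuum_map this] have "th (gen (dT (f, 0)) * p) + th (gen (f, 0) * trans p) = 0"
	by (simp add: trans_times trans_gen th.add)
	moreover have "th (gen (dT (f, 0)) * p) = 0" using assms dT_nonneg[OF x] by (simp add: sing_def kap_def dT_def)
	ultimately show "th (gen (f, 0) * trans p) = 0" by simp
qed
text \<open>The vacuum module is spanned by words with negative letters.\<close>
abbreviation "neg_word == map (%f :: 'g fls. (f, 0 :: complex))"
abbreviation "negs == {f :: 'g fls. ALL n>=0. fls_nth f n = 0}"
lemma negative_split: "EX f1 f2. f = f1 + f2 & f1 : negs & (ALL n<0. fls_nth f2 n = 0)" for f :: "'g fls"
proof -
	define f1 where "f1 = Abs_fls (%n. if n < 0 then fls_nth f n else 0)"
	have f1: "fls_nth f1 n = (if n < 0 then fls_nth f n else 0)" for n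
	unfolding f1_def by (subst nth_Abs_fls_lower_bound[of "fls_subdegree f"]) auto
	show ?thesis by (rule exI[of _ f1], rule exI[of _ "f - f1"]) (simp add: f1)
qed
lemma PBW_spanning: "EX q:word_polys negs. th p = th (push neg_word q)"
proof -
	interpret P: Vector_Spaces.linear pm_scale pm_scale "push neg_word" by (rule linear_push)
	define W where "W = {v. EX q:word_polys negs. v = th (push neg_word q)}"
	have W: "pm.subspace W" unfolding pm.subspace_def W_def
	proof (intro conjI ballI allI)
	show "0 : {v. EX q:word_polys negs. v = th (push neg_word q)}" by (auto intro!: bexI[of _ 0])
	fix x y assume "x : {v. EX q:word_polys negs. v = th (push neg_word q)}"
	then obtain q where q: "q : word_polys negs" "x = th (push neg_word q)" by blast
	{ assume "y : {v. EX q:word_polys negs. v = th (push neg_word q)}"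
	then obtain q' where "q' : word_polys negs" "y = th (push neg_word q')" by blast
	thus "x + y : {v. EX q:word_polys negs. v = th (push neg_word q)}"
	using q by (auto intro!: bexI[of _ "q + q'"] simp: P.add th.add) }
	show "pm_scale c x : {v. EX q:word_polys negs. v = th (push neg_word q)}" for c
	using q by (auto intro!: bexI[of _ "pm_scale c q"] simp: P.scale th.scale)
	qed
	have wordI: "v : lists negs ==> th (sgl (neg_word v)) : W" for v
	unfolding W_def by (intro CollectI bexI[of _ "sgl v"]) auto
	have act: "th (sgl (y # neg_word v)) : W" if "v : lists negs" for y v
	using that
	proof (induction v arbitrary: y rule: list.induct)
	case Nil
	obtain f a where y: "y = (f, a)" by (cases y)
	obtain f1 f2 where f: "f = f1 + f2" "f1 : negs" "ALL n<0. fls_nth f2 n = 0" using negative_split by blast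
	have "th (gen (f2, a)) = pm_scale (kap (f2, a)) (th 1)"
	using th_snoc[of "(f2, a)" 1] f by (simp add: nonneg_iff)
	moreover have "th (sgl [y]) = th (sgl [(f1, 0)]) + th (gen (f2, a))"
	using th_letter(1)[of "[]" "(f1, 0)" "(f2, a)" "[]"] by (simp add: y f)
	ultimately show ?case
	using wordI[of "[f1]"] wordI[of "[]"] f W by (simp add: one_words pm.subspace_add pm.subspace_scale)
	next
	case (Cons g v)
	obtain f a where y: "y = (f, a)" by (cases y)
	obtain f1 f2 where f: "f = f1 + f2" "f1 : negs" "ALL n<0. fls_nth f2 n = 0" using negative_split by blast
	have "th (sgl ((f1, 0) # neg_word (g # v))) : W" using wordI[of "f1 # g # v"] f Cons.prems by simp
	moreover have "th (sgl ((f2, a) # (g, 0) # neg_word v)) : W"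
	proof -
	have "th (sgl ((f2, a) # neg_word v)) : W" using Cons by auto
	then obtain q where q: "q : word_polys negs" "th (sgl ((f2, a) # neg_word v)) = th (push neg_word q)" by (auto simp: W_def)
	have "th (gen (g, 0) * sgl ((f2, a) # neg_word v)) = th (gen (g, 0) * push neg_word q)" by (rule th_left_cong[OF q(2)])
	also have "\<dots> = th (push neg_word (gen g * q))" by (simp add: push_map_times)
	also have "\<dots> : W" unfolding W_def using q Cons.prems by (intro CollectI bexI[of _ "gen g * q"]) auto
	finally have "th (sgl ((g, 0) # (f2, a) # neg_word v)) : W" by simp
	moreover have "th (sgl (abr (f2, a) (g, 0) # neg_word v)) : W" using Cons by auto
	ultimately show ?thesis using th_word_swap[of "[]" "(f2, a)" "(g, 0)" "neg_word v"] W by (simp add: pm.subspace_add)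
	qed
	ultimately show ?case
	using th_letter(1)[of "[]" "(f1, 0)" "(f2, a)" "neg_word (g # v)"] W f by (simp add: y pm.subspace_add)
	qed
	have word: "th (sgl w) : W" for w
	proof (induction w)
	case Nil
	thus ?case using wordI[of "[]"] by simp
	next
	case (Cons x w)
	then obtain q where q: "q : word_polys negs" "th (sgl w) = th (push neg_word q)" by (auto simp: W_def)
	have "pm.subspace {q. th (gen x * push neg_word q) : W}"
	using W by (auto simp: pm.subspace_def P.add P.scale distrib_left times_pm_scale th.add th.scale)
	hence "q : {q. th (gen x * push neg_word q) : W}"
	by (rule supported_memI[OF _ q(1)]) (use act in simp)
	thus ?case using th_left_cong[OF q(2), of "gen x"] by simp
	qed
	have "pm.subspace {p. th p : W}" using W by (auto simp: pm.subspace_def th.add th.scale)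
	hence "p : {p. th p : W}" by (rule pm_subspace_memI) (simp add: word)
	thus ?thesis by (simp add: W_def)
qed
lemma vacuum_vector_class: assumes "q : word_polys negs"
	shows "vacuum_vector D k (uea_class (negative_alg D) q) = theta (push neg_word q)"
proof -
	have "uea_map (affine_alg D) (%f. (f, 0)) (uea_class (negative_alg D) q) = uea_class (affine_alg D) (push neg_word q)"
	by (rule uea_map_class(1)[OF lie_space_neg lie_space_affine]) (use assms neg_lb in auto)
	thus ?thesis by (simp add: vacuum_vector_def theta_def)
qed
end
section \<open>The algebras U and the evaluation of words\<close>
lemma fder_push:
	assumes "!!x. d' (\<phi> x) = \<phi> (d x)"
	shows "fder d' (push (map \<phi>) p) = push (map \<phi>) (fder d p)"
proof -
	interpret P: Vector_Spaces.linear pm_scale pm_scale "push (map \<phi>)" by (rule linear_push)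
	interpret D: Vector_Spaces.linear pm_scale pm_scale "fder d" by (rule linear_free_derivation)
	interpret D': Vector_Spaces.linear pm_scale pm_scale "fder d'" by (rule linear_free_derivation)
	show ?thesis
	proof (rule pm_linear_eq_on[where p=p and sc=pm_scale])
	show "fder d' (push (map \<phi>) (sgl w)) = push (map \<phi>) (fder d (sgl w))" for w
	using dsum_map[of d' \<phi> d, OF assms, of w "%v. sgl v"] dsum_linear[OF linear_push[of "map \<phi>"], of d w "%v. sgl v"]
	by (simp add: fder_sgl)
	qed (auto simp: pm_lin_iff P.add P.scale D.add D.scale D'.add D'.scale)
qed
locale gaudin_U = gaudin_level D k for D :: "('g::ab_group_add) cyclotomic_data" and k +
	fixes n :: "place => nat"
	assumes n_exp: "n : exponents D"
begin
abbreviation mulU (infixl "\<otimes>\<^sub>U" 70) where "a \<otimes>\<^sub>U b == a \<otimes>\<^bsub>U_alg D n\<^esub> b"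
abbreviation addU (infixl "\<oplus>\<^sub>U" 65) where "a \<oplus>\<^sub>U b == a \<oplus>\<^bsub>U_alg D n\<^esub> b"
abbreviation smU (infixr "\<odot>\<^sub>U" 75) where "c \<odot>\<^sub>U b == c \<odot>\<^bsub>U_alg D n\<^esub> b"
abbreviation zeroU ("\<zero>\<^sub>U") where "\<zero>\<^sub>U == \<zero>\<^bsub>U_alg D n\<^esub>"
abbreviation oneU ("\<one>\<^sub>U") where "\<one>\<^sub>U == \<one>\<^bsub>U_alg D n\<^esub>"
abbreviation "UC == carrier (U_alg D n)"
sublocale PL: lie_space "p_alg D" by (rule lie_space_p)
abbreviation "NN == nonneg_multiloops D (marked D)"
lemma ideal_U_ideal: "ideal (U_ideal D n) (uea (p_alg D))"
	unfolding U_ideal_def by (rule PL.U.genideal_ideal) (use PL.uea_incl_closed in auto)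
sublocale UA: calg "U_alg D n"
	unfolding U_alg_def by (rule PL.U.calg_quot[OF ideal_U_ideal])
lemmas csub_U_ideal = PL.U.ideal_csub[OF ideal_U_ideal]
definition cl where "cl p = U_class D n (uea_class (p_alg D) p)"
lemma U_class_closed [simp]: "a : carrier (uea (p_alg D)) ==> U_class D n a : UC"
	by (simp add: U_alg_def quot_simps U_class_def)
lemma U_class_ops:
	assumes "a : carrier (uea (p_alg D))" "b : carrier (uea (p_alg D))"
	shows "U_class D n a \<oplus>\<^sub>U U_class D n b = U_class D n (a \<oplus>\<^bsub>uea (p_alg D)\<^esub> b)"
	"U_class D n a \<otimes>\<^sub>U U_class D n b = U_class D n (a \<otimes>\<^bsub>uea (p_alg D)\<^esub> b)"
	using PL.U.quot_add[OF csub_U_ideal] PL.U.quot_mult[OF ideal_U_ideal] assms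
	by (simp_all add: U_alg_def U_class_def)
lemma U_class_scale:
	"a : carrier (uea (p_alg D)) ==> c \<odot>\<^sub>U U_class D n a = U_class D n (c \<odot>\<^bsub>uea (p_alg D)\<^esub> a)"
	using PL.U.quot_smult[OF csub_U_ideal] by (simp add: U_alg_def U_class_def)
lemma cl_closed [simp]: "p : PL.WP ==> cl p : UC"
	unfolding cl_def by (intro U_class_closed PL.uea_class_closed)
lemma cl_ops:
	assumes "p : PL.WP" "q : PL.WP"
	shows "cl p \<oplus>\<^sub>U cl q = cl (p + q)" "cl p \<otimes>\<^sub>U cl q = cl (p * q)"
	"c \<odot>\<^sub>U cl p = cl (pm_scale c p)"
	using PL.uea_class_closed[OF assms(1)] PL.uea_class_closed[OF assms(2)]
	by (simp_all only: cl_def U_class_ops U_class_scale PL.uea_class_ops[OF assms] PL.uea_class_scale[OF assms(1)])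
lemma cl_one: "\<one>\<^sub>U = cl 1" and cl_zero: "\<zero>\<^sub>U = cl 0"
	using PL.U.quot_zero[OF csub_U_ideal] by (simp_all add: cl_def U_alg_def quot_simps U_class_def PL.uea_one_zero)
lemma cl_surj: "x : UC ==> EX p:PL.WP. x = cl p"
	by (auto simp: U_alg_def quot_simps U_class_def PL.uea_carrier cl_def)
definition rho where "rho f = cl (gen f)"
lemma rho_incl: "rho f = U_class D n (uea_incl (p_alg D) f)" by (simp add: rho_def cl_def uea_incl_def)
lemma gen_NN: "f : NN ==> gen f : PL.WP" by (rule PL.gen_WP) simp
lemma rho_closed [simp]: "f : NN ==> rho f : UC"
	unfolding rho_def by (intro cl_closed gen_NN)
lemma incl_NN: "f : NN ==> uea_incl (p_alg D) f : carrier (uea (p_alg D))"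
	by (rule PL.uea_incl_closed) simp
lemma rho_add: "f : NN ==> h : NN ==> rho (f + h) = rho f \<oplus>\<^sub>U rho h"
	using PL.uea_incl_add[of f h] by (simp add: rho_incl U_class_ops incl_NN)
lemma rho_scale: "f : NN ==> rho (msc c f) = c \<odot>\<^sub>U rho f"
	using PL.uea_incl_scale[of f c] by (simp add: rho_incl U_class_scale incl_NN)
lemma rho_zero: "rho 0 = \<zero>\<^sub>U"
	using rho_scale[OF mv.subspace_0[OF nonneg_subspace], of 0] rho_closed[OF mv.subspace_0[OF nonneg_subspace]] by simp
lemma rho_bracket:
	assumes "f : NN" "h : NN"
	shows "rho f \<otimes>\<^sub>U rho h = rho h \<otimes>\<^sub>U rho f \<oplus>\<^sub>U rho (mb f h)"
	using PL.uea_incl_bracket[of f h] assms nonneg_bracket_closed[OF assms]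
	by (simp add: rho_incl U_class_ops incl_NN)
lemma rho_small:
	assumes "f : NN" "x : U_places D" "!!y. y ~= x ==> f y = 0" "!!i. i < int (n x) ==> fls_nth (f x) i = 0"
	shows "rho f = \<zero>\<^sub>U"
proof -
	have "uea_incl (p_alg D) f : U_ideal D n"
	unfolding U_ideal_def by (rule subsetD[OF PL.U.genideal_self]) (use assms PL.uea_incl_closed in auto)
	hence "uea_incl (p_alg D) f \<ominus>\<^bsub>uea (p_alg D)\<^esub> \<zero>\<^bsub>uea (p_alg D)\<^esub> : U_ideal D n"
	using incl_NN[OF assms(1)] by (simp add: PL.U.minus_eq)
	hence "U_class D n (uea_incl (p_alg D) f) = U_class D n \<zero>\<^bsub>uea (p_alg D)\<^esub>"
	unfolding U_class_def using PL.U.coset_eq_iff[OF csub_U_ideal incl_NN[OF assms(1)] PL.U.zero_closed] by simp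
	thus ?thesis by (simp add: rho_incl cl_zero cl_def PL.uea_one_zero)
qed
abbreviation "em == emb (U_alg D n)"
abbreviation "un == unemb (U_alg D n)"
definition res :: "'g multiloop => 'g multiloop" where "res f = (%x. if x : U_places D then f x else 0)"
lemma res_add: "res (f + h) = res f + res h" and res_scale: "res (msc c f) = msc c (res f)"
	and res_mb: "res (mb f h) = mb (res f) (res h)" and res_zero: "res 0 = 0"
	by (auto simp: res_def fun_eq_iff mb_Infty multiloop_bracket_def split: place.splits)
definition R :: "'g multiloop \<times> complex => ('g U_elem pm) => ('g U_elem pm)" where
	"R x v = em (un v \<otimes>\<^sub>U rho (res (fst x))) + pm_scale (snd x * k) v"
abbreviation "e1 == em \<one>\<^sub>U"
text \<open>The places of the Lie algebra to which a letter of the affine algebra is attached.\<close>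
definition atl :: "complex => 'g fls \<times> complex => 'g multiloop \<times> complex" where
	"atl y x = (at_place y (fst x), snd x)"
lemma rp_nonneg:
	assumes "ALL i<0. fls_nth f i = 0" "ALL i<0. fls_nth h i = 0" shows "rp f h = 0"
proof -
	have "fls_nth (ld h) i = 0" if "i < 0" for i using assms(2) that by (cases "i = -1") auto
	thus ?thesis unfolding rp_def lf_conv fls_residue_def
	by (subst gfb.conv_nth[of 0 _ 0]) (use assms(1) in auto)
qed
lemma cocycle_nonneg:
	assumes "f : nonneg_multiloops D S" "h : nonneg_multiloops D S'" shows "cocycle D SS f h = 0"
	unfolding cocycle_eq using assms by (simp add: nonneg_multiloops_def rp_nonneg)
lemma lb_const: "fls_nth (lb (ten 1 X) h) m = gb X (fls_nth h m)"
	by (induction h rule: fls_vec_induct) (simp_all add: lb_ten lb_add gb.add gb.scale)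
lemma rp_const: "rp (ten 1 X) h = 0"
	by (induction h rule: fls_vec_induct) (simp_all add: rp_ten rp_add)
lemma p_derivation_eq: "p_derivation D X f x = lb (ten 1 X) (f x)"
	unfolding p_derivation_def
	by (rule fls_eqI) (subst nth_Abs_fls_lower_bound[of "fls_subdegree (f x)"], auto simp: lb_const)
lemma p_derivation_closed: assumes "sig X = X" "f : NN" shows "p_derivation D X f : NN"
proof -
	have e: "equivariant c (ten 1 X)" for c using assms(1) by (auto simp: equivariant_def)
	have "equivariant (inverse om) (f Infty)" "equivariant om (f (At 0))"
	using assms(2) by (auto simp: nonneg_multiloops_def multiloop_space_eq)
	thus ?thesis using assms(2) equivariant_lb[OF e] omega_nonzero
	unfolding nonneg_multiloops_def multiloop_space_eq by (simp add: p_derivation_eq lb_const)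
qed
lemma p_derivation_ideal: assumes "sig X = X" "r : uea_ideal (p_alg D)"
	shows "fder (p_derivation D X) r : uea_ideal (p_alg D)"
proof (rule PL.fder_uea_ideal[OF _ _ _ _ assms(2)])
	fix f h
	show "f : lcarrier (p_alg D) ==> p_derivation D X f : lcarrier (p_alg D)" using p_derivation_closed[OF assms(1)] by simp
	show "p_derivation D X (f + h) = p_derivation D X f + p_derivation D X h"
	by (rule ext) (simp add: p_derivation_eq lb_add)
	show "p_derivation D X (lscale (p_alg D) c f) = lscale (p_alg D) c (p_derivation D X f)" for c
	by (rule ext) (simp add: p_derivation_eq lb_scale)
	show "p_derivation D X (lbracket (p_alg D) f h) = lbracket (p_alg D) (p_derivation D X f) h + lbracket (p_alg D) f (p_derivation D X h)"
	proof (rule ext)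
	fix x show "p_derivation D X (lbracket (p_alg D) f h) x = (lbracket (p_alg D) (p_derivation D X f) h + lbracket (p_alg D) f (p_derivation D X h)) x"
	using lb_jacobi[of "ten 1 X" "f x" "h x"] lb_jacobi[of "ten 1 X" "h x" "f x"]
	by (cases x) (simp_all add: p_derivation_eq mb_Infty)
	qed
qed
definition dlt where "dlt X = U_derivation D n X"
lemma fder_WP: assumes "sig X = X" "p : PL.WP" shows "fder (p_derivation D X) p : PL.WP"
	by (rule fder_supported[OF assms(2)]) (use p_derivation_closed[OF assms(1)] in simp)
lemma dlt_cl:
	assumes X: "sig X = X" and p: "p : PL.WP"
	shows "dlt X (cl p) = cl (fder (p_derivation D X) p)"
proof -
	let ?d = "fder (p_derivation D X)" and ?c = "uea_class (p_alg D)" and ?U = "uea (p_alg D)"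
	interpret d: Vector_Spaces.linear pm_scale pm_scale ?d by (rule linear_free_derivation)
	have Up: "Up_derivation D X (?c q) = ?c (?d q)" if "q : PL.WP" for q
	unfolding Up_derivation_def
	by (rule PL.uea_class_UN[OF that])
	(use that fder_WP[OF X] p_derivation_ideal[OF X] in "auto simp: PL.uea_class_eq_iff simp flip: d.diff")
	define J where "J = {a : U_ideal D n. Up_derivation D X a : U_ideal D n}"
	have cls: "a : carrier ?U ==> EX q:PL.WP. a = ?c q" for a by (auto simp: PL.uea_carrier)
	have UI: "U_ideal D n <= carrier ?U" using csub_U_ideal by (simp add: csub_def)
	have Upops: "Up_derivation D X (a \<oplus>\<^bsub>?U\<^esub> b) = Up_derivation D X a \<oplus>\<^bsub>?U\<^esub> Up_derivation D X b"
	"Up_derivation D X (a \<otimes>\<^bsub>?U\<^esub> b) = Up_derivation D X a \<otimes>\<^bsub>?U\<^esub> b \<oplus>\<^bsub>?U\<^esub> a \<otimes>\<^bsub>?U\<^esub> Up_derivation D X b"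
	"Up_derivation D X (c \<odot>\<^bsub>?U\<^esub> a) = c \<odot>\<^bsub>?U\<^esub> Up_derivation D X a"
	"Up_derivation D X a : carrier ?U"
	if ab: "a : carrier ?U" "b : carrier ?U" for a b c
	proof -
	from cls[OF ab(1)] obtain q where q: "q : PL.WP" "a = ?c q" by (elim bexE)
	from cls[OF ab(2)] obtain r where r: "r : PL.WP" "b = ?c r" by (elim bexE)
	note W = q(1) r(1) fder_WP[OF X q(1)] fder_WP[OF X r(1)]
	have W2: "?d q * r : PL.WP" "q * ?d r : PL.WP" "q * r : PL.WP" "q + r : PL.WP" "pm_scale c q : PL.WP" using W by blast+
	show "Up_derivation D X (a \<oplus>\<^bsub>?U\<^esub> b) = Up_derivation D X a \<oplus>\<^bsub>?U\<^esub> Up_derivation D X b"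
	"Up_derivation D X (a \<otimes>\<^bsub>?U\<^esub> b) = Up_derivation D X a \<otimes>\<^bsub>?U\<^esub> b \<oplus>\<^bsub>?U\<^esub> a \<otimes>\<^bsub>?U\<^esub> Up_derivation D X b"
	"Up_derivation D X (c \<odot>\<^bsub>?U\<^esub> a) = c \<odot>\<^bsub>?U\<^esub> Up_derivation D X a"
	"Up_derivation D X a : carrier ?U"
	unfolding q(2) r(2)
	by (simp_all only: PL.uea_class_ops[OF W(1,2)] PL.uea_class_ops[OF W(3,4)] PL.uea_class_ops[OF W(3,2)] PL.uea_class_ops[OF W(1,4)]
	PL.uea_class_ops[OF W2(1,2)] PL.uea_class_scale[OF W(1)] PL.uea_class_scale[OF W(3)] Up[OF W(1)] Up[OF W(2)] Up[OF W2(3)] Up[OF W2(4)] Up[OF W2(5)]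
	fder_times d.add d.scale PL.uea_class_closed[OF W(3)])
	qed
	have idl: "ideal J ?U"
	proof -
	interpret I: ideal "U_ideal D n" ?U by (rule ideal_U_ideal)
	have "csub ?U J" unfolding csub_def J_def
	proof (intro conjI ballI allI)
	have "Up_derivation D X \<zero>\<^bsub>?U\<^esub> = \<zero>\<^bsub>?U\<^esub>" using Up[of 0] by (simp add: PL.uea_one_zero)
	thus "\<zero>\<^bsub>?U\<^esub> : {a : U_ideal D n. Up_derivation D X a : U_ideal D n}" using csub_U_ideal by (simp add: csub_def)
	qed (use UI csub_U_ideal Upops(1) Upops(3)[OF subsetD[OF UI] subsetD[OF UI]] in "auto simp: csub_def subset_iff")
	then interpret J: abelian_subgroup J ?U by (rule PL.U.additive_subgroup_csub)
	show ?thesis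
	proof (rule idealI[OF PL.U.ring_axioms J.a_subgroup])
	fix a x assume "a : J" and x: "x : carrier ?U"
	hence a: "a : U_ideal D n" "Up_derivation D X a : U_ideal D n" by (auto simp: J_def)
	have ac: "a : carrier ?U" using a UI by auto
	show "x \<otimes>\<^bsub>?U\<^esub> a : J" "a \<otimes>\<^bsub>?U\<^esub> x : J"
	using a x ac Upops(2,4)[OF x ac] Upops(2,4)[OF ac x] Upops(4)[OF x x]
	by (auto simp: J_def I.I_l_closed I.I_r_closed I.a_closed)
	qed
	qed
	have "U_ideal D n <= J"
	proof -
	have "{uea_incl (p_alg D) f | f x. x : U_places D &
	f : lcarrier (p_alg D) & (ALL y. y ~= x --> f y = 0) & (ALL i < int (n x). fls_nth (f x) i = 0)} <= J" (is "?G <= J")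
	proof
	fix a assume a: "a : ?G"
	then obtain f x where f: "a = uea_incl (p_alg D) f" "x : U_places D" "f : NN" "ALL y. y ~= x --> f y = 0" "ALL i < int (n x). fls_nth (f x) i = 0" by auto
	have G: "?G <= U_ideal D n"
	unfolding U_ideal_def by (rule PL.U.genideal_self) (use PL.uea_incl_closed in auto)
	have "Up_derivation D X a = uea_incl (p_alg D) (p_derivation D X f)"
	unfolding f(1) uea_incl_def Up[OF gen_NN[OF f(3)]] by (simp add: fder_sgl)
	also have "\<dots> : ?G"
	using f p_derivation_closed[OF X f(3)]
	by (intro CollectI exI[of _ "p_derivation D X f"] exI[of _ x]) (auto simp: p_derivation_eq lb_const)
	finally show "a : J" using G a by (auto simp: J_def)
	qed
	thus ?thesis unfolding U_ideal_def[of D n] by (rule PL.U.genideal_minimal[OF idl])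
	qed
	hence J: "Up_derivation D X a : U_ideal D n" if "a : U_ideal D n" for a using that by (auto simp: J_def)
	have "U_class D n (Up_derivation D X a) = U_class D n (Up_derivation D X (?c p))"
	if a: "a : carrier ?U" and d: "a \<ominus>\<^bsub>?U\<^esub> ?c p : U_ideal D n" for a
	proof -
	have cp: "?c p : carrier ?U" using p by (rule PL.uea_class_closed)
	have "a \<ominus>\<^bsub>?U\<^esub> ?c p = a \<oplus>\<^bsub>?U\<^esub> (-1) \<odot>\<^bsub>?U\<^esub> ?c p" using cp by (simp add: PL.U.minus_eq PL.U.a_inv_eq_sm)
	hence "Up_derivation D X (a \<ominus>\<^bsub>?U\<^esub> ?c p) = Up_derivation D X a \<ominus>\<^bsub>?U\<^esub> Up_derivation D X (?c p)"
	using a cp Upops(1,3,4) by (simp add: PL.U.minus_eq PL.U.a_inv_eq_sm)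
	thus ?thesis unfolding U_class_def
	using J[OF d] Upops(4) a cp by (subst PL.U.coset_eq_iff[OF csub_U_ideal]) auto
	qed
	hence "(\<Union>a\<in>U_class D n (?c p). U_class D n (Up_derivation D X a)) = U_class D n (Up_derivation D X (?c p))"
	unfolding U_class_def[of D n "?c p"] by (intro PL.U.quot_UN[OF csub_U_ideal PL.uea_class_closed[OF p]])
	thus ?thesis by (simp add: dlt_def U_derivation_def cl_def Up[OF p])
qed
lemma dlt_ops:
	assumes X: "sig X = X" and a: "a : UC" and b: "b : UC"
	shows "dlt X (a \<oplus>\<^sub>U b) = dlt X a \<oplus>\<^sub>U dlt X b"
	"dlt X (a \<otimes>\<^sub>U b) = dlt X a \<otimes>\<^sub>U b \<oplus>\<^sub>U a \<otimes>\<^sub>U dlt X b"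
	"dlt X (c \<odot>\<^sub>U a) = c \<odot>\<^sub>U dlt X a"
	"dlt X a : UC"
proof -
	let ?d = "fder (p_derivation D X)"
	interpret d: Vector_Spaces.linear pm_scale pm_scale ?d by (rule linear_free_derivation)
	from cl_surj[OF a] obtain q where q: "q : PL.WP" "a = cl q" by (elim bexE)
	from cl_surj[OF b] obtain r where r: "r : PL.WP" "b = cl r" by (elim bexE)
	note W = q(1) r(1) fder_WP[OF X q(1)] fder_WP[OF X r(1)]
	have W2: "?d q * r : PL.WP" "q * ?d r : PL.WP" "q * r : PL.WP" "q + r : PL.WP" "pm_scale c q : PL.WP" using W by blast+
	show "dlt X (a \<oplus>\<^sub>U b) = dlt X a \<oplus>\<^sub>U dlt X b"
	"dlt X (a \<otimes>\<^sub>U b) = dlt X a \<otimes>\<^sub>U b \<oplus>\<^sub>U a \<otimes>\<^sub>U dlt X b"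
	"dlt X (c \<odot>\<^sub>U a) = c \<odot>\<^sub>U dlt X a"
	"dlt X a : UC"
	unfolding q(2) r(2)
	by (simp_all only: cl_ops[OF W(1,2)] cl_ops[OF W(3,4)] cl_ops[OF W(3,2)] cl_ops[OF W(1,4)] cl_ops(1)[OF W2(1,2)]
	cl_ops(3)[OF W(1,1)] cl_ops(3)[OF W(3,3)] dlt_cl[OF X W(1)] dlt_cl[OF X W(2)] dlt_cl[OF X W2(3)] dlt_cl[OF X W2(4)] dlt_cl[OF X W2(5)]
	fder_times d.add d.scale cl_closed[OF W(3)])
qed
lemma dlt_scale: "sig X = X ==> a : UC ==> dlt X (c \<odot>\<^sub>U a) = c \<odot>\<^sub>U dlt X a"
	and dlt_closed: "sig X = X ==> a : UC ==> dlt X a : UC"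
	by (rule dlt_ops, assumption+)+
lemma dlt_rho: assumes "sig X = X" "f : NN" shows "dlt X (rho f) = rho (p_derivation D X f)"
	unfolding rho_def dlt_cl[OF assms(1) gen_NN[OF assms(2)]] by (simp add: fder_sgl)
lemma dlt_zero_one: assumes X: "sig X = X"
	shows "dlt X \<zero>\<^sub>U = \<zero>\<^sub>U" "dlt X \<one>\<^sub>U = \<zero>\<^sub>U"
proof -
	interpret d: Vector_Spaces.linear pm_scale pm_scale "fder (p_derivation D X)" by (rule linear_free_derivation)
	show "dlt X \<zero>\<^sub>U = \<zero>\<^sub>U" "dlt X \<one>\<^sub>U = \<zero>\<^sub>U"
	using dlt_cl[OF X, of 0] dlt_cl[OF X, of 1] by (simp_all add: cl_one cl_zero) (simp add: one_words fder_sgl)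
qed
end
locale gaudin_eval = gaudin_U D k n + gaudin_points D E
	for D :: "('g::ab_group_add) cyclotomic_data" and k n E
begin
lemma res_PE: assumes "x : PE" shows "res (fst x) : NN"
	using assms zero_marked unfolding PE_def nonneg_multiloops_def multiloop_space_eq
	by (auto simp: res_def U_places_def)
lemma R_linear: assumes "p : PE" shows "pmlin (R p)"
	using res_PE[OF assms] unfolding Vector_Spaces.linear_iff R_def
	by (simp add: pm.vector_space_axioms UA.unemb_add UA.unemb_scale UA.l_distr UA.emb_add UA.sm_mult1 UA.emb_scale
	pm.scale_right_distrib mult.commute)
sublocale Sp: split_lie hsc "hbr SE" LE GG PE pm_scale R
proof (intro split_lie.intro h_lie split_lie_axioms.intro)
	fix p q and a :: "'g U_elem pm" assume p: "p : PE" and q: "q : PE"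
	note P = res_PE[OF p] and Q = res_PE[OF q]
	show "R (p + q) a = R p a + R q a"
	unfolding R_def using P Q by (simp add: res_add rho_add UA.r_distr UA.emb_add distrib_right pm.scale_left_distrib)
	have z: "snd (hbr SE p q) = 0" "fst (hbr SE p q) = mb (fst p) (fst q)"
	using p q cocycle_nonneg by (auto simp: PE_def hbr_def split: prod.splits)
	have B: "rho (mb (res (fst p)) (res (fst q))) : UC" using nonneg_bracket_closed[OF P Q] by simp
	have "un a \<otimes>\<^sub>U rho (res (fst p)) \<otimes>\<^sub>U rho (res (fst q)) =
	un a \<otimes>\<^sub>U rho (res (fst q)) \<otimes>\<^sub>U rho (res (fst p)) \<oplus>\<^sub>U un a \<otimes>\<^sub>U rho (mb (res (fst p)) (res (fst q)))"
	using P Q B rho_bracket[OF P Q] by (simp add: UA.m_assoc UA.r_distr)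
	hence "em (un a \<otimes>\<^sub>U rho (res (fst p)) \<otimes>\<^sub>U rho (res (fst q))) =
	em (un a \<otimes>\<^sub>U rho (res (fst q)) \<otimes>\<^sub>U rho (res (fst p))) + em (un a \<otimes>\<^sub>U rho (mb (res (fst p)) (res (fst q))))"
	using P Q B by (simp add: UA.emb_add)
	thus "R (hbr SE p q) a = R q (R p a) - R p (R q a)"
	unfolding R_def z res_mb using P Q
	by (simp add: UA.unemb_add UA.unemb_scale UA.l_distr UA.emb_add UA.sm_mult1 UA.emb_scale pm.scale_right_distrib mult.commute)
next
	fix p c and a :: "'g U_elem pm" assume p: "p : PE"
	show "R (hsc c p) a = pm_scale c (R p a)"
	unfolding R_def hsc_def using res_PE[OF p]
	by (simp add: res_scale rho_scale UA.sm_mult2 UA.emb_scale pm.scale_right_distrib split_beta mult.assoc)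
qed (use LE_subspace GG_subspace PE_subspace PE_LE GG_LE LE_bracket GG_bracket PE_bracket LE_split GG_PE_disjoint
	pm.vector_space_axioms R_linear in auto)
lemma hbr_atl: assumes "v : E" shows "hbr SE P (atl v y) = atl v (abr (fst P (At v), 0) y)"
proof -
	obtain f a where P: "P = (f, a)" by (cases P)
	obtain h b where y: "y = (h, b)" by (cases y)
	have v: "v : SE" "v ~= 0" using assms E0 by (auto simp: SE_def)
	have "(SUM x:SE. rp (f (At x)) (at_place v h (At x))) = (SUM x:SE. if x = v then rp (f (At v)) h else 0)"
	by (rule sum.cong) (auto simp: at_place_def)
	hence "cocycle D SE f (at_place v h) = rp (f (At v)) h"
	unfolding cocycle_eq using v finSE by (simp add: at_place_def)
	moreover have "mb f (at_place v h) = at_place v (lb (f (At v)) h)"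
	by (auto simp: fun_eq_iff at_place_def multiloop_bracket_def split: place.splits)
	ultimately show ?thesis by (simp add: P y atl_def)
qed
lemma atl_LE: "v : E ==> atl v x : LE"
	using E0 unfolding LE_def multiloop_space_eq by (auto simp: atl_def at_place_def SE_def)
lemma atl_PE: "v : E ==> x : affine_nonneg ==> atl v x : PE"
	by (rule PE_I[OF atl_LE]) (auto simp: atl_def at_place_def affine_nonneg_def)
lemma R_atl: assumes "v : E" shows "R (atl v x) a = pm_scale (kap x) a"
proof -
	have "At v ~: U_places D" using assms E0 E_marked by (auto simp: U_places_def)
	hence "res (fst (atl v x)) = 0" by (auto simp: res_def atl_def at_place_def fun_eq_iff)
	thus ?thesis by (simp add: R_def rho_zero kap_def) (simp add: atl_def)
qed
abbreviation "pat v == push (map (atl v))"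
lemma atl_words: "v : E ==> map (atl v) w : lists LE" using atl_LE by auto
lemma pat_WP: "v : E ==> pat v p : word_polys LE"
	by (rule supported_push[of p UNIV]) (use atl_words in auto)
lemma atl_add: "atl v (x + y) = atl v x + atl v y" and atl_scale: "atl v (asc c x) = hsc c (atl v x)"
	by (auto simp: atl_def at_place_def fun_eq_iff asc_def hsc_def split: prod.splits)
lemma atl_br: assumes "v : E" shows "atl v (abr x y) = hbr SE (atl v x) (atl v y)"
	unfolding hbr_atl[OF assms] by (simp add: atl_def at_place_def abr_def split_beta)
lemma pat_ideal: assumes "v : E" "r : AI" shows "pat v r : uea_ideal Sp.LL"
proof -
	interpret LL: lie_space Sp.LL by (rule Sp.lie_space_LL)
	have *: "uea_map Sp.LL (atl v) (uea_class (affine_alg D) p) = uea_class Sp.LL (pat v p)" for p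
	by (rule uea_map_class(1)[OF lie_space_affine Sp.lie_space_LL])
	(simp_all add: atl_LE assms atl_add atl_scale atl_br)
	have "uea_class (affine_alg D) r = uea_class (affine_alg D) 0" using assms by (subst AL.uea_class_eq_iff) auto
	hence "uea_class Sp.LL (pat v r) = uea_class Sp.LL (pat v 0)" using *[of r] *[of 0] by simp
	moreover have "pat v 0 = 0" by (simp add: push_def)
	ultimately show ?thesis using LL.uea_class_eq_iff[of "pat v r" 0] pat_WP[OF assms(1)] by simp
qed
lemma eval_vacuum_map:
	assumes "v : E" "q : word_polys LE"
	shows "vacuum_map pm_scale (%r. Sp.PsiL e (q * pat v r))"
	unfolding vacuum_map_def
proof (intro conjI ballI allI)
	interpret LL: lie_space Sp.LL by (rule Sp.lie_space_LL)
	interpret P: Vector_Spaces.linear pm_scale pm_scale "pat v" by (rule linear_push)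
	show "pmlin (%r. Sp.PsiL e (q * pat v r))"
	by (auto simp: pm_lin_iff P.add P.scale distrib_left times_pm_scale Sp.PsiL.add Sp.PsiL_scale)
	show "Sp.PsiL e (q * pat v r) = 0" if "r : AI" for r
	using LL.uea_ideal_times[OF pat_ideal[OF assms(1) that], of q 1] assms(2) Sp.PsiL_ideal[of e] by auto
	show "Sp.PsiL e (q * pat v (p * gen x)) = pm_scale (kap x) (Sp.PsiL e (q * pat v p))" if "x : affine_nonneg" for p x
	using Sp.PsiL_snoc[OF atl_PE[OF assms(1) that], of e "q * pat v p"]
	by (simp add: push_map_times R_atl[OF assms(1)] mult.assoc)
qed
lemma Psi_e1: "em (un (Sp.Psi e1 w)) = Sp.Psi e1 w"
proof -
	have "em (un (Sp.Psi e1 w)) = Sp.Psi (em (un e1)) w"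
	proof (rule Sp.Psi_endo)
	show "pmlin (%a. em (un a))"
	by (simp add: pm_lin_iff UA.unemb_add UA.unemb_scale UA.emb_add UA.emb_scale)
	show "em (un (R p a)) = R p (em (un a))" if "p : PE" for p a
	using res_PE[OF that] by (simp add: R_def UA.unemb_add UA.unemb_scale UA.emb_add UA.emb_scale)
	qed
	thus ?thesis by simp
qed
lemma PsiL_e1: "em (un (Sp.PsiL e1 p)) = Sp.PsiL e1 p"
proof (rule pm_linear_eq_on[where p=p and sc=pm_scale])
	show "pmlin (%p. em (un (Sp.PsiL e1 p)))"
	by (simp add: pm_lin_iff UA.unemb_add UA.unemb_scale UA.emb_add UA.emb_scale Sp.PsiL.add Sp.PsiL_scale)
qed (auto simp: Sp.PsiL_linear Psi_e1)
text \<open>A singular vector on the right splits off as a left factor.\<close>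
lemma eval_product:
	assumes u: "u : E" and v: "v : E" and q: "sing q"
	shows "Sp.PsiL e1 (pat u p * pat v q) = em (un (Sp.PsiL e1 (pat v q)) \<otimes>\<^sub>U un (Sp.PsiL e1 (pat u p)))"
proof -
	define c where "c = un (Sp.PsiL e1 (pat v q))"
	have c: "c : UC" "em c = Sp.PsiL e1 (pat v q)" by (simp_all add: c_def PsiL_e1)
	let ?l = "%a. em (c \<otimes>\<^sub>U un a)"
	have l: "pmlin ?l"
	using c by (simp add: pm_lin_iff UA.unemb_add UA.unemb_scale UA.emb_add UA.emb_scale UA.r_distr UA.sm_mult2)
	interpret l: Vector_Spaces.linear pm_scale pm_scale ?l by (rule l)
	interpret P: Vector_Spaces.linear pm_scale pm_scale "pat u" by (rule linear_push)
	have word: "Sp.PsiL e1 (sgl (map (atl u) w) * pat v q) = ?l (Sp.Psi e1 (map (atl u) w))" for w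
	proof -
	have "Sp.PsiL e1 (sgl (map (atl u) w) * pat v q) = Sp.Psi (Sp.PsiL e1 (pat v q)) (map (atl u) w)"
	proof (rule Sp.Psi_split_off[where S="range (atl u)"])
	show "hbr SE (Sp.proj x) y : range (atl u)" if "x : range (atl u)" "y : range (atl u)" for x y
	using that(2) by (elim imageE) (simp add: hbr_atl[OF u])
	fix x w' assume x: "x : range (atl u)" and "w' : lists (range (atl u))"
	hence w': "sgl w' : word_polys LE" using atl_LE[OF u] by (auto intro!: supported_single)
	let ?y = "(fst (Sp.proj x) (At v), 0) :: 'g fls \<times> complex"
	have y: "?y : affine_nonneg" using Sp.proj(2)[of x] by (auto simp: nonneg_iff PE_def nonneg_multiloops_def)
	have "fder (hbr SE (Sp.proj x)) (pat v q) = pat v (fder (abr ?y) q)"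
	by (rule fder_push) (rule hbr_atl[OF v])
	thus "Sp.PsiL e1 (sgl w' * fder (hbr SE (Sp.proj x)) (pat v q)) = 0"
	using vacuum_map_zero[OF eval_vacuum_map[OF v w'] sing_ad[OF q y]] by simp
	qed auto
	also have "\<dots> = Sp.Psi (?l e1) (map (atl u) w)" using c by simp
	also have "\<dots> = ?l (Sp.Psi e1 (map (atl u) w))"
	proof (rule Sp.Psi_endo[OF l, symmetric])
	show "?l (R p a) = R p (?l a)" if "p : PE" for p a
	using res_PE[OF that] c by (simp add: R_def UA.unemb_add UA.unemb_scale UA.emb_add UA.emb_scale UA.r_distr UA.sm_mult2 UA.m_assoc)
	qed
	finally show ?thesis .
	qed
	have "Sp.PsiL e1 (pat u p * pat v q) = ?l (Sp.PsiL e1 (pat u p))"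
	by (rule pm_linear_eq_on[where p=p and sc=pm_scale])
	(auto simp: pm_lin_iff P.add P.scale distrib_right pm_scale_times Sp.PsiL.add Sp.PsiL_scale l.add l.scale word)
	thus ?thesis by (simp add: c_def)
qed
lemma eval_swap:
	assumes u: "u : E" and v: "v : E" and uv: "u ~= v"
	shows "Sp.PsiL e (pat u p * pat v q) = Sp.PsiL e (pat v q * pat u p)"
proof -
	interpret P: Vector_Spaces.linear pm_scale pm_scale "pat u" by (rule linear_push)
	interpret Q: Vector_Spaces.linear pm_scale pm_scale "pat v" by (rule linear_push)
	have "abr (0, 0) y = 0" for y by (cases y) (simp add: zero_prod_def)
	hence br: "hbr SE (atl u x) (atl v y) = 0" for x y
	using uv unfolding hbr_atl[OF v] by (simp add: atl_def at_place_def zero_prod_def fun_eq_iff)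
	have sw1: "Sp.Psi e (a @ atl u x # atl v y # b) = Sp.Psi e (a @ atl v y # atl u x # b)" for a b x y
	using Sp.Psi_swap[OF atl_LE[OF u] atl_LE[OF v], of e a x y b] br Sp.Psi_letter(5)[of e a b] by simp
	have sw2: "Sp.Psi e (a @ map (atl u) w @ atl v y # b) = Sp.Psi e (a @ atl v y # map (atl u) w @ b)" for a w y b
	proof (induction w arbitrary: a)
	case (Cons x w)
	thus ?case using sw1[of a x y "map (atl u) w @ b"] Cons[of "a @ [atl u x]"] by simp
	qed simp
	have sw3: "Sp.Psi e (map (atl u) w @ map (atl v) w') = Sp.Psi e (map (atl v) w' @ map (atl u) w)" for w w'
	proof -
	have "Sp.Psi e (a @ map (atl u) w @ map (atl v) w') = Sp.Psi e (a @ map (atl v) w' @ map (atl u) w)" for a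
	proof (induction w' arbitrary: a)
	case (Cons y w')
	thus ?case using sw2[of a w y "map (atl v) w'"] Cons[of "a @ [atl v y]"] by simp
	qed simp
	from this[of "[]"] show ?thesis by simp
	qed
	have 1: "Sp.PsiL e (sgl (map (atl u) w) * pat v q) = Sp.PsiL e (pat v q * sgl (map (atl u) w))" for w
	by (rule pm_linear_eq_on[where p=q and sc=pm_scale])
	(auto simp: pm_lin_iff Q.add Q.scale distrib_left distrib_right pm_scale_times times_pm_scale Sp.PsiL.add Sp.PsiL_scale sw3)
	show ?thesis
	by (rule pm_linear_eq_on[where p=p and sc=pm_scale])
	(auto simp: pm_lin_iff P.add P.scale distrib_left distrib_right pm_scale_times times_pm_scale Sp.PsiL.add Sp.PsiL_scale 1)
qed
lemma Psi_atl_Cons: assumes "u : E"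
	shows "Sp.Psi e (map (atl u) (x # w)) = R (Sp.proj (atl u x)) (Sp.Psi e (map (atl u) w)) +
	dsum (abr (fst (Sp.proj (atl u x)) (At u), 0)) w (%v. Sp.Psi e (map (atl u) v))"
	using dsum_map[of "hbr SE (Sp.proj (atl u x))" "atl u", OF hbr_atl[OF assms]] by (simp add: Sp.Psi_Cons)
text \<open>Invariance: the constant functions act by derivations.\<close>
lemma eval_invariant:
	assumes X: "sig X = X" and u: "u : E" and p: "sing p"
	shows "dlt X (un (Sp.PsiL e1 (pat u p))) = \<zero>\<^sub>U"
proof -
	define c where "c = gemb (%t. X)"
	have cG: "c : GG" unfolding c_def by (rule gemb_GG) (simp_all add: ratg_const equivariant_fun_def X)
	have GE: "GE (%t. X) x = ten 1 X" for x using GE_tensor[of "%t. 1" X x] by simp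
	have c: "fst c Infty = - ten 1 X" "y = 0 | y : SE ==> fst c (At y) = ten 1 X" "snd c = 0" for y
	by (simp_all add: c_def gemb_simps GE)
	let ?b = "hbr SE"
	have bP: "?b c y : PE" "snd (?b c y) = 0" "res (fst (?b c y)) = p_derivation D X (res (fst y))" if "y : PE" for y
	proof -
	have nz: "fst y (At z) = 0" if "z ~= 0" "z ~: SE" for z
	using that \<open>y : PE\<close> by (auto simp: PE_def nonneg_multiloops_def multiloop_space_eq)
	have f: "fst (?b c y) Infty = lb (ten 1 X) (fst y Infty)" "fst (?b c y) (At z) = lb (ten 1 X) (fst y (At z))" for z
	using c nz[of z] lb_anti[of "fst y Infty" "- ten 1 X"] lb_minus(1)[of "ten 1 X" "fst y Infty"]
	by (cases "z = 0 | z : SE"; simp add: hbr_def split_beta mb_Infty)+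
	show "?b c y : PE"
	using \<open>y : PE\<close> PE_LE GG_LE cG
	by (intro PE_I LE_bracket) (auto simp: f lb_const PE_def nonneg_multiloops_def)
	show "snd (?b c y) = 0" unfolding hbr_def split_beta snd_conv cocycle_eq
	using c by (simp add: rp_const rp_minus)
	show "res (fst (?b c y)) = p_derivation D X (res (fst y))"
	proof (rule ext)
	fix x show "res (fst (?b c y)) x = p_derivation D X (res (fst y)) x"
	by (cases x) (simp_all add: res_def p_derivation_eq f)
	qed
	qed
	have bproj: "Sp.proj (?b c x) = ?b c (Sp.proj x)" if "x : LE" for x
	proof (rule Sp.proj_eqI)
	show "?b c x - ?b c (Sp.proj x) : GG"
	using GG_bracket[OF cG Sp.diff_proj[OF that]] by (simp add: Sp.br_diff)
	qed (rule bP(1)[OF Sp.proj(2)])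
	let ?\<delta> = "%a. em (dlt X (un a))"
	have \<delta>: "pmlin ?\<delta>"
	by (simp add: pm_lin_iff UA.unemb_add UA.unemb_scale dlt_ops(1)[OF X] dlt_scale[OF X] dlt_closed[OF X] UA.emb_add UA.emb_scale)
	interpret \<delta>: Vector_Spaces.linear pm_scale pm_scale ?\<delta> by (rule \<delta>)
	have \<delta>R: "?\<delta> (R y a) = R (?b c y) a + R y (?\<delta> a)" if y: "y : PE" for y a
	using res_PE[OF y] p_derivation_closed[OF X res_PE[OF y]]
	by (simp add: R_def bP[OF y] UA.unemb_add UA.unemb_scale dlt_ops(1,2)[OF X] dlt_scale[OF X] dlt_closed[OF X] UA.emb_add UA.emb_scale dlt_rho[OF X] add_ac)
	have "?\<delta> (Sp.Psi e1 w) = dsum (?b c) w (Sp.Psi e1)" if "w : lists LE" for w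
	using that
	proof (induction "length w" arbitrary: w rule: less_induct)
	case less
	show ?case
	proof (cases w)
	case Nil
	thus ?thesis by (simp add: dlt_zero_one[OF X])
	next
	case (Cons x w')
	hence x: "x : LE" "w' : lists LE" using less.prems by auto
	let ?p = "Sp.proj x"
	have IH: "?\<delta> (Sp.Psi e1 v) = dsum (?b c) v (Sp.Psi e1)" if "v : lists LE" "length v = length w'" for v
	using less that Cons by simp
	have "dsum (?b ?p) w' (%v. ?\<delta> (Sp.Psi e1 v)) = dsum (?b ?p) w' (%v. dsum (?b c) v (Sp.Psi e1))"
	by (rule dsum_cong_lists[OF x(2) LE_bracket[OF subsetD[OF PE_LE Sp.proj(2)]] IH])
	hence L: "?\<delta> (Sp.Psi e1 w) = R (?b c ?p) (Sp.Psi e1 w') + R ?p (dsum (?b c) w' (Sp.Psi e1)) + dsum (?b ?p) w' (%v. dsum (?b c) v (Sp.Psi e1))"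
	using dsum_linear[OF \<delta>, of "?b ?p" w' "Sp.Psi e1"] IH[OF x(2) refl]
	by (simp add: Cons Sp.Psi_Cons \<delta>.add \<delta>R[OF Sp.proj(2)])
	have "dsum (?b c) w' (%v. Sp.Psi e1 (x # v)) = R ?p (dsum (?b c) w' (Sp.Psi e1)) + dsum (?b c) w' (%v. dsum (?b ?p) v (Sp.Psi e1))"
	by (simp add: Sp.Psi_Cons dsum_add dsum_linear[OF R_linear[OF Sp.proj(2)]])
	hence Rr: "dsum (?b c) w (Sp.Psi e1) = R (?b c ?p) (Sp.Psi e1 w') + dsum (?b (?b c ?p)) w' (Sp.Psi e1) +
	(R ?p (dsum (?b c) w' (Sp.Psi e1)) + dsum (?b c) w' (%v. dsum (?b ?p) v (Sp.Psi e1)))"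
	by (simp add: Cons Sp.Psi_Cons[of e1 "?b c x"] bproj[OF x(1)])
	have "(%y. ?b c (?b ?p y) - ?b ?p (?b c y)) = ?b (?b c ?p)"
	by (rule ext) (simp add: Sp.jacobi[of c ?p])
	hence "dsum (?b ?p) w' (%v. dsum (?b c) v (Sp.Psi e1)) - dsum (?b c) w' (%v. dsum (?b ?p) v (Sp.Psi e1)) = dsum (?b (?b c ?p)) w' (Sp.Psi e1)"
	using dsum_commutator[OF Sp.vls pm.vector_space_axioms Sp.Psi_mlin, of "?b ?p" w' "?b c" e1] by simp
	thus ?thesis unfolding L Rr by (simp add: algebra_simps)
	qed
	qed
	hence w: "?\<delta> (Sp.PsiL e1 (sgl (map (atl u) w))) = Sp.PsiL e1 (fder (?b c) (sgl (map (atl u) w)))" for w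
	using atl_words[OF u, of w] dsum_linear[OF Sp.PsiL_linear[of e1], of "?b c" "map (atl u) w" "%v. sgl v"] by (simp add: fder_sgl)
	interpret P: Vector_Spaces.linear pm_scale pm_scale "pat u" by (rule linear_push)
	interpret fd: Vector_Spaces.linear pm_scale pm_scale "fder (?b c)" by (rule linear_free_derivation)
	have "?\<delta> (Sp.PsiL e1 (pat u p)) = Sp.PsiL e1 (fder (?b c) (pat u p))"
	by (rule pm_linear_eq_on[where p=p and sc=pm_scale])
	(auto simp: pm_lin_iff P.add P.scale Sp.PsiL.add Sp.PsiL_scale \<delta>.add \<delta>.scale fd.add fd.scale w simp del: Sp.PsiL_sgl)
	also have "fder (?b c) (pat u p) = pat u (fder (abr (fst c (At u), 0)) p)"
	by (rule fder_push) (rule hbr_atl[OF u])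
	also have "Sp.PsiL e1 \<dots> = Sp.PsiL e1 (1 * \<dots>)" by simp
	also have "\<dots> = 0"
	proof (rule vacuum_map_zero[OF eval_vacuum_map[OF u]])
	show "th (fder (abr (fst c (At u), 0)) p) = 0"
	by (rule sing_ad[OF p]) (use u c(2)[of u] in "auto simp: nonneg_iff SE_def")
	qed simp
	finally have "em (dlt X (un (Sp.PsiL e1 (pat u p)))) = em \<zero>\<^sub>U" by simp
	thus ?thesis using dlt_ops(4)[OF X] UA.emb_eq_iff by (metis UA.unemb_closed UA.zero_closed)
qed
end
section \<open>The elements X(u)\<close>
lemma (in gaudin_points) GG_repr: "x : GG ==> EX f. x = gemb f & ratg f & equivariant_fun f"
	by (auto simp: GG_def)
context gaudin_eval begin
definition ev :: "complex => (('g fls \<times> complex) list pm) => 'g U_elem" where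
	"ev y p = un (Sp.PsiL e1 (pat y p))"
lemma em_ev: "em (ev y p) = Sp.PsiL e1 (pat y p)" by (simp add: ev_def PsiL_e1)
lemma ev_closed [simp]: "ev y p : UC" by (simp add: ev_def)
lemma em_ev_vacuum_map: "y : E ==> vacuum_map pm_scale (%p. em (ev y p))"
	unfolding em_ev using eval_vacuum_map[of y 1 e1] by simp
lemma ev_product: "u : E ==> sing q ==> ev u (p * q) = ev u q \<otimes>\<^sub>U ev u p"
	using eval_product[of u u q p] UA.emb_eq_iff[of "ev u (p * q)" "ev u q \<otimes>\<^sub>U ev u p"]
	by (simp add: em_ev ev_def push_map_times)
lemma ev_commute:
	assumes "u : E" "v : E" "u ~= v" "sing p" "sing q"
	shows "ev u p \<otimes>\<^sub>U ev v q = ev v q \<otimes>\<^sub>U ev u p"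
proof -
	have "em (ev u p \<otimes>\<^sub>U ev v q) = em (ev v q \<otimes>\<^sub>U ev u p)"
	using eval_product[OF assms(1,2,5), of p] eval_product[OF assms(2,1,4), of q] eval_swap[OF assms(1-3), of e1 p q]
	by (simp add: ev_def)
	thus ?thesis by (subst (asm) UA.emb_eq_iff) simp_all
qed
lemma ev_one: "ev y 1 = \<one>\<^sub>U"
	by (simp add: ev_def one_words)
lemma ev_invariant: "sig X = X ==> u : E ==> sing p ==> dlt X (ev u p) = \<zero>\<^sub>U"
	unfolding ev_def by (rule eval_invariant)
end
text \<open>Propagation of vacua: adding points with the vacuum module does not change the values.\<close>
lemma ev_propagation:
	assumes "gaudin_eval D n E" "gaudin_eval D n E'" and sub: "E <= E'" and u: "u : E"
	shows "gaudin_eval.ev D k n E' u p = gaudin_eval.ev D k n E u p"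
proof -
	interpret A: gaudin_eval D k n E by fact
	interpret B: gaudin_eval D k n E' by fact
	have uB: "u : E'" using u sub by auto
	have SE: "A.SE <= B.SE" using sub by (auto simp: A.SE_def B.SE_def)
	hence PS: "A.PS <= B.PS" by (auto simp: A.PS_def B.PS_def)
	have nPS: "y ~: A.PS" if "y : B.SE" "y ~: A.SE" for y
	proof
	assume "y : A.PS"
	moreover have "y ~= 0" using that B.SE0 by auto
	ultimately obtain z where z: "z : A.SE" "y : Gamma_orbit D z" by (auto simp: A.PS_def)
	hence "y ~= z" using that by auto
	thus False using B.E_orbits[of y z] that z SE B.orbit_self[of y] by (auto simp: A.SE_def B.SE_def)
	qed
	have proj: "fst (B.Sp.proj (A.atl u x)) y = fst (A.Sp.proj (A.atl u x)) y & snd (B.Sp.proj (A.atl u x)) = snd (A.Sp.proj (A.atl u x))"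
	if y: "y : U_places D | y = At u" for x y
	proof -
	obtain f where f: "A.atl u x - A.Sp.proj (A.atl u x) = A.gemb f" "A.ratg f" "A.equivariant_fun f"
	using A.GG_repr[OF A.Sp.diff_proj[OF A.atl_LE[OF u]], of x] by blast
	have fB: "B.ratg f" "B.equivariant_fun f"
	using f(2,3) sr_mono[OF _ PS] PS by (auto simp: A.ratg_def B.ratg_def A.equivariant_fun_def B.equivariant_fun_def)
	have Ap: "A.Sp.proj (A.atl u x) = A.atl u x - A.gemb f" using f(1) by (simp add: algebra_simps)
	have "B.Sp.proj (A.atl u x) = A.atl u x - B.gemb f"
	proof (rule B.Sp.proj_eqI)
	show "A.atl u x - B.gemb f : B.PE"
	proof (rule B.PE_I)
	show "A.atl u x - B.gemb f : B.LE"
	using B.atl_LE[OF uB] B.GG_LE B.gemb_GG[OF fB] A.hv.subspace_diff[OF B.LE_subspace] by blast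
	have PA: "A.atl u x - A.gemb f : A.PE" using A.Sp.proj(2)[of "A.atl u x"] Ap by simp
	show "fls_nth (fst (A.atl u x - B.gemb f) Infty) m = 0" if "m < 1" for m
	proof -
	have "fls_nth (fst (A.atl u x - A.gemb f) Infty) m = 0"
	using PA that unfolding A.PE_def mem_Times_iff nonneg_multiloops_def by blast
	thus ?thesis by (simp add: A.gemb_simps B.gemb_simps)
	qed
	fix z m assume m: "m < (0::int)"
	show "fls_nth (fst (A.atl u x - B.gemb f) (At z)) m = 0"
	proof (cases "z : B.SE & z ~: A.SE")
	case True
	hence "z ~= u" using u by (auto simp: A.SE_def)
	moreover have "fls_nth (A.GE f (At z)) m = 0"
	proof (rule A.fs.co_eqI)
	fix b assume b: "b : A.basis"
	hence "srat A.PS (A.crd f b)" using f by (simp add: A.ratg_def)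
	from se_regular(1)[OF A.finPS this _ m] show "A.fs.co (fls_nth (A.GE f (At z)) m) b = A.fs.co 0 b"
	using nPS True by (simp add: A.co_GE[OF b])
	qed
	ultimately show ?thesis using True by (simp add: B.gemb_simps A.atl_def at_place_def)
	next
	case False
	hence "fst (B.gemb f) (At z) = fst (A.gemb f) (At z)" using SE by (auto simp: A.gemb_simps B.gemb_simps)
	moreover have "fls_nth (fst (A.atl u x - A.gemb f) (At z)) m = 0"
	using PA m unfolding A.PE_def mem_Times_iff nonneg_multiloops_def by blast
	ultimately show ?thesis by simp
	qed
	qed
	show "A.atl u x - (A.atl u x - B.gemb f) : B.GG" using B.gemb_GG[OF fB] by simp
	qed
	moreover have "fst (B.gemb f) y = fst (A.gemb f) y"
	using y u uB SE by (cases y) (auto simp: A.gemb_simps B.gemb_simps A.SE_def B.SE_def U_places_def)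
	ultimately show ?thesis by (simp add: Ap A.gemb_simps B.gemb_simps)
	qed
	have R: "A.R (B.Sp.proj (A.atl u x)) = A.R (A.Sp.proj (A.atl u x))" for x
	proof -
	have "A.res (fst (B.Sp.proj (A.atl u x))) = A.res (fst (A.Sp.proj (A.atl u x)))"
	using proj[of _ x] by (auto simp: A.res_def fun_eq_iff)
	moreover have "snd (B.Sp.proj (A.atl u x)) = snd (A.Sp.proj (A.atl u x))" using proj[of "At u" x] by simp
	ultimately show ?thesis by (intro ext) (simp only: A.R_def)
	qed
	have word: "B.Sp.Psi A.e1 (map (A.atl u) w) = A.Sp.Psi A.e1 (map (A.atl u) w)" for w
	proof (induction "length w" arbitrary: w rule: less_induct)
	case less
	show ?case
	proof (cases w)
	case (Cons x w')
	have "dsum d w' (%v. B.Sp.Psi A.e1 (map (A.atl u) v)) = dsum d w' (%v. A.Sp.Psi A.e1 (map (A.atl u) v))" for d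
	by (rule dsum_cong) (use less Cons in auto)
	thus ?thesis using A.Psi_atl_Cons[OF u, of A.e1 x w'] B.Psi_atl_Cons[OF uB, of A.e1 x w'] proj[of "At u" x] less Cons R[of x]
	by simp
	qed simp
	qed
	have "B.Sp.PsiL A.e1 (A.pat u p) = A.Sp.PsiL A.e1 (A.pat u p)"
	proof -
	interpret P: Vector_Spaces.linear pm_scale pm_scale "A.pat u" by (rule linear_push)
	show ?thesis
	by (rule pm_linear_eq_on[where p=p and sc=pm_scale])
	(auto simp: pm_lin_iff P.add P.scale A.Sp.PsiL.add A.Sp.PsiL_scale B.Sp.PsiL.add B.Sp.PsiL_scale word)
	qed
	thus ?thesis by (simp add: A.ev_def B.ev_def)
qed
context gaudin_U begin
lemma omega_power_period: "om ^ T = 1" using prim by (simp add: primitive_root_of_unity_def)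
lemma orbit_sym: assumes "y : Gamma_orbit D z" "y : Gamma_orbit D w" shows "z : Gamma_orbit D w"
proof -
	obtain i where i: "y = om ^ i * z" using assms(1) by (auto simp: Gamma_orbit_def)
	obtain j where j: "y = om ^ j * w" using assms(2) by (auto simp: Gamma_orbit_def)
	obtain T' where T': "T = Suc T'" using period by (metis Suc_le_D One_nat_def)
	have "(om ^ T') ^ i * om ^ i = (om ^ T) ^ i" by (simp add: T' power_mult_distrib mult.commute)
	hence one: "om ^ (T' * i) * om ^ i = 1" by (simp add: omega_power_period power_mult)
	have "z = om ^ (T' * i) * y" using one by (simp add: i mult.assoc[symmetric])
	hence "z = om ^ (T' * i + j) * w" by (simp add: j power_add mult.assoc)
	thus ?thesis by (auto simp: Gamma_orbit_def)
qed
lemma eval_set: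
	assumes "finite E" "E \<inter> finite_poles D = {}" "!!u v. u : E ==> v : E ==> u ~= v ==> v ~: Gamma_orbit D u"
	shows "gaudin_eval D n E"
proof -
	have self: "z : Gamma_orbit D z" for z unfolding Gamma_orbit_def by (auto intro: exI[of _ 0])
	have m: "marked D <= finite_poles D" "0 : finite_poles D" using self by (auto simp: finite_poles_def)
	have mix: "Gamma_orbit D u \<inter> Gamma_orbit D z = {}" if "u : E" "z : marked D" for u z
	using orbit_sym[of _ u z] that assms(2) by (auto simp: finite_poles_def)
	have EE: "Gamma_orbit D u \<inter> Gamma_orbit D v = {}" if "u : E" "v : E" "u ~= v" for u v
	using orbit_sym[of _ u v] assms(3)[of v u] that by auto
	show ?thesis
	proof (intro gaudin_eval.intro gaudin_U_axioms gaudin_points.intro gaudin_data_axioms gaudin_points_axioms.intro)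
	fix z w assume "z : E \<union> marked D" "w : E \<union> marked D" "z ~= w"
	thus "Gamma_orbit D z \<inter> Gamma_orbit D w = {}" using mix[of z w] mix[of w z] EE[of z w] orbits[of z w] by blast
	qed (use assms m in auto)
qed
lemma eval_one: "u ~: finite_poles D ==> gaudin_eval D n {u}"
	by (rule eval_set) auto
lemma eval_two: "u ~: finite_poles D ==> v ~: finite_poles D ==> v ~: Gamma_orbit D u ==> gaudin_eval D n {u, v}"
proof (rule eval_set)
	fix a b assume "v ~: Gamma_orbit D u" "a : {u, v}" "b : {u, v}" "a ~= b"
	moreover have "u : Gamma_orbit D u" unfolding Gamma_orbit_def by (auto intro: exI[of _ 0])
	moreover have "v : Gamma_orbit D v" unfolding Gamma_orbit_def by (auto intro: exI[of _ 0])
	ultimately show "b ~: Gamma_orbit D a" using orbit_sym[of u u v] orbit_sym[of u v u] by auto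
qed auto
end
locale gaudin_at = gaudin_eval D k n "{u}" for D :: "('g::ab_group_add) cyclotomic_data" and k n u
begin
lemma g_hat_eq: "g_hat D u = Sp.LL"
	unfolding Sp.LL_def g_hat_def by (simp add: LE_def SE_def hsc_def hbr_def)
lemma p_u_eq: "p_u D u = PE"
	by (simp add: p_u_def PE_def SE_def)
lemma global_functions_eq: "global_functions D u = GG"
proof -
	have S: "finite_poles D \<union> Gamma_orbit D u = PS" by (auto simp: finite_poles_def PS_def SE_def)
	have e: "global_embedding D u PS f = gemb f" if "ratg f" for f
	unfolding global_embedding_def gemb_def using that
	by (auto simp: g_expansion_eq SE_def fun_eq_iff split: place.splits)
	show ?thesis unfolding global_functions_def Let_def S GG_def ratg_iff equivariant_fun_def
	proof (intro Collect_cong ex_cong1)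
	fix x f
	show "(x = global_embedding D u PS f & ratg f & (ALL t. t ~: PS --> f (om * t) = sig (f t))) =
	(x = gemb f & ratg f & (ALL t. t ~: PS --> f (om * t) = sig (f t)))"
	by (cases "ratg f") (simp_all add: e)
	qed
qed
lemma u_out: "u ~= 0" "u ~: marked D" using E0 E_marked by auto
lemma act_eq: assumes "x : PE"
	shows "M_action D n k u x m = (rho (res (fst x)) \<otimes>\<^sub>U m) \<oplus>\<^sub>U ((snd x * k) \<odot>\<^sub>U m)"
proof -
	have "(fst x)(At u := 0) = res (fst x)"
	proof (rule ext)
	fix y
	have "fst x (At z) = 0" if "z ~= 0" "z ~: SE" for z
	using that assms by (auto simp: PE_def nonneg_multiloops_def multiloop_space_eq)
	thus "((fst x)(At u := 0)) y = res (fst x) y"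
	using u_out by (cases y) (auto simp: res_def U_places_def SE_def)
	qed
	thus ?thesis by (simp add: M_action_def split_beta rho_incl)
qed
sublocale M: induced_data "g_hat D u" "U_alg D n" "p_u D u" "M_action D n k u"
proof (intro induced_data.intro induced_data_axioms.intro)
	show "lie_space (g_hat D u)" unfolding g_hat_eq by (rule Sp.lie_space_LL)
	show "p_u D u <= lcarrier (g_hat D u)" unfolding g_hat_eq p_u_eq using PE_LE by simp
	show "M_action D n k u x m : UC" if "x : p_u D u" "m : UC" for x m
	using that res_PE by (simp add: act_eq p_u_eq)
qed (rule UA.cspace_axioms)
abbreviation "wc == uea_class (g_hat D u)"
abbreviation "K == coinvariant_kernel D n k u"
abbreviation "W == word_polys LE"
lemma lcar [simp]: "lcarrier (g_hat D u) = LE" "lscale (g_hat D u) = hsc" "lbracket (g_hat D u) = hbr SE"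
	unfolding g_hat_eq by simp_all
lemma M_u_eq: "M_u D n k u = M.Ind" by (simp add: M_u_def)
lemma kernel_sub: "{M.iact f v | f v. f : GG & v : carrier M.Ind} <= carrier M.Ind"
	using M.iact_closed GG_LE by auto
lemma K_eq: "K = lin_span M.Ind {M.iact f v | f v. f : GG & v : carrier M.Ind}"
	by (simp add: coinvariant_kernel_def M_u_eq global_functions_eq)
lemma csub_K: "csub M.Ind K"
	unfolding K_eq by (rule csub_lin_span(1)[OF M.Ind.cspace_axioms kernel_sub])
sublocale Q: cspace "quot M.Ind K" by (rule M.Ind.cspace_quot[OF csub_K])
definition cc where "cc v = K +>\<^bsub>M.Ind\<^esub> v"
definition cv where "cv p m = emb (quot M.Ind K) (cc (M.tens (wc p) m))"
lemma wc_closed: "p : W ==> wc p : carrier (uea (g_hat D u))"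
	by (rule M.uea_class_closed) simp
lemma cc_closed: "v : carrier M.Ind ==> cc v : carrier (quot M.Ind K)"
	by (simp add: cc_def quot_simps)
lemma cc_ops: "v : carrier M.Ind ==> w : carrier M.Ind ==> cc (v \<oplus>\<^bsub>M.Ind\<^esub> w) = cc v \<oplus>\<^bsub>quot M.Ind K\<^esub> cc w"
	"v : carrier M.Ind ==> cc (c \<odot>\<^bsub>M.Ind\<^esub> v) = c \<odot>\<^bsub>quot M.Ind K\<^esub> cc v"
	using M.Ind.quot_add[OF csub_K] M.Ind.quot_smult[OF csub_K] by (simp_all add: cc_def)
lemma cv_linear:
	"p : W ==> q : W ==> m : UC ==> cv (p + q) m = cv p m + cv q m"
	"p : W ==> m : UC ==> cv (pm_scale c p) m = pm_scale c (cv p m)"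
	"p : W ==> m : UC ==> m' : UC ==> cv p (m \<oplus>\<^sub>U m') = cv p m + cv p m'"
	"p : W ==> m : UC ==> cv p (c \<odot>\<^sub>U m) = pm_scale c (cv p m)"
proof -
	assume p: "p : W" and m: "m : UC"
	have p': "p : M.WP" using p by simp
	show "cv (pm_scale c p) m = pm_scale c (cv p m)"
	unfolding cv_def M.uea_class_scale[OF p', symmetric] M.tens_scale1[OF wc_closed[OF p] m]
	by (simp only: cc_ops Q.emb_scale cc_closed M.tens_closed wc_closed p m)
	show "cv p (c \<odot>\<^sub>U m) = pm_scale c (cv p m)"
	unfolding cv_def M.tens_scale2[OF wc_closed[OF p] m]
	by (simp only: cc_ops Q.emb_scale cc_closed M.tens_closed wc_closed p m)
	show "cv p (m \<oplus>\<^sub>U m') = cv p m + cv p m'" if "m' : UC"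
	unfolding cv_def M.tens_add2[OF wc_closed[OF p] m that]
	by (simp only: cc_ops Q.emb_add cc_closed M.tens_closed wc_closed p m that)
	assume q: "q : W"
	hence q': "q : M.WP" by simp
	show "cv (p + q) m = cv p m + cv q m"
	unfolding cv_def M.uea_class_ops(1)[OF p' q', symmetric] M.tens_add1[OF wc_closed[OF p] wc_closed[OF q] m]
	by (simp only: cc_ops Q.emb_add cc_closed M.tens_closed wc_closed p q m)
qed
lemma cv_cong: "p : W ==> q : W ==> p - q : uea_ideal (g_hat D u) ==> cv p m = cv q m"
	using M.uea_class_eq_iff[of p q] by (simp add: cv_def)
lemma wc_gen: "x : LE ==> p : W ==> uea_incl (g_hat D u) x \<otimes>\<^bsub>uea (g_hat D u)\<^esub> wc p = wc (gen x * p)"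
	"x : LE ==> p : W ==> wc p \<otimes>\<^bsub>uea (g_hat D u)\<^esub> uea_incl (g_hat D u) x = wc (p * gen x)"
	using M.uea_class_ops(2)[of "gen x" p] M.uea_class_ops(2)[of p "gen x"] by (simp_all add: uea_incl_def)
lemma cv_G: assumes "g : GG" "p : W" "m : UC" shows "cv (gen g * p) m = 0"
proof -
	have g: "g : LE" using assms GG_LE by auto
	have "M.iact g (M.tens (wc p) m) = M.tens (wc (gen g * p)) m"
	using M.iact_tens[of g "wc p" m] g assms wc_closed wc_gen(1) by simp
	moreover have "M.iact g (M.tens (wc p) m) : {M.iact f v | f v. f : GG & v : carrier M.Ind}"
	using assms(1) M.tens_closed[OF wc_closed[OF assms(2)] assms(3)] by blast
	hence "M.iact g (M.tens (wc p) m) : K"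
	unfolding K_eq by (rule subsetD[OF csub_lin_span(2)[OF M.Ind.cspace_axioms kernel_sub]])
	ultimately have k: "M.tens (wc (gen g * p)) m : K" by simp
	have "M.tens (wc (gen g * p)) m : carrier M.Ind" using csub_K k by (auto simp: csub_def)
	hence "cc (M.tens (wc (gen g * p)) m) = cc \<zero>\<^bsub>M.Ind\<^esub>"
	unfolding cc_def using k by (subst M.Ind.coset_eq_iff[OF csub_K]) (simp_all add: M.Ind.minus_eq M.Ind.a_inv_eq_sm)
	also have "\<dots> = \<zero>\<^bsub>quot M.Ind K\<^esub>" using M.Ind.quot_zero[OF csub_K] by (simp add: cc_def)
	finally show ?thesis by (simp add: cv_def)
qed
lemma cv_P: assumes "x : PE" "p : W" "m : UC" shows "cv (p * gen x) m = cv p (M_action D n k u x m)"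
proof -
	have x: "x : LE" using assms PE_LE by auto
	show ?thesis
	using M.tens_bal[OF wc_closed[OF assms(2)], of x m] assms x wc_gen(2)[OF x assms(2)] by (simp add: cv_def p_u_eq)
qed
lemma word_W: "w : lists LE ==> sgl w : W" by (rule supported_single)
lemma cv_word: "w : lists LE ==> m : UC ==> cv (sgl w) m = cv 1 (un (Sp.Psi e1 w) \<otimes>\<^sub>U m)"
proof (induction "length w" arbitrary: w m rule: less_induct)
	case less
	have one: "1 : W" by simp
	show ?case
	proof (cases w)
	case Nil
	thus ?thesis using less.prems by (simp flip: one_words)
	next
	case (Cons x w')
	hence x: "x : LE" and w': "w' : lists LE" using less.prems by auto
	let ?p = "Sp.proj x" and ?l = "%m a. cv 1 (un a \<otimes>\<^sub>U m)"
	have p: "?p : PE" "?p : LE" "x - ?p : GG" "x - ?p : LE"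
	using Sp.proj(2)[of x] PE_LE Sp.diff_proj[OF x] GG_LE by auto
	have l: "pmlin (?l m)" if "m : UC" for m
	using that by (simp add: pm_lin_iff UA.unemb_add UA.unemb_scale UA.l_distr UA.sm_mult1 cv_linear[OF one])
	interpret l: Vector_Spaces.linear pm_scale pm_scale "?l m" by (rule l) (rule less.prems)
	have sw: "cv (sgl (v @ a # b # w'')) m = cv (sgl (v @ b # a # w'')) m + cv (sgl (v @ hbr SE a b # w'')) m"
	if "v : lists LE" "w'' : lists LE" "a : LE" "b : LE" for v w'' a b
	proof -
	have ab: "hbr SE a b : LE" using that LE_bracket by blast
	have in_W: "sgl (v @ a # b # w'') : W" "sgl (v @ b # a # w'') : W" "sgl (v @ hbr SE a b # w'') : W"
	using that ab by (auto intro!: supported_single)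
	have "sgl v * (sgl [a, b] - sgl [b, a] - gen (hbr SE a b)) * sgl w'' : uea_ideal (g_hat D u)"
	using that by (intro M.uea_ideal_times M.uea_ideal_rel) (use M.uea_relationsI(3)[of a b] in auto)
	hence "sgl (v @ a # b # w'') - (sgl (v @ b # a # w'') + sgl (v @ hbr SE a b # w'')) : uea_ideal (g_hat D u)"
	by (simp add: algebra_simps)
	from cv_cong[OF in_W(1) supported_add[OF in_W(2,3)] this, of m] show ?thesis
	using in_W less.prems by (simp add: cv_linear)
	qed
	have mv: "cv (sgl (?p # w')) m = cv (sgl (w' @ [?p])) m + dsum (hbr SE ?p) w' (%v. cv (sgl v) m)"
	by (rule move_letter[where L=LE, OF sw p(2) w'])
	have act: "M_action D n k u ?p m : UC" using M.act_closed[of ?p m] less.prems p by (simp add: p_u_eq)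
	have "cv (sgl (w' @ [?p])) m = cv (sgl w') (M_action D n k u ?p m)"
	using cv_P[OF p(1) word_W[OF w'] less.prems(2)] by simp
	also have "\<dots> = ?l (M_action D n k u ?p m) (Sp.Psi e1 w')" using less Cons w' act by simp
	also have "\<dots> = ?l m (R ?p (Sp.Psi e1 w'))"
	using less.prems res_PE[OF p(1)]
	by (simp add: act_eq[OF p(1)] R_def UA.unemb_add UA.unemb_scale UA.r_distr UA.l_distr UA.sm_mult1 UA.sm_mult2 UA.m_assoc)
	finally have 1: "cv (sgl (w' @ [?p])) m = ?l m (R ?p (Sp.Psi e1 w'))" .
	have "dsum (hbr SE ?p) w' (%v. cv (sgl v) m) = dsum (hbr SE ?p) w' (%v. ?l m (Sp.Psi e1 v))"
	by (rule dsum_cong_lists[OF w' LE_bracket[OF p(2)]]) (use less Cons in auto)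
	also have "\<dots> = ?l m (dsum (hbr SE ?p) w' (Sp.Psi e1))" by (rule dsum_linear[OF l[OF less.prems(2)]])
	finally have 2: "cv (sgl (?p # w')) m = ?l m (Sp.Psi e1 w)"
	unfolding mv 1 by (simp add: Cons Sp.Psi_Cons l.add)
	have W: "sgl (x # w') : W" "sgl ((x - ?p) # w') : W" "sgl (?p # w') : W"
	using x w' p by (auto intro!: supported_single)
	have "1 * (gen ((x - ?p) + ?p) - gen (x - ?p) - gen ?p) * sgl w' : uea_ideal (g_hat D u)"
	using M.uea_relationsI(1)[of "x - ?p" ?p] p word_W[OF w'] by (intro M.uea_ideal_times M.uea_ideal_rel) auto
	hence "sgl (x # w') - (sgl ((x - ?p) # w') + sgl (?p # w')) : uea_ideal (g_hat D u)" by (simp add: algebra_simps)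
	from cv_cong[OF W(1) supported_add[OF W(2,3)] this, of m]
	have "cv (sgl w) m = cv (sgl ((x - ?p) # w')) m + cv (sgl (?p # w')) m"
	using W less.prems by (simp add: Cons cv_linear)
	moreover have "cv (sgl ((x - ?p) # w')) m = 0" using cv_G[OF p(3) word_W[OF w'] less.prems(2)] by simp
	ultimately show ?thesis using 2 by simp
	qed
qed
lemma cv_poly: assumes "p : W" "m : UC" shows "cv p m = cv 1 (un (Sp.PsiL e1 p) \<otimes>\<^sub>U m)"
proof -
	have one: "1 : W" by simp
	have z: "cv 0 m = 0" "cv 1 \<zero>\<^sub>U = 0"
	using cv_linear(2)[of 0 m 0] cv_linear(4)[of 1 "\<zero>\<^sub>U" 0] assms(2) one by simp_all
	have "pm.subspace {p : W. cv p m = cv 1 (un (Sp.PsiL e1 p) \<otimes>\<^sub>U m)}"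
	unfolding pm.subspace_def using assms(2) z
	by (auto simp: cv_linear Sp.PsiL.add Sp.PsiL_scale Sp.PsiL.zero UA.unemb_add UA.unemb_scale UA.l_distr UA.sm_mult1)
	hence "p : {p : W. cv p m = cv 1 (un (Sp.PsiL e1 p) \<otimes>\<^sub>U m)}"
	by (rule supported_memI[OF _ assms(1)]) (use cv_word assms(2) word_W in auto)
	thus ?thesis by simp
qed
lemma cc_injective:
	assumes m: "m : UC" "m' : UC" and eq: "cc (M.tens (wc 1) m) = cc (M.tens (wc 1) m')"
	shows "m = m'"
proof -
	define r where "r a = (SOME p. p : W & a = wc p)" for a
	have rp: "r (wc p) : W & wc p = wc (r (wc p))" if "p : W" for p
	unfolding r_def by (rule someI[of _ p]) (use that in simp)
	have rc: "Sp.PsiL e1 (r (wc p)) = Sp.PsiL e1 p" if "p : W" for p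
	using rp[OF that] that by (intro Sp.PsiL_cong[symmetric]) (simp flip: g_hat_eq M.uea_class_eq_iff add: M.uea_class_eq_iff[symmetric, simplified])
	have C: "EX p:W. a = wc p" if "a : carrier (uea (g_hat D u))" for a using that by (auto simp: M.uea_carrier)
	let ?\<Phi> = "%a m. em (un (Sp.PsiL e1 (r a)) \<otimes>\<^sub>U m)"
	have "EX F. (ALL X:carrier M.Ind. ALL Y:carrier M.Ind. F (X \<oplus>\<^bsub>M.Ind\<^esub> Y) = F X + F Y) &
	(ALL c. ALL X:carrier M.Ind. F (c \<odot>\<^bsub>M.Ind\<^esub> X) = pm_scale c (F X)) &
	(ALL a:carrier (uea (g_hat D u)). ALL m:UC. F (M.tens a m) = ?\<Phi> a m)"
	proof (rule M.Ind_lift[OF pm.vector_space_axioms])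
	fix a b x m m' and c :: complex assume a: "a : carrier (uea (g_hat D u))" and m: "m : UC"
	from C[OF a] obtain p where p: "p : W" "a = wc p" by (elim bexE)
	have p': "p : M.WP" using p by simp
	show "?\<Phi> (c \<odot>\<^bsub>uea (g_hat D u)\<^esub> a) m = pm_scale c (?\<Phi> a m)"
	unfolding p(2) M.uea_class_scale[OF p'] using rc[OF p(1)] rc[OF supported_scale[OF p(1)]] m
	by (simp add: Sp.PsiL_scale UA.unemb_scale UA.sm_mult1 UA.emb_scale)
	show "?\<Phi> a (c \<odot>\<^sub>U m) = pm_scale c (?\<Phi> a m)" using m by (simp add: UA.sm_mult2 UA.emb_scale)
	show "m' : UC ==> ?\<Phi> a (m \<oplus>\<^sub>U m') = ?\<Phi> a m + ?\<Phi> a m'" using m by (simp add: UA.r_distr UA.emb_add)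
	show "?\<Phi> (a \<otimes>\<^bsub>uea (g_hat D u)\<^esub> uea_incl (g_hat D u) x) m = ?\<Phi> a (M_action D n k u x m)" if x: "x : p_u D u"
	proof -
	have x': "x : PE" "x : LE" using x PE_LE by (auto simp: p_u_eq)
	have "p * gen x : W" using p x' by (auto intro!: word_polys_times)
	thus ?thesis
	unfolding p(2) wc_gen(2)[OF x'(2) p(1)] using rc[OF p(1)] rc[of "p * gen x"] m res_PE[OF x'(1)]
	by (simp add: Sp.PsiL_snoc[OF x'(1)] act_eq[OF x'(1)] R_def UA.unemb_add UA.unemb_scale UA.l_distr UA.r_distr UA.m_assoc UA.sm_mult1 UA.sm_mult2)
	qed
	assume "b : carrier (uea (g_hat D u))"
	from C[OF this] obtain q where q: "q : W" "b = wc q" by (elim bexE)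
	have q': "q : M.WP" using q by simp
	show "?\<Phi> (a \<oplus>\<^bsub>uea (g_hat D u)\<^esub> b) m = ?\<Phi> a m + ?\<Phi> b m"
	unfolding p(2) q(2) M.uea_class_ops(1)[OF p' q'] using rc[OF p(1)] rc[OF q(1)] rc[OF supported_add[OF p(1) q(1)]] m
	by (simp add: Sp.PsiL.add UA.unemb_add UA.l_distr UA.emb_add)
	qed
	then obtain F where F: "!!X Y. X : carrier M.Ind ==> Y : carrier M.Ind ==> F (X \<oplus>\<^bsub>M.Ind\<^esub> Y) = F X + F Y"
	"!!c X. X : carrier M.Ind ==> F (c \<odot>\<^bsub>M.Ind\<^esub> X) = pm_scale c (F X)"
	"!!a m. a : carrier (uea (g_hat D u)) ==> m : UC ==> F (M.tens a m) = ?\<Phi> a m" by blast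
	have Fz: "F \<zero>\<^bsub>M.Ind\<^esub> = 0" using F(2)[OF M.Ind.zero_closed, of 0] by simp
	have iz: "M.iact g \<zero>\<^bsub>M.Ind\<^esub> = \<zero>\<^bsub>M.Ind\<^esub>" if "g : LE" for g
	using M.iact_ops(2)[of g "\<zero>\<^bsub>M.Ind\<^esub>" "\<zero>\<^bsub>M.Ind\<^esub>" 0] M.iact_closed[of g "\<zero>\<^bsub>M.Ind\<^esub>"] that by simp
	have FG: "F (M.iact g v) = 0" if g: "g : GG" and v: "v : carrier M.Ind" for g v
	proof -
	have gL: "g : LE" using g GG_LE by auto
	hence gL': "g : lcarrier (g_hat D u)" by simp
	have "csub M.Ind {v : carrier M.Ind. F (M.iact g v) = 0}"
	unfolding csub_def using M.iact_ops(1)[OF gL'] M.iact_ops(2)[OF gL' _ M.Ind.zero_closed] M.iact_closed[OF gL'] F(1,2) Fz iz[OF gL] by auto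
	hence "v : {v : carrier M.Ind. F (M.iact g v) = 0}"
	proof (rule M.Ind_induct[OF _ _ v])
	fix a m assume a: "a : carrier (uea (g_hat D u))" and m: "m : UC"
	from C[OF a] obtain p where p: "p : W" "a = wc p" by (elim bexE)
	have gp: "gen g * p : W" using p gL by (auto intro!: word_polys_times)
	have "M.iact g (M.tens a m) = M.tens (wc (gen g * p)) m"
	using M.iact_tens[OF gL' a m] wc_gen(1)[OF gL p(1)] p(2) by simp
	hence "F (M.iact g (M.tens a m)) = 0"
	using F(3)[OF wc_closed[OF gp] m] rc[OF gp] Sp.PsiL_G[OF g, of e1 p] m by simp
	thus "M.tens a m : {v : carrier M.Ind. F (M.iact g v) = 0}" using M.tens_closed[OF a m] by simp
	qed
	thus ?thesis by simp
	qed
	have FK: "F v = 0" if "v : K" for v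
	proof -
	have "csub M.Ind {v : carrier M.Ind. F v = 0}" unfolding csub_def using F(1,2) Fz by auto
	hence "K <= {v : carrier M.Ind. F v = 0}"
	unfolding K_eq
	proof (rule csub_lin_span(3)[OF M.Ind.cspace_axioms kernel_sub], intro subsetI)
	fix x assume x: "x : {M.iact f v | f v. f : GG & v : carrier M.Ind}"
	then obtain g v where "x = M.iact g v" "g : GG" "v : carrier M.Ind" by blast
	hence "F x = 0" using FG by blast
	thus "x : {v : carrier M.Ind. F v = 0}" using subsetD[OF kernel_sub x] by simp
	qed
	thus ?thesis using that by auto
	qed
	have one: "wc 1 : carrier (uea (g_hat D u))" by (rule wc_closed) simp
	have c1: "Sp.PsiL e1 (r (wc 1)) = e1" using rc[of 1] by (simp add: one_words)
	have t: "M.tens (wc 1) m : carrier M.Ind" "M.tens (wc 1) m' : carrier M.Ind" using M.tens_closed[OF one] m by auto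
	have "M.tens (wc 1) m \<ominus>\<^bsub>M.Ind\<^esub> M.tens (wc 1) m' : K"
	using eq t unfolding cc_def by (simp add: M.Ind.coset_eq_iff[OF csub_K])
	from FK[OF this] have "F (M.tens (wc 1) m) = F (M.tens (wc 1) m')"
	using F(1)[OF t(1)] F(2)[OF t(2), of "-1"] t by (simp add: M.Ind.minus_eq M.Ind.a_inv_eq_sm)
	hence "em m = em m'" using F(3)[OF one] m c1 by simp
	thus ?thesis using m by (simp add: UA.emb_eq_iff)
qed
theorem X_elem_theta: "X_elem D n k (theta p) u = ev u p"
proof -
	have one: "1 : W" by simp
	have onec: "\<one>\<^sub>U : UC" by simp
	have main: "coinvariant_class D n k u (M_tensor D n k u (uea_map (g_hat D u) (%f. (at_place u f, 0)) (uea_class (negative_alg D) q)) \<one>\<^sub>U)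
	= cc (M.tens (wc 1) (ev u (push neg_word q)))" if q: "q : word_polys negs" for q
	proof -
	let ?a = "%f::'g fls. (at_place u f, 0::complex)"
	have a: "?a f = atl u (f, 0)" for f by (simp add: atl_def)
	have um: "uea_map (g_hat D u) ?a (uea_class (negative_alg D) q) = wc (push (map ?a) q)"
	proof (rule uea_map_class(1)[OF lie_space_neg M.lie_space_axioms])
	fix x y :: "'g fls" assume xy: "x : lcarrier (negative_alg D)" "y : lcarrier (negative_alg D)"
	show "?a x : lcarrier (g_hat D u)" unfolding a using atl_LE[of u] by simp
	show "?a (x + y) = ?a x + ?a y" by (auto simp: at_place_def fun_eq_iff)
	show "?a (lscale (negative_alg D) c x) = lscale (g_hat D u) c (?a x)" for c
	by (auto simp: at_place_def fun_eq_iff hsc_def)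
	show "?a (lbracket (negative_alg D) x y) = lbracket (g_hat D u) (?a x) (?a y)"
	using atl_br[of u "(x, 0)" "(y, 0)"] neg_lb(2)[of x y] xy by (simp add: a)
	qed (use q in simp)
	have pq: "push (map ?a) q = pat u (push neg_word q)"
	unfolding push_compose by (simp add: a comp_def)
	have W: "pat u (push neg_word q) : W" by (rule pat_WP) simp
	have "cv (pat u (push neg_word q)) \<one>\<^sub>U = cv 1 (ev u (push neg_word q))"
	using cv_poly[OF W onec] by (simp add: ev_def)
	hence "cc (M.tens (wc (pat u (push neg_word q))) \<one>\<^sub>U) = cc (M.tens (wc 1) (ev u (push neg_word q)))"
	unfolding cv_def using Q.emb_eq_iff[OF cc_closed cc_closed] M.tens_closed[OF wc_closed[OF W] onec] M.tens_closed[OF wc_closed[OF one] ev_closed] by simp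
	thus ?thesis by (simp add: coinvariant_class_def M_tensor_def M_u_eq cc_def um pq)
	qed
	have right: "coinvariant_class D n k u (M_tensor D n k u \<one>\<^bsub>uea (g_hat D u)\<^esub> m') = cc (M.tens (wc 1) m')" for m'
	by (simp add: coinvariant_class_def M_tensor_def M_u_eq cc_def M.uea_one_zero)
	have evq: "ev u (push neg_word q) = ev u p" if "theta p = theta (push neg_word q)" for q
	proof -
	have "em (ev u p) = em (ev u (push neg_word q))"
	by (rule vacuum_map_cong[OF em_ev_vacuum_map]) (use that th_eq_iff in auto)
	thus ?thesis by (subst (asm) UA.emb_eq_iff) simp_all
	qed
	show ?thesis
	unfolding X_elem_def X_map_def
	proof (rule the_equality)
	obtain q where q: "q : word_polys negs" "th p = th (push neg_word q)" using PBW_spanning by blast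
	hence t: "theta p = theta (push neg_word q)" by (simp add: th_eq_iff)
	have "uea_class (negative_alg D) q : carrier (uea (negative_alg D))"
	by (rule lie_space.uea_class_closed[OF lie_space_neg]) (use q in simp)
	moreover have "theta p = vacuum_vector D k (uea_class (negative_alg D) q)" using vacuum_vector_class[OF q(1)] t by simp
	ultimately show "ev u p : UC & (EX P:carrier (uea (negative_alg D)). theta p = vacuum_vector D k P &
	coinvariant_class D n k u (M_tensor D n k u (uea_map (g_hat D u) (%f. (at_place u f, 0)) P) \<one>\<^sub>U)
	= coinvariant_class D n k u (M_tensor D n k u \<one>\<^bsub>uea (g_hat D u)\<^esub> (ev u p)))"
	using main[OF q(1)] evq[OF t] by (intro conjI bexI[of _ "uea_class (negative_alg D) q"]) (simp_all add: right)
	fix m' assume "m' : UC & (EX P:carrier (uea (negative_alg D)). theta p = vacuum_vector D k P &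
	coinvariant_class D n k u (M_tensor D n k u (uea_map (g_hat D u) (%f. (at_place u f, 0)) P) \<one>\<^sub>U)
	= coinvariant_class D n k u (M_tensor D n k u \<one>\<^bsub>uea (g_hat D u)\<^esub> m'))"
	then obtain P where m': "m' : UC" and P: "P : carrier (uea (negative_alg D))" "theta p = vacuum_vector D k P"
	"coinvariant_class D n k u (M_tensor D n k u (uea_map (g_hat D u) (%f. (at_place u f, 0)) P) \<one>\<^sub>U)
	= coinvariant_class D n k u (M_tensor D n k u \<one>\<^bsub>uea (g_hat D u)\<^esub> m')" by blast
	from P(1) obtain q where q: "q : word_polys negs" "P = uea_class (negative_alg D) q"
	unfolding lie_space.uea_carrier[OF lie_space_neg] by auto
	have t: "theta p = theta (push neg_word q)" using P(2) vacuum_vector_class[OF q(1)] q(2) by simp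
	have "cc (M.tens (wc 1) (ev u (push neg_word q))) = cc (M.tens (wc 1) m')"
	using P(3) main[OF q(1)] right q(2) by simp
	from cc_injective[OF ev_closed m' this] show "m' = ev u p" using evq[OF t] by simp
	qed
qed
end
section \<open>Dependence on the point\<close>
text \<open>
  Pairs of a vector-valued rational function and its derivative; the definition as a closure
  keeps the coefficients scalar.
\<close>
inductive has_der :: "complex set => (complex => ('b pm)) => (complex => ('b pm)) => bool" for S where
	scalar: "srat S r ==> has_der S (%u. pm_scale (r u) a) (%u. pm_scale (deriv r u) a)"
| add: "has_der S f f' ==> has_der S g g' ==> has_der S (%u. f u + g u) (%u. f' u + g' u)"
| cong: "has_der S f f' ==> (!!u. u ~: S ==> f u = g u) ==> (!!u. u ~: S ==> f' u = g' u) ==> has_der S g g'"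
lemma has_der_zero: "has_der S (%u. 0) (%u. 0)"
	using has_der.scalar[of S "%u. 0" 0] by (rule has_der.cong) auto
lemma has_der_sum: "(!!j. j : J ==> has_der S (f j) (f' j)) ==> has_der S (%u. SUM j:J. f j u) (%u. SUM j:J. f' j u)"
	by (induction J rule: infinite_finite_induct) (auto intro: has_der_zero has_der.add)
lemma has_der_linear:
	assumes l: "pmlin l"
	shows "has_der S f f' ==> has_der S (%u. l (f u)) (%u. l (f' u))"
proof -
	interpret l: Vector_Spaces.linear pm_scale pm_scale l by fact
	show "has_der S f f' ==> has_der S (%u. l (f u)) (%u. l (f' u))"
	proof (induction rule: has_der.induct)
	case (scalar r a)
	thus ?case unfolding l.scale by (rule has_der.scalar)
	next
	case (add f f' g g')
	thus ?case unfolding l.add by (intro has_der.add)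
	next
	case (cong f f' g g')
	thus ?case by (intro has_der.cong[OF cong(4)]) auto
	qed
qed
lemma has_der_scale:
	assumes S: "finite S" and r: "srat S r"
	shows "has_der S f f' ==> has_der S (%u. pm_scale (r u) (f u)) (%u. pm_scale (deriv r u) (f u) + pm_scale (r u) (f' u))"
proof (induction rule: has_der.induct)
	case (scalar q a)
	have "deriv (%u. r u * q u) u = deriv r u * q u + r u * deriv q u" if "u ~: S" for u
	using that sr_analytic(2)[OF S r that] sr_analytic(2)[OF S scalar that]
	by (subst deriv_mult) (auto simp: analytic_on_imp_differentiable_at algebra_simps)
	thus ?case
	by (intro has_der.cong[OF has_der.scalar[OF sr_mult[OF r scalar], of a]]) (simp_all add: pm.scale_left_distrib)
next
	case (add f f' g g')
	show ?case
	by (rule has_der.cong[OF has_der.add[OF add(3,4)]]) (simp_all add: pm.scale_right_distrib)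
next
	case (cong f f' g g')
	thus ?case by (intro has_der.cong[OF cong(4)]) auto
qed
lemma has_der_functional:
	assumes S: "finite S" and l: "pmfun l"
	shows "has_der S f f' ==> srat S (%u. l (f u)) & (ALL u. u ~: S --> deriv (%u. l (f u)) u = l (f' u))"
proof (induction rule: has_der.induct)
	interpret l: Vector_Spaces.linear pm_scale "(*)" l by fact
	{ case (scalar r a)
	have "deriv (%u. r u * l a) u = deriv r u * l a" if "u ~: S" for u
	using that sr_analytic(2)[OF S scalar that] by (subst deriv_mult) (auto simp: analytic_on_imp_differentiable_at)
	thus ?case using scalar by (auto simp: l.scale) }
	{ case (add f f' g g')
	have "deriv (%u. l (f u) + l (g u)) u = l (f' u) + l (g' u)" if "u ~: S" for u
	proof -
	have "(%u. l (f u)) field_differentiable at u" "(%u. l (g u)) field_differentiable at u"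
	using sr_analytic(2)[OF S conjunct1[OF add(3)] that] sr_analytic(2)[OF S conjunct1[OF add(4)] that]
	analytic_on_imp_differentiable_at by blast+
	thus ?thesis using that add(3,4) by (subst deriv_add) auto
	qed
	thus ?case using add by (auto simp: l.add) }
	case (cong f f' g g')
	have op: "open (- S)" using S by (simp add: finite_imp_closed open_Compl)
	have "deriv (%u. l (g u)) u = deriv (%u. l (f u)) u" if "u ~: S" for u
	by (rule deriv_cong_ev) (use that cong eventually_nhds_in_open[OF op, of u] in "auto elim!: eventually_mono")
	thus ?case using cong by (auto intro: sr_cong[of S "%u. l (f u)"])
qed
lemma (in cspace) has_der_rational:
	assumes "has_der S f f'" shows "rational_function V S (%u. unemb V (f u))"
proof -
	have "EX l r a. (ALL j<l::nat. srat S (r j)) & (ALL u. u ~: S --> f u = (\<Sum>j<l. pm_scale (r j u) (a j)))"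
	using assms
	proof (induction rule: has_der.induct)
	case (scalar r a)
	thus ?case by (intro exI[of _ "Suc 0"] exI[of _ "%_. r"] exI[of _ "%_. a"]) simp
	next
	case (add f f' g g')
	obtain l r a where 1: "ALL j<l::nat. srat S (r j)" "ALL u. u ~: S --> f u = (\<Sum>j<l. pm_scale (r j u) (a j))"
	using add.IH(1) by blast
	obtain m q b where 2: "ALL j<m::nat. srat S (q j)" "ALL u. u ~: S --> g u = (\<Sum>j<m. pm_scale (q j u) (b j))"
	using add.IH(2) by blast
	let ?r = "%j. if j < l then r j else q (j - l)" and ?a = "%j. if j < l then a j else b (j - l)"
	have "(\<Sum>j<l + m. pm_scale (?r j u) (?a j)) = (\<Sum>j<l. pm_scale (r j u) (a j)) + (\<Sum>j<m. pm_scale (q j u) (b j))" for u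
	proof -
	have "(\<Sum>j<l + m. pm_scale (?r j u) (?a j)) = (\<Sum>j<l. pm_scale (?r j u) (?a j)) + (\<Sum>j<m. pm_scale (?r (l + j) u) (?a (l + j)))"
	by (induction m) (simp_all add: add.assoc)
	thus ?thesis by simp
	qed
	thus ?case using 1 2
	by (intro exI[of _ "l + m"] exI[of _ ?r] exI[of _ ?a]) auto
	next
	case (cong f f' g g')
	thus ?case by metis
	qed
	then obtain l r a where lra: "ALL j<l::nat. srat S (r j)" "ALL u. u ~: S --> f u = (\<Sum>j<l. pm_scale (r j u) (a j))" by blast
	have "rational_repr V S (%u. unemb V (f u)) l r (%j. unemb V (a j))"
	unfolding rational_repr_def using lra by (auto simp: unemb_sum unemb_scale)
	thus ?thesis by (auto simp: rational_function_def)
qed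
lemma neg_binom_deriv:
	assumes "N >= 1"
	shows "(of_nat (Suc m)) * neg_binom N (Suc m) c = - of_nat N * neg_binom (Suc N) m c"
	and "of_nat (N + m) * ((-1) ^ m * of_nat ((N + m - 1) choose m)) = of_nat N * ((-1) ^ m * of_nat ((Suc N + m - 1) choose m) :: complex)"
proof -
	obtain M where M: "N = Suc M" using assms by (metis Suc_le_D One_nat_def)
	have "Suc m * ((Suc M + m) choose Suc m) = (Suc M + m) * ((M + m) choose m)"
	using Suc_times_binomial_eq[of "M + m" m] by (simp add: mult.commute)
	moreover have e: "(Suc M + m) * ((M + m) choose m) = Suc M * ((Suc M + m) choose m)"
	using binomial_absorb_comp[of "Suc M + m" m] by (simp add: mult.commute)
	ultimately have "Suc m * ((Suc M + m) choose Suc m) = Suc M * ((Suc M + m) choose m)" by simp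
	hence "of_nat (Suc m) * of_nat ((Suc M + m) choose Suc m) = (of_nat (Suc M) * of_nat ((Suc M + m) choose m) :: complex)"
	by (metis of_nat_mult)
	thus "(of_nat (Suc m)) * neg_binom N (Suc m) c = - of_nat N * neg_binom (Suc N) m c"
	unfolding neg_binom_def M by (simp add: mult_ac del: of_nat_Suc binomial_Suc_Suc)
	show "of_nat (N + m) * ((-1) ^ m * of_nat ((N + m - 1) choose m)) = of_nat N * ((-1) ^ m * of_nat ((Suc N + m - 1) choose m) :: complex)"
	proof -
	have e': "of_nat (Suc M + m) * of_nat ((M + m) choose m) = (of_nat (Suc M) * of_nat ((Suc M + m) choose m) :: complex)"
	by (metis e of_nat_mult)
	have i: "N + m - 1 = M + m" "Suc N + m - 1 = Suc M + m" by (simp_all add: M)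
	show ?thesis unfolding i unfolding M by (simp only: mult.left_commute[of _ "(-1) ^ m"] e')
	qed
qed
lemma neg_binom_has_derivative:
	assumes "N >= 1" "c + b * u ~= 0"
	shows "((%u. neg_binom N m (c + b * u)) has_field_derivative (b * (- of_nat N * neg_binom (Suc N) m (c + b * u)))) (at u)"
proof -
	obtain M where M: "N + m = Suc M" using assms(1) by (cases "N + m") auto
	define i where "i = inverse (c + b * u)"
	define n' where "n' = (of_nat (N + m) :: complex)"
	define K where "K = (-1) ^ m * (of_nat ((N + m - 1) choose m) :: complex)"
	define K2 where "K2 = (-1) ^ m * (of_nat ((Suc N + m - 1) choose m) :: complex)"
	have K: "n' * K = of_nat N * K2" unfolding n'_def K_def K2_def by (rule neg_binom_deriv(2)[OF assms(1)])
	have p: "i ^ (N + m - 1) = i ^ M" "i ^ (Suc N + m) = i * i * i ^ M" by (simp_all add: M)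
	have d: "((%u. K * inverse (c + b * u) ^ (N + m)) has_field_derivative
	K * (of_nat (N + m) * (inverse (c + b * u) ^ (N + m - 1) * (- (inverse (c + b * u) * b * inverse (c + b * u)))))) (at u)"
	using assms(2) by (auto intro!: derivative_eq_intros)
	have "K * (of_nat (N + m) * (inverse (c + b * u) ^ (N + m - 1) * (- (inverse (c + b * u) * b * inverse (c + b * u))))) =
	b * (- of_nat N * (K2 * i ^ (Suc N + m)))"
	proof -
	have "K * (n' * (i ^ M * (- (i * b * i)))) = - b * ((n' * K) * (i * i * i ^ M))" by (simp add: mult_ac)
	also have "\<dots> = b * (- of_nat N * (K2 * (i * i * i ^ M)))" unfolding K by (simp add: mult_ac)
	finally show ?thesis unfolding i_def[symmetric] n'_def[symmetric] p .
	qed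
	from DERIV_cong[OF d this] show ?thesis unfolding neg_binom_def K_def K2_def i_def .
qed
lemma infinity_coefficient_derivative:
	assumes "N >= 1" "N <= m"
	shows "of_nat (m - N) * of_nat ((m - 1) choose (m - N)) = (if m < Suc N then 0 else of_nat N * of_nat ((m - 1) choose (m - Suc N)) :: complex)"
proof (cases "m = N")
	case False
	define j where "j = m - Suc N"
	have m: "m = Suc N + j" using assms False by (simp add: j_def)
	have "Suc j * ((N + j) choose Suc j) = N * ((N + j) choose j)"
	using binomial_absorb_comp[of "N + j" j] binomial_absorption[of j "N + j"] by simp
	hence "of_nat (Suc j) * of_nat ((N + j) choose Suc j) = (of_nat N * of_nat ((N + j) choose j) :: complex)" by (metis of_nat_mult)
	moreover have "m - N = Suc j" "m - 1 = N + j" "m - Suc N = j" "\<not> m < Suc N" using m by auto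
	ultimately show ?thesis by (simp only: if_False)
qed simp
context gaudin_eval begin
lemma ev_Cons: assumes u: "u : E"
	shows "em (ev u (gen x * p)) = R (Sp.proj (atl u x)) (em (ev u p)) + em (ev u (gen (fst (Sp.proj (atl u x)) (At u), 0) * p))"
proof -
	interpret P: Vector_Spaces.linear pm_scale pm_scale "pat u" by (rule linear_push)
	let ?P = "Sp.proj (atl u x)" let ?h = "(fst ?P (At u), 0) :: 'g fls \<times> complex"
	interpret R: Vector_Spaces.linear pm_scale pm_scale "R ?P" by (rule R_linear[OF Sp.proj(2)])
	have h: "?h : affine_nonneg" using Sp.proj(2)[of "atl u x"] by (auto simp: nonneg_iff PE_def nonneg_multiloops_def)
	have vm: "vacuum_map pm_scale (%p. Sp.PsiL e1 (pat u p))" using em_ev_vacuum_map[OF u] by (simp add: em_ev)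
	show ?thesis unfolding em_ev
	proof (rule pm_linear_eq_on[where p=p and sc=pm_scale])
	fix w
	have "dsum (abr ?h) w (%v. Sp.Psi e1 (map (atl u) v)) = Sp.PsiL e1 (pat u (fder (abr ?h) (sgl w)))"
	using dsum_linear[OF Sp.PsiL_linear[of e1], of "abr ?h" w "%v. sgl (map (atl u) v)"] dsum_linear[OF linear_push, of "abr ?h" w "map (atl u)" "%v. sgl v"]
	by (simp add: fder_sgl)
	also have "\<dots> = Sp.PsiL e1 (pat u (gen ?h * sgl w))"
	by (rule vacuum_map_cong[OF vm]) (simp only: th_ad th_snoc[OF h], simp add: kap_def)
	finally show "Sp.PsiL e1 (pat u (gen x * sgl w)) = R ?P (Sp.PsiL e1 (pat u (sgl w))) + Sp.PsiL e1 (pat u (gen ?h * sgl w))"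
	using Psi_atl_Cons[OF u, of e1 x w] by simp
	qed (auto simp: pm_lin_iff P.add P.scale distrib_left times_pm_scale Sp.PsiL.add Sp.PsiL_scale R.add R.scale pm.scale_right_distrib)
qed
end
context gaudin_U begin
abbreviation "Fu u p == gaudin_eval.ev D k n {u} u p"
abbreviation "SS == finite_poles D"
lemma finite_SS: "finite SS"
proof -
	interpret E: gaudin_eval D k n "{}" by (rule eval_set) auto
	have "SS = E.PS" by (auto simp: finite_poles_def E.PS_def E.SE_def)
	thus ?thesis using E.finPS by simp
qed
lemma SS_rotate: "u ~: SS ==> om ^ j * u ~: SS"
proof -
	interpret E: gaudin_eval D k n "{}" by (rule eval_set) auto
	have "SS = E.PS" by (auto simp: finite_poles_def E.PS_def E.SE_def)
	thus "u ~: SS ==> om ^ j * u ~: SS"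
	using E.PS_rotate_iff by (induction j) (auto simp: mult.assoc)
qed
lemma SS_places: "At z : U_places D ==> z : SS"
proof -
	have "z : Gamma_orbit D z" unfolding Gamma_orbit_def by (auto intro: exI[of _ 0])
	thus "At z : U_places D ==> z : SS" by (auto simp: U_places_def finite_poles_def)
qed
lemma em_Fu_vacuum_map: "u ~: SS ==> vacuum_map pm_scale (%p. em (Fu u p))"
proof -
	assume "u ~: SS"
	then interpret E: gaudin_eval D k n "{u}" by (rule eval_one)
	show ?thesis using E.em_ev_vacuum_map[of u] by simp
qed
lemma Fu_linear: "u ~: SS ==> pmlin (%p. em (Fu u p))"
	using em_Fu_vacuum_map by (simp add: vacuum_map_def)
lemma X_elem_Fu: "u ~: SS ==> X_elem D n k (theta p) u = Fu u p"
proof -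
	assume "u ~: SS"
	then interpret E: gaudin_at D k n u by (intro gaudin_at.intro eval_one)
	show ?thesis by (rule E.X_elem_theta)
qed
text \<open>The coefficients of the regular part of the function with a pole of order \<open>N\<close> at \<open>u\<close>.\<close>
definition cf :: "nat => complex => nat => place => nat => complex" where
	"cf N u j y m = (case y of At z => - (om ^ (j * N)) * neg_binom N m (z + (- (om ^ j)) * u)
	| Infty => om ^ (j * N) * (if m < N then 0 else of_nat ((m - 1) choose (m - N)) * (om ^ j * u) ^ (m - N)))"
definition cu :: "nat => complex => nat => nat => complex" where
	"cu N u j m = - (om ^ (j * N)) * neg_binom N m (0 + (1 - om ^ j) * u)"
abbreviation "ser c == fps_to_fls (Abs_fps c)"
definition atp :: "place => 'g fls => 'g multiloop" where "atp y f = (%x. if x = y then f else 0)"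
definition rhol :: "'g multiloop => ('g U_elem pm)" where
	"rhol = (SOME l. vlin msc pm_scale l & (ALL f:NN. l f = em (rho f)))"
lemma rhol: "vlin msc pm_scale rhol" "f : NN ==> rhol f = em (rho f)"
proof -
	from kernel_retraction[OF mv.vector_space_axioms nonneg_subspace[of "marked D"]]
	obtain q where q0: "vlin msc msc q" "ALL x:NN. q x = 0" "ALL x. x - q x : NN" by (elim exE conjE)
	note q = q0(1) bspec[OF q0(2)] spec[OF q0(3)]
	interpret q: Vector_Spaces.linear msc msc q by fact
	have sub: "mv.subspace NN" by (rule nonneg_subspace)
	have "vlin msc pm_scale (%f. em (rho (f - q f)))"
	unfolding Vector_Spaces.linear_iff
	proof (intro conjI allI)
	fix x y c
	have "x + y - q (x + y) = (x - q x) + (y - q y)" "msc c x - q (msc c x) = msc c (x - q x)"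
	by (simp_all add: q.add q.scale mv.scale_right_diff_distrib)
	thus "em (rho (x + y - q (x + y))) = em (rho (x - q x)) + em (rho (y - q y))"
	"em (rho (msc c x - q (msc c x))) = pm_scale c (em (rho (x - q x)))"
	by (simp_all only: rho_add[OF q(3) q(3)] rho_scale[OF q(3)] UA.emb_add[OF rho_closed[OF q(3)] rho_closed[OF q(3)]] UA.emb_scale[OF rho_closed[OF q(3)]])
	qed (simp_all add: mv.vector_space_axioms pm.vector_space_axioms)
	hence "EX l. vlin msc pm_scale l & (ALL f:NN. l f = em (rho f))"
	using q(2) by (intro exI[of _ "%f. em (rho (f - q f))"]) auto
	from someI_ex[OF this] show "vlin msc pm_scale rhol" "f : NN ==> rhol f = em (rho f)"
	unfolding rhol_def by auto
qed
sublocale rhol: Vector_Spaces.linear msc pm_scale rhol by (rule rhol)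
lemma finite_U_places: "finite (U_places D)" using fin_marked by (simp add: U_places_def)
lemma atp_ops: "atp y (f + h) = atp y f + atp y h" "atp y 0 = 0" "atp y (lsc c f) = msc c (atp y f)"
	by (auto simp: atp_def fun_eq_iff)
lemma atp_sum: "atp y (SUM a:A. F a) = (SUM a:A. atp y (F a))"
proof (induction A rule: infinite_finite_induct)
	case (insert a A)
	thus ?case by (simp only: sum.insert[OF insert(1,2)] atp_ops)
qed (simp_all add: atp_ops)
lemma fls_truncate:
	assumes "!!i. i < 0 ==> fls_nth f i = 0"
	shows "EX r. f = (\<Sum>m<M. ten (fls_X ^ m) (fls_nth f (int m))) + r & (ALL i<int M. fls_nth r i = 0)"
proof -
	define r where "r = f - (\<Sum>m<M. ten (fls_X ^ m) (fls_nth f (int m)))"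
	have "fls_nth r i = 0" if "i < int M" for i
	proof (cases "i < 0")
	case True
	thus ?thesis using assms by (simp add: r_def fls_nth_sum)
	next
	case False
	have "(\<Sum>m<M. fls_nth (ten (fls_X ^ m) (fls_nth f (int m))) i) = (\<Sum>m<M. if m = nat i then fls_nth f i else 0)"
	by (rule sum.cong) (use False in auto)
	thus ?thesis using False that by (simp add: r_def fls_nth_sum)
	qed
	moreover have "f = (\<Sum>m<M. ten (fls_X ^ m) (fls_nth f (int m))) + r" by (simp add: r_def)
	ultimately show ?thesis by blast
qed
text \<open>Only finitely many coefficients are seen by the truncated algebra.\<close>
lemma rho_finite:
	assumes f: "f : NN"
	shows "em (rho f) = (SUM y:U_places D. \<Sum>m<n y. rhol (atp y (ten (fls_X ^ m) (fls_nth (f y) (int m)))))"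
proof -
	have f': "equivariant (inverse om) (f Infty)" "equivariant om (f (At 0))" "!!x. x ~: marked D ==> x ~= 0 ==> f (At x) = 0"
	"!!i. i < 1 ==> fls_nth (f Infty) i = 0" "!!y i. i < 0 ==> fls_nth (f y) i = 0"
	proof -
	show "fls_nth (f y) i = 0" if "i < 0" for y i
	using f that by (cases y) (auto simp: nonneg_multiloops_def)
	qed (use f in "auto simp: nonneg_multiloops_def multiloop_space_eq")
	have ap: "(SUM z:A. F z) x = (SUM z:A. F z x)" for F :: "place => 'g multiloop" and A x
	by (induction A rule: infinite_finite_induct) auto
	have f_sum: "f = (SUM y:U_places D. atp y (f y))"
	proof (rule ext)
	fix x
	have "(SUM y:U_places D. atp y (f y)) x = (SUM y:U_places D. if y = x then f x else 0)"
	unfolding ap by (rule sum.cong) (auto simp: atp_def)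
	also have "\<dots> = f x"
	using finite_U_places f'(3) by (cases x) (auto simp: U_places_def)
	finally show "f x = (SUM y:U_places D. atp y (f y)) x" by simp
	qed
	have "rhol (atp y (f y)) = (\<Sum>m<n y. rhol (atp y (ten (fls_X ^ m) (fls_nth (f y) (int m)))))" if y: "y : U_places D" for y
	proof -
	obtain r where r: "f y = (\<Sum>m<n y. ten (fls_X ^ m) (fls_nth (f y) (int m))) + r" "ALL i<int (n y). fls_nth r i = 0"
	using fls_truncate[of "f y" "n y", OF f'(5)] by blast
	have yNN: "atp y h : NN" if "!!c. equivariant c (f y) ==> equivariant c h" "!!i. fls_nth (f y) i = 0 ==> fls_nth h i = 0" for h
	using that f' y unfolding nonneg_multiloops_def multiloop_space_eq U_places_def by (cases y) (auto simp: atp_def)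
	have mono: "atp y (ten (fls_X ^ m) (fls_nth (f y) (int m))) : NN" for m
	proof (rule yNN)
	show "equivariant c (ten (fls_X ^ m) (fls_nth (f y) (int m)))" if "equivariant c (f y)" for c
	using that by (auto simp: equivariant_def dest: spec[of _ "int m"])
	qed auto
	have "atp y (f y) : NN" by (rule yNN) auto
	hence "atp y (f y) - (\<Sum>m<n y. atp y (ten (fls_X ^ m) (fls_nth (f y) (int m)))) : NN"
	using mono by (intro mv.subspace_diff[OF nonneg_subspace] mv.subspace_sum[OF nonneg_subspace])
	moreover have e: "atp y (f y) = (\<Sum>m<n y. atp y (ten (fls_X ^ m) (fls_nth (f y) (int m)))) + atp y r"
	by (subst r(1)) (simp only: atp_ops atp_sum)
	ultimately have rN: "atp y r : NN" by (metis add_diff_cancel_left')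
	have "rho (atp y r) = \<zero>\<^sub>U"
	by (rule rho_small[OF rN y]) (use r(2) in "auto simp: atp_def")
	hence "rhol (atp y r) = 0" using rhol(2)[OF rN] by simp
	thus ?thesis by (subst e) (simp add: rhol.add rhol.sum)
	qed
	hence "rhol f = (SUM y:U_places D. \<Sum>m<n y. rhol (atp y (ten (fls_X ^ m) (fls_nth (f y) (int m)))))"
	by (subst f_sum) (simp add: rhol.sum)
	thus ?thesis using rhol(2)[OF f] by simp
qed
definition Rho :: "complex => nat => 'g => ('g U_elem pm)" where
	"Rho u N a = (SUM y:U_places D. \<Sum>m<n y. \<Sum>j<T. pm_scale (cf N u j y m) (rhol (atp y (ten (fls_X ^ m) ((sig ^^ j) a)))))"
definition hh :: "complex => nat => 'g => 'g fls" where
	"hh u N a = (SUM j:{1..<T}. ten (ser (cu N u j)) ((sig ^^ j) a))"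
definition rm :: "('g U_elem pm) => ('g U_elem pm) => ('g U_elem pm)" where
	"rm b v = em (un v \<otimes>\<^sub>U un b)"
lemma rm_linear: "pmlin (rm b)" "pmlin (%b. rm b v)"
	by (simp_all add: pm_lin_iff rm_def UA.unemb_add UA.unemb_scale UA.l_distr UA.r_distr UA.sm_mult1 UA.sm_mult2 UA.emb_add UA.emb_scale)
lemma Fu_negative:
	assumes u: "u ~: SS" and N: "N >= 1"
	shows "em (Fu u (gen (ten (fls_X_inv ^ N) a, 0) * p)) = rm (Rho u N a) (em (Fu u p)) + em (Fu u (gen (hh u N a, 0) * p))"
proof -
	interpret E: gaudin_eval D k n "{u}" by (rule eval_one[OF u])
	have uE: "u : E.SE" by (simp add: E.SE_def)
	have u0: "u ~= 0" using uE E.SE0 by auto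
	let ?x = "(ten (fls_X_inv ^ N) a, 0 :: complex)"
	have at: "atl u ?x = (E.at_pl (At u) (ten (fls_X_inv ^ N) a), 0)" by (auto simp: atl_def at_place_def E.at_pl_def)
	have pr: "E.Sp.proj (atl u ?x) = (E.at_pl (At u) (ten (fls_X_inv ^ N) a), 0) - E.gemb (E.gpt u N a)"
	using E.gpt_split[OF uE N, of a] E.gemb_GG[OF E.gpt_ratg[OF uE, of N a] E.gpt_equivariant] unfolding at
	by (intro E.Sp.proj_eqI) simp_all
	have nth_sum: "fls_nth (SUM k:A. ten (F k) (G k)) i = (SUM k:A. gs (fls_nth (F k) i) (G k))" for A F G and i
	by (simp add: fls_nth_sum)
	have h: "fst (E.Sp.proj (atl u ?x)) (At u) = hh u N a"
	proof (rule fls_eqI)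
	fix i
	have T: "{..<T} = insert 0 {1..<T}" using period by auto
	have ne: "u ~= om ^ j * u" if "j : {1..<T}" for j
	using E.pole_distinct[OF uE, of u j] uE that by auto
	have "fls_nth (ten (fls_X_inv ^ N) a) i - fls_nth (E.GE (E.gpt u N a) (At u)) i =
	- (SUM j:{1..<T}. gs (om ^ (j * N) * (fls_nth (sexp (%t. inverse (t - om ^ j * u) ^ N) (At u)) i)) ((sig ^^ j) a))"
	unfolding E.GE_gpt[OF uE] nth_sum T by (subst sum.insert) (auto simp: se_neg_power_At(2))
	also have "\<dots> = (SUM j:{1..<T}. gs (fls_nth (ser (cu N u j)) i) ((sig ^^ j) a))"
	unfolding sum_negf[symmetric]
	by (rule sum.cong) (use ne in "auto simp: se_neg_power_At(1) cu_def algebra_simps")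
	finally show "fls_nth (fst (E.Sp.proj (atl u ?x)) (At u)) i = fls_nth (hh u N a) i"
	unfolding pr hh_def nth_sum using uE by (simp add: E.gemb_simps E.at_pl_def)
	qed
	have reg: "fls_nth (fst (E.Sp.proj (atl u ?x)) y) (int m) = (\<Sum>j<T. gs (cf N u j y m) ((sig ^^ j) a))"
	if y: "y : U_places D" for y m
	proof (cases y)
	case Infty
	have "fls_nth (E.GE (E.gpt u N a) Infty) (int m) = (\<Sum>j<T. gs (cf N u j y m) ((sig ^^ j) a))"
	unfolding E.GE_gpt[OF uE] nth_sum Infty by (rule sum.cong) (auto simp: se_neg_power_Infty cf_def)
	thus ?thesis unfolding pr by (simp add: Infty E.gemb_simps E.at_pl_def)
	next
	case (At z)
	have z: "z : SS" "z = 0 | z : E.SE" using SS_places[of z] y At by (auto simp: U_places_def E.SE_def)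
	hence ne: "z ~= om ^ j * u" "z ~= u" for j using SS_rotate[OF u, of j] u by auto
	have "- fls_nth (E.GE (E.gpt u N a) (At z)) (int m) = (\<Sum>j<T. gs (cf N u j y m) ((sig ^^ j) a))"
	unfolding E.GE_gpt[OF uE] nth_sum At sum_negf[symmetric]
	by (rule sum.cong) (use ne in "auto simp: se_neg_power_At(1) cf_def")
	thus ?thesis unfolding pr using z ne by (simp add: At E.gemb_simps E.at_pl_def)
	qed
	have snd: "snd (E.Sp.proj (atl u ?x)) = 0" unfolding pr by (simp add: E.gemb_simps)
	let ?P = "E.Sp.proj (atl u ?x)"
	have NN: "res (fst ?P) : NN" by (rule E.res_PE[OF E.Sp.proj(2)])
	have "em (rho (res (fst ?P))) = Rho u N a"
	unfolding rho_finite[OF NN] Rho_def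
	proof (intro sum.cong refl)
	fix y m assume y: "y : U_places D"
	have "atp y (ten (fls_X ^ m) (fls_nth (res (fst ?P) y) (int m))) = (\<Sum>j<T. msc (cf N u j y m) (atp y (ten (fls_X ^ m) ((sig ^^ j) a))))"
	proof -
	have t: "ten (fls_X ^ m) (\<Sum>j<T. gs (c j) (b j)) = (\<Sum>j<T. lsc (c j) (ten (fls_X ^ m) (b j)))" for c b
	by (rule fls_eqI) (simp add: fls_nth_sum g.scale_sum_right g.scale_left_commute)
	show ?thesis using y by (simp add: res_def reg[OF y] t atp_sum atp_ops)
	qed
	thus "rhol (atp y (ten (fls_X ^ m) (fls_nth (res (fst ?P) y) (int m)))) = (\<Sum>j<T. pm_scale (cf N u j y m) (rhol (atp y (ten (fls_X ^ m) ((sig ^^ j) a)))))"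
	by (simp add: rhol.sum rhol.scale)
	qed
	hence "R ?P v = rm (Rho u N a) v" for v
	using rho_closed[OF NN] by (simp add: R_def snd rm_def) (metis UA.unemb_emb)
	thus ?thesis using E.ev_Cons[of u ?x p] by (simp add: h)
qed
lemma rm_sum: "rm (SUM a:A. F a) v = (SUM a:A. rm (F a) v)" and rm_scale: "rm (pm_scale c b) v = pm_scale c (rm b v)"
proof -
	interpret Vector_Spaces.linear pm_scale pm_scale "%b. rm b v" by (rule rm_linear)
	show "rm (SUM a:A. F a) v = (SUM a:A. rm (F a) v)" by (rule sum)
	show "rm (pm_scale c b) v = pm_scale c (rm b v)" by (rule scale)
qed
lemma rm_Rho: "rm (Rho u N a) v = (SUM y:U_places D. \<Sum>m<n y. \<Sum>j<T. pm_scale (cf N u j y m) (rm (rhol (atp y (ten (fls_X ^ m) ((sig ^^ j) a)))) v))"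
	unfolding Rho_def by (simp add: rm_sum rm_scale)
abbreviation "xm j m a == (ten (fls_X ^ m) ((sig ^^ j) a), 0 :: complex)"
lemma th_gen_asc: "th (gen (asc c x) * q) = pm_scale c (th (gen x * q))"
proof -
	have "gen (asc c x) - pm_scale c (gen x) : AI"
	using AL.uea_ideal_rel[OF AL.uea_relationsI(2)[of x c]] by simp
	from th_ideal[OF AI_times[OF this, of 1 q]] have "th (gen (asc c x) * q) = th (pm_scale c (gen x * q))"
	by (simp add: left_diff_distrib th.diff pm_scale_times del: pm_scale_single)
	thus ?thesis by (simp only: th.scale)
qed
text \<open>Letters of high order annihilate, so the regular part at the point itself can be truncated.\<close>
lemma th_hh:
	assumes M: "ALL f. (ALL i<int M. fls_nth f i = 0) --> th (gen (f, 0) * p) = 0"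
	shows "th (gen (hh u N a, 0) * p) = th (\<Sum>m<M. SUM j:{1..<T}. pm_scale (cu N u j m) (gen (xm j m a) * p))"
proof -
	have z: "fls_nth (hh u N a) i = 0" if "i < 0" for i using that by (simp add: hh_def fls_nth_sum)
	obtain r where r: "hh u N a = (\<Sum>m<M. ten (fls_X ^ m) (fls_nth (hh u N a) (int m))) + r" "ALL i<int M. fls_nth r i = 0"
	using fls_truncate[of "hh u N a" M, OF z] by blast
	have c: "ten (fls_X ^ m) (fls_nth (hh u N a) (int m)) = (SUM j:{1..<T}. lsc (cu N u j m) (ten (fls_X ^ m) ((sig ^^ j) a)))" for m
	by (rule fls_eqI) (simp add: hh_def fls_nth_sum g.scale_sum_right g.scale_left_commute)
	have ts: "th (gen (SUM b:B. F b, 0) * p) = (SUM b:B. th (gen (F b, 0) * p))" if "finite B" for B :: "nat set" and F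
	using that
	proof (induction B rule: finite_induct)
	case empty
	thus ?case using th_central[of 0 p] by simp
	next
	case (insert b B)
	thus ?case using th_gen_add[of "(F b, 0)" "(sum F B, 0)" p] by simp
	qed
	have sc: "th (gen (lsc c f, 0) * p) = pm_scale c (th (gen (f, 0) * p))" for c f
	using th_gen_asc[of c "(f, 0)" p] by simp
	have "th (gen (hh u N a, 0) * p) = th (gen (\<Sum>m<M. ten (fls_X ^ m) (fls_nth (hh u N a) (int m)), 0) * p) + th (gen (r, 0) * p)"
	by (subst r(1)) (simp flip: th_gen_add)
	also have "th (gen (r, 0) * p) = 0" using M r(2) by blast
	also have "th (gen (\<Sum>m<M. ten (fls_X ^ m) (fls_nth (hh u N a) (int m)), 0) * p) = (\<Sum>m<M. SUM j:{1..<T}. pm_scale (cu N u j m) (th (gen (xm j m a) * p)))"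
	by (simp only: ts[OF finite_lessThan] ts[OF finite_atLeastLessThan] c sc)
	finally show ?thesis by (simp add: th.sum th.scale)
qed
lemma cf_rational: assumes "y : U_places D" shows "srat SS (%u. cf N u j y m)"
proof (cases y)
	case Infty
	show ?thesis unfolding cf_def Infty
	by (cases "m < N") (auto intro!: sr_mult sr_power)
next
	case (At z)
	have "z + (- (om ^ j)) * u ~= 0" if "u ~: SS" for u
	using SS_rotate[OF that, of j] SS_places[of z] assms At by auto
	thus ?thesis unfolding cf_def At place.case neg_binom_def
	by (intro sr_mult sr_power sr_const sr_inverse_affine)
qed
lemma cf_deriv: assumes "y : U_places D" "u ~: SS" "N >= 1"
	shows "deriv (%u. cf N u j y m) u = of_nat N * cf (Suc N) u j y m"
proof (cases y)
	case (At z)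
	have nz: "z + (- (om ^ j)) * u ~= 0"
	using SS_rotate[OF assms(2), of j] SS_places[of z] assms At by auto
	have "((%u. - (om ^ (j * N)) * neg_binom N m (z + (- (om ^ j)) * u)) has_field_derivative
	- (om ^ (j * N)) * (- (om ^ j) * (- of_nat N * neg_binom (Suc N) m (z + (- (om ^ j)) * u)))) (at u)"
	by (rule DERIV_cmult[OF neg_binom_has_derivative[OF assms(3) nz]])
	from DERIV_imp_deriv[OF this] show ?thesis
	unfolding cf_def At place.case by (simp add: power_add mult_ac)
next
	case Infty
	show ?thesis
	proof (cases "m < N")
	case True
	thus ?thesis by (simp add: cf_def Infty)
	next
	case False
	let ?b = "of_nat ((m - 1) choose (m - N)) :: complex"
	have "((%u. om ^ (j * N) * (?b * (om ^ j * u) ^ (m - N))) has_field_derivative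
	om ^ (j * N) * (?b * (of_nat (m - N) * ((om ^ j * u) ^ (m - N - 1) * om ^ j)))) (at u)"
	by (auto intro!: derivative_eq_intros)
	from DERIV_imp_deriv[OF this]
	have "deriv (%u. cf N u j y m) u = om ^ (j * N) * om ^ j * (of_nat (m - N) * ?b) * (om ^ j * u) ^ (m - N - 1)"
	using False by (simp add: cf_def Infty mult_ac)
	also have "of_nat (m - N) * ?b = (if m < Suc N then 0 else of_nat N * of_nat ((m - 1) choose (m - Suc N)))"
	by (rule infinity_coefficient_derivative[OF assms(3)]) (use False in simp)
	finally show ?thesis by (simp add: cf_def Infty power_add mult_ac)
	qed
qed
lemma cu_rational: assumes "j : {1..<T}" shows "srat SS (%u. cu N u j m)"
	and cu_deriv: "u ~: SS ==> N >= 1 ==> deriv (%u. cu N u j m) u = of_nat (Suc m) * cu N u j (Suc m) + of_nat N * cu (Suc N) u j m"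
proof -
	have w: "om ^ j ~= 1" using prim assms by (auto simp: primitive_root_of_unity_def)
	have nz: "0 + (1 - om ^ j) * u ~= 0" if "u ~: SS" for u
	using that w by (auto simp: finite_poles_def)
	thus "srat SS (%u. cu N u j m)" unfolding cu_def neg_binom_def
	by (intro sr_mult sr_power sr_const sr_inverse_affine)
	assume u: "u ~: SS" and N: "N >= 1"
	let ?b = "%N m. neg_binom N m (0 + (1 - om ^ j) * u)"
	have "((%u. - (om ^ (j * N)) * neg_binom N m (0 + (1 - om ^ j) * u)) has_field_derivative
	- (om ^ (j * N)) * ((1 - om ^ j) * (- of_nat N * ?b (Suc N) m))) (at u)"
	by (rule DERIV_cmult[OF neg_binom_has_derivative[OF N nz[OF u]]])
	from DERIV_imp_deriv[OF this] have "deriv (%u. cu N u j m) u = - (om ^ (j * N)) * ((1 - om ^ j) * (- of_nat N * ?b (Suc N) m))"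
	unfolding cu_def .
	also have "\<dots> = - (om ^ (j * N)) * (- of_nat N * ?b (Suc N) m) + of_nat N * (- (om ^ (j * Suc N)) * ?b (Suc N) m)"
	by (simp add: algebra_simps power_add)
	also have "- of_nat N * ?b (Suc N) m = of_nat (Suc m) * ?b N (Suc m)" by (rule neg_binom_deriv(1)[OF N, symmetric])
	finally show "deriv (%u. cu N u j m) u = of_nat (Suc m) * cu N u j (Suc m) + of_nat N * cu (Suc N) u j m"
	unfolding cu_def by (simp add: mult_ac del: of_nat_Suc)
qed
text \<open>The derivative of \<open>X(u)\<close> is the value of the translate of \<open>X\<close>.\<close>
definition DD where "DD p \<longleftrightarrow> has_der SS (%u. em (Fu u p)) (%u. em (Fu u (trans p)))"
lemma DD_add: "DD p ==> DD q ==> DD (p + q)"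
	and DD_scale: "DD p ==> DD (pm_scale c p)"
proof -
	have l: "em (Fu u (x + y)) = em (Fu u x) + em (Fu u y)" "em (Fu u (pm_scale c x)) = pm_scale c (em (Fu u x))" if "u ~: SS" for u x y
	proof -
	interpret Vector_Spaces.linear pm_scale pm_scale "%p. em (Fu u p)" by (rule Fu_linear[OF that])
	show "em (Fu u (x + y)) = em (Fu u x) + em (Fu u y)" "em (Fu u (pm_scale c x)) = pm_scale c (em (Fu u x))"
	by (rule add scale)+
	qed
	show "DD p ==> DD q ==> DD (p + q)" unfolding DD_def
	by (rule has_der.cong[OF has_der.add]) (simp_all add: l trans.add)
	have "pmlin (pm_scale c :: ('g U_elem pm) => _)"
	by (simp add: pm_lin_iff pm.scale_right_distrib mult.commute)
	note sc = has_der_linear[OF this]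
	show "DD (pm_scale c p)" if "DD p"
	proof -
	have "has_der SS (%u. pm_scale c (em (Fu u p))) (%u. pm_scale c (em (Fu u (trans p))))"
	by (rule sc) (use that in "simp add: DD_def")
	thus ?thesis unfolding DD_def by (rule has_der.cong) (simp_all add: l trans.scale)
	qed
qed
lemma DD_sum: "(!!j. j : J ==> DD (F j)) ==> DD (SUM j:J. F j)"
proof (induction J rule: infinite_finite_induct)
	case empty
	have "em (Fu u 0) = 0" if "u ~: SS" for u
	proof -
	interpret Vector_Spaces.linear pm_scale pm_scale "%p. em (Fu u p)" by (rule Fu_linear[OF that])
	show ?thesis by (rule zero)
	qed
	thus ?case unfolding DD_def by (intro has_der.cong[OF has_der_zero]) (simp_all add: trans.zero)
next
	case (infinite A)
	have "em (Fu u 0) = 0" if "u ~: SS" for u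
	proof -
	interpret Vector_Spaces.linear pm_scale pm_scale "%p. em (Fu u p)" by (rule Fu_linear[OF that])
	show ?thesis by (rule zero)
	qed
	thus ?case using infinite unfolding DD_def by (intro has_der.cong[OF has_der_zero]) (simp_all add: trans.zero)
qed (simp add: DD_add)
lemma DD_cong: assumes "th p = th q" "DD p" shows "DD q"
proof -
	have "em (Fu u p) = em (Fu u q)" "em (Fu u (trans p)) = em (Fu u (trans q))" if "u ~: SS" for u
	by (rule vacuum_map_cong[OF em_Fu_vacuum_map[OF that] assms(1)],
	rule vacuum_map_cong[OF em_Fu_vacuum_map[OF that] vacuum_map_cong[OF trans_vacuum_map assms(1)]])
	thus ?thesis using assms(2) unfolding DD_def by (elim has_der.cong)
qed
lemma DD_negative:
	assumes w: "DD p" and nn: "!!x. x : affine_nonneg ==> DD (gen x * p)" and N: "N >= 1"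
	shows "DD (gen (ten (fls_X_inv ^ N) a, 0) * p)"
proof -
	obtain M1 where M1: "ALL f. (ALL i<M1. fls_nth f i = 0) --> th (gen (f, 0) * p) = 0" using th_smooth[of p] by (elim exE)
	obtain M2 where M2: "ALL f. (ALL i<M2. fls_nth f i = 0) --> th (gen (f, 0) * trans p) = 0" using th_smooth[of "trans p"] by (elim exE)
	define M where "M = nat (max M1 M2)"
	have Mp: "ALL f. (ALL i<int M. fls_nth f i = 0) --> th (gen (f, 0) * p) = 0" "ALL f. (ALL i<int (Suc M). fls_nth f i = 0) --> th (gen (f, 0) * p) = 0"
	and Mt: "ALL f. (ALL i<int (Suc M). fls_nth f i = 0) --> th (gen (f, 0) * trans p) = 0"
	using M1 M2 by (auto simp: M_def)
	let ?J = "{1..<T}"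
	have hhF: "em (Fu u (gen (hh u N' a, 0) * q)) = (\<Sum>m<M'. SUM j:?J. pm_scale (cu N' u j m) (em (Fu u (gen (xm j m a) * q))))"
	if "u ~: SS" "ALL f. (ALL i<int M'. fls_nth f i = 0) --> th (gen (f, 0) * q) = 0" for u N' M' q
	proof -
	interpret Fu: Vector_Spaces.linear pm_scale pm_scale "%p. em (Fu u p)" by (rule Fu_linear[OF that(1)])
	show ?thesis using vacuum_map_cong[OF em_Fu_vacuum_map[OF that(1)] th_hh[OF that(2), of u N' a]] by (simp add: Fu.sum Fu.scale)
	qed
	let ?b = "%y m j. rhol (atp y (ten (fls_X ^ m) ((sig ^^ j) a)))"
	let ?G = "%u m j. em (Fu u (gen (xm j m a) * p))"
	let ?T = "%u m j. em (Fu u (trans (gen (xm j m a) * p)))"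
	have A: "has_der SS
	(%u. (SUM y:U_places D. \<Sum>m<n y. \<Sum>j<T. pm_scale (cf N u j y m) (rm (?b y m j) (em (Fu u p)))) +
	(\<Sum>m<Suc M. SUM j:?J. pm_scale (cu N u j m) (?G u m j)))
	(%u. (SUM y:U_places D. \<Sum>m<n y. \<Sum>j<T. pm_scale (deriv (%u. cf N u j y m) u) (rm (?b y m j) (em (Fu u p))) + pm_scale (cf N u j y m) (rm (?b y m j) (em (Fu u (trans p))))) +
	(\<Sum>m<Suc M. SUM j:?J. pm_scale (deriv (%u. cu N u j m) u) (?G u m j) + pm_scale (cu N u j m) (?T u m j)))"
	proof (intro has_der.add has_der_sum has_der_scale[OF finite_SS])
	fix y m j assume y: "y : U_places D"
	show "srat SS (%u. cf N u j y m)" by (rule cf_rational[OF y])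
	show "has_der SS (%u. rm (?b y m j) (em (Fu u p))) (%u. rm (?b y m j) (em (Fu u (trans p))))"
	by (rule has_der_linear[OF rm_linear(1)]) (use w in "simp add: DD_def")
	next
	fix m j assume j: "j : ?J"
	show "srat SS (%u. cu N u j m)" by (rule cu_rational[OF j])
	have "xm j m a : affine_nonneg" by (auto simp: nonneg_iff)
	from nn[OF this] show "has_der SS (%u. ?G u m j) (%u. ?T u m j)" by (simp only: DD_def)
	qed
	show ?thesis unfolding DD_def
	proof (rule has_der.cong[OF A])
	fix u assume u: "u ~: SS"
	interpret Fu: Vector_Spaces.linear pm_scale pm_scale "%p. em (Fu u p)" by (rule Fu_linear[OF u])
	show "(SUM y:U_places D. \<Sum>m<n y. \<Sum>j<T. pm_scale (cf N u j y m) (rm (?b y m j) (em (Fu u p)))) +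
	(\<Sum>m<Suc M. SUM j:?J. pm_scale (cu N u j m) (?G u m j)) = em (Fu u (gen (ten (fls_X_inv ^ N) a, 0) * p))"
	unfolding Fu_negative[OF u N] rm_Rho hhF[OF u Mp(2)] ..
	have F1: "(SUM y:U_places D. \<Sum>m<n y. \<Sum>j<T. pm_scale (deriv (%u. cf N u j y m) u) (rm (?b y m j) (em (Fu u p))) + pm_scale (cf N u j y m) (rm (?b y m j) (em (Fu u (trans p)))))
	= pm_scale (of_nat N) (rm (Rho u (Suc N) a) (em (Fu u p))) + rm (Rho u N a) (em (Fu u (trans p)))"
	proof -
	have "(SUM y:U_places D. \<Sum>m<n y. \<Sum>j<T. pm_scale (deriv (%u. cf N u j y m) u) (rm (?b y m j) (em (Fu u p))) + pm_scale (cf N u j y m) (rm (?b y m j) (em (Fu u (trans p)))))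
	= (SUM y:U_places D. \<Sum>m<n y. \<Sum>j<T. pm_scale (of_nat N) (pm_scale (cf (Suc N) u j y m) (rm (?b y m j) (em (Fu u p)))) + pm_scale (cf N u j y m) (rm (?b y m j) (em (Fu u (trans p)))))"
	by (intro sum.cong refl) (simp add: cf_deriv[OF _ u N])
	thus ?thesis unfolding rm_Rho by (simp only: sum.distrib pm.scale_sum_right)
	qed
	have dT: "dT (xm j m a) = asc (- of_nat m) (xm j (m - 1) a)" for j m
	proof -
	have "- ld (ten (fls_X ^ m) ((sig ^^ j) a)) = lsc (- of_nat m) (ten (fls_X ^ (m - 1)) ((sig ^^ j) a))"
	proof (rule fls_eqI)
	fix i show "fls_nth (- ld (ten (fls_X ^ m) ((sig ^^ j) a))) i = fls_nth (lsc (- of_nat m) (ten (fls_X ^ (m - 1)) ((sig ^^ j) a))) i"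
	proof (cases m)
	case 0
	thus ?thesis by (cases "i + 1 = 0") (auto simp: eq_neg_iff_add_eq_0)
	next
	case (Suc m')
	have e: "i + 1 = int (Suc m') \<longleftrightarrow> i = int m'" by auto
	show ?thesis unfolding Suc uminus_fls.rep_eq fun_Compl_def ld_nth lsc_nth ten_nth fls_X_power_nth e
	by (cases "i = int m'") (simp_all add: add.commute flip: g.scale_minus_left)
	qed
	qed
	thus ?thesis by (simp add: dT_def)
	qed
	have asc: "em (Fu u (gen (asc c x) * q)) = pm_scale c (em (Fu u (gen x * q)))" for c x q
	proof -
	have "th (gen (asc c x) * q) = th (pm_scale c (gen x * q))" by (simp only: th_gen_asc th.scale)
	from vacuum_map_cong[OF em_Fu_vacuum_map[OF u] this] show ?thesis by (simp add: Fu.scale)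
	qed
	have Tm: "?T u m j = pm_scale (- of_nat m) (?G u (m - 1) j) + em (Fu u (gen (xm j m a) * trans p))" for m j
	by (simp only: trans_times trans_gen Fu.add dT asc)
	have GM: "?G u M j = 0" for j
	proof -
	have "th (gen (xm j M a) * p) = 0" using Mp(1) by (simp add: fls_X_power_nth)
	from vacuum_map_zero[OF em_Fu_vacuum_map[OF u] this] show ?thesis .
	qed
	have shift: "(\<Sum>m<Suc M. SUM j:?J. pm_scale (cu N u j m * - of_nat m) (?G u (m - 1) j)) = (\<Sum>m<M. SUM j:?J. pm_scale (- (of_nat (Suc m) * cu N u j (Suc m))) (?G u m j))"
	by (subst sum.lessThan_Suc_shift) (simp add: mult.commute del: of_nat_Suc)
	have F2: "(\<Sum>m<Suc M. SUM j:?J. pm_scale (deriv (%u. cu N u j m) u) (?G u m j) + pm_scale (cu N u j m) (?T u m j)) =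
	pm_scale (of_nat N) (em (Fu u (gen (hh u (Suc N) a, 0) * p))) + em (Fu u (gen (hh u N a, 0) * trans p))"
	proof -
	have "(\<Sum>m<Suc M. SUM j:?J. pm_scale (deriv (%u. cu N u j m) u) (?G u m j) + pm_scale (cu N u j m) (?T u m j)) =
	(\<Sum>m<Suc M. SUM j:?J. pm_scale (deriv (%u. cu N u j m) u) (?G u m j)) + (\<Sum>m<Suc M. SUM j:?J. pm_scale (cu N u j m * - of_nat m) (?G u (m - 1) j))
	+ (\<Sum>m<Suc M. SUM j:?J. pm_scale (cu N u j m) (em (Fu u (gen (xm j m a) * trans p))))"
	unfolding Tm by (simp only: sum.distrib pm.scale_right_distrib pm.scale_scale add.assoc)
	also have "(\<Sum>m<Suc M. SUM j:?J. pm_scale (cu N u j m) (em (Fu u (gen (xm j m a) * trans p)))) = em (Fu u (gen (hh u N a, 0) * trans p))"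
	by (rule hhF[OF u Mt, symmetric])
	also have "(\<Sum>m<Suc M. SUM j:?J. pm_scale (deriv (%u. cu N u j m) u) (?G u m j)) = (\<Sum>m<M. SUM j:?J. pm_scale (deriv (%u. cu N u j m) u) (?G u m j))"
	by (simp add: GM)
	also have "\<dots> + (\<Sum>m<Suc M. SUM j:?J. pm_scale (cu N u j m * - of_nat m) (?G u (m - 1) j)) =
	(\<Sum>m<M. SUM j:?J. pm_scale (of_nat N) (pm_scale (cu (Suc N) u j m) (?G u m j)))"
	unfolding shift sum.distrib[symmetric]
	by (intro sum.cong refl) (simp add: cu_deriv[OF _ u N] pm.scale_left_distrib del: of_nat_Suc)
	also have "\<dots> = pm_scale (of_nat N) (em (Fu u (gen (hh u (Suc N) a, 0) * p)))"
	unfolding hhF[OF u Mp(1)] by (simp only: pm.scale_sum_right)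
	finally show ?thesis .
	qed
	have dTx: "dT (ten (fls_X_inv ^ N) a, 0) = asc (of_nat N) (ten (fls_X_inv ^ Suc N) a, 0)"
	proof -
	have "- ld (ten (fls_X_inv ^ N) a) = lsc (of_nat N) (ten (fls_X_inv ^ Suc N) a)"
	proof (rule fls_eqI)
	fix i
	have e: "i + 1 = - int N \<longleftrightarrow> i = - int (Suc N)" by auto
	show "fls_nth (- ld (ten (fls_X_inv ^ N) a)) i = fls_nth (lsc (of_nat N) (ten (fls_X_inv ^ Suc N) a)) i"
	unfolding uminus_fls.rep_eq fun_Compl_def ld_nth lsc_nth ten_nth fls_X_inv_power_nth e
	by (cases "i = - int (Suc N)") simp_all
	qed
	thus ?thesis by (simp add: dT_def del: power_Suc)
	qed
	have "em (Fu u (trans (gen (ten (fls_X_inv ^ N) a, 0) * p))) =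
	pm_scale (of_nat N) (em (Fu u (gen (ten (fls_X_inv ^ Suc N) a, 0) * p))) + em (Fu u (gen (ten (fls_X_inv ^ N) a, 0) * trans p))"
	by (simp only: trans_times trans_gen Fu.add dTx asc)
	also have "\<dots> = pm_scale (of_nat N) (rm (Rho u (Suc N) a) (em (Fu u p))) + rm (Rho u N a) (em (Fu u (trans p))) +
	(pm_scale (of_nat N) (em (Fu u (gen (hh u (Suc N) a, 0) * p))) + em (Fu u (gen (hh u N a, 0) * trans p)))"
	using Fu_negative[OF u, of "Suc N" a p] Fu_negative[OF u N, of a "trans p"] by (simp add: pm.scale_right_distrib del: power_Suc)
	finally show "(SUM y:U_places D. \<Sum>m<n y. \<Sum>j<T. pm_scale (deriv (%u. cf N u j y m) u) (rm (?b y m j) (em (Fu u p))) + pm_scale (cf N u j y m) (rm (?b y m j) (em (Fu u (trans p))))) +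
	(\<Sum>m<Suc M. SUM j:?J. pm_scale (deriv (%u. cu N u j m) u) (?G u m j) + pm_scale (cu N u j m) (?T u m j))
	= em (Fu u (trans (gen (ten (fls_X_inv ^ N) a, 0) * p)))"
	unfolding F1 F2 by simp
	qed
qed
lemma DD_all: "DD p"
proof -
	interpret E: gaudin_eval D k n "{}" by (rule eval_set) auto
	have word: "DD (sgl w)" for w
	proof (induction "length w" arbitrary: w rule: less_induct)
	case less
	show ?case
	proof (cases w)
	case Nil
	have "has_der SS (%u. e1) (%u. 0)"
	using has_der.scalar[of SS "%u. 1" e1] by (rule has_der.cong) auto
	moreover have "em (Fu u (sgl w)) = e1" "em (Fu u (trans (sgl w))) = 0" if "u ~: SS" for u
	proof -
	interpret U: gaudin_eval D k n "{u}" by (rule eval_one[OF that])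
	interpret Fu: Vector_Spaces.linear pm_scale pm_scale "%p. em (Fu u p)" by (rule Fu_linear[OF that])
	show "em (Fu u (sgl w)) = e1" using U.ev_one[of u] by (simp add: Nil one_words)
	show "em (Fu u (trans (sgl w))) = 0" using Fu.zero by (simp add: Nil trans_def fder_sgl)
	qed
	ultimately show ?thesis unfolding DD_def by (elim has_der.cong) simp_all
	next
	case (Cons x w')
	have IH: "DD (sgl v)" if "length v = length w'" for v using less that Cons by simp
	have nn: "DD (gen y * sgl w')" if y: "y : affine_nonneg" for y
	proof (rule DD_cong)
	show "th (fder (abr y) (sgl w') + pm_scale (kap y) (sgl w')) = th (gen y * sgl w')"
	using th_ad[of y "sgl w'"] th_snoc[OF y, of "sgl w'"] by (simp only: th.add th.scale) simp
	have "DD (fder (abr y) (sgl w'))"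
	unfolding fder_sgl dsum_eq_sum by (rule DD_sum) (simp add: IH)
	thus "DD (fder (abr y) (sgl w') + pm_scale (kap y) (sgl w'))"
	using DD_add DD_scale IH by blast
	qed
	obtain f a where x: "x = (f, a)" by (cases x)
	obtain M r where r: "f = r + (\<Sum>m<M. ten (fls_X_inv ^ m) (fls_nth f (- int m)))" "!!m. m <= 0 ==> fls_nth r m = 0"
	by (rule E.fls_polar_decomposition[of f], rule that)
	have letter: "DD (gen (y + z) * sgl w')" if "DD (gen y * sgl w')" "DD (gen z * sgl w')" for y z
	by (rule DD_cong[OF _ DD_add[OF that]]) (simp only: th.add th_gen_add)
	have mono: "DD (gen (ten (fls_X_inv ^ m) b, 0) * sgl w')" for m b
	using nn[of "(ten (fls_X_inv ^ m) b, 0)"] DD_negative[OF IH[OF refl] nn, of m b]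
	by (cases "m = 0") (auto simp: nonneg_iff)
	have "DD (gen (\<Sum>m<M. ten (fls_X_inv ^ m) (F m), 0) * sgl w')" for M F
	proof (induction M)
	case 0
	thus ?case using nn[of "(0, 0)"] by (simp add: nonneg_iff)
	next
	case (Suc M)
	thus ?case using letter[OF Suc mono[of M "F M"]] by simp
	qed
	moreover have "DD (gen (r, a) * sgl w')" by (rule nn) (simp add: nonneg_iff r(2))
	ultimately have "DD (gen ((r, a) + (\<Sum>m<M. ten (fls_X_inv ^ m) (fls_nth f (- int m)), 0)) * sgl w')" by (rule letter[rotated])
	moreover have "(r, a) + (\<Sum>m<M. ten (fls_X_inv ^ m) (fls_nth f (- int m)), 0) = x" using r(1)[symmetric] by (simp add: x)
	ultimately show ?thesis by (simp add: Cons)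
	qed
	qed
	have "DD (SUM w:pkeys p. pm_scale (lkp p w) (sgl w))" by (intro DD_sum DD_scale word)
	thus ?thesis by (simp only: pm_expand[symmetric])
qed
end
section \<open>The Gaudin algebras\<close>
lemma vector_space_complex: "vector_space ((*) :: complex => complex => complex)"
	by unfold_locales (auto simp: algebra_simps)
context gaudin_U begin
lemma Fu_closed: "u ~: SS ==> Fu u p : UC"
proof -
	assume "u ~: SS"
	then interpret E: gaudin_eval D k n "{u}" by (rule eval_one)
	show ?thesis by (rule E.ev_closed)
qed
lemma Fu_product: "u ~: SS ==> sing q ==> Fu u (p * q) = Fu u q \<otimes>\<^sub>U Fu u p"
proof -
	assume "u ~: SS" "sing q"
	then interpret E: gaudin_eval D k n "{u}" by (intro eval_one)
	show ?thesis by (rule E.ev_product) (use \<open>sing q\<close> in auto)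
qed
lemma Fu_one: "u ~: SS ==> Fu u 1 = \<one>\<^sub>U"
proof -
	assume "u ~: SS"
	then interpret E: gaudin_eval D k n "{u}" by (rule eval_one)
	show ?thesis by (rule E.ev_one)
qed
lemma Fu_invariant: "u ~: SS ==> sig X = X ==> sing p ==> dlt X (Fu u p) = \<zero>\<^sub>U"
proof -
	assume "u ~: SS" "sig X = X" "sing p"
	then interpret E: gaudin_eval D k n "{u}" by (intro eval_one)
	show ?thesis by (rule E.ev_invariant) (use \<open>sig X = X\<close> \<open>sing p\<close> in auto)
qed
lemma Fu_commute_distinct:
	assumes "u ~: SS" "v ~: SS" "v ~: Gamma_orbit D u" "sing p" "sing q"
	shows "Fu u p \<otimes>\<^sub>U Fu v q = Fu v q \<otimes>\<^sub>U Fu u p"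
proof -
	interpret E: gaudin_eval D k n "{u, v}" by (rule eval_two[OF assms(1-3)])
	have "u ~= v" using assms(3) E.orbit_self by auto
	moreover have "E.ev u p = Fu u p" by (rule ev_propagation[OF eval_one[OF assms(1)] E.gaudin_eval_axioms]) simp_all
	moreover have "E.ev v q = Fu v q" by (rule ev_propagation[OF eval_one[OF assms(2)] E.gaudin_eval_axioms]) simp_all
	ultimately show ?thesis using E.ev_commute[of u v p q] assms(4,5) by simp
qed
text \<open>A functional that annihilates all translates of a vector at one point annihilates its values everywhere.\<close>
lemma continuation:
	assumes l: "pmfun l" and u: "u ~: SS"
	and z: "!!m. l (em (Fu u ((trans ^^ m) q))) = 0" and v: "v ~: SS"
	shows "l (em (Fu v q)) = 0"
proof (rule sr_zero_of_derivatives[OF finite_SS _ u _ v])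
	have d: "srat SS (%u. l (em (Fu u q)))" "w ~: SS ==> deriv (%u. l (em (Fu u q))) w = l (em (Fu w (trans q)))" for q w
	using has_der_functional[OF finite_SS l DD_all[unfolded DD_def]] by auto
	show "srat SS (%u. l (em (Fu u q)))" by (rule d)
	have op: "open (- SS)" using finite_SS by (simp add: finite_imp_closed open_Compl)
	have "(deriv ^^ m) (%u. l (em (Fu u q))) w = l (em (Fu w ((trans ^^ m) q)))" if "w ~: SS" for m w
	using that
	proof (induction m arbitrary: w)
	case (Suc m)
	have "deriv ((deriv ^^ m) (%u. l (em (Fu u q)))) w = deriv (%u. l (em (Fu u ((trans ^^ m) q)))) w"
	by (rule deriv_cong_ev) (use Suc eventually_nhds_in_open[OF op, of w] in "auto elim!: eventually_mono")
	thus ?case using d(2)[OF Suc.prems, of "(trans ^^ m) q"] by simp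
	qed simp
	thus "(deriv ^^ m) (%u. l (em (Fu u q))) u = 0" for m using u z by simp
qed
lemma sing_trans_power: "sing p ==> sing ((trans ^^ m) p)"
	by (induction m) (auto intro: sing_trans)
lemma functional_eqI:
	assumes x: "x : UC" and y: "y : UC" and e: "!!l. pmfun l ==> l (em x) = (l (em y) :: complex)"
	shows "x = y"
proof -
	have "em x = em y"
	proof (rule ccontr)
	assume "em x ~= em y"
	hence "em x - em y ~: {0}" by simp
	from separating_functional[OF pm.vector_space_axioms pm.subspace_single_0 this]
	obtain l where l: "pmfun l" "l (em x - em y) ~= (0::complex)" by blast
	interpret l: Vector_Spaces.linear pm_scale "(*)" l by fact
	show False using l(2) e[OF l(1)] by (simp add: l.diff)
	qed
	thus ?thesis using UA.emb_eq_iff[OF x y] by simp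
qed
lemma Fu_commute:
	assumes u: "u ~: SS" and v: "v ~: SS" and p: "sing p" and q: "sing q"
	shows "Fu u p \<otimes>\<^sub>U Fu v q = Fu v q \<otimes>\<^sub>U Fu u p"
proof -
	interpret E: gaudin_eval D k n "{u}" by (rule eval_one[OF u])
	have "finite (SS \<union> Gamma_orbit D u)" using finite_SS by (simp add: E.Gamma_orbit_eq)
	then obtain v0 where v0: "v0 ~: SS" "v0 ~: Gamma_orbit D u"
	using ex_new_if_finite[OF infinite_UNIV_char_0] by blast
	note c = Fu_closed[OF u, of p]
	show ?thesis
	proof (rule functional_eqI)
	fix l :: "('g U_elem pm) => complex" assume l: "pmfun l"
	interpret l: Vector_Spaces.linear pm_scale "(*)" l by fact
	let ?m = "%b. l (em (Fu u p \<otimes>\<^sub>U un b)) - l (em (un b \<otimes>\<^sub>U Fu u p))"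
	have m: "pmfun ?m"
	using c by (simp add: pm_lin_iff vector_space_complex UA.unemb_add UA.unemb_scale
	UA.l_distr UA.r_distr UA.sm_mult1 UA.sm_mult2 UA.emb_add UA.emb_scale l.add l.scale right_diff_distrib)
	have "?m (em (Fu v q)) = 0"
	proof (rule continuation[OF m v0(1) _ v])
	fix j
	show "?m (em (Fu v0 ((trans ^^ j) q))) = 0"
	using Fu_commute_distinct[OF u v0 p sing_trans_power[OF q], of j] Fu_closed[OF v0(1)] by simp
	qed
	thus "l (em (Fu u p \<otimes>\<^sub>U Fu v q)) = l (em (Fu v q \<otimes>\<^sub>U Fu u p))" using Fu_closed[OF v] by simp
	qed (use Fu_closed u v in auto)
qed
definition "B1 = {Fu u p | u p. u ~: SS & sing p}"
definition "GA = lin_span (U_alg D n) B1"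
lemma B1_closed: "B1 <= UC" using Fu_closed by (auto simp: B1_def)
lemma csub_GA: "csub (U_alg D n) GA" and B1_GA: "B1 <= GA"
	and GA_minimal: "csub (U_alg D n) W ==> B1 <= W ==> GA <= W"
	unfolding GA_def by (rule csub_lin_span[OF UA.cspace_axioms B1_closed])+
lemma GA_carrier: "x : GA ==> x : UC" using csub_GA by (auto simp: csub_def)
lemma csubI:
	assumes "\<zero>\<^sub>U : W" "W <= UC" "!!x y. x : W ==> y : W ==> x \<oplus>\<^sub>U y : W"
	"!!c x. x : W ==> c \<odot>\<^sub>U x : W"
	shows "csub (U_alg D n) W"
	using assms by (auto simp: csub_def)
lemma GA_ops: "\<zero>\<^sub>U : GA" "x : GA ==> y : GA ==> x \<oplus>\<^sub>U y : GA" "x : GA ==> c \<odot>\<^sub>U x : GA"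
	using csub_GA by (auto simp: csub_def)
lemma GA_product_basis:
	assumes u: "u ~: SS" and v: "v ~: SS" and p: "sing p" and q: "sing q"
	shows "Fu u p \<otimes>\<^sub>U Fu v q : GA"
proof (rule UA.mem_csub_iff_functional[OF csub_GA])
	note c = Fu_closed[OF u, of p]
	fix l assume l: "pmfun l" and lG: "ALL w:GA. l (em w) = (0::complex)"
	interpret l: Vector_Spaces.linear pm_scale "(*)" l by fact
	let ?m = "%b. l (em (Fu u p \<otimes>\<^sub>U un b))"
	have m: "pmfun ?m"
	using c by (simp add: pm_lin_iff vector_space_complex UA.unemb_add UA.unemb_scale
	UA.r_distr UA.sm_mult2 UA.emb_add UA.emb_scale l.add l.scale)
	have "?m (em (Fu v q)) = 0"
	proof (rule continuation[OF m u _ v])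
	fix j
	have "Fu u ((trans ^^ j) q * p) : GA"
	using B1_GA u sing_times[OF sing_trans_power[OF q] p] by (auto simp: B1_def)
	thus "?m (em (Fu u ((trans ^^ j) q))) = 0"
	using lG Fu_product[OF u p] Fu_closed[OF u] by auto
	qed
	thus "l (em (Fu u p \<otimes>\<^sub>U Fu v q)) = 0" using Fu_closed[OF v] by simp
qed (use Fu_closed u v in auto)
lemma GA_product: assumes "x : GA" "y : GA" shows "x \<otimes>\<^sub>U y : GA"
proof -
	have 1: "b \<otimes>\<^sub>U y : GA" if "b : B1" "y : GA" for b y
	proof -
	have b: "b : UC" using B1_closed that by auto
	have "csub (U_alg D n) {y : UC. b \<otimes>\<^sub>U y : GA}"
	by (rule csubI) (use b GA_ops in "auto simp: UA.r_distr UA.sm_mult2")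
	hence "GA <= {y : UC. b \<otimes>\<^sub>U y : GA}"
	by (rule GA_minimal) (use \<open>b : B1\<close> GA_product_basis Fu_closed in "auto simp: B1_def")
	thus ?thesis using that by auto
	qed
	have y: "y : UC" using GA_carrier assms by auto
	have "csub (U_alg D n) {x : UC. x \<otimes>\<^sub>U y : GA}"
	by (rule csubI) (use y GA_ops in "auto simp: UA.l_distr UA.sm_mult1")
	hence "GA <= {x : UC. x \<otimes>\<^sub>U y : GA}"
	by (rule GA_minimal) (use 1 assms B1_closed in auto)
	thus ?thesis using assms by auto
qed
lemma GA_commute: assumes "x : GA" "y : GA" shows "x \<otimes>\<^sub>U y = y \<otimes>\<^sub>U x"
proof -
	let ?C = "%b. {y : UC. b \<otimes>\<^sub>U y = y \<otimes>\<^sub>U b}"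
	have C: "csub (U_alg D n) (?C b)" if "b : UC" for b
	by (rule csubI) (use that in "auto simp: UA.l_distr UA.r_distr UA.sm_mult1 UA.sm_mult2")
	have 1: "GA <= ?C b" if "b : B1" for b
	by (rule GA_minimal[OF C]) (use that B1_closed Fu_commute Fu_closed in "auto simp: B1_def")
	have "GA <= ?C y"
	proof (rule GA_minimal[OF C])
	show "B1 <= ?C y"
	proof
	fix b assume b: "b : B1"
	hence "y : ?C b" using 1 assms(2) by blast
	thus "b : ?C y" using b B1_closed by auto
	qed
	qed (use assms GA_carrier in auto)
	thus ?thesis using assms by auto
qed
lemma GA_one: "\<one>\<^sub>U : GA"
proof -
	obtain u where "u ~: SS" using ex_new_if_finite[OF infinite_UNIV_char_0 finite_SS] by blast
	thus ?thesis using B1_GA Fu_one[of u] sing_one unfolding B1_def by force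
qed
definition "Inv = {a : UC. ALL X. sig X = X --> U_derivation D n X a = \<zero>\<^sub>U}"
lemma Inv_ops: "\<zero>\<^sub>U : Inv" "\<one>\<^sub>U : Inv" "x : Inv ==> y : Inv ==> x \<oplus>\<^sub>U y : Inv"
	"x : Inv ==> y : Inv ==> x \<otimes>\<^sub>U y : Inv" "x : Inv ==> c \<odot>\<^sub>U x : Inv"
	using dlt_zero_one dlt_ops(1,2) dlt_scale by (auto simp: Inv_def dlt_def)
lemma csub_Inv: "csub (U_alg D n) Inv"
	by (rule csubI) (use Inv_ops in "auto simp: Inv_def")
lemma GA_Inv: "GA <= Inv"
	by (rule GA_minimal[OF csub_Inv]) (use Fu_invariant Fu_closed in "auto simp: B1_def Inv_def dlt_def")
lemma GA_comm_subalgebra: "comm_subalgebra GA (U_invariants D n)"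
proof -
	have e: "U_invariants D n = (U_alg D n)\<lparr>carrier := Inv\<rparr>" by (simp add: U_invariants_def Inv_def)
	show ?thesis unfolding e
	proof (rule comm_subalgebraI)
	show "calg ((U_alg D n)\<lparr>carrier := Inv\<rparr>)" by (rule calg_restrict[OF UA.calg_axioms csub_Inv Inv_ops(2)]) (rule Inv_ops)
	show "csub ((U_alg D n)\<lparr>carrier := Inv\<rparr>) GA" using csub_GA GA_Inv by (auto simp: csub_def)
	qed (use GA_one GA_product GA_commute in auto)
qed
subsection \<open>Laurent coefficients and values\<close>
definition "B0 = {laurent_coeff (U_alg D n) SS (X_elem D n k Z) x q | Z x q. Z : singular_vectors D k & (x, q) : singular_positions D}"
lemma laurent_functional:
	shows "laurent_coeff (U_alg D n) SS (X_elem D n k (theta p)) x q \<in> carrier (U_alg D n)"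
	and "Vector_Spaces.linear pm_scale (*) l \<Longrightarrow>
	l (em (laurent_coeff (U_alg D n) SS (X_elem D n k (theta p)) x q)) = fls_nth (scalar_expansion (\<lambda>u. l (em (Fu u p))) x) q"
proof -
	let ?f = "X_elem D n k (theta p)"
	let ?c = "\<lambda>l r a. (\<Oplus>\<^bsub>U_alg D n\<^esub> j\<in>{..<l::nat}. fls_nth (scalar_expansion (r j) x) q \<odot>\<^bsub>U_alg D n\<^esub> a j)"
	have f: "?f u = Fu u p" if "u \<notin> SS" for u using X_elem_Fu[OF that] .
	have "rational_function (U_alg D n) SS (\<lambda>u. un (em (Fu u p)))"
	by (rule UA.has_der_rational[OF DD_all[unfolded DD_def]])
	then obtain L r a where "rational_repr (U_alg D n) SS (\<lambda>u. un (em (Fu u p))) L r a" by (auto simp: rational_function_def)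
	then have lra: "rational_repr (U_alg D n) SS ?f L r a" using f Fu_closed by (simp add: rational_repr_def)
	have val: "?c L r a \<in> carrier (U_alg D n) \<and> (\<forall>l. Vector_Spaces.linear pm_scale (*) l \<longrightarrow> l (em (?c L r a)) = fls_nth (scalar_expansion (\<lambda>u. l (em (Fu u p))) x) q)"
	if "rational_repr (U_alg D n) SS ?f L r a" for L r a
	proof (intro conjI allI impI)
	have r: "\<And>j. j < L \<Longrightarrow> scalar_rational SS (r j)" and a: "\<And>j. j < L \<Longrightarrow> a j \<in> carrier (U_alg D n)"
	and fu: "\<And>u. u \<notin> SS \<Longrightarrow> Fu u p = (\<Oplus>\<^bsub>U_alg D n\<^esub> j\<in>{..<L}. r j u \<odot>\<^bsub>U_alg D n\<^esub> a j)"
	using that f by (auto simp: rational_repr_def)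
	show "?c L r a \<in> carrier (U_alg D n)" using a by (intro UA.finsum_closed) auto
	fix l :: "('g U_elem \<Rightarrow>\<^sub>0 complex) \<Rightarrow> complex" assume l: "Vector_Spaces.linear pm_scale (*) l"
	interpret l: Vector_Spaces.linear pm_scale "(*)" l by fact
	have lin: "l (em (\<Oplus>\<^bsub>U_alg D n\<^esub> j\<in>{..<L}. c j \<odot>\<^bsub>U_alg D n\<^esub> a j)) = (\<Sum>j<L. c j * l (em (a j)))" for c
	using a by (subst UA.emb_finsum) (auto simp: l.sum UA.emb_scale l.scale)
	have "l (em (?c L r a)) = fls_nth (\<Sum>j<L. fls_const (l (em (a j))) * scalar_expansion (r j) x) q"
	unfolding lin by (simp add: fls_nth_sum mult.commute)
	also have "(\<Sum>j<L. fls_const (l (em (a j))) * scalar_expansion (r j) x) = scalar_expansion (\<lambda>u. \<Sum>j<L. l (em (a j)) * r j u) x"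
	using r by (subst se_sum[OF finite_SS]) (auto intro!: sr_mult sum.cong simp: se_scale[OF finite_SS])
	also have "\<dots> = scalar_expansion (\<lambda>u. l (em (Fu u p))) x"
	by (rule se_cong[OF finite_SS]) (use r in \<open>auto intro!: sr_sum sr_mult simp: fu lin mult.commute\<close>)
	finally show "l (em (?c L r a)) = fls_nth (scalar_expansion (\<lambda>u. l (em (Fu u p))) x) q" .
	qed
	have "laurent_coeff (U_alg D n) SS ?f x q = ?c L r a"
	unfolding laurent_coeff_def
	proof (rule the_equality)
	show "\<exists>l r' a'. rational_repr (U_alg D n) SS ?f l r' a' \<and> ?c L r a = ?c l r' a'" using lra by blast
	fix c assume "\<exists>l r a. rational_repr (U_alg D n) SS ?f l r a \<and> c = ?c l r a"
	then obtain L' r' a' where c: "rational_repr (U_alg D n) SS ?f L' r' a'" "c = ?c L' r' a'" by blast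
	show "c = ?c L r a" unfolding c(2)
	by (rule functional_eqI) (use val[OF c(1)] val[OF lra] in auto)
	qed
	then show "laurent_coeff (U_alg D n) SS ?f x q \<in> carrier (U_alg D n)"
	"Vector_Spaces.linear pm_scale (*) l \<Longrightarrow> l (em (laurent_coeff (U_alg D n) SS ?f x q)) = fls_nth (scalar_expansion (\<lambda>u. l (em (Fu u p))) x) q"
	using val[OF lra] by auto
qed
lemma B0_eq: "B0 = {laurent_coeff (U_alg D n) SS (X_elem D n k (theta p)) x q | p x q. sing p & (x, q) : singular_positions D}"
	unfolding B0_def singular_vectors_eq by blast
lemma B0_closed: "B0 <= UC" using laurent_functional(1) by (auto simp: B0_eq)
text \<open>The singular Laurent coefficients and the values span the same space.\<close>
lemma span_B0: "lin_span (U_alg D n) B0 = GA"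
proof
	note span = csub_lin_span[OF UA.cspace_axioms B0_closed]
	show "lin_span (U_alg D n) B0 <= GA"
	proof (rule span(3)[OF csub_GA], rule subsetI)
	fix b assume "b : B0"
	then obtain p x q where b: "b = laurent_coeff (U_alg D n) SS (X_elem D n k (theta p)) x q" "sing p" by (auto simp: B0_eq)
	show "b : GA"
	proof (rule UA.mem_csub_iff_functional[OF csub_GA])
	show "b : UC" unfolding b(1) by (rule laurent_functional)
	fix l assume l: "pmfun l" and z: "ALL w:GA. l (em w) = (0::complex)"
	have "l (em (Fu u p)) = 0" if "u ~: SS" for u using z B1_GA b(2) that by (auto simp: B1_def)
	hence "sexp (%u. l (em (Fu u p))) x = sexp (%u. 0) x"
	by (intro se_cong[symmetric, OF finite_SS]) auto
	thus "l (em b) = 0" unfolding b(1) laurent_functional(2)[OF l] by simp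
	qed
	qed
	show "GA <= lin_span (U_alg D n) B0"
	proof (rule GA_minimal[OF span(1)], rule subsetI)
	fix b assume "b : B1"
	then obtain u p where b: "b = Fu u p" "u ~: SS" "sing p" by (auto simp: B1_def)
	show "b : lin_span (U_alg D n) B0"
	proof (rule UA.mem_csub_iff_functional[OF span(1)])
	show "b : UC" unfolding b(1) by (rule Fu_closed[OF b(2)])
	fix l assume l: "pmfun l" and z: "ALL w:lin_span (U_alg D n) B0. l (em w) = (0::complex)"
	have c: "fls_nth (sexp (%u. l (em (Fu u p))) x) q = 0" if "(x, q) : singular_positions D" for x q
	using z span(2) b(3) that unfolding laurent_functional(2)[OF l, symmetric] B0_eq by blast
	have "l (em (Fu u p)) = 0"
	proof (rule no_poles_imp_zero[OF finite_SS _ _ _ b(2)])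
	show "srat SS (%u. l (em (Fu u p)))"
	using has_der_functional[OF finite_SS l DD_all[unfolded DD_def]] by blast
	qed (rule c, auto simp: singular_positions_def)+
	thus "l (em b) = 0" by (simp add: b)
	qed
	qed
qed
end
lemma (in gaudin_level) gaudin_UI: "m : exponents D ==> gaudin_U D m"
	by (intro gaudin_U.intro gaudin_level.intro gaudin_data_axioms gaudin_U_axioms.intro)
subsection \<open>The inverse limit\<close>
context gaudin_level begin
lemma U_proj_class:
	assumes m: "m : exponents D" and n: "n : exponents D" and le: "n <= m" and a: "a : carrier (uea (p_alg D))"
	shows "U_proj D n (U_class D m a) = U_class D n a"
proof -
	interpret M: gaudin_U D k m by (rule gaudin_UI[OF m])
	interpret N: gaudin_U D k n by (rule gaudin_UI[OF n])
	have sub: "U_ideal D m <= U_ideal D n"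
	proof -
	let ?G = "%n. {uea_incl (p_alg D) f | f x. x : U_places D & f : lcarrier (p_alg D) & (ALL y. y ~= x --> f y = 0) & (ALL i < int (n x). fls_nth (f x) i = 0)}"
	have "?G m <= ?G n"
	proof
	fix a assume "a : ?G m"
	then obtain f x where f: "a = uea_incl (p_alg D) f" "x : U_places D" "f : lcarrier (p_alg D)" "ALL y. y ~= x --> f y = 0" "ALL i < int (m x). fls_nth (f x) i = 0"
	by (elim CollectE exE conjE)
	have "ALL i < int (n x). fls_nth (f x) i = 0"
	using f(5) le_funD[OF le, of x] by simp
	thus "a : ?G n" using f(1-4) by (intro CollectI exI[of _ f] exI[of _ x]) simp
	qed
	moreover have "?G n <= U_ideal D n"
	unfolding U_ideal_def by (rule M.PL.U.genideal_self) (use M.PL.uea_incl_closed in auto)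
	ultimately show ?thesis unfolding U_ideal_def[of D m]
	by (intro M.PL.U.genideal_minimal[OF N.ideal_U_ideal]) (rule subset_trans)
	qed
	show ?thesis unfolding U_proj_def U_class_def[of D m]
	by (rule M.PL.U.quot_UN[OF M.csub_U_ideal a])
	(use sub a in "auto simp: U_class_def M.PL.U.coset_eq_iff[OF N.csub_U_ideal]")
qed
lemma U_surj: "m : exponents D ==> x : carrier (U_alg D m) ==> EX a:carrier (uea (p_alg D)). x = U_class D m a"
	by (auto simp: U_alg_def quot_simps U_class_def)
lemma U_proj_ops:
	assumes m: "m : exponents D" and n: "n : exponents D" and le: "n <= m"
	and x: "x : carrier (U_alg D m)" and y: "y : carrier (U_alg D m)"
	shows "U_proj D n (x \<oplus>\<^bsub>U_alg D m\<^esub> y) = U_proj D n x \<oplus>\<^bsub>U_alg D n\<^esub> U_proj D n y"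
	"U_proj D n (x \<otimes>\<^bsub>U_alg D m\<^esub> y) = U_proj D n x \<otimes>\<^bsub>U_alg D n\<^esub> U_proj D n y"
	"U_proj D n (c \<odot>\<^bsub>U_alg D m\<^esub> x) = c \<odot>\<^bsub>U_alg D n\<^esub> U_proj D n x"
	"U_proj D n \<zero>\<^bsub>U_alg D m\<^esub> = \<zero>\<^bsub>U_alg D n\<^esub>" "U_proj D n \<one>\<^bsub>U_alg D m\<^esub> = \<one>\<^bsub>U_alg D n\<^esub>"
proof -
	interpret M: gaudin_U D k m by (rule gaudin_UI[OF m])
	interpret N: gaudin_U D k n by (rule gaudin_UI[OF n])
	from U_surj[OF m x] obtain a where a: "a : carrier (uea (p_alg D))" "x = U_class D m a" by (elim bexE)
	from U_surj[OF m y] obtain b where b: "b : carrier (uea (p_alg D))" "y = U_class D m b" by (elim bexE)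
	note cls = U_proj_class[OF m n le]
	show "U_proj D n (x \<oplus>\<^bsub>U_alg D m\<^esub> y) = U_proj D n x \<oplus>\<^bsub>U_alg D n\<^esub> U_proj D n y"
	"U_proj D n (x \<otimes>\<^bsub>U_alg D m\<^esub> y) = U_proj D n x \<otimes>\<^bsub>U_alg D n\<^esub> U_proj D n y"
	"U_proj D n (c \<odot>\<^bsub>U_alg D m\<^esub> x) = c \<odot>\<^bsub>U_alg D n\<^esub> U_proj D n x"
	unfolding a(2) b(2) using a b by (simp_all add: M.U_class_ops M.U_class_scale N.U_class_ops N.U_class_scale cls)
	show "U_proj D n \<zero>\<^bsub>U_alg D m\<^esub> = \<zero>\<^bsub>U_alg D n\<^esub>" "U_proj D n \<one>\<^bsub>U_alg D m\<^esub> = \<one>\<^bsub>U_alg D n\<^esub>"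
	using cls[of "uea_class (p_alg D) 0"] cls[of "uea_class (p_alg D) 1"]
	by (simp_all add: M.cl_zero N.cl_zero M.cl_one N.cl_one M.cl_def N.cl_def M.PL.uea_class_closed)
qed
abbreviation "UL == U_lim D"
lemma U_lim_simps:
	"monoid.mult UL = (%a b. \<lambda>n\<in>exponents D. a n \<otimes>\<^bsub>U_alg D n\<^esub> b n)" "one UL = (\<lambda>n\<in>exponents D. \<one>\<^bsub>U_alg D n\<^esub>)"
	"ring.zero UL = (\<lambda>n\<in>exponents D. \<zero>\<^bsub>U_alg D n\<^esub>)" "add UL = (%a b. \<lambda>n\<in>exponents D. a n \<oplus>\<^bsub>U_alg D n\<^esub> b n)"
	"smult UL = (%c a. \<lambda>n\<in>exponents D. c \<odot>\<^bsub>U_alg D n\<^esub> a n)"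
	by (simp_all add: U_lim_def)
lemma UL_carrier: "a : carrier UL \<longleftrightarrow> a : extensional (exponents D) & (ALL n:exponents D. a n : carrier (U_alg D n)) &
	(ALL m:exponents D. ALL n:exponents D. n <= m --> U_proj D n (a m) = a n)"
	by (auto simp: U_lim_def PiE_iff)
lemma UL_eqI: "a : carrier UL ==> b : carrier UL ==> (!!n. n : exponents D ==> a n = b n) ==> a = b"
	unfolding UL_carrier by (rule extensionalityI) auto
lemma calg_U: "m : exponents D ==> calg (U_alg D m)"
proof -
	assume "m : exponents D"
	then interpret M: gaudin_U D k m by (rule gaudin_UI)
	show ?thesis by (rule M.UA.calg_axioms)
qed
lemma UL_closed:
	"a : carrier UL ==> b : carrier UL ==> a \<oplus>\<^bsub>UL\<^esub> b : carrier UL"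
	"a : carrier UL ==> b : carrier UL ==> a \<otimes>\<^bsub>UL\<^esub> b : carrier UL"
	"a : carrier UL ==> c \<odot>\<^bsub>UL\<^esub> a : carrier UL" "\<zero>\<^bsub>UL\<^esub> : carrier UL" "\<one>\<^bsub>UL\<^esub> : carrier UL"
proof -
	have R: "abelian_group (U_alg D m)" "ring (U_alg D m)" "cspace (U_alg D m)" if "m : exponents D" for m
	using calg_U[OF that] by (auto simp: calg_def cspace_def)
	note cl = abelian_monoid.a_closed[OF abelian_group.axioms(1)[OF R(1)]] ring.ring_simprules(5)[OF R(2)] cspace.sm_closed[OF R(3)]
	show "a \<oplus>\<^bsub>UL\<^esub> b : carrier UL" "a \<otimes>\<^bsub>UL\<^esub> b : carrier UL" if "a : carrier UL" "b : carrier UL"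
	using that unfolding UL_carrier U_lim_simps by (auto simp: cl U_proj_ops)
	show "c \<odot>\<^bsub>UL\<^esub> a : carrier UL" if "a : carrier UL"
	using that U_proj_ops(3) unfolding UL_carrier U_lim_simps by (auto simp: cl)
	have zo: "\<zero>\<^bsub>U_alg D m\<^esub> : carrier (U_alg D m)" "\<one>\<^bsub>U_alg D m\<^esub> : carrier (U_alg D m)" if "m : exponents D" for m
	using ring.ring_simprules(2,6)[OF R(2)[OF that]] by auto
	show "\<zero>\<^bsub>UL\<^esub> : carrier UL" "\<one>\<^bsub>UL\<^esub> : carrier UL"
	unfolding UL_carrier U_lim_simps using zo U_proj_ops(4,5)[OF _ _ _ zo(1) zo(1)] by auto
qed
lemma UL_apply:
	assumes "m : exponents D"
	shows "(a \<oplus>\<^bsub>UL\<^esub> b) m = a m \<oplus>\<^bsub>U_alg D m\<^esub> b m" "(a \<otimes>\<^bsub>UL\<^esub> b) m = a m \<otimes>\<^bsub>U_alg D m\<^esub> b m"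
	"(c \<odot>\<^bsub>UL\<^esub> a) m = c \<odot>\<^bsub>U_alg D m\<^esub> a m" "\<zero>\<^bsub>UL\<^esub> m = \<zero>\<^bsub>U_alg D m\<^esub>" "\<one>\<^bsub>UL\<^esub> m = \<one>\<^bsub>U_alg D m\<^esub>"
	using assms by (simp_all add: U_lim_simps)
lemma UL_component: "a : carrier UL ==> m : exponents D ==> a m : carrier (U_alg D m)"
	by (simp add: UL_carrier)
lemma calg_UL: "calg UL"
proof -
	have neg: "EX y:carrier UL. y \<oplus>\<^bsub>UL\<^esub> x = \<zero>\<^bsub>UL\<^esub>" if x: "x : carrier UL" for x
	proof (rule bexI[of _ "(-1) \<odot>\<^bsub>UL\<^esub> x"], rule UL_eqI)
	fix m assume m: "m : exponents D"
	interpret M: calg "U_alg D m" by (rule calg_U[OF m])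
	have xm: "x m : carrier (U_alg D m)" by (rule UL_component[OF x m])
	show "((-1) \<odot>\<^bsub>UL\<^esub> x \<oplus>\<^bsub>UL\<^esub> x) m = \<zero>\<^bsub>UL\<^esub> m"
	unfolding UL_apply[OF m] M.a_inv_eq_sm[OF xm, symmetric] by (rule M.l_neg[OF xm])
	qed (use x UL_closed in auto)
	have R: "ring (U_alg D m)" "cspace (U_alg D m)" "calg (U_alg D m)" if "m : exponents D" for m
	using calg_U[OF that] by (auto simp: calg_def)
	have ab: "abelian_group UL"
	by (rule abelian_groupI) (auto intro!: neg UL_eqI UL_closed simp: UL_apply UL_component ring.ring_simprules[OF R(1)])
	have cs: "cspace UL"
	by (rule cspaceI[OF ab]) (auto intro!: UL_eqI UL_closed simp: UL_apply UL_component
	cspace.sm_l_distr[OF R(2)] cspace.sm_r_distr[OF R(2)] cspace.sm_assoc[OF R(2)] cspace.sm_one[OF R(2)])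
	have mo: "monoid UL"
	by (rule monoidI) (auto intro!: UL_eqI UL_closed simp: UL_apply UL_component monoid.l_one[OF ring.axioms(2)[OF R(1)]]
	monoid.r_one[OF ring.axioms(2)[OF R(1)]] monoid.m_assoc[OF ring.axioms(2)[OF R(1)]])
	have rg: "ring UL"
	by (rule ringI[OF ab mo]) (auto intro!: UL_eqI UL_closed simp: UL_apply UL_component ring.ring_simprules(13,23)[OF R(1)])
	show ?thesis
	by (rule calgI[OF cs rg]) (auto intro!: UL_eqI UL_closed simp: UL_apply UL_component calg.sm_mult1[OF R(3)] calg.sm_mult2[OF R(3)])
qed
definition "ULI = {a : carrier UL. ALL X. sig X = X --> U_lim_derivation D X a = \<zero>\<^bsub>UL\<^esub>}"
lemma ULI_iff: "a : ULI \<longleftrightarrow> a : carrier UL & (ALL m:exponents D. a m : carrier (U_invariants D m))"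
proof -
	have "U_lim_derivation D X a = \<zero>\<^bsub>UL\<^esub> \<longleftrightarrow> (ALL m:exponents D. U_derivation D m X (a m) = \<zero>\<^bsub>U_alg D m\<^esub>)" for X
	unfolding U_lim_derivation_def U_lim_simps by (auto simp: fun_eq_iff restrict_def)
	thus ?thesis unfolding ULI_def U_invariants_def using UL_component by auto
qed
lemma invariants_ops: assumes "m : exponents D"
	shows "\<zero>\<^bsub>U_alg D m\<^esub> : carrier (U_invariants D m)" "\<one>\<^bsub>U_alg D m\<^esub> : carrier (U_invariants D m)"
	"x : carrier (U_invariants D m) ==> y : carrier (U_invariants D m) ==> x \<oplus>\<^bsub>U_alg D m\<^esub> y : carrier (U_invariants D m)"
	"x : carrier (U_invariants D m) ==> y : carrier (U_invariants D m) ==> x \<otimes>\<^bsub>U_alg D m\<^esub> y : carrier (U_invariants D m)"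
	"x : carrier (U_invariants D m) ==> c \<odot>\<^bsub>U_alg D m\<^esub> x : carrier (U_invariants D m)"
proof -
	interpret M: gaudin_U D k m by (rule gaudin_UI[OF assms])
	have e: "carrier (U_invariants D m) = M.Inv" by (simp add: U_invariants_def M.Inv_def)
	show "\<zero>\<^bsub>U_alg D m\<^esub> : carrier (U_invariants D m)" "\<one>\<^bsub>U_alg D m\<^esub> : carrier (U_invariants D m)"
	"x : carrier (U_invariants D m) ==> y : carrier (U_invariants D m) ==> x \<oplus>\<^bsub>U_alg D m\<^esub> y : carrier (U_invariants D m)"
	"x : carrier (U_invariants D m) ==> y : carrier (U_invariants D m) ==> x \<otimes>\<^bsub>U_alg D m\<^esub> y : carrier (U_invariants D m)"
	"x : carrier (U_invariants D m) ==> c \<odot>\<^bsub>U_alg D m\<^esub> x : carrier (U_invariants D m)"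
	unfolding e by (rule M.Inv_ops; assumption)+
qed
lemma calg_ULI: "calg (UL\<lparr>carrier := ULI\<rparr>)"
proof (rule calg_restrict[OF calg_UL])
	show "csub UL ULI"
	unfolding csub_def
	proof (intro conjI ballI allI)
	show "ULI <= carrier UL" by (auto simp: ULI_iff)
	show "\<zero>\<^bsub>UL\<^esub> : ULI" using UL_closed(4) invariants_ops(1) by (simp add: ULI_iff UL_apply)
	show "x \<oplus>\<^bsub>UL\<^esub> y : ULI" if "x : ULI" "y : ULI" for x y
	using that UL_closed(1) invariants_ops(3) by (simp add: ULI_iff UL_apply)
	show "c \<odot>\<^bsub>UL\<^esub> x : ULI" if "x : ULI" for c x
	using that UL_closed(3) invariants_ops(5) by (simp add: ULI_iff UL_apply)
	qed
	show "\<one>\<^bsub>UL\<^esub> : ULI" using UL_closed(5) invariants_ops(2) by (simp add: ULI_iff UL_apply)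
	show "x \<otimes>\<^bsub>UL\<^esub> y : ULI" if "x : ULI" "y : ULI" for x y
	using that UL_closed(2) invariants_ops(4) by (simp add: ULI_iff UL_apply)
qed
lemma limit_comm_subalgebra:
	assumes A: "!!m. m : exponents D ==> EX G. S m = G & csub (U_alg D m) G & \<one>\<^bsub>U_alg D m\<^esub> : G & G <= carrier (U_invariants D m) &
	(ALL x:G. ALL y:G. x \<otimes>\<^bsub>U_alg D m\<^esub> y : G & x \<otimes>\<^bsub>U_alg D m\<^esub> y = y \<otimes>\<^bsub>U_alg D m\<^esub> x)"
	shows "comm_subalgebra {a : carrier UL. ALL m:exponents D. a m : S m} (U_lim_invariants D)"
proof -
	have S: "\<zero>\<^bsub>U_alg D m\<^esub> : S m" "\<one>\<^bsub>U_alg D m\<^esub> : S m" "S m <= carrier (U_invariants D m)"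
	"x : S m ==> y : S m ==> x \<oplus>\<^bsub>U_alg D m\<^esub> y : S m" "x : S m ==> c \<odot>\<^bsub>U_alg D m\<^esub> x : S m"
	"x : S m ==> y : S m ==> x \<otimes>\<^bsub>U_alg D m\<^esub> y : S m" "x : S m ==> y : S m ==> x \<otimes>\<^bsub>U_alg D m\<^esub> y = y \<otimes>\<^bsub>U_alg D m\<^esub> x"
	if "m : exponents D" for m x y c using A[OF that] by (auto simp: csub_def)
	have e: "U_lim_invariants D = UL\<lparr>carrier := ULI\<rparr>" by (simp add: U_lim_invariants_def ULI_def)
	show ?thesis unfolding e
	proof (rule comm_subalgebraI[OF calg_ULI])
	show "csub (UL\<lparr>carrier := ULI\<rparr>) {a : carrier UL. ALL m:exponents D. a m : S m}"
	unfolding csub_def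
	proof (intro conjI ballI allI)
	show "{a : carrier UL. ALL m:exponents D. a m : S m} <= carrier (UL\<lparr>carrier := ULI\<rparr>)"
	by ((auto simp: ULI_iff intro: subsetD[OF S(3)]); use A in blast)
	qed (use S UL_closed in "auto simp: UL_apply")
	fix x y assume xy: "x : {a : carrier UL. ALL m:exponents D. a m : S m}" "y : {a : carrier UL. ALL m:exponents D. a m : S m}"
	show "x \<otimes>\<^bsub>UL\<lparr>carrier := ULI\<rparr>\<^esub> y : {a : carrier UL. ALL m:exponents D. a m : S m}"
	using xy S(6) UL_closed(2) by (auto simp: UL_apply)
	have "x \<otimes>\<^bsub>UL\<^esub> y = y \<otimes>\<^bsub>UL\<^esub> x"
	by (rule UL_eqI) (use xy S(7) UL_closed(2) in "auto simp: UL_apply")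
	thus "x \<otimes>\<^bsub>UL\<lparr>carrier := ULI\<rparr>\<^esub> y = y \<otimes>\<^bsub>UL\<lparr>carrier := ULI\<rparr>\<^esub> x" by simp
	qed (use S(2) UL_closed(5) in "auto simp: UL_apply")
qed
end
theorem theorem2p4:
  fixes D :: "('g::ab_group_add) cyclotomic_data"
  assumes "finite_dimensional_space D" and "simple_lie_algebra D"
    and "invariant_form D" and "normalised_form D"
    and "period D \<ge> 1" and "primitive_root_of_unity (period D) (omega D)"
    and "lie_automorphism D" and "(gsigma D ^^ period D) = id"
    and "finite (marked D)" and "0 \<notin> marked D"
    and "\<And>z w. z \<in> marked D \<Longrightarrow> w \<in> marked D \<Longrightarrow> z \<noteq> w \<Longrightarrow> Gamma_orbit D z \<inter> Gamma_orbit D w = {}"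
  shows "(\<forall>n\<in>exponents D. comm_subalgebra (gaudin_algebra D n) (U_invariants D n)) \<and>
    comm_subalgebra (universal_gaudin_algebra D) (U_lim_invariants D)"
proof -
  interpret L: gaudin_level D "- dual_coxeter_number D"
    by (intro gaudin_level.intro gaudin_data.intro simple_data.intro gaudin_data_axioms.intro) (use assms in auto)
  let ?k = "- dual_coxeter_number D"
  have main: "comm_subalgebra (gaudin_algebra D n) (U_invariants D n) \<and>
      (\<exists>G. gaudin_algebra D n = G \<and> csub (U_alg D n) G \<and> \<one>\<^bsub>U_alg D n\<^esub> \<in> G \<and> G \<subseteq> carrier (U_invariants D n) \<and>
      (\<forall>x\<in>G. \<forall>y\<in>G. x \<otimes>\<^bsub>U_alg D n\<^esub> y \<in> G \<and> x \<otimes>\<^bsub>U_alg D n\<^esub> y = y \<otimes>\<^bsub>U_alg D n\<^esub> x))"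
    if n: "n \<in> exponents D" for n
  proof -
    interpret U: gaudin_U D "?k" n by (rule L.gaudin_UI[OF n])
    have G: "gaudin_algebra D n = U.GA"
      unfolding gaudin_algebra_def Let_def U.span_B0[symmetric] U.B0_def ..
    have "U.GA \<subseteq> carrier (U_invariants D n)" using U.GA_Inv by (simp add: U_invariants_def U.Inv_def)
    then show ?thesis unfolding G
      using U.GA_comm_subalgebra U.csub_GA U.GA_one U.GA_product U.GA_commute by blast
  qed
  then show ?thesis
    unfolding universal_gaudin_algebra_def using L.limit_comm_subalgebra[of "gaudin_algebra D"] by blast
qed

end
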